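(* Assume that $\gamma_+<\gamma_-$. For $\tau>0$ let $v=v(\cdot,\tau)\in H^1(\mathbb{R}^3)$ be the weak solution of $(\nabla\cdot\gamma_0\nabla-\tau^2)v+f=0$ in $\mathbb{R}^3$. Then there exist positive numbers $C$ and $\tau_0$ such that, for all $\tau\ge\tau_0$, $$C^{-1}\tau^{-4}e^{-2\tau l(D,B)}\le\int_D|\nabla v(x)|^2\,dx\le C\tau^2e^{-2\tau l(D,B)}.$$
   Context: Let $\mathbb{R}^3_\pm=\{x=(x_1,x_2,x_3)\in\mathbb{R}^3: \pm x_3>0\}$. Let $\gamma_+,\gamma_->0$ be constants and $\gamma_0(x)=\gamma_+$ if $x_3>0$, $\gamma_0(x)=\gamma_-$ if $x_3<0$. Let $D$ be a nonempty bounded open subset of $\mathbb{R}^3_-$ with $C^2$-boundary and $\overline D\subset\mathbb{R}^3_-$. Let $B$ be an open ball with $\overline B\subset\mathbb{R}^3_+$. Let $f\in L^2(\mathbb{R}^3)$ be real-valued with $\mathrm{supp}\,f\subset\overline B$ and such that there is a constant $C_0>0$ with either $f(x)\ge C_0$ for a.e. $x\in B$ or $-f(x)\ge C_0$ for a.e. $x\in B$. Optical distance: for $x\in\mathbb{R}^3_-$, $y\in\mathbb{R}^3_+$ and $z'=(z_1,z_2)\in\mathbb{R}^2$, $\tilde z'=(z_1,z_2,0)$, put $l_{x,y}(z')=\frac{1}{\sqrt{\gamma_-}}|\tilde z'-x|+\frac{1}{\sqrt{\gamma_+}}|\tilde z'-y|$, $l(x,y)=\inf_{z'\in\mathbb{R}^2}l_{x,y}(z')$,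 and $l(D,B)=\inf_{x\in D,\,y\in B}l(x,y)$. *)

theory Defs
  imports "HOL-Analysis.Analysis"
begin

text \<open>Functions of class C^k on the whole space, by recursion on the gradient.\<close>

primrec Ck :: "nat \<Rightarrow> ('a::euclidean_space \<Rightarrow> real) \<Rightarrow> bool" where
  "Ck 0 f \<longleftrightarrow> continuous_on UNIV f"
| "Ck (Suc k) f \<longleftrightarrow> (\<exists>g. (\<forall>x. GDERIV f x :> g x) \<and> (\<forall>b\<in>Basis. Ck k (\<lambda>x. g x \<bullet> b)))"

definition test_function :: "('a::euclidean_space \<Rightarrow> real) \<Rightarrow> bool" where
  "test_function \<phi> \<longleftrightarrow> (\<forall>k. Ck k \<phi>) \<and> compact (closure {x. \<phi> x \<noteq> 0})"

text \<open>Elements of L^2 and H^1 are represented by functions; everything below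
  is insensitive to changes on null sets.\<close>

definition square_integrable :: "('a::euclidean_space \<Rightarrow> 'b::euclidean_space) \<Rightarrow> bool" where
  "square_integrable f \<longleftrightarrow>
     f \<in> borel_measurable lebesgue \<and> integrable lebesgue (\<lambda>x. (norm (f x))\<^sup>2)"

text \<open>The complement of the largest open set on which f vanishes almost everywhere.\<close>

definition ess_support :: "('a::euclidean_space \<Rightarrow> real) \<Rightarrow> 'a set" where
  "ess_support f = - \<Union>{U. open U \<and> (AE x in lebesgue. x \<in> U \<longrightarrow> f x = 0)}"

definition has_weak_gradient ::
    "('a::euclidean_space \<Rightarrow> real) \<Rightarrow> ('a \<Rightarrow> 'a) \<Rightarrow> bool" where
  "has_weak_gradient u G \<longleftrightarrow>
     square_integrable u \<and> square_integrable G \<and>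
     (\<forall>\<phi> g. test_function \<phi> \<and> (\<forall>x. GDERIV \<phi> x :> g x) \<longrightarrow>
        (LINT x|lebesgue. u x *\<^sub>R g x) = - (LINT x|lebesgue. \<phi> x *\<^sub>R G x))"

definition H1 :: "('a::euclidean_space \<Rightarrow> real) \<Rightarrow> bool" where
  "H1 u \<longleftrightarrow> (\<exists>G. has_weak_gradient u G)"

text \<open>The weak gradient of a member of H^1 is unique up to null sets, so the choice
  made here does not affect any integral in which it occurs.\<close>

definition weak_gradient :: "('a::euclidean_space \<Rightarrow> real) \<Rightarrow> 'a \<Rightarrow> 'a" where
  "weak_gradient u = (SOME G. has_weak_gradient u G)"

text \<open>The value on the null set where the third coordinate vanishes is immaterial.\<close>

definition two_layer :: "real \<Rightarrow> real \<Rightarrow> real^3 \<Rightarrow> real" where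
  "two_layer \<gamma>p \<gamma>m x = (if x $ 3 > 0 then \<gamma>p else \<gamma>m)"

definition weak_solution ::
    "('a::euclidean_space \<Rightarrow> real) \<Rightarrow> ('a \<Rightarrow> real) \<Rightarrow> real \<Rightarrow> ('a \<Rightarrow> real) \<Rightarrow> bool" where
  "weak_solution \<gamma> f \<tau> v \<longleftrightarrow> H1 v \<and>
     (\<forall>\<phi>. H1 \<phi> \<longrightarrow>
        (LINT x|lebesgue. \<gamma> x * (weak_gradient v x \<bullet> weak_gradient \<phi> x) + \<tau>\<^sup>2 * v x * \<phi> x)
        = (LINT x|lebesgue. f x * \<phi> x))"

text \<open>Near each boundary point, D is, after a rigid motion, the region above the graph of a
  C^2 function of two variables. Translations and a local domain of h are not needed:
  h can be shifted, and extended to the plane after shrinking the ball.\<close>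

definition C2_boundary :: "(real^3) set \<Rightarrow> bool" where
  "C2_boundary D \<longleftrightarrow>
     (\<forall>p\<in>frontier D. \<exists>r>0. \<exists>T::real^3 \<Rightarrow> real^3. \<exists>h::real^2 \<Rightarrow> real.
        orthogonal_transformation T \<and> Ck 2 h \<and>
        D \<inter> ball p r = {x \<in> ball p r. T x $ 3 > h (vector [T x $ 1, T x $ 2])})"

definition upper_half :: "(real^3) set" where
  "upper_half = {x. x $ 3 > 0}"

definition lower_half :: "(real^3) set" where
  "lower_half = {x. x $ 3 < 0}"

definition optical_length ::
    "real \<Rightarrow> real \<Rightarrow> real^3 \<Rightarrow> real^3 \<Rightarrow> real^2 \<Rightarrow> real" where
  "optical_length \<gamma>p \<gamma>m x y z =
     (let z0 = vector [z $ 1, z $ 2, 0]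
      in 1 / sqrt \<gamma>m * norm (z0 - x) + 1 / sqrt \<gamma>p * norm (z0 - y))"

definition optical_dist :: "real \<Rightarrow> real \<Rightarrow> real^3 \<Rightarrow> real^3 \<Rightarrow> real" where
  "optical_dist \<gamma>p \<gamma>m x y = (INF z. optical_length \<gamma>p \<gamma>m x y z)"

definition optical_dist_sets ::
    "real \<Rightarrow> real \<Rightarrow> (real^3) set \<Rightarrow> (real^3) set \<Rightarrow> real" where
  "optical_dist_sets \<gamma>p \<gamma>m D B = (INF (x, y)\<in>D \<times> B. optical_dist \<gamma>p \<gamma>m x y)"

end

theory Submission
  imports Defs
begin

text \<open>
  Upper bound: the equation is tested with \<open>W v\<close>, where \<open>W\<close> is a mollification of
  \<open>exp (- 2 (\<tau> - 1) d)\<close> and \<open>d\<close> is the optical distance to \<open>D\<close>, truncated at \<open>l(D, B)\<close>. The weight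
  satisfies the eikonal inequality \<open>sqrt \<gamma> |\<nabla>W| \<le> 2 (\<tau> - 1) W\<close>; shifting \<open>d\<close> by \<open>1/\<tau>\<close> before mollifying
  keeps this true below the interface, where \<open>\<gamma>\<^sub>+ < \<gamma>\<^sub>-\<close> makes the constraint stronger.

  Lower bound: assume \<open>f \<ge> 0\<close>, so that \<open>v \<ge> 0\<close>. Let a shortest optical path run from \<open>p \<in> \<partial>D\<close> through
  \<open>z\<close> on the interface to \<open>y \<in> \<partial>B\<close>. Along it one has an explicit subsolution of size \<open>exp (- \<tau> l)\<close> at \<open>y\<close>:
  below the interface a radial wave centred at a point \<open>q\<close> of \<open>D\<close> near \<open>p\<close>, above it the trace of that
  wave transported along the direction refracted by Snell's law. A boundary layer
  \<open>1 - \<kappa> exp (\<sigma> \<tau> x\<^sub>3)\<close> gives the jump of the flux the right sign. The equation is tested with the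
  subsolution, cut off far away and in a shell of thickness \<open>1/\<tau>\<close> inside an interior ball of \<open>D\<close> at \<open>p\<close>.
  The right-hand side is at least \<open>c \<tau>\<^sup>-\<^sup>2 exp (- \<tau> l)\<close>, from a tube at \<open>y\<close>. The far error is smaller by
  \<open>exp (- \<tau>)\<close>. In the shell the beam has \<open>L\<^sup>2\<close> norm \<open>O(1/\<tau>)\<close>, because the wave fronts and the ball
  curve differently, and there the equation bounds the mass of \<open>v\<close> by its gradient; so the shell error is at
  most a constant times the \<open>L\<^sup>2(D)\<close> norm of \<open>\<nabla>v\<close>.
\<close>

section \<open>Smooth functions\<close>

text \<open>The lower bound concerns the gradient of \<open>v\<close> on \<open>D\<close> alone, so
  every error in the test must either live inside \<open>D\<close> or be exponentially small. Since
  \<open>v\<close> has a sign, only inequalities are required of the wave. Any excess in the two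
  Laplacians and any upward jump of the flux may be dropped, so crude corrections of the exponents
  replace amplitude equations, and no exact transmission coefficient is computed. The power
  \<open>\<tau>^-4\<close> is the square of the volume, of order \<open>\<tau>^-2\<close>, of the
  tube at \<open>y\<close>: a length \<open>1/\<tau>\<close> and a width
  \<open>1/sqrt \<tau>\<close> fit into the ball while the wave keeps its size. The shell error must
  then cost no power of \<open>\<tau>\<close>. Differentiating the cutoff costs one, which the
  thinness of the beam repays; the term with \<open>v\<close> costs two, and the second is repaid by
  testing the equation once more, with the wave cut off to the shell, where the source
  vanishes.\<close>

lemma Ck_SucE:
  assumes "Ck (Suc k) f"
  obtains g where "\<And>x. GDERIV f x :> g x" "\<And>b. b \<in> Basis \<Longrightarrow> Ck k (\<lambda>x. g x \<bullet> b)"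
  using assms by auto

lemma Ck_SucI:
  assumes "\<And>x. GDERIV f x :> g x" "\<And>b. b \<in> Basis \<Longrightarrow> Ck k (\<lambda>x. g x \<bullet> b)"
  shows "Ck (Suc k) f"
  using assms by auto

lemma Ck_SucD:
  fixes f :: "'a::euclidean_space \<Rightarrow> real"
  shows "Ck (Suc k) f \<Longrightarrow> Ck k f"
proof (induction k arbitrary: f)
  case 0
  then obtain g where "\<And>x. GDERIV f x :> g x" by auto
  then show ?case
    by (auto simp: gderiv_def intro!: continuous_at_imp_continuous_on has_derivative_continuous)
next
  case (Suc k)
  obtain g where g: "\<And>x. GDERIV f x :> g x" and "\<And>b. b \<in> Basis \<Longrightarrow> Ck (Suc k) (\<lambda>x. g x \<bullet> b)"
    using Ck_SucE[OF Suc.prems] by blast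
  with Suc.IH have "\<And>b. b \<in> Basis \<Longrightarrow> Ck k (\<lambda>x. g x \<bullet> b)" by blast
  with g show ?case by auto
qed

lemma Ck_continuous:
  fixes f :: "'a::euclidean_space \<Rightarrow> real"
  shows "Ck k f \<Longrightarrow> continuous_on S f"
proof (induction k)
  case 0
  then show ?case using continuous_on_subset by (metis Ck.simps(1) subset_UNIV)
qed (use Ck_SucD in blast)

lemma Ck_const: "Ck k (\<lambda>x::'a::euclidean_space. c)"
proof (induction k arbitrary: c)
  case (Suc k)
  show ?case
    by (rule Ck_SucI[OF GDERIV_const]) (simp add: Suc)
qed simp

lemma Ck_add:
  fixes f g :: "'a::euclidean_space \<Rightarrow> real"
  shows "Ck k f \<Longrightarrow> Ck k g \<Longrightarrow> Ck k (\<lambda>x. f x + g x)"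
proof (induction k arbitrary: f g)
  case 0
  then show ?case by (simp add: continuous_intros)
next
  case (Suc k)
  obtain f' where "\<And>x. GDERIV f x :> f' x" "\<And>b. b \<in> Basis \<Longrightarrow> Ck k (\<lambda>x. f' x \<bullet> b)"
    using Ck_SucE[OF Suc.prems(1)] by blast
  moreover obtain g' where "\<And>x. GDERIV g x :> g' x" "\<And>b. b \<in> Basis \<Longrightarrow> Ck k (\<lambda>x. g' x \<bullet> b)"
    using Ck_SucE[OF Suc.prems(2)] by blast
  ultimately show ?case
    by (intro Ck_SucI[OF GDERIV_add]) (auto simp: inner_add_left intro!: Suc.IH)
qed

lemma Ck_mult:
  fixes f g :: "'a::euclidean_space \<Rightarrow> real"
  shows "Ck k f \<Longrightarrow> Ck k g \<Longrightarrow> Ck k (\<lambda>x. f x * g x)"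
proof (induction k arbitrary: f g)
  case 0
  then show ?case by (simp add: continuous_intros)
next
  case (Suc k)
  obtain f' where f': "\<And>x. GDERIV f x :> f' x" "\<And>b. b \<in> Basis \<Longrightarrow> Ck k (\<lambda>x. f' x \<bullet> b)"
    using Ck_SucE[OF Suc.prems(1)] by blast
  obtain g' where g': "\<And>x. GDERIV g x :> g' x" "\<And>b. b \<in> Basis \<Longrightarrow> Ck k (\<lambda>x. g' x \<bullet> b)"
    using Ck_SucE[OF Suc.prems(2)] by blast
  note fg = Ck_SucD[OF Suc.prems(1)] Ck_SucD[OF Suc.prems(2)]
  have "Ck k (\<lambda>x. f x * (g' x \<bullet> b) + g x * (f' x \<bullet> b))" if "b \<in> Basis" for b
    by (rule Ck_add[OF Suc.IH[OF fg(1) g'(2)[OF that]] Suc.IH[OF fg(2) f'(2)[OF that]]])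
  then show ?case
    unfolding Ck.simps using GDERIV_mult[OF f'(1) g'(1)]
    by (intro exI[of _ "\<lambda>x. f x *\<^sub>R g' x + g x *\<^sub>R f' x"]) (simp add: inner_add_left)
qed

lemma Ck_minus: "Ck k f \<Longrightarrow> Ck k (\<lambda>x::'a::euclidean_space. - f x)"
  using Ck_mult[OF Ck_const[of k "-1"], of f] by simp

lemma Ck_sum: "finite I \<Longrightarrow> (\<And>i. i \<in> I \<Longrightarrow> Ck k (f i)) \<Longrightarrow> Ck k (\<lambda>x::'a::euclidean_space. \<Sum>i\<in>I. f i x)"
  by (induction I rule: finite_induct) (auto intro: Ck_const Ck_add)

lemma Ck_inner: "Ck k (\<lambda>x::'a::euclidean_space. x \<bullet> b)"
proof (cases k)
  case (Suc k)
  have "GDERIV (\<lambda>x::'a. x \<bullet> b) x :> b" for x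
    unfolding gderiv_def by (auto intro!: derivative_eq_intros)
  then show ?thesis unfolding Suc Ck.simps by (intro exI[of _ "\<lambda>x. b"]) (auto intro: Ck_const)
qed (simp add: continuous_intros)

lemma Ck_norm_power2: "Ck k (\<lambda>x::'a::euclidean_space. (norm x)\<^sup>2)"
proof -
  have "Ck k (\<lambda>x::'a. \<Sum>b\<in>Basis. (x \<bullet> b) * (x \<bullet> b))"
    by (intro Ck_sum Ck_mult Ck_inner) auto
  then show ?thesis
    by (metis (no_types, lifting) ext euclidean_inner power2_norm_eq_inner)
qed

text \<open>\<open>F\<close> is the whole sequence of derivatives of the outer function. The chain
  rule turns \<open>F j\<close> into \<open>F (Suc j)\<close>, so the induction on \<open>k\<close>
  must be over all \<open>j\<close> at once.\<close>

lemma Ck_compose: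
  fixes u :: "'a::euclidean_space \<Rightarrow> real"
  assumes F: "\<And>j t. (F j has_real_derivative F (Suc j) t) (at t)"
    and u: "Ck k u"
  shows "Ck k (\<lambda>x. F j (u x))"
  using u
proof (induction k arbitrary: j)
  case 0
  have "continuous_on UNIV (F j)"
    by (intro continuous_at_imp_continuous_on ballI DERIV_isCont[OF F])
  with 0 show ?case by (auto intro: continuous_on_compose2)
next
  case (Suc k)
  obtain u' where *: "\<And>x. GDERIV u x :> u' x" "\<And>b. b \<in> Basis \<Longrightarrow> Ck k (\<lambda>x. u' x \<bullet> b)"
    using Ck_SucE[OF Suc.prems] by blast
  have "Ck k (\<lambda>x. F (Suc j) (u x) * (u' x \<bullet> b))" if "b \<in> Basis" for b
    by (rule Ck_mult[OF Suc.IH[OF Ck_SucD[OF Suc.prems]] *(2)[OF that]])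
  then show ?case
    unfolding Ck.simps using GDERIV_DERIV_compose[OF *(1) F]
    by (intro exI[of _ "\<lambda>x. F (Suc j) (u x) *\<^sub>R u' x"]) simp
qed

lemma Ck_affine:
  fixes u :: "'a::euclidean_space \<Rightarrow> real"
  shows "Ck k u \<Longrightarrow> Ck k (\<lambda>x. u (a + s *\<^sub>R x))"
proof (induction k arbitrary: u)
  case 0
  then show ?case by (auto intro!: continuous_on_compose2[of UNIV u] continuous_intros)
next
  case (Suc k)
  obtain u' where *: "\<And>x. GDERIV u x :> u' x" "\<And>b. b \<in> Basis \<Longrightarrow> Ck k (\<lambda>x. u' x \<bullet> b)"
    using Ck_SucE[OF Suc.prems] by blast
  have "GDERIV (\<lambda>x. u (a + s *\<^sub>R x)) x :> s *\<^sub>R u' (a + s *\<^sub>R x)" for x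
  proof -
    have "((\<lambda>x. a + s *\<^sub>R x) has_derivative (\<lambda>h. s *\<^sub>R h)) (at x)"
      by (auto intro!: derivative_eq_intros)
    from has_derivative_compose[OF this *(1)[of "a + s *\<^sub>R x", unfolded gderiv_def]]
    show ?thesis by (simp add: gderiv_def)
  qed
  then show ?case
    unfolding Ck.simps using Suc.IH[OF *(2)]
    by (intro exI[of _ "\<lambda>x. s *\<^sub>R u' (a + s *\<^sub>R x)"]) (auto intro!: Ck_mult Ck_const)
qed

text \<open>The function \<open>exp (- 1/t)\<close> with a polynomial factor in \<open>1/t\<close>,
  extended by zero to \<open>t \<le> 0\<close>. Carrying the polynomial makes the family closed
  under differentiation, so smoothness at the origin is settled by one derivative formula.\<close>

definition flat_exp :: "real poly \<Rightarrow> real \<Rightarrow> real" where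
  "flat_exp p t = (if t > 0 then poly p (1 / t) * exp (- (1 / t)) else 0)"

lemma poly_exp_tendsto_0: "((\<lambda>s. poly p s * exp (- s)) \<longlongrightarrow> 0) at_top" for p :: "real poly"
proof -
  have "((\<lambda>s. \<Sum>i\<le>degree p. coeff p i * (s ^ i / exp s)) \<longlongrightarrow> (\<Sum>i\<le>degree p. coeff p i * 0)) at_top"
    by (intro tendsto_intros tendsto_power_div_exp_0)
  then show ?thesis
    by (simp add: poly_altdef exp_minus field_simps sum_divide_distrib)
qed

text \<open>With \<open>s = 1/t\<close> the derivative of \<open>p(s) exp (- s)\<close> in
  \<open>t\<close> is \<open>s^2 (p(s) - p'(s)) exp (- s)\<close>, which explains the new
  polynomial. At \<open>t = 0\<close> both one-sided quotients tend to zero, because the exponential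
  beats every polynomial.\<close>

lemma flat_exp_DERIV:
  "(flat_exp p has_real_derivative flat_exp ([:0,0,1:] * (p - pderiv p)) t) (at t)"
proof -
  consider "t > 0" | "t < 0" | "t = 0" by linarith
  then show ?thesis
  proof cases
    case 1
    have "((\<lambda>t. poly p (1 / t) * exp (- (1 / t))) has_real_derivative
        flat_exp ([:0,0,1:] * (p - pderiv p)) t) (at t)"
      using 1 by (auto intro!: derivative_eq_intros DERIV_chain2[OF poly_DERIV]
          simp: flat_exp_def field_simps power2_eq_square)
    moreover have "\<forall>\<^sub>F s in nhds t. flat_exp p s = poly p (1 / s) * exp (- (1 / s))"
      by (rule eventually_mono[OF eventually_nhds_in_open[of "{0<..}" t]]) (use 1 in \<open>auto simp: flat_exp_def\<close>)
    ultimately show ?thesis by (rule DERIV_cong_ev[OF refl _ refl, THEN iffD2, rotated])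
  next
    case 2
    have "((\<lambda>t. 0) has_real_derivative flat_exp ([:0,0,1:] * (p - pderiv p)) t) (at t)"
      using 2 by (auto simp: flat_exp_def)
    moreover have "\<forall>\<^sub>F s in nhds t. flat_exp p s = 0"
      by (rule eventually_mono[OF eventually_nhds_in_open[of "{..<0}" t]]) (use 2 in \<open>auto simp: flat_exp_def\<close>)
    ultimately show ?thesis by (rule DERIV_cong_ev[OF refl _ refl, THEN iffD2, rotated])
  next
    case 3
    have "((\<lambda>h. flat_exp p h / h) \<longlongrightarrow> 0) (at_right 0)"
    proof -
      have "((\<lambda>h. poly ([:0,1:] * p) (inverse h) * exp (- inverse h)) \<longlongrightarrow> 0) (at_right 0)"
        by (rule filterlim_compose[OF poly_exp_tendsto_0 filterlim_inverse_at_top_right])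
      moreover have "\<forall>\<^sub>F h in at_right 0. poly ([:0,1:] * p) (inverse h) * exp (- inverse h) = flat_exp p h / h"
        by (rule eventually_mono[OF eventually_at_right_less[of 0]]) (simp add: flat_exp_def field_simps)
      ultimately show ?thesis by (blast intro: Lim_transform_eventually)
    qed
    moreover have "((\<lambda>h. flat_exp p h / h) \<longlongrightarrow> 0) (at_left 0)"
      by (rule Lim_transform_eventually[OF tendsto_const])
        (auto simp: flat_exp_def eventually_at_left_field intro!: exI[of _ "-1"])
    ultimately have "((\<lambda>h. flat_exp p h / h) \<longlongrightarrow> 0) (at 0)"
      using filterlim_split_at by blast
    then show ?thesis using 3 by (simp add: DERIV_def flat_exp_def)
  qed
qed

lemma Ck_flat_exp: "Ck k u \<Longrightarrow> Ck k (\<lambda>x::'a::euclidean_space. flat_exp p (u x))"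
proof -
  define F where "F j = flat_exp (((\<lambda>p. [:0,0,1:] * (p - pderiv p)) ^^ j) p)" for j
  have F: "(F j has_real_derivative F (Suc j) t) (at t)" for j t
    unfolding F_def funpow.simps o_apply by (rule flat_exp_DERIV)
  assume "Ck k u"
  then have "Ck k (\<lambda>x. F 0 (u x))"
    by (rule Ck_compose[of F, OF F])
  then show ?thesis by (simp add: F_def)
qed

section \<open>Test functions and mollifiers\<close>

lemma test_function_continuous: "test_function \<phi> \<Longrightarrow> continuous_on S \<phi>"
  using Ck_continuous by (auto simp: test_function_def)

lemma test_function_mult:
  assumes "\<And>k. Ck k \<psi>" "test_function \<phi>"
  shows "test_function (\<lambda>x. \<psi> x * \<phi> x)"
proof -
  have "closure {x. \<psi> x * \<phi> x \<noteq> 0} \<subseteq> closure {x. \<phi> x \<noteq> 0}"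
    by (intro closure_mono) auto
  then have "compact (closure {x. \<psi> x * \<phi> x \<noteq> 0})"
    using assms(2) compact_Int_closed[of "closure {x. \<phi> x \<noteq> 0}" "closure {x. \<psi> x * \<phi> x \<noteq> 0}"]
    by (simp add: test_function_def inf.absorb2)
  moreover have "Ck k (\<lambda>x. \<psi> x * \<phi> x)" for k
    using assms by (intro Ck_mult) (auto simp: test_function_def)
  ultimately show ?thesis by (simp add: test_function_def)
qed

lemma test_functionI:
  assumes "\<And>k. Ck k \<phi>" "\<And>x. norm x > r \<Longrightarrow> \<phi> x = 0"
  shows "test_function \<phi>"
proof -
  have "{x. \<phi> x \<noteq> 0} \<subseteq> cball 0 r" using assms(2) by (auto simp: not_less[symmetric])
  then have "bounded {x. \<phi> x \<noteq> 0}" using bounded_subset bounded_cball by blast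
  then show ?thesis using assms(1) by (simp add: test_function_def)
qed

lemma test_function_bounded_support:
  assumes "test_function \<phi>"
  obtains r where "r > 0" "\<And>x. norm x > r \<Longrightarrow> \<phi> x = 0"
proof -
  have "bounded {x. \<phi> x \<noteq> 0}"
    using assms bounded_subset[OF compact_imp_bounded closure_subset] by (simp add: test_function_def)
  then obtain r where "r > 0" "\<forall>x\<in>{x. \<phi> x \<noteq> 0}. norm x \<le> r"
    by (auto simp: bounded_pos)
  then have "r > 0" "\<And>x. norm x > r \<Longrightarrow> \<phi> x = 0" by fastforce+
  then show ?thesis using that by blast
qed

lemma GDERIV_unique:
  fixes f :: "'a::euclidean_space \<Rightarrow> real"
  assumes "GDERIV f x :> D" "GDERIV f x :> D'"
  shows "D = D'"
proof -
  have "(\<lambda>h. h \<bullet> D) = (\<lambda>h. h \<bullet> D')"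
    using assms unfolding gderiv_def by (rule has_derivative_unique)
  then have "\<And>h. h \<bullet> D = h \<bullet> D'" by meson
  then show ?thesis by (metis euclidean_eqI inner_commute)
qed

lemma GDERIV_0_outside:
  fixes \<phi> :: "'a::euclidean_space \<Rightarrow> real"
  assumes "\<And>x. norm x > r \<Longrightarrow> \<phi> x = 0" "norm z > r" "GDERIV \<phi> z :> g"
  shows "g = 0"
proof -
  have "open {x::'a. norm x > r}" by (auto intro: open_Collect_less continuous_intros)
  from has_derivative_transform_within_open[OF has_derivative_const this, of z 0 \<phi>]
  have "GDERIV \<phi> z :> 0" using assms(1,2) by (simp add: gderiv_def)
  then show ?thesis by (rule GDERIV_unique[OF assms(3)])
qed

lemma test_function_gderiv:
  assumes "test_function \<phi>" "\<And>x. GDERIV \<phi> x :> g x"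
  shows "test_function (\<lambda>x. g x \<bullet> b)"
proof -
  obtain r where r: "r > 0" "\<And>x. norm x > r \<Longrightarrow> \<phi> x = 0"
    using test_function_bounded_support[OF assms(1)] by blast
  have Ck: "Ck k (\<lambda>x. g x \<bullet> c)" if "c \<in> Basis" for k c
  proof -
    have "Ck (Suc k) \<phi>" using assms(1) by (simp add: test_function_def del: Ck.simps)
    then obtain g' where g': "\<And>x. GDERIV \<phi> x :> g' x"
      "\<And>b. b \<in> Basis \<Longrightarrow> Ck k (\<lambda>x. g' x \<bullet> b)"
      using Ck_SucE by metis
    \<comment> \<open>The gradient supplied by \<open>Ck (Suc k)\<close> could depend on
      \<open>k\<close>; uniqueness identifies all of them with \<open>g\<close>.\<close>
    have "g' = g" by (rule ext) (rule GDERIV_unique[OF g'(1) assms(2)])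
    then show ?thesis using g'(2)[OF that] by simp
  qed
  have "Ck k (\<lambda>x. g x \<bullet> b)" for k
  proof -
    have "Ck k (\<lambda>x. \<Sum>c\<in>Basis. (g x \<bullet> c) * (b \<bullet> c))"
      by (intro Ck_sum Ck_mult Ck_const Ck) auto
    then show ?thesis by (metis (no_types, lifting) ext euclidean_inner)
  qed
  moreover have "g x \<bullet> b = 0" if "norm x > r" for x
    using GDERIV_0_outside[OF r(2) that assms(2)] by simp
  ultimately show ?thesis using test_functionI by blast
qed

lemma test_function_affine:
  assumes "test_function \<phi>" "s \<noteq> 0"
  shows "test_function (\<lambda>x. \<phi> (a + s *\<^sub>R x))"
proof -
  obtain r where r: "r > 0" "\<And>x. norm x > r \<Longrightarrow> \<phi> x = 0"
    using test_function_bounded_support[OF assms(1)] by blast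
  have "\<phi> (a + s *\<^sub>R x) = 0" if "norm x > (r + norm a) / \<bar>s\<bar>" for x
  proof (rule r(2))
    have "r + norm a < \<bar>s\<bar> * norm x" using that assms(2) by (simp add: field_simps)
    also have "\<dots> \<le> norm (a + s *\<^sub>R x) + norm a"
      using norm_triangle_ineq4[of "a + s *\<^sub>R x" a] by simp
    finally show "norm (a + s *\<^sub>R x) > r" by simp
  qed
  moreover have "Ck k (\<lambda>x. \<phi> (a + s *\<^sub>R x))" for k
    using assms(1) by (intro Ck_affine) (auto simp: test_function_def)
  ultimately show ?thesis by (rule test_functionI[rotated])
qed

definition mollifier :: "real \<Rightarrow> ('a::euclidean_space \<Rightarrow> real) \<Rightarrow> bool" where
  "mollifier \<delta> \<rho> \<longleftrightarrow> test_function \<rho> \<and> (\<forall>x. \<rho> x \<ge> 0) \<and> (\<forall>x. norm x \<ge> \<delta> \<longrightarrow> \<rho> x = 0)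
     \<and> integrable lborel \<rho> \<and> (LINT x|lborel. \<rho> x) = 1"

lemma test_function_integrable:
  assumes "test_function \<phi>"
  shows "integrable lborel \<phi>"
proof -
  obtain r where r: "r > 0" "\<And>x. norm x > r \<Longrightarrow> \<phi> x = 0"
    using test_function_bounded_support[OF assms(1)] by blast
  have "integrable lborel (\<lambda>x. indicator (cball 0 r) x *\<^sub>R \<phi> x)"
    using assms by (intro borel_integrable_compact test_function_continuous) auto
  also have "(\<lambda>x. indicator (cball 0 r) x *\<^sub>R \<phi> x) = \<phi>"
    using r by (auto simp: indicator_def fun_eq_iff)
  finally show ?thesis .
qed

lemma mollifier_exists:
  assumes "\<delta> > 0"
  obtains \<rho> :: "'a::euclidean_space \<Rightarrow> real" where "mollifier \<delta> \<rho>"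
proof -
  define \<phi> :: "'a \<Rightarrow> real" where "\<phi> x = flat_exp 1 (\<delta>\<^sup>2 + - (norm x)\<^sup>2)" for x
  have nn: "\<phi> x \<ge> 0" for x by (auto simp: \<phi>_def flat_exp_def)
  have pos: "\<phi> x > 0" if "norm x < \<delta>" for x
    using power_strict_mono[OF that, of 2] by (simp add: \<phi>_def flat_exp_def)
  have zero: "\<phi> x = 0" if "norm x \<ge> \<delta>" for x
    using power_mono[OF that, of 2] assms by (simp add: \<phi>_def flat_exp_def not_less)
  have "Ck k \<phi>" for k
    unfolding \<phi>_def by (intro Ck_flat_exp Ck_add Ck_const Ck_minus Ck_norm_power2)
  then have test: "test_function \<phi>" using zero by (intro test_functionI[of _ \<delta>]) auto
  note int = test_function_integrable[OF test]
  have "(LINT x|lborel. \<phi> x) \<noteq> 0"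
  proof
    assume "(LINT x|lborel. \<phi> x) = 0"
    then have "AE x in lborel. \<phi> x = 0"
      using integral_nonneg_eq_0_iff_AE[OF int] nn by auto
    then have "AE x in lborel. x \<notin> ball (0::'a) \<delta>"
      by eventually_elim (metis dist_0_norm less_irrefl mem_ball pos)
    then have "ball (0::'a) \<delta> \<in> null_sets lborel"
      by (subst AE_iff_null_sets) auto
    then have "measure lborel (ball (0::'a) \<delta>) = 0" by (simp add: measure_eq_0_null_sets)
    then show False using content_ball_pos[OF assms, of "0::'a"] by simp
  qed
  moreover have "(LINT x|lborel. \<phi> x) \<ge> 0" using nn by (simp add: integral_nonneg_AE)
  ultimately have I: "(LINT x|lborel. \<phi> x) > 0" (is "?I > 0") by linarith
  have "test_function (\<lambda>x. inverse ?I * \<phi> x)"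
    using test by (intro test_function_mult Ck_const)
  then have "mollifier \<delta> (\<lambda>x. inverse ?I * \<phi> x)"
    using I nn zero int by (auto simp: mollifier_def)
  then show ?thesis using that by blast
qed

section \<open>Convolution with mollifiers\<close>

lemma integrable_lebesgue_bounded_support:
  fixes f :: "'a::euclidean_space \<Rightarrow> 'b::{banach, second_countable_topology}"
  assumes "f \<in> borel_measurable lebesgue" "\<And>x. norm (f x) \<le> M" "\<And>x. norm x > r \<Longrightarrow> f x = 0"
  shows "integrable lebesgue f"
proof (rule integrableI_bounded_set[where A="cball 0 r" and B=M])
  show "emeasure lebesgue (cball (0::'a) r) < \<infinity>"
    using emeasure_lborel_cball_finite by simp
qed (use assms in \<open>auto intro!: AE_I2 simp: not_le\<close>)

lemma continuous_imp_lebesgue_measurable: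
  "continuous_on UNIV (f :: 'a::euclidean_space \<Rightarrow> 'b::euclidean_space) \<Longrightarrow> f \<in> borel_measurable lebesgue"
  by (intro measurable_completion) (simp add: borel_measurable_continuous_onI)

lemma indicator_cball_lebesgue [measurable, simp]:
  "indicat_real (cball a r) \<in> borel_measurable lebesgue"
  by (intro borel_measurable_indicator fmeasurableD lmeasurable_cball)

lemma affine_Basis_sum: "(\<lambda>x::'a::euclidean_space. t + (\<Sum>j\<in>Basis. (c * (x \<bullet> j)) *\<^sub>R j)) = (\<lambda>x. t + c *\<^sub>R x)"
  by (simp add: fun_eq_iff scaleR_scaleR[symmetric] scaleR_sum_right[symmetric] euclidean_representation del: scaleR_scaleR)

lemma measurable_lebesgue_comp_affine:
  fixes f :: "'a::euclidean_space \<Rightarrow> 'b::euclidean_space"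
  assumes "c \<noteq> 0" "f \<in> borel_measurable lebesgue"
  shows "(\<lambda>x. f (t + c *\<^sub>R x)) \<in> borel_measurable lebesgue"
proof -
  have "(\<lambda>x. t + (\<Sum>j\<in>Basis. (c * (x \<bullet> j)) *\<^sub>R j)) \<in> lebesgue \<rightarrow>\<^sub>M lebesgue"
    using assms by (intro lebesgue_affine_measurable) auto
  also have "(\<lambda>x. t + (\<Sum>j\<in>Basis. (c * (x \<bullet> j)) *\<^sub>R j)) = (\<lambda>x. t + c *\<^sub>R x)"
    by (rule affine_Basis_sum)
  finally show ?thesis using measurable_comp[OF _ assms(2)] by (simp add: o_def)
qed

lemma lebesgue_affine_distr:
  assumes "\<bar>c\<bar> = 1"
  shows "lebesgue = distr lebesgue lebesgue (\<lambda>x::'a::euclidean_space. t + c *\<^sub>R x)"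
proof -
  have "lebesgue = density (distr lebesgue lebesgue (\<lambda>x::'a. t + (\<Sum>j\<in>Basis. (c * (x \<bullet> j)) *\<^sub>R j))) (\<lambda>_. (\<Prod>j\<in>(Basis::'a set). \<bar>c\<bar>))"
    using assms by (intro lebesgue_affine_euclidean) auto
  also have "(\<lambda>x. t + (\<Sum>j\<in>Basis. (c * (x \<bullet> j)) *\<^sub>R j)) = (\<lambda>x. t + c *\<^sub>R x)"
    by (rule affine_Basis_sum)
  finally show ?thesis using assms by (simp add: density_1)
qed

text \<open>Only \<open>\<bar>c\<bar> = 1\<close> occurs: translations, and the reflection that
  turns \<open>\<rho> (x - y)\<close> into \<open>\<rho> y\<close>, both of Jacobian one.\<close>

lemma
  fixes f :: "'a::euclidean_space \<Rightarrow> 'b::euclidean_space"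
  assumes "\<bar>c\<bar> = 1"
  shows integral_lebesgue_affine: "f \<in> borel_measurable lebesgue \<Longrightarrow>
      (LINT x|lebesgue. f (t + c *\<^sub>R x)) = (LINT x|lebesgue. f x)" (is "_ \<Longrightarrow> ?E")
    and integrable_lebesgue_affine: "integrable lebesgue f \<Longrightarrow> integrable lebesgue (\<lambda>x. f (t + c *\<^sub>R x))" (is "_ \<Longrightarrow> ?I")
proof -
  let ?T = "\<lambda>x::'a. t + c *\<^sub>R x"
  have c: "c \<noteq> 0" using assms by auto
  have T: "?T \<in> lebesgue \<rightarrow>\<^sub>M lebesgue"
  proof -
    have "(\<lambda>x. t + (\<Sum>j\<in>Basis. (c * (x \<bullet> j)) *\<^sub>R j)) \<in> lebesgue \<rightarrow>\<^sub>M lebesgue"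
      using c by (intro lebesgue_affine_measurable) auto
    also have "(\<lambda>x. t + (\<Sum>j\<in>Basis. (c * (x \<bullet> j)) *\<^sub>R j)) = ?T"
      by (rule affine_Basis_sum)
    finally show ?thesis .
  qed
  note d = lebesgue_affine_distr[OF assms, of t]
  show ?E if "f \<in> borel_measurable lebesgue"
    using integral_distr[OF T, of f] that d by metis
  show ?I if "integrable lebesgue f"
    using integrable_distr[OF T, of f] that d by metis
qed

definition locally_integrable :: "('a::euclidean_space \<Rightarrow> 'b::euclidean_space) \<Rightarrow> bool" where
  "locally_integrable u \<longleftrightarrow> (\<forall>r. integrable lebesgue (\<lambda>y. indicator (cball 0 r) y *\<^sub>R u y))"

definition conv :: "('a::euclidean_space \<Rightarrow> real) \<Rightarrow> ('a \<Rightarrow> 'b::euclidean_space) \<Rightarrow> 'a \<Rightarrow> 'b" where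
  "conv \<rho> u x = (LINT y|lebesgue. \<rho> (x - y) *\<^sub>R u y)"

lemma locally_integrable_measurable:
  assumes "locally_integrable u"
  shows "u \<in> borel_measurable lebesgue"
proof (rule borel_measurable_LIMSEQ_metric)
  show "(\<lambda>y. indicator (cball 0 (real n)) y *\<^sub>R u y) \<in> borel_measurable lebesgue" for n
    using assms by (intro borel_measurable_integrable) (simp add: locally_integrable_def)
  show "(\<lambda>n. indicator (cball 0 (real n)) x *\<^sub>R u x) \<longlonglongrightarrow> u x" for x
  proof (rule tendsto_eventually, rule eventually_sequentiallyI)
    fix n assume "nat \<lceil>norm x\<rceil> \<le> n"
    then have "norm x \<le> real n" by linarith
    then show "indicator (cball 0 (real n)) x *\<^sub>R u x = u x" by simp
  qed
qed

lemma square_integrable_locally_integrable: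
  assumes "square_integrable u"
  shows "locally_integrable u"
  unfolding locally_integrable_def
proof
  fix r
  have [measurable]: "u \<in> borel_measurable lebesgue" and "integrable lebesgue (\<lambda>x. (norm (u x))\<^sup>2)"
    using assms by (auto simp: square_integrable_def)
  moreover have "integrable lebesgue (indicator (cball (0::'a) r) :: 'a \<Rightarrow> real)"
    by (rule integrable_lebesgue_bounded_support[of _ 1 r]) (auto simp: indicator_def)
  ultimately have "integrable lebesgue (\<lambda>x. indicator (cball 0 r) x + (norm (u x))\<^sup>2)" by simp
  then show "integrable lebesgue (\<lambda>y. indicator (cball 0 r) y *\<^sub>R u y)"
  proof (rule Bochner_Integration.integrable_bound)
    have "norm (u x) \<le> 1 + (norm (u x))\<^sup>2" for x
      using sum_squares_ge_zero[of "norm (u x) - 1/2" 0] by (simp add: power2_eq_square algebra_simps)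
    then show "AE x in lebesgue. norm (indicator (cball 0 r) x *\<^sub>R u x) \<le> norm (indicator (cball 0 r) x + (norm (u x))\<^sup>2)"
      by (auto intro!: AE_I2 simp: indicator_def)
  qed (rule borel_measurable_scaleR, simp_all)
qed

lemma locally_integrable_bounded:
  assumes "u \<in> borel_measurable lebesgue" "\<And>x. norm (u x) \<le> M"
  shows "locally_integrable u"
  unfolding locally_integrable_def
proof
  fix r
  have "0 \<le> M" using assms(2)[of 0] norm_ge_zero order_trans by blast
  then show "integrable lebesgue (\<lambda>y. indicator (cball 0 r) y *\<^sub>R u y)"
    using assms by (intro integrable_lebesgue_bounded_support[of _ M r] borel_measurable_scaleR
        indicator_cball_lebesgue) (auto simp: indicator_def split: if_splits)
qed

lemma integrable_bounded_mult_locally_integrable: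
  fixes \<phi> :: "'a::euclidean_space \<Rightarrow> real" and u :: "'a \<Rightarrow> 'b::euclidean_space"
  assumes "locally_integrable u" "\<phi> \<in> borel_measurable lebesgue" "\<And>x. \<bar>\<phi> x\<bar> \<le> M" "\<And>x. norm x > r \<Longrightarrow> \<phi> x = 0"
  shows "integrable lebesgue (\<lambda>y. \<phi> y *\<^sub>R u y)"
proof -
  have M: "0 \<le> M" using assms(3)[of 0] by linarith
  have "integrable lebesgue (\<lambda>y. M *\<^sub>R (indicator (cball 0 r) y *\<^sub>R u y))"
    using assms(1) by (intro integrable_scaleR_right) (simp add: locally_integrable_def)
  then show ?thesis
  proof (rule Bochner_Integration.integrable_bound)
    show "(\<lambda>y. \<phi> y *\<^sub>R u y) \<in> borel_measurable lebesgue"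
      using assms(2) locally_integrable_measurable[OF assms(1)] by simp
    have "norm (\<phi> x *\<^sub>R u x) \<le> norm (M *\<^sub>R (indicator (cball 0 r) x *\<^sub>R u x))" for x
      using assms(3)[of x] assms(4)[of x] M by (cases "norm x > r") (auto intro!: mult_right_mono)
    then show "AE x in lebesgue. norm (\<phi> x *\<^sub>R u x) \<le> norm (M *\<^sub>R (indicator (cball 0 r) x *\<^sub>R u x))"
      by simp
  qed
qed

lemma test_function_bounded:
  assumes "test_function \<phi>"
  obtains M where "M > 0" "\<And>x. \<bar>\<phi> x\<bar> \<le> M"
proof -
  obtain r where r: "r > 0" "\<And>x. norm x > r \<Longrightarrow> \<phi> x = 0"
    using test_function_bounded_support[OF assms] by blast
  have "compact (\<phi> ` cball 0 r)"
    by (intro compact_continuous_image test_function_continuous assms) auto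
  then obtain M where M: "M > 0" "\<forall>y\<in>\<phi> ` cball 0 r. norm y \<le> M"
    using compact_imp_bounded bounded_pos by metis
  have "\<bar>\<phi> x\<bar> \<le> M" for x
    using M r(2)[of x] by (cases "norm x > r") auto
  then show ?thesis using M that by blast
qed

lemma test_function_measurable: "test_function \<phi> \<Longrightarrow> \<phi> \<in> borel_measurable lebesgue"
  by (intro continuous_imp_lebesgue_measurable test_function_continuous)

lemma integrable_test_function_mult:
  assumes "test_function \<phi>" "locally_integrable u"
  shows "integrable lebesgue (\<lambda>y. \<phi> y *\<^sub>R u y)"
  using test_function_bounded[OF assms(1)] test_function_bounded_support[OF assms(1)]
    integrable_bounded_mult_locally_integrable[OF assms(2) test_function_measurable[OF assms(1)]] by metis

lemma integrable_mult_test_function_gradient: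
  assumes \<phi>: "test_function \<phi>" "\<And>x. GDERIV \<phi> x :> g x" and u: "locally_integrable u"
  shows "integrable lebesgue (\<lambda>x. u x *\<^sub>R g x)"
proof -
  have "integrable lebesgue (\<lambda>x. \<Sum>c\<in>Basis. ((g x \<bullet> c) *\<^sub>R u x) *\<^sub>R c)"
    by (intro Bochner_Integration.integrable_sum integrable_scaleR_left
        integrable_test_function_mult[OF test_function_gderiv[OF \<phi>] u])
  also have "(\<lambda>x. \<Sum>c\<in>Basis. ((g x \<bullet> c) *\<^sub>R u x) *\<^sub>R c) = (\<lambda>x. u x *\<^sub>R (\<Sum>c\<in>Basis. (g x \<bullet> c) *\<^sub>R c))"
    by (simp add: fun_eq_iff scaleR_sum_right mult.commute)
  finally show ?thesis by (simp add: euclidean_representation)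
qed

lemma test_function_reflect: "test_function \<phi> \<Longrightarrow> test_function (\<lambda>y. \<phi> (x - y))"
  using test_function_affine[of \<phi> "-1" x] by simp

lemma integrable_conv:
  assumes "test_function \<phi>" "locally_integrable u"
  shows "integrable lebesgue (\<lambda>y. \<phi> (x - y) *\<^sub>R u y)"
  by (intro integrable_test_function_mult test_function_reflect assms)

lemma gderiv_lipschitz:
  fixes f :: "'a::euclidean_space \<Rightarrow> real"
  assumes "convex S" "\<And>z. z \<in> S \<Longrightarrow> GDERIV f z :> g z" "\<And>z. z \<in> S \<Longrightarrow> norm (g z) \<le> B" "x \<in> S" "y \<in> S"
  shows "\<bar>f x - f y\<bar> \<le> B * norm (x - y)"
proof -
  have "onorm (\<lambda>h. h \<bullet> g z) \<le> B" if "z \<in> S" for z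
  proof (rule onorm_bound)
    show "0 \<le> B" using assms(3)[OF that] norm_ge_zero order_trans by blast
    show "norm (h \<bullet> g z) \<le> B * norm h" for h
      using Cauchy_Schwarz_ineq2[of h "g z"] mult_left_mono[OF assms(3)[OF that] norm_ge_zero[of h]]
      by (simp add: mult.commute)
  qed
  then show ?thesis
    using differentiable_bound[of S f "\<lambda>z h. h \<bullet> g z" B x y] assms
    by (simp add: gderiv_def has_derivative_at_withinI)
qed

lemma test_function_obtain_gradient:
  assumes "test_function \<phi>"
  obtains g where "\<And>x. GDERIV \<phi> x :> g x"
proof -
  have "Ck (Suc 0) \<phi>" using assms by (simp add: test_function_def del: Ck.simps)
  then show ?thesis using that Ck_SucE by metis
qed

lemma norm_le_sum_Basis_bound:
  fixes x :: "'a::euclidean_space"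
  assumes "\<And>b. b \<in> Basis \<Longrightarrow> \<bar>x \<bullet> b\<bar> \<le> M b"
  shows "norm x \<le> (\<Sum>b\<in>Basis. M b)"
  using norm_le_l1[of x] sum_mono[of Basis "\<lambda>b. \<bar>x \<bullet> b\<bar>" M] assms by force

lemma test_function_gradient_bounded:
  assumes "test_function \<phi>" "\<And>x. GDERIV \<phi> x :> g x"
  obtains B where "B > 0" "\<And>x. norm (g x) \<le> B"
proof -
  have "\<forall>b. \<exists>M. M > 0 \<and> (\<forall>x. \<bar>g x \<bullet> b\<bar> \<le> M)"
    using test_function_bounded[OF test_function_gderiv[OF assms]] by metis
  then obtain M where M: "\<And>b. M b > 0" "\<And>b x. \<bar>g x \<bullet> b\<bar> \<le> M b" by metis
  then have "norm (g x) \<le> (\<Sum>b\<in>Basis. M b)" for x by (intro norm_le_sum_Basis_bound)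
  moreover have "(\<Sum>b\<in>Basis. M b) > 0" using M by (intro sum_pos) auto
  ultimately show ?thesis using that by blast
qed

lemma test_function_gradient_lipschitz:
  assumes "test_function \<phi>" "\<And>x. GDERIV \<phi> x :> g x"
  obtains K where "K > 0" "\<And>x y. norm (g x - g y) \<le> K * norm (x - y)"
proof -
  have "\<exists>M. M > 0 \<and> (\<forall>x y. \<bar>(g x - g y) \<bullet> b\<bar> \<le> M * norm (x - y))" for b
  proof -
    have t: "test_function (\<lambda>x. g x \<bullet> b)" by (rule test_function_gderiv[OF assms])
    obtain h where h: "\<And>x. GDERIV (\<lambda>x. g x \<bullet> b) x :> h x"
      using test_function_obtain_gradient[OF t] by metis
    obtain B where "B > 0" "\<And>x. norm (h x) \<le> B" using test_function_gradient_bounded[OF t h] by metis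
    then show ?thesis
      using gderiv_lipschitz[of UNIV "\<lambda>x. g x \<bullet> b" h B] h by (auto simp: inner_diff_left)
  qed
  then obtain M where M: "\<And>b. M b > 0" "\<And>b x y. \<bar>(g x - g y) \<bullet> b\<bar> \<le> M b * norm (x - y)" by metis
  then have "norm (g x - g y) \<le> (\<Sum>b\<in>Basis. M b * norm (x - y))" for x y
    by (intro norm_le_sum_Basis_bound)
  then have "norm (g x - g y) \<le> (\<Sum>b\<in>Basis. M b) * norm (x - y)" for x y
    by (simp add: sum_distrib_right)
  moreover have "(\<Sum>b\<in>Basis. M b) > 0" using M by (intro sum_pos) auto
  ultimately show ?thesis using that by blast
qed

text \<open>The mean value inequality for \<open>f\<close> minus its linear part at
  \<open>x\<close>, on the part of \<open>S\<close> within distance \<open>norm h\<close> of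
  \<open>x\<close>, where the gradient differs from \<open>g x\<close> by at most
  \<open>K * norm h\<close>. A convex \<open>S\<close> is allowed because for graphs of class C^2
  the Lipschitz bound is available only on a ball.\<close>

lemma gderiv_taylor_bound:
  fixes f :: "'a::euclidean_space \<Rightarrow> real"
  assumes S: "convex S" "x \<in> S" "x + h \<in> S"
    and f: "\<And>z. z \<in> S \<Longrightarrow> GDERIV f z :> g z"
    and K: "K \<ge> 0" "\<And>z. z \<in> S \<Longrightarrow> norm (g z - g x) \<le> K * norm (z - x)"
  shows "\<bar>f (x + h) - f x - h \<bullet> g x\<bar> \<le> K * (norm h)\<^sup>2"
proof -
  let ?S = "S \<inter> cball x (norm h)"
  have "GDERIV (\<lambda>z. f z - z \<bullet> g x) z :> g z - g x" if "z \<in> ?S" for z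
    by (intro GDERIV_diff f) (use that in \<open>auto simp: gderiv_def intro!: derivative_eq_intros\<close>)
  moreover have "norm (g z - g x) \<le> K * norm h" if "z \<in> ?S" for z
  proof -
    have "norm (z - x) \<le> norm h" using that by (simp add: dist_norm norm_minus_commute)
    then show ?thesis using K(2)[of z] mult_left_mono[OF _ K(1)] that by fastforce
  qed
  ultimately have "\<bar>(f (x + h) - (x + h) \<bullet> g x) - (f x - x \<bullet> g x)\<bar> \<le> K * norm h * norm (x + h - x)"
    using S by (intro gderiv_lipschitz[of ?S]) (auto simp: convex_Int dist_norm)
  then show ?thesis by (simp add: inner_add_left power2_eq_square algebra_simps)
qed

text \<open>Differentiation under the integral, done by hand: the Taylor remainder of
  \<open>\<phi>\<close> is at most \<open>K * (norm h)\<^sup>2\<close> uniformly in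
  \<open>y\<close>, and it vanishes off a fixed ball, over which \<open>u\<close> is
  integrable.\<close>

lemma GDERIV_conv:
  fixes u :: "'a::euclidean_space \<Rightarrow> real"
  assumes \<phi>: "test_function \<phi>" "\<And>x. GDERIV \<phi> x :> g x" and u: "locally_integrable u"
  shows "GDERIV (conv \<phi> u) x :> (LINT y|lebesgue. u y *\<^sub>R g (x - y))"
    and "integrable lebesgue (\<lambda>y. u y *\<^sub>R g (x - y))"
proof -
  obtain r where r: "r > 0" "\<And>x. norm x > r \<Longrightarrow> \<phi> x = 0"
    using test_function_bounded_support[OF \<phi>(1)] by blast
  have gb: "integrable lebesgue (\<lambda>y. (g (x - y) \<bullet> b) *\<^sub>R u y)" for b
    using integrable_conv[OF test_function_gderiv[OF \<phi>, of b] u] by simp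
  have "integrable lebesgue (\<lambda>y. \<Sum>b\<in>Basis. ((g (x - y) \<bullet> b) *\<^sub>R u y) *\<^sub>R b)"
    using gb by (intro Bochner_Integration.integrable_sum integrable_scaleR_left) auto
  also have "(\<lambda>y. \<Sum>b\<in>Basis. ((g (x - y) \<bullet> b) *\<^sub>R u y) *\<^sub>R b) = (\<lambda>y. u y *\<^sub>R g (x - y))"
  proof
    fix y
    have "(\<Sum>b\<in>Basis. ((g (x - y) \<bullet> b) *\<^sub>R u y) *\<^sub>R b) = u y *\<^sub>R (\<Sum>b\<in>Basis. (g (x - y) \<bullet> b) *\<^sub>R b)"
      by (simp add: scaleR_sum_right mult.commute)
    then show "(\<Sum>b\<in>Basis. ((g (x - y) \<bullet> b) *\<^sub>R u y) *\<^sub>R b) = u y *\<^sub>R g (x - y)"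
      by (simp add: euclidean_representation)
  qed
  finally show int: "integrable lebesgue (\<lambda>y. u y *\<^sub>R g (x - y))" .
  obtain K where K: "K > 0" "\<And>x y. norm (g x - g y) \<le> K * norm (x - y)"
    using test_function_gradient_lipschitz[OF \<phi>] by blast
  define I where "I = (LINT y|lebesgue. norm (indicator (cball 0 (norm x + r + 1)) y *\<^sub>R u y))"
  have iI: "integrable lebesgue (\<lambda>y. norm (indicator (cball 0 (norm x + r + 1)) y *\<^sub>R u y))"
    using u by (intro integrable_norm) (simp add: locally_integrable_def)
  have "I \<ge> 0" unfolding I_def by (intro integral_nonneg_AE) simp
  have g0: "g z = 0" if "norm z > r" for z by (rule GDERIV_0_outside[OF r(2) that \<phi>(2)])
  \<comment> \<open>For \<open>norm h \<le> 1\<close> both \<open>\<phi> (x - y)\<close> and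
    \<open>\<phi> (x + h - y)\<close> vanish once \<open>norm y > norm x + r + 1\<close>; hence the
    radius in \<open>I\<close>.\<close>
  have bound: "\<bar>conv \<phi> u (x + h) - conv \<phi> u x - h \<bullet> (LINT y|lebesgue. u y *\<^sub>R g (x - y))\<bar> \<le> (K * I) * (norm h)\<^sup>2"
    if h: "norm h \<le> 1" for h
  proof -
    let ?D = "\<lambda>y. (\<phi> (x + h - y) - \<phi> (x - y) - h \<bullet> g (x - y)) *\<^sub>R u y"
    have i1: "integrable lebesgue (\<lambda>y. \<phi> (x + h - y) *\<^sub>R u y)" "integrable lebesgue (\<lambda>y. \<phi> (x - y) *\<^sub>R u y)"
      by (intro integrable_conv \<phi> u)+
    have i2: "integrable lebesgue (\<lambda>y. h \<bullet> (u y *\<^sub>R g (x - y)))"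
      using int by (intro integrable_inner_right)
    have eq: "?D = (\<lambda>y. \<phi> (x + h - y) *\<^sub>R u y - \<phi> (x - y) *\<^sub>R u y - h \<bullet> (u y *\<^sub>R g (x - y)))"
      by (simp add: fun_eq_iff algebra_simps)
    have iD: "integrable lebesgue ?D"
      unfolding eq by (intro Bochner_Integration.integrable_diff i1 i2)
    have "conv \<phi> u (x + h) - conv \<phi> u x - h \<bullet> (LINT y|lebesgue. u y *\<^sub>R g (x - y)) = (LINT y|lebesgue. ?D y)"
      unfolding eq conv_def using i1 i2 integral_inner_right[of h lebesgue "\<lambda>y. u y *\<^sub>R g (x - y)"] int by simp
    also have "norm \<dots> \<le> (LINT y|lebesgue. norm (?D y))" by (rule integral_norm_bound)
    also have "\<dots> \<le> (LINT y|lebesgue. (K * (norm h)\<^sup>2) * norm (indicator (cball 0 (norm x + r + 1)) y *\<^sub>R u y))"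
    proof (rule integral_mono)
      show "integrable lebesgue (\<lambda>y. norm (?D y))" using iD by (rule integrable_norm)
      show "integrable lebesgue (\<lambda>y. (K * (norm h)\<^sup>2) * norm (indicator (cball 0 (norm x + r + 1)) y *\<^sub>R u y))"
        using iI by simp
      fix y
      show "norm (?D y) \<le> (K * (norm h)\<^sup>2) * norm (indicator (cball 0 (norm x + r + 1)) y *\<^sub>R u y)"
      proof (cases "norm y \<le> norm x + r + 1")
        case True
        have *: "\<bar>\<phi> (x - y + h) - \<phi> (x - y) - h \<bullet> g (x - y)\<bar> \<le> K * (norm h)\<^sup>2"
          by (rule gderiv_taylor_bound[of UNIV]) (use \<phi>(2) K in auto)
        have e: "x + h - y = x - y + h" by simp
        show ?thesis unfolding e using True mult_right_mono[OF *, of "\<bar>u y\<bar>"] by (simp add: abs_mult)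
      next
        case False
        have "norm (x - y) \<ge> norm y - norm x" "norm (x + h - y) \<ge> norm y - norm x - norm h"
          using norm_triangle_ineq2[of y x] norm_triangle_ineq2[of y "x + h"] norm_triangle_ineq[of x h]
          by (auto simp: norm_minus_commute)
        then have "norm (x - y) > r" "norm (x + h - y) > r" using False h by linarith+
        then show ?thesis using r g0 K(1) by (simp add: zero_le_mult_iff)
      qed
    qed
    also have "\<dots> = (K * I) * (norm h)\<^sup>2" by (simp add: I_def)
    finally show ?thesis by simp
  qed
  show "GDERIV (conv \<phi> u) x :> (LINT y|lebesgue. u y *\<^sub>R g (x - y))"
    unfolding gderiv_def has_derivative_at_alt
  proof (intro conjI allI impI)
    show "bounded_linear (\<lambda>h. h \<bullet> (LINT y|lebesgue. u y *\<^sub>R g (x - y)))" by (rule bounded_linear_inner_left)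
    fix e :: real assume "e > 0"
    define d where "d = min 1 (e / (K * I + 1))"
    have KI: "K * I + 1 > 0" using K \<open>I \<ge> 0\<close> by (simp add: add_nonneg_pos)
    then have "d > 0" using \<open>e > 0\<close> by (simp add: d_def)
    moreover have "norm (conv \<phi> u y - conv \<phi> u x - (y - x) \<bullet> (LINT y|lebesgue. u y *\<^sub>R g (x - y))) \<le> e * norm (y - x)"
      if "norm (y - x) < d" for y
    proof -
      have "norm (y - x) \<le> 1" "norm (y - x) * (K * I + 1) \<le> e"
        using that KI by (auto simp: d_def field_simps)
      then have "(K * I) * norm (y - x) \<le> e"
        using mult_right_mono[of "K * I" "K * I + 1" "norm (y - x)"] by (simp add: mult.commute)
      then have "(K * I) * (norm (y - x))\<^sup>2 \<le> e * norm (y - x)"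
        using mult_right_mono[of "(K * I) * norm (y - x)" e "norm (y - x)"] by (simp add: power2_eq_square mult.assoc)
      moreover have "\<bar>conv \<phi> u y - conv \<phi> u x - (y - x) \<bullet> (LINT y|lebesgue. u y *\<^sub>R g (x - y))\<bar> \<le> (K * I) * (norm (y - x))\<^sup>2"
        using bound[of "y - x"] \<open>norm (y - x) \<le> 1\<close> by simp
      ultimately show ?thesis by simp
    qed
    ultimately show "\<exists>d>0. \<forall>y. norm (y - x) < d \<longrightarrow>
        norm (conv \<phi> u y - conv \<phi> u x - (y - x) \<bullet> (LINT y|lebesgue. u y *\<^sub>R g (x - y))) \<le> e * norm (y - x)"
      by blast
  qed
qed

text \<open>A derivative of the convolution is the convolution with a component of the gradient of
  \<open>\<phi>\<close>, again a test function; so the induction runs over all test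
  functions.\<close>

lemma Ck_conv:
  fixes u :: "'a::euclidean_space \<Rightarrow> real"
  assumes "test_function \<phi>" "locally_integrable u"
  shows "Ck k (conv \<phi> u)"
  using assms(1)
proof (induction k arbitrary: \<phi>)
  case 0
  obtain g where g: "\<And>x. GDERIV \<phi> x :> g x" using test_function_obtain_gradient[OF 0] by metis
  have "continuous (at x) (conv \<phi> u)" for x
    using GDERIV_conv(1)[OF 0 g assms(2)] has_derivative_continuous unfolding gderiv_def by blast
  then show ?case by (simp add: continuous_at_imp_continuous_on)
next
  case (Suc k)
  obtain g where g: "\<And>x. GDERIV \<phi> x :> g x" using test_function_obtain_gradient[OF Suc.prems] by metis
  show ?case
  proof (rule Ck_SucI[OF GDERIV_conv(1)[OF Suc.prems g assms(2)]])
    fix b :: 'a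
    have "(LINT y|lebesgue. u y *\<^sub>R g (x - y)) \<bullet> b = conv (\<lambda>z. g z \<bullet> b) u x" for x
      using GDERIV_conv(2)[OF Suc.prems g assms(2), of x]
      by (simp add: conv_def integral_inner_left[symmetric] mult.commute)
    then show "Ck k (\<lambda>x. (LINT y|lebesgue. u y *\<^sub>R g (x - y)) \<bullet> b)"
      using Suc.IH[OF test_function_gderiv[OF Suc.prems g, of b]] by simp
  qed
qed

lemma conv_inner:
  assumes "test_function \<phi>" "locally_integrable u"
  shows "conv \<phi> u x \<bullet> b = conv \<phi> (\<lambda>x. u x \<bullet> b) x"
  using integrable_conv[OF assms, of x] by (simp add: conv_def integral_inner_left[symmetric])

lemma locally_integrable_inner: "locally_integrable u \<Longrightarrow> locally_integrable (\<lambda>x. u x \<bullet> b)"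
  unfolding locally_integrable_def
proof
  fix r assume "\<forall>r. integrable lebesgue (\<lambda>y. indicat_real (cball 0 r) y *\<^sub>R u y)"
  then have "integrable lebesgue (\<lambda>y. (indicat_real (cball 0 r) y *\<^sub>R u y) \<bullet> b)"
    by (intro integrable_inner_left) simp
  then show "integrable lebesgue (\<lambda>y. indicat_real (cball 0 r) y *\<^sub>R (u y \<bullet> b))"
    by (simp only: inner_scaleR_left real_scaleR_def)
qed

lemma continuous_on_conv:
  assumes "test_function \<phi>" "locally_integrable u"
  shows "continuous_on S (conv \<phi> u)"
proof -
  have "continuous_on S (\<lambda>x. conv \<phi> u x \<bullet> b)" for b
    unfolding conv_inner[OF assms]
    by (rule Ck_continuous[OF Ck_conv[where k=0, OF assms(1) locally_integrable_inner[OF assms(2)]]])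
  then show ?thesis by (subst continuous_on_componentwise) blast
qed

lemma conv_bounded_support:
  assumes "\<And>x. norm x > r \<Longrightarrow> \<phi> x = 0" "\<And>x. norm x > s \<Longrightarrow> u x = 0" "norm x > r + s"
  shows "conv \<phi> u x = 0"
proof -
  have "\<phi> (x - y) *\<^sub>R u y = 0" for y
  proof (cases "norm y > s")
    case False
    then have "norm (x - y) > r" using assms(3) norm_triangle_ineq[of "x - y" y] by simp
    then show ?thesis using assms(1) by simp
  qed (simp add: assms(2))
  then show ?thesis unfolding conv_def by (simp only: integral_zero)
qed

lemma integrable_const_indicator_cball:
  "integrable lebesgue (\<lambda>x::'a::euclidean_space. c * indicat_real (cball a r) x)"
proof (intro integrable_mult_right)
  show "integrable lebesgue (indicat_real (cball a r))"
    using emeasure_lborel_cball_finite[of a r] by (intro integrable_real_indicator fmeasurableD) auto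
qed

section \<open>Mollification in L^2\<close>

lemma mollifierD:
  assumes "mollifier \<delta> \<rho>"
  shows "test_function \<rho>" "\<rho> x \<ge> 0" "norm x \<ge> \<delta> \<Longrightarrow> \<rho> x = 0"
    "integrable lebesgue \<rho>" "(LINT x|lebesgue. \<rho> x) = 1"
proof -
  show t: "test_function \<rho>" and "\<rho> x \<ge> 0" "norm x \<ge> \<delta> \<Longrightarrow> \<rho> x = 0"
    using assms by (auto simp: mollifier_def)
  have m: "\<rho> \<in> borel_measurable lborel"
    using test_function_continuous[OF t, of UNIV] borel_measurable_continuous_onI by auto
  show "integrable lebesgue \<rho>" "(LINT x|lebesgue. \<rho> x) = 1"
    using assms integrable_completion[OF m] integral_completion[OF m] by (auto simp: mollifier_def)
qed

lemma mollifier_integral_reflect: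
  assumes "mollifier \<delta> \<rho>"
  shows "integrable lebesgue (\<lambda>y. \<rho> (x - y))" "(LINT y|lebesgue. \<rho> (x - y)) = 1"
  using integrable_lebesgue_affine[of "-1" \<rho> x] integral_lebesgue_affine[of "-1" \<rho> x]
    mollifierD[OF assms] test_function_measurable by auto

lemma integrable_locally_integrable:
  assumes "integrable lebesgue u"
  shows "locally_integrable u"
  unfolding locally_integrable_def
proof
  fix r
  show "integrable lebesgue (\<lambda>y. indicat_real (cball 0 r) y *\<^sub>R u y)"
  proof (rule Bochner_Integration.integrable_bound[OF assms])
    show "(\<lambda>y. indicat_real (cball 0 r) y *\<^sub>R u y) \<in> borel_measurable lebesgue"
      using assms by (intro borel_measurable_scaleR indicator_cball_lebesgue) (rule borel_measurable_integrable)
  qed (auto intro!: AE_I2 simp: indicator_def)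
qed

lemma locally_integrable_norm:
  fixes u :: "'a::euclidean_space \<Rightarrow> 'b::euclidean_space"
  assumes "locally_integrable u"
  shows "locally_integrable (\<lambda>x. norm (u x))"
  unfolding locally_integrable_def
proof
  fix r
  have "integrable lebesgue (\<lambda>y. norm (indicat_real (cball 0 r) y *\<^sub>R u y))"
    using assms by (intro integrable_norm) (simp add: locally_integrable_def)
  then show "integrable lebesgue (\<lambda>y. indicat_real (cball 0 r) y *\<^sub>R norm (u y))"
    by (simp add: norm_scaleR)
qed

text \<open>Jensen's inequality for the probability density \<open>\<rho> (x - y)\<close>: the
  variance of \<open>norm (u y)\<close> about its mean \<open>m\<close> is nonnegative.\<close>

lemma conv_power2_le:
  fixes u :: "'a::euclidean_space \<Rightarrow> 'b::euclidean_space"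
  assumes \<rho>: "mollifier \<delta> \<rho>" and u: "square_integrable u"
  shows "(norm (conv \<rho> u x))\<^sup>2 \<le> (LINT y|lebesgue. \<rho> (x - y) * (norm (u y))\<^sup>2)"
    and "integrable lebesgue (\<lambda>y. \<rho> (x - y) * (norm (u y))\<^sup>2)"
proof -
  note t = mollifierD(1)[OF \<rho>]
  have lu: "locally_integrable u" using u by (rule square_integrable_locally_integrable)
  define m where "m = (LINT y|lebesgue. \<rho> (x - y) * norm (u y))"
  have i1: "integrable lebesgue (\<lambda>y. \<rho> (x - y) * norm (u y))"
    using integrable_conv[OF t locally_integrable_norm[OF lu]] by simp
  have "locally_integrable (\<lambda>y. (norm (u y))\<^sup>2)"
    using u by (intro integrable_locally_integrable) (simp add: square_integrable_def)
  from integrable_conv[OF t this] show i2: "integrable lebesgue (\<lambda>y. \<rho> (x - y) * (norm (u y))\<^sup>2)"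
    by simp
  note i3 = mollifier_integral_reflect[OF \<rho>, of x]
  have "norm (conv \<rho> u x) \<le> (LINT y|lebesgue. norm (\<rho> (x - y) *\<^sub>R u y))"
    unfolding conv_def by (rule integral_norm_bound)
  then have le: "norm (conv \<rho> u x) \<le> m" using mollifierD(2)[OF \<rho>] by (simp add: m_def)
  have "0 \<le> (LINT y|lebesgue. \<rho> (x - y) * (norm (u y) - m)\<^sup>2)"
    using mollifierD(2)[OF \<rho>] by (intro integral_nonneg_AE) simp
  also have "(\<lambda>y. \<rho> (x - y) * (norm (u y) - m)\<^sup>2) =
      (\<lambda>y. \<rho> (x - y) * (norm (u y))\<^sup>2 - (2 * m) * (\<rho> (x - y) * norm (u y)) + m\<^sup>2 * \<rho> (x - y))"
    by (simp add: fun_eq_iff power2_eq_square algebra_simps)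
  also have "(LINT y|lebesgue. \<dots> y) = (LINT y|lebesgue. \<rho> (x - y) * (norm (u y))\<^sup>2) - (2 * m) * m + m\<^sup>2"
    using i1 i2 i3 by (simp add: m_def)
  finally have "m\<^sup>2 \<le> (LINT y|lebesgue. \<rho> (x - y) * (norm (u y))\<^sup>2)"
    by (simp add: power2_eq_square)
  then show "(norm (conv \<rho> u x))\<^sup>2 \<le> (LINT y|lebesgue. \<rho> (x - y) * (norm (u y))\<^sup>2)"
    using power_mono[OF le, of 2] by simp
qed

text \<open>The pointwise bound by Jensen integrates to the contraction property, since
  \<open>\<rho>\<close> has integral one in the other variable too.\<close>

lemma square_integrable_conv:
  fixes u :: "'a::euclidean_space \<Rightarrow> 'b::euclidean_space"
  assumes \<rho>: "mollifier \<delta> \<rho>" and u: "square_integrable u"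
  shows "square_integrable (conv \<rho> u)"
    and "(LINT x|lebesgue. (norm (conv \<rho> u x))\<^sup>2) \<le> (LINT x|lebesgue. (norm (u x))\<^sup>2)"
proof -
  note t = mollifierD(1)[OF \<rho>]
  have lu: "locally_integrable u" using u by (rule square_integrable_locally_integrable)
  have [measurable]: "\<rho> \<in> borel_measurable borel"
    using test_function_continuous[OF t, of UNIV] borel_measurable_continuous_onI by auto
  have "(\<lambda>x. (norm (u x))\<^sup>2) \<in> borel_measurable lebesgue"
    using u by (intro borel_measurable_integrable) (simp add: square_integrable_def)
  \<comment> \<open>Fubini is used on \<open>lborel\<close>, so the square of \<open>u\<close> is
    replaced by a Borel function equal to it almost everywhere; taking the absolute value keeps the
    substitute nonnegative everywhere.\<close>
  then obtain w where [measurable]: "w \<in> borel_measurable lborel" and w: "AE x in lborel. (norm (u x))\<^sup>2 = w x"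
    using completion_ex_borel_measurable_real by blast
  have pt: "ennreal ((norm (conv \<rho> u x))\<^sup>2) \<le> (\<integral>\<^sup>+y. ennreal (\<rho> (x - y) * \<bar>w y\<bar>) \<partial>lborel)" for x
  proof -
    have "ennreal ((norm (conv \<rho> u x))\<^sup>2) \<le> ennreal (LINT y|lebesgue. \<rho> (x - y) * (norm (u y))\<^sup>2)"
      by (intro ennreal_leI conv_power2_le[OF \<rho> u])
    also have "\<dots> = (\<integral>\<^sup>+y. ennreal (\<rho> (x - y) * (norm (u y))\<^sup>2) \<partial>lebesgue)"
      using conv_power2_le(2)[OF \<rho> u] mollifierD(2)[OF \<rho>]
      by (intro nn_integral_eq_integral[symmetric]) auto
    also have "\<dots> = (\<integral>\<^sup>+y. ennreal (\<rho> (x - y) * (norm (u y))\<^sup>2) \<partial>lborel)"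
      by (rule nn_integral_completion)
    also have "\<dots> = (\<integral>\<^sup>+y. ennreal (\<rho> (x - y) * \<bar>w y\<bar>) \<partial>lborel)"
    proof (rule nn_integral_cong_AE)
      show "AE y in lborel. ennreal (\<rho> (x - y) * (norm (u y))\<^sup>2) = ennreal (\<rho> (x - y) * \<bar>w y\<bar>)"
        using w by eventually_elim (metis abs_of_nonneg zero_le_power2)
    qed
    finally show ?thesis .
  qed
  have one: "(\<integral>\<^sup>+x. ennreal (\<rho> (x - y)) \<partial>lborel) = 1" for y
  proof -
    have "integrable lebesgue (\<lambda>x. \<rho> (- y + 1 *\<^sub>R x))" "(LINT x|lebesgue. \<rho> (- y + 1 *\<^sub>R x)) = 1"
      using integrable_lebesgue_affine[of 1 \<rho> "-y"] integral_lebesgue_affine[of 1 \<rho> "-y"]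
        mollifierD[OF \<rho>] test_function_measurable[OF t] by auto
    then have "(\<integral>\<^sup>+x. ennreal (\<rho> (x - y)) \<partial>lebesgue) = 1"
      using mollifierD(2)[OF \<rho>] by (subst nn_integral_eq_integral) auto
    then show ?thesis by (simp add: nn_integral_completion)
  qed
  have "(\<integral>\<^sup>+x. ennreal ((norm (conv \<rho> u x))\<^sup>2) \<partial>lebesgue) = (\<integral>\<^sup>+x. ennreal ((norm (conv \<rho> u x))\<^sup>2) \<partial>lborel)"
    by (rule nn_integral_completion)
  also have "\<dots> \<le> (\<integral>\<^sup>+x. \<integral>\<^sup>+y. ennreal (\<rho> (x - y) * \<bar>w y\<bar>) \<partial>lborel \<partial>lborel)"
    by (intro nn_integral_mono pt)
  also have "\<dots> = (\<integral>\<^sup>+y. \<integral>\<^sup>+x. ennreal (\<rho> (x - y) * \<bar>w y\<bar>) \<partial>lborel \<partial>lborel)"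
    by (rule lborel_pair.Fubini'[symmetric]) measurable
  also have "\<dots> = (\<integral>\<^sup>+y. \<integral>\<^sup>+x. ennreal \<bar>w y\<bar> * ennreal (\<rho> (x - y)) \<partial>lborel \<partial>lborel)"
    using mollifierD(2)[OF \<rho>] by (intro nn_integral_cong) (simp add: ennreal_mult mult.commute)
  also have "\<dots> = (\<integral>\<^sup>+y. ennreal \<bar>w y\<bar> * 1 \<partial>lborel)"
    by (intro nn_integral_cong) (simp add: nn_integral_cmult one)
  also have "\<dots> = (\<integral>\<^sup>+y. ennreal ((norm (u y))\<^sup>2) \<partial>lborel)"
  proof (rule nn_integral_cong_AE)
    show "AE y in lborel. ennreal \<bar>w y\<bar> * 1 = ennreal ((norm (u y))\<^sup>2)"
      using w by eventually_elim (metis abs_of_nonneg mult.right_neutral zero_le_power2)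
  qed
  also have "\<dots> = (\<integral>\<^sup>+y. ennreal ((norm (u y))\<^sup>2) \<partial>lebesgue)"
    by (rule nn_integral_completion[symmetric])
  also have "\<dots> = ennreal (LINT x|lebesgue. (norm (u x))\<^sup>2)"
    using u by (intro nn_integral_eq_integral) (auto simp: square_integrable_def)
  finally have le: "(\<integral>\<^sup>+x. ennreal ((norm (conv \<rho> u x))\<^sup>2) \<partial>lebesgue) \<le> ennreal (LINT x|lebesgue. (norm (u x))\<^sup>2)" .
  have m: "conv \<rho> u \<in> borel_measurable lebesgue"
    by (intro continuous_imp_lebesgue_measurable continuous_on_conv t lu)
  have int: "integrable lebesgue (\<lambda>x. (norm (conv \<rho> u x))\<^sup>2)"
    by (rule integrableI_bounded) (use m le in \<open>auto simp: le_less_trans less_top\<close>)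
  then show "square_integrable (conv \<rho> u)" using m by (simp add: square_integrable_def)
  have "ennreal (LINT x|lebesgue. (norm (conv \<rho> u x))\<^sup>2) \<le> ennreal (LINT x|lebesgue. (norm (u x))\<^sup>2)"
    using le int by (simp add: nn_integral_eq_integral)
  then show "(LINT x|lebesgue. (norm (conv \<rho> u x))\<^sup>2) \<le> (LINT x|lebesgue. (norm (u x))\<^sup>2)"
    by (simp add: ennreal_le_iff integral_nonneg_AE)
qed

lemma norm_add_power2_le:
  fixes a b :: "'b::real_inner"
  shows "(norm (a + b))\<^sup>2 \<le> 2 * (norm a)\<^sup>2 + 2 * (norm b)\<^sup>2"
proof -
  have "(norm (a + b))\<^sup>2 + (norm (a - b))\<^sup>2 = 2 * (norm a)\<^sup>2 + 2 * (norm b)\<^sup>2"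
    unfolding power2_norm_eq_inner by (simp add: inner_add inner_diff inner_commute)
  then show ?thesis using zero_le_power2[of "norm (a - b)"] by linarith
qed

lemma square_integrable_add:
  fixes u :: "'a::euclidean_space \<Rightarrow> 'b::euclidean_space"
  assumes "square_integrable u" "square_integrable w"
  shows "square_integrable (\<lambda>x. u x + w x)"
    "(LINT x|lebesgue. (norm (u x + w x))\<^sup>2) \<le> 2 * (LINT x|lebesgue. (norm (u x))\<^sup>2) + 2 * (LINT x|lebesgue. (norm (w x))\<^sup>2)"
proof -
  have m: "(\<lambda>x. u x + w x) \<in> borel_measurable lebesgue"
    using assms by (intro borel_measurable_add) (auto simp: square_integrable_def)
  have i: "integrable lebesgue (\<lambda>x. 2 * (norm (u x))\<^sup>2 + 2 * (norm (w x))\<^sup>2)"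
    using assms by (simp add: square_integrable_def)
  have int: "integrable lebesgue (\<lambda>x. (norm (u x + w x))\<^sup>2)"
    by (rule Bochner_Integration.integrable_bound[OF i]) (use m norm_add_power2_le in \<open>auto intro!: AE_I2\<close>)
  then show "square_integrable (\<lambda>x. u x + w x)" using m by (simp add: square_integrable_def)
  have "(LINT x|lebesgue. (norm (u x + w x))\<^sup>2) \<le> (LINT x|lebesgue. 2 * (norm (u x))\<^sup>2 + 2 * (norm (w x))\<^sup>2)"
    using int i norm_add_power2_le by (intro integral_mono) auto
  also have "\<dots> = 2 * (LINT x|lebesgue. (norm (u x))\<^sup>2) + 2 * (LINT x|lebesgue. (norm (w x))\<^sup>2)"
    using assms by (simp add: square_integrable_def)
  finally show "(LINT x|lebesgue. (norm (u x + w x))\<^sup>2) \<le> 2 * (LINT x|lebesgue. (norm (u x))\<^sup>2) + 2 * (LINT x|lebesgue. (norm (w x))\<^sup>2)" .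
qed

lemma square_integrable_bound:
  fixes u :: "'a::euclidean_space \<Rightarrow> 'b::euclidean_space" and w :: "'a \<Rightarrow> 'c::euclidean_space"
  assumes u: "square_integrable u" and w: "w \<in> borel_measurable lebesgue" "\<And>x. norm (w x) \<le> M * norm (u x)"
  shows "square_integrable w"
proof -
  have i: "integrable lebesgue (\<lambda>x. M\<^sup>2 * (norm (u x))\<^sup>2)" using u by (simp add: square_integrable_def)
  have le: "(norm (w x))\<^sup>2 \<le> M\<^sup>2 * (norm (u x))\<^sup>2" for x
    using power_mono[OF w(2), of x 2] by (simp add: power_mult_distrib)
  have "integrable lebesgue (\<lambda>x. (norm (w x))\<^sup>2)"
    by (rule Bochner_Integration.integrable_bound[OF i]) (use w(1) le in auto)
  then show ?thesis using w(1) by (simp add: square_integrable_def)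
qed

lemma square_integrable_minus: "square_integrable u \<Longrightarrow> square_integrable (\<lambda>x. - u x)"
  by (auto simp: square_integrable_def)

lemma square_integrable_diff:
  fixes u :: "'a::euclidean_space \<Rightarrow> 'b::euclidean_space"
  assumes "square_integrable u" "square_integrable w"
  shows "square_integrable (\<lambda>x. u x - w x)"
  using square_integrable_add[OF assms(1) square_integrable_minus[OF assms(2)]] by simp

lemma square_integrable_bounded_support:
  fixes f :: "'a::euclidean_space \<Rightarrow> 'b::euclidean_space"
  assumes "f \<in> borel_measurable lebesgue" "\<And>x. norm (f x) \<le> M" "\<And>x. norm x > r \<Longrightarrow> f x = 0"
  shows "square_integrable f"
  unfolding square_integrable_def
proof
  show "integrable lebesgue (\<lambda>x. (norm (f x))\<^sup>2)"
    by (rule integrable_lebesgue_bounded_support[of _ "M\<^sup>2" r]) (use assms in \<open>auto intro: power_mono\<close>)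
qed fact

lemma square_integrable_truncation:
  fixes u :: "'a::euclidean_space \<Rightarrow> 'b::euclidean_space"
  assumes u: "square_integrable u" and e: "e > 0"
  obtains w M where "w \<in> borel_measurable lebesgue" "M > 0" "\<And>x. norm (w x) \<le> M" "\<And>x. norm x > M \<Longrightarrow> w x = 0"
    "(LINT x|lebesgue. (norm (u x - w x))\<^sup>2) < e"
proof -
  define w where "w n x = (if norm x \<le> real n \<and> norm (u x) \<le> real n then u x else 0)" for n x
  have um[measurable]: "u \<in> borel_measurable lebesgue" and ui: "integrable lebesgue (\<lambda>x. (norm (u x))\<^sup>2)"
    using u by (auto simp: square_integrable_def)
  have [measurable]: "(\<lambda>x::'a. norm x) \<in> borel_measurable lebesgue"
    by (intro continuous_imp_lebesgue_measurable continuous_intros)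
  have wm[measurable]: "w n \<in> borel_measurable lebesgue" for n unfolding w_def by measurable
  have "(\<lambda>n. LINT x|lebesgue. (norm (u x - w n x))\<^sup>2) \<longlonglongrightarrow> (LINT x|(lebesgue::'a measure). 0)"
  proof (rule integral_dominated_convergence[OF _ _ ui])
    show "AE x in lebesgue. (\<lambda>n. (norm (u x - w n x))\<^sup>2) \<longlonglongrightarrow> 0"
    proof (rule AE_I2)
      fix x
      show "(\<lambda>n. (norm (u x - w n x))\<^sup>2) \<longlonglongrightarrow> 0"
      proof (rule tendsto_eventually, rule eventually_sequentiallyI)
        fix n assume "nat \<lceil>max (norm x) (norm (u x))\<rceil> \<le> n"
        then have "norm x \<le> real n" "norm (u x) \<le> real n" by linarith+
        then show "(norm (u x - w n x))\<^sup>2 = 0" by (simp add: w_def)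
      qed
    qed
    show "AE x in lebesgue. norm ((norm (u x - w n x))\<^sup>2) \<le> (norm (u x))\<^sup>2" for n
      by (rule AE_I2) (simp add: w_def)
  qed auto
  then have "\<forall>\<^sub>F n in sequentially. (LINT x|lebesgue. (norm (u x - w n x))\<^sup>2) < e"
    using e by (simp add: order_tendstoD)
  then obtain n where "(LINT x|lebesgue. (norm (u x - w n x))\<^sup>2) < e"
    by (auto simp: eventually_sequentially)
  moreover have "w n x = 0" if "norm x > real n + 1" for x using that by (simp add: w_def)
  moreover have "norm (w n x) \<le> real n + 1" for x by (simp add: w_def)
  ultimately show ?thesis using that[of "w n" "real n + 1"] wm by simp
qed

text \<open>A measurable function is an almost everywhere limit of continuous \<open>h n\<close>.
  After truncation to a bounded function of bounded support, projecting the values of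
  \<open>h n\<close> to the ball of radius \<open>M\<close> and multiplying by a cutoff makes the
  sequence dominated.\<close>

lemma square_integrable_approx_continuous:
  fixes u :: "'a::euclidean_space \<Rightarrow> 'b::euclidean_space"
  assumes u: "square_integrable u" and e: "e > 0"
  obtains g r where "continuous_on UNIV g" "\<And>x. norm x > r \<Longrightarrow> g x = 0" "square_integrable g"
    "(LINT x|lebesgue. (norm (u x - g x))\<^sup>2) \<le> e"
proof -
  obtain w M where wm[measurable]: "w \<in> borel_measurable lebesgue" and M: "M > 0" "\<And>x. norm (w x) \<le> M" "\<And>x. norm x > M \<Longrightarrow> w x = 0"
    and uw: "(LINT x|lebesgue. (norm (u x - w x))\<^sup>2) < e / 4"
    using square_integrable_truncation[OF u, of "e / 4"] e by auto
  have w: "square_integrable w" by (rule square_integrable_bounded_support[OF wm M(2,3)])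
  obtain N h where N: "negligible N" and h: "\<And>n. continuous_on UNIV (h n)" "\<And>x. x \<notin> N \<Longrightarrow> (\<lambda>n. h n x) \<longlonglongrightarrow> w x"
    using lebesgue_measurable_imp_measurable_on[OF wm, of UNIV] by (auto simp: measurable_on_def)
  define g where "g n x = (max 0 (min 1 (M + 1 - norm x))) *\<^sub>R closest_point (cball 0 M) (h n x)" for n x
  have gc: "continuous_on UNIV (g n)" for n
    unfolding g_def using M
    by (intro continuous_intros continuous_on_compose2[OF continuous_on_closest_point h(1)]) auto
  have gM: "norm (g n x) \<le> M" for n x
  proof -
    have "closest_point (cball 0 M) (h n x) \<in> cball 0 M" using M by (intro closest_point_in_set) auto
    then have "norm (closest_point (cball 0 M) (h n x)) \<le> M" by simp
    moreover have "\<bar>max 0 (min 1 (M + 1 - norm x))\<bar> \<le> 1" by auto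
    ultimately have "\<bar>max 0 (min 1 (M + 1 - norm x))\<bar> * norm (closest_point (cball 0 M) (h n x)) \<le> 1 * M"
      by (intro mult_mono) auto
    then show ?thesis by (simp add: g_def)
  qed
  have g0: "g n x = 0" if "norm x > M + 1" for n x using that by (simp add: g_def)
  have gm[measurable]: "g n \<in> borel_measurable lebesgue" for n
    by (rule continuous_imp_lebesgue_measurable[OF gc])
  have lim: "(\<lambda>n. g n x) \<longlonglongrightarrow> w x" if x: "x \<notin> N" for x
  proof -
    have "continuous_on UNIV (closest_point (cball (0::'b) M))"
      using M by (intro continuous_on_closest_point) auto
    then have "(\<lambda>n. closest_point (cball 0 M) (h n x)) \<longlonglongrightarrow> closest_point (cball 0 M) (w x)"
      using h(2)[OF x] continuous_on_tendsto_compose[of UNIV "closest_point (cball 0 M)" "\<lambda>n. h n x"] by auto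
    also have "closest_point (cball 0 M) (w x) = w x" using M(2)[of x] by (intro closest_point_self) simp
    finally have "(\<lambda>n. g n x) \<longlonglongrightarrow> (max 0 (min 1 (M + 1 - norm x))) *\<^sub>R w x"
      unfolding g_def by (intro tendsto_intros)
    also have "(max 0 (min 1 (M + 1 - norm x))) *\<^sub>R w x = w x"
      using M(3)[of x] by (cases "norm x > M") auto
    finally show ?thesis .
  qed
  have "(\<lambda>n. LINT x|lebesgue. (norm (w x - g n x))\<^sup>2) \<longlonglongrightarrow> (LINT x|(lebesgue::'a measure). 0)"
  proof (rule integral_dominated_convergence)
    show "integrable lebesgue (\<lambda>x::'a. (2 * M)\<^sup>2 * indicat_real (cball 0 (M + 1)) x)"
      by (rule integrable_const_indicator_cball)
    show "AE x in lebesgue. (\<lambda>n. (norm (w x - g n x))\<^sup>2) \<longlonglongrightarrow> 0"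
    proof (rule AE_I'[of N])
      show "N \<in> null_sets lebesgue" using N by (simp add: negligible_iff_null_sets)
      have "(\<lambda>n. (norm (w x - g n x))\<^sup>2) \<longlonglongrightarrow> (norm (w x - w x))\<^sup>2" if "x \<notin> N" for x
        by (intro tendsto_intros lim that)
      then show "{x \<in> space lebesgue. \<not> (\<lambda>n. (norm (w x - g n x))\<^sup>2) \<longlonglongrightarrow> 0} \<subseteq> N" by auto
    qed
    show "AE x in lebesgue. norm ((norm (w x - g n x))\<^sup>2) \<le> (2 * M)\<^sup>2 * indicat_real (cball 0 (M + 1)) x" for n
    proof (rule AE_I2)
      fix x
      show "norm ((norm (w x - g n x))\<^sup>2) \<le> (2 * M)\<^sup>2 * indicat_real (cball 0 (M + 1)) x"
      proof (cases "norm x > M + 1")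
        case True
        then show ?thesis using g0 M(3)[of x] by simp
      next
        case False
        have "norm (w x - g n x) \<le> 2 * M" using norm_triangle_ineq4[of "w x" "g n x"] M(2)[of x] gM[of n x] by linarith
        then have "(norm (w x - g n x))\<^sup>2 \<le> (2 * M)\<^sup>2" by (intro power_mono) auto
        then show ?thesis using False by simp
      qed
    qed
  qed auto
  then have "\<forall>\<^sub>F n in sequentially. (LINT x|lebesgue. (norm (w x - g n x))\<^sup>2) < e / 4"
    by (rule order_tendstoD(2)) (use e in simp)
  then obtain n where n: "(LINT x|lebesgue. (norm (w x - g n x))\<^sup>2) < e / 4"
    by (auto simp: eventually_sequentially)
  have g: "square_integrable (g n)" by (rule square_integrable_bounded_support[OF gm gM g0])
  have "(LINT x|lebesgue. (norm ((u x - w x) + (w x - g n x)))\<^sup>2)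
      \<le> 2 * (LINT x|lebesgue. (norm (u x - w x))\<^sup>2) + 2 * (LINT x|lebesgue. (norm (w x - g n x))\<^sup>2)"
    by (intro square_integrable_add square_integrable_diff u w g)
  then have "(LINT x|lebesgue. (norm (u x - g n x))\<^sup>2) \<le> e" using uw n by simp
  then show ?thesis using that[OF gc g0 g] by blast
qed

lemma norm_conv_diff_le:
  assumes \<rho>: "mollifier \<delta> \<rho>" and F: "locally_integrable F"
    and B: "\<And>y. norm (x - y) < \<delta> \<Longrightarrow> norm (F y - F x) \<le> B"
  shows "norm (conv \<rho> F x - F x) \<le> B"
proof -
  note i = mollifier_integral_reflect[OF \<rho>, of x]
  have i1: "integrable lebesgue (\<lambda>y. \<rho> (x - y) *\<^sub>R F y)" by (rule integrable_conv[OF mollifierD(1)[OF \<rho>] F])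
  have i2: "integrable lebesgue (\<lambda>y. \<rho> (x - y) *\<^sub>R F x)" using i by simp
  have iD: "integrable lebesgue (\<lambda>y. \<rho> (x - y) *\<^sub>R F y - \<rho> (x - y) *\<^sub>R F x)"
    by (rule Bochner_Integration.integrable_diff[OF i1 i2])
  have "conv \<rho> F x - F x = (LINT y|lebesgue. \<rho> (x - y) *\<^sub>R F y - \<rho> (x - y) *\<^sub>R F x)"
    using i i1 i2 by (simp add: conv_def)
  also have "norm \<dots> \<le> (LINT y|lebesgue. norm (\<rho> (x - y) *\<^sub>R F y - \<rho> (x - y) *\<^sub>R F x))"
    by (rule integral_norm_bound)
  also have "\<dots> \<le> (LINT y|lebesgue. B * \<rho> (x - y))"
  proof (rule integral_mono)
    show "integrable lebesgue (\<lambda>y. norm (\<rho> (x - y) *\<^sub>R F y - \<rho> (x - y) *\<^sub>R F x))" by (rule integrable_norm[OF iD])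
    show "integrable lebesgue (\<lambda>y. B * \<rho> (x - y))" using i by simp
    fix y
    show "norm (\<rho> (x - y) *\<^sub>R F y - \<rho> (x - y) *\<^sub>R F x) \<le> B * \<rho> (x - y)"
    proof (cases "norm (x - y) < \<delta>")
      case True
      then show ?thesis using mult_left_mono[OF B[OF True] mollifierD(2)[OF \<rho>, of "x - y"]] mollifierD(2)[OF \<rho>, of "x - y"]
        by (simp add: scaleR_diff_right[symmetric] mult.commute)
    next
      case False
      then show ?thesis using mollifierD(3)[OF \<rho>, of "x - y"] by simp
    qed
  qed
  also have "\<dots> = B" using i by simp
  finally show ?thesis .
qed

text \<open>Uniform continuity makes the difference small, and it is supported in the fixed ball of
  radius \<open>R\<close>; \<open>\<eta>\<close> is chosen such that \<open>\<eta>\<^sup>2\<close>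
  times the volume of that ball stays below \<open>e\<close>.\<close>

lemma conv_continuous_L2:
  fixes g :: "'a::euclidean_space \<Rightarrow> 'b::euclidean_space"
  assumes g: "continuous_on UNIV g" "\<And>x. norm x > r \<Longrightarrow> g x = 0" and e: "e > 0"
  obtains \<delta> where "\<delta> > 0" "\<And>\<rho>. mollifier \<delta> \<rho> \<Longrightarrow> (LINT x|lebesgue. (norm (conv \<rho> g x - g x))\<^sup>2) \<le> e"
proof -
  define R where "R = \<bar>r\<bar> + 1"
  define V where "V = measure lebesgue (cball (0::'a) R)"
  define \<eta> where "\<eta> = sqrt (e / (V + 1))"
  have V: "V \<ge> 0" by (simp add: V_def)
  have \<eta>: "\<eta> > 0" "\<eta>\<^sup>2 * V \<le> e" using e V by (auto simp: \<eta>_def field_simps)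
  have "uniformly_continuous_on (cball 0 (R + 1)) g"
    using g(1) continuous_on_subset by (intro compact_uniformly_continuous) auto
  then obtain d where d: "d > 0" "\<And>x y. x \<in> cball 0 (R + 1) \<Longrightarrow> y \<in> cball 0 (R + 1) \<Longrightarrow> dist y x < d \<Longrightarrow> dist (g y) (g x) < \<eta>"
    using \<eta>(1) unfolding uniformly_continuous_on_def by metis
  define \<delta> where "\<delta> = min d 1"
  have close: "norm (g y - g x) \<le> (if norm x \<le> R then \<eta> else 0)" if "norm (x - y) < \<delta>" for x y
  proof (cases "norm x \<le> R")
    case True
    have "norm y \<le> norm x + norm (x - y)" using norm_triangle_ineq4[of x "x - y"] by simp
    then have "norm y \<le> R + 1" using True that by (simp add: \<delta>_def)
    then have "dist (g y) (g x) < \<eta>" using d(2)[of x y] True that by (simp add: \<delta>_def dist_norm norm_minus_commute)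
    then show ?thesis using True by (simp add: dist_norm)
  next
    case False
    have "norm x \<le> norm y + norm (x - y)" using norm_triangle_ineq[of y "x - y"] by simp
    then have "norm y > r" "norm x > r" using False that by (auto simp: \<delta>_def R_def)
    then show ?thesis using g(2) False by simp
  qed
  have gm: "g \<in> borel_measurable lebesgue" by (rule continuous_imp_lebesgue_measurable[OF g(1)])
  have "compact (g ` cball 0 \<bar>r\<bar>)" using g(1) continuous_on_subset by (intro compact_continuous_image) auto
  then obtain M where M: "M > 0" "\<forall>y\<in>g ` cball 0 \<bar>r\<bar>. norm y \<le> M" using compact_imp_bounded bounded_pos by metis
  have "norm (g x) \<le> M" for x using M g(2)[of x] by (cases "norm x > r") auto
  then have gl: "locally_integrable g" using locally_integrable_bounded[OF gm] by blast
  have "(LINT x|lebesgue. (norm (conv \<rho> g x - g x))\<^sup>2) \<le> e" if \<rho>: "mollifier \<delta> \<rho>" for \<rho>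
  proof -
    have pt: "norm (conv \<rho> g x - g x) \<le> (if norm x \<le> R then \<eta> else 0)" for x
      using norm_conv_diff_le[OF \<rho> gl close] by simp
    have m: "(\<lambda>x. conv \<rho> g x - g x) \<in> borel_measurable lebesgue"
      by (intro borel_measurable_diff gm continuous_imp_lebesgue_measurable continuous_on_conv mollifierD(1)[OF \<rho>] gl)
    have *: "(norm (conv \<rho> g x - g x))\<^sup>2 \<le> \<eta>\<^sup>2 * indicat_real (cball 0 R) x" for x
      using pt[of x] power_mono[OF pt[of x], of 2] by (simp split: if_splits)
    have "(LINT x|lebesgue. (norm (conv \<rho> g x - g x))\<^sup>2) \<le> (LINT x|lebesgue. \<eta>\<^sup>2 * indicat_real (cball (0::'a) R) x)"
    proof (rule integral_mono)
      show i: "integrable lebesgue (\<lambda>x::'a. \<eta>\<^sup>2 * indicat_real (cball 0 R) x)"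
        by (rule integrable_const_indicator_cball)
      show "integrable lebesgue (\<lambda>x. (norm (conv \<rho> g x - g x))\<^sup>2)"
        by (rule Bochner_Integration.integrable_bound[OF i]) (use m * in \<open>auto intro!: AE_I2\<close>)
    qed (rule *)
    also have "(LINT x|lebesgue. \<eta>\<^sup>2 * indicat_real (cball (0::'a) R) x) = \<eta>\<^sup>2 * V" by (simp add: V_def)
    finally show ?thesis using \<eta> by linarith
  qed
  moreover have "\<delta> > 0" using d by (simp add: \<delta>_def)
  ultimately show ?thesis using that by blast
qed

lemma conv_diff:
  assumes "test_function \<rho>" "locally_integrable u" "locally_integrable w"
  shows "conv \<rho> (\<lambda>x. u x - w x) x = conv \<rho> u x - conv \<rho> w x"
  using integrable_conv[OF assms(1,2), of x] integrable_conv[OF assms(1,3), of x]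
  by (simp add: conv_def scaleR_diff_right)

lemma mollifier_mono: "mollifier d \<rho> \<Longrightarrow> d \<le> \<delta> \<Longrightarrow> mollifier \<delta> \<rho>"
  by (auto simp: mollifier_def)

text \<open>Approximate by a continuous \<open>g\<close> of bounded support and use that
  mollification contracts the norm. Each of the two splittings of a sum doubles squares, so three
  terms of size \<open>e / 12\<close> add up to ten twelfths of \<open>e\<close>.\<close>

lemma conv_L2_convergence:
  fixes u :: "'a::euclidean_space \<Rightarrow> 'b::euclidean_space"
  assumes u: "square_integrable u" and e: "e > 0"
  obtains \<delta> where "\<delta> > 0" "\<And>\<rho>. mollifier \<delta> \<rho> \<Longrightarrow> (LINT x|lebesgue. (norm (conv \<rho> u x - u x))\<^sup>2) \<le> e"
proof -
  obtain g r where g: "continuous_on UNIV g" "\<And>x. norm x > r \<Longrightarrow> g x = 0" "square_integrable g"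
    and ug: "(LINT x|lebesgue. (norm (u x - g x))\<^sup>2) \<le> e / 12"
    using square_integrable_approx_continuous[OF u, of "e / 12"] e by auto
  obtain \<delta> where \<delta>: "\<delta> > 0" "\<And>\<rho>. mollifier \<delta> \<rho> \<Longrightarrow> (LINT x|lebesgue. (norm (conv \<rho> g x - g x))\<^sup>2) \<le> e / 12"
    using conv_continuous_L2[OF g(1) g(2), where e = "e / 12"] e by (metis divide_pos_pos zero_less_numeral)
  have "(LINT x|lebesgue. (norm (conv \<rho> u x - u x))\<^sup>2) \<le> e" if \<rho>: "mollifier \<delta> \<rho>" for \<rho>
  proof -
    note t = mollifierD(1)[OF \<rho>]
    have d: "square_integrable (\<lambda>x. u x - g x)" "square_integrable (\<lambda>x. g x - u x)"
      by (intro square_integrable_diff u g(3))+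
    have c: "(LINT x|lebesgue. (norm (conv \<rho> (\<lambda>x. u x - g x) x))\<^sup>2) \<le> e / 12"
      using square_integrable_conv(2)[OF \<rho> d(1)] ug by linarith
    have s1: "square_integrable (\<lambda>x. conv \<rho> g x - g x)"
      by (intro square_integrable_diff square_integrable_conv(1)[OF \<rho>] g(3))
    have s2: "square_integrable (\<lambda>x. (conv \<rho> g x - g x) + (g x - u x))"
      by (intro square_integrable_add s1 d)
    have 1: "(LINT x|lebesgue. (norm ((conv \<rho> g x - g x) + (g x - u x)))\<^sup>2) \<le> 2 * (e / 12) + 2 * (e / 12)"
      using square_integrable_add(2)[OF s1 d(2)] \<delta>(2)[OF \<rho>] ug by (simp add: norm_minus_commute)
    have "(LINT x|lebesgue. (norm (conv \<rho> (\<lambda>x. u x - g x) x + ((conv \<rho> g x - g x) + (g x - u x))))\<^sup>2)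
        \<le> 2 * (e / 12) + 2 * (2 * (e / 12) + 2 * (e / 12))"
      by (rule order_trans[OF square_integrable_add(2)[OF square_integrable_conv(1)[OF \<rho> d(1)] s2]])
        (intro add_mono mult_left_mono 1 c; simp)
    also have "(\<lambda>x. conv \<rho> (\<lambda>x. u x - g x) x + ((conv \<rho> g x - g x) + (g x - u x))) = (\<lambda>x. conv \<rho> u x - u x)"
      using conv_diff[OF t square_integrable_locally_integrable[OF u] square_integrable_locally_integrable[OF g(3)]]
      by (simp add: fun_eq_iff)
    finally show ?thesis using e by simp
  qed
  with \<delta> show ?thesis using that by blast
qed

section \<open>Weak gradients\<close>

lemma lebesgue_measurable_gradient:
  assumes "\<And>x. GDERIV \<psi> x :> h x" "Ck (Suc 0) \<psi>"
  shows "continuous_on UNIV h"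
proof -
  obtain g where g: "\<And>x. GDERIV \<psi> x :> g x" "\<And>b. b \<in> Basis \<Longrightarrow> Ck 0 (\<lambda>x. g x \<bullet> b)"
    using assms(2) Ck_SucE by metis
  have "g = h" by (rule ext) (rule GDERIV_unique[OF g(1) assms(1)])
  then show ?thesis using g(2) by (subst continuous_on_componentwise) simp
qed

lemma weak_gradient_test:
  assumes "has_weak_gradient u G" "test_function \<phi>" "\<And>x. GDERIV \<phi> x :> g x"
  shows "(LINT x|lebesgue. u x *\<^sub>R g x) = - (LINT x|lebesgue. \<phi> x *\<^sub>R G x)"
  using assms unfolding has_weak_gradient_def by (elim conjE) metis

lemma square_integrable_AE_0:
  assumes "square_integrable K" "\<And>e. e > 0 \<Longrightarrow> (LINT x|lebesgue. (norm (K x))\<^sup>2) \<le> e"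
  shows "AE x in lebesgue. K x = 0"
proof -
  have "(LINT x|lebesgue. (norm (K x))\<^sup>2) \<le> 0" by (rule field_le_epsilon) (use assms(2) in simp)
  then have "(LINT x|lebesgue. (norm (K x))\<^sup>2) = 0" by (intro antisym) (simp_all add: integral_nonneg_AE)
  then have "AE x in lebesgue. (norm (K x))\<^sup>2 = 0"
    using integral_nonneg_eq_0_iff_AE[of lebesgue "\<lambda>x. (norm (K x))\<^sup>2"] assms(1)
    by (simp add: square_integrable_def)
  then show ?thesis by simp
qed

text \<open>Testing with the reflected mollifier \<open>\<rho> (x - y)\<close> shows that every
  mollification of the difference vanishes, while the mollifications converge to it in L^2.\<close>

lemma weak_gradient_unique:
  assumes "has_weak_gradient u G" "has_weak_gradient u H"
  shows "AE x in lebesgue. G x = H x"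
proof -
  define K where "K x = G x - H x" for x
  have sG: "square_integrable G" and sH: "square_integrable H"
    using assms by (auto simp: has_weak_gradient_def)
  have sK: "square_integrable K" unfolding K_def by (rule square_integrable_diff[OF sG sH])
  have conv0: "conv \<rho> K x = 0" if \<rho>: "mollifier \<delta> \<rho>" for \<delta> \<rho> x
  proof -
    note t = mollifierD(1)[OF \<rho>]
    have t': "test_function (\<lambda>y. \<rho> (x - y))" by (rule test_function_reflect[OF t])
    obtain g where g: "\<And>y. GDERIV (\<lambda>y. \<rho> (x - y)) y :> g y" using test_function_obtain_gradient[OF t'] by metis
    have "conv \<rho> G x = conv \<rho> H x"
      using weak_gradient_test[OF assms(1) t' g] weak_gradient_test[OF assms(2) t' g] by (simp add: conv_def)
    then show ?thesis
      unfolding K_def using conv_diff[OF t square_integrable_locally_integrable[OF sG] square_integrable_locally_integrable[OF sH]]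
      by simp
  qed
  have "AE x in lebesgue. K x = 0"
  proof (rule square_integrable_AE_0[OF sK])
    fix e :: real assume "e > 0"
    then obtain \<delta> where \<delta>: "\<delta> > 0" "\<And>\<rho>. mollifier \<delta> \<rho> \<Longrightarrow> (LINT x|lebesgue. (norm (conv \<rho> K x - K x))\<^sup>2) \<le> e"
      using conv_L2_convergence[OF sK] by metis
    obtain \<rho> :: "'a \<Rightarrow> real" where "mollifier \<delta> \<rho>" using mollifier_exists[OF \<delta>(1)] .
    then show "(LINT x|lebesgue. (norm (K x))\<^sup>2) \<le> e" using \<delta>(2) conv0 by fastforce
  qed
  then show ?thesis by eventually_elim (simp add: K_def)
qed

lemma GDERIV_reflect:
  assumes "GDERIV \<rho> (x - y) :> g"
  shows "GDERIV (\<lambda>y. \<rho> (x - y)) y :> - g"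
proof -
  have "((\<lambda>y. x - y) has_derivative (\<lambda>h. - h)) (at y)" by (auto intro!: derivative_eq_intros)
  from has_derivative_compose[OF this assms[unfolded gderiv_def]]
  show ?thesis by (simp add: gderiv_def)
qed

text \<open>The gradient of the convolution falls on \<open>\<rho>\<close>; the definition of the
  weak gradient, applied to the reflected \<open>\<rho>\<close>, moves it to \<open>v\<close>. The
  two minus signs cancel.\<close>

lemma GDERIV_conv_weak:
  assumes "has_weak_gradient v G" "test_function \<rho>"
  shows "GDERIV (conv \<rho> v) x :> conv \<rho> G x"
proof -
  obtain g where g: "\<And>x. GDERIV \<rho> x :> g x" using test_function_obtain_gradient[OF assms(2)] by metis
  have lv: "locally_integrable v" using assms(1) by (intro square_integrable_locally_integrable) (simp add: has_weak_gradient_def)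
  have "(LINT y|lebesgue. v y *\<^sub>R - g (x - y)) = - (LINT y|lebesgue. \<rho> (x - y) *\<^sub>R G y)"
    by (rule weak_gradient_test[OF assms(1) test_function_reflect[OF assms(2)]]) (rule GDERIV_reflect[OF g])
  then have eq: "(LINT y|lebesgue. v y *\<^sub>R g (x - y)) = conv \<rho> G x"
    by (simp add: conv_def scaleR_minus_right)
  show ?thesis using GDERIV_conv(1)[OF assms(2) g lv, of x] unfolding eq .
qed

text \<open>\<open>\<psi> * \<phi>\<close> is again a test function, so the product rule for it
  carries over to \<open>v\<close>. This admits weights \<open>\<psi>\<close> that are bounded
  together with their gradient but not compactly supported.\<close>

lemma has_weak_gradient_mult_smooth:
  assumes v: "has_weak_gradient v G" and \<psi>: "\<And>k. Ck k \<psi>" "\<And>x. GDERIV \<psi> x :> h x"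
    and M: "\<And>x. \<bar>\<psi> x\<bar> \<le> M" "\<And>x. norm (h x) \<le> M"
  shows "has_weak_gradient (\<lambda>x. \<psi> x * v x) (\<lambda>x. \<psi> x *\<^sub>R G x + v x *\<^sub>R h x)"
proof -
  have sv: "square_integrable v" and sG: "square_integrable G" using v by (auto simp: has_weak_gradient_def)
  then have [measurable]: "v \<in> borel_measurable lebesgue" "G \<in> borel_measurable lebesgue" by (auto simp: square_integrable_def)
  have hc: "continuous_on UNIV h" by (rule lebesgue_measurable_gradient[OF \<psi>(2)]) (rule \<psi>(1))
  have [measurable]: "h \<in> borel_measurable lebesgue" by (rule continuous_imp_lebesgue_measurable[OF hc])
  have [measurable]: "\<psi> \<in> borel_measurable lebesgue" by (rule continuous_imp_lebesgue_measurable[OF Ck_continuous[OF \<psi>(1)]])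
  have s1: "square_integrable (\<lambda>x. \<psi> x * v x)"
    by (rule square_integrable_bound[OF sv, of _ M]) (use M(1) in \<open>auto simp: abs_mult mult_right_mono\<close>)
  have s2: "square_integrable (\<lambda>x. \<psi> x *\<^sub>R G x)"
    by (rule square_integrable_bound[OF sG, of _ M]) (use M(1) in \<open>auto simp: mult_right_mono\<close>)
  have s3: "square_integrable (\<lambda>x. v x *\<^sub>R h x)"
    by (rule square_integrable_bound[OF sv, of _ M]) (use M(2) in \<open>auto simp: mult.commute[of M] mult_left_mono\<close>)
  have "(LINT x|lebesgue. (\<psi> x * v x) *\<^sub>R g x) = - (LINT x|lebesgue. \<phi> x *\<^sub>R (\<psi> x *\<^sub>R G x + v x *\<^sub>R h x))"
    if \<phi>: "test_function \<phi>" "\<And>x. GDERIV \<phi> x :> g x" for \<phi> g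
  proof -
    have t: "test_function (\<lambda>x. \<psi> x * \<phi> x)" by (rule test_function_mult[OF \<psi>(1) \<phi>(1)])
    obtain B where B: "B > 0" "\<And>x. norm (g x) \<le> B" using test_function_gradient_bounded[OF \<phi>] by metis
    obtain r where r: "r > 0" "\<And>x. norm x > r \<Longrightarrow> \<phi> x = 0" using test_function_bounded_support[OF \<phi>(1)] by metis
    have i1: "integrable lebesgue (\<lambda>x. \<phi> x *\<^sub>R (v x *\<^sub>R h x))"
      by (rule integrable_test_function_mult[OF \<phi>(1) square_integrable_locally_integrable[OF s3]])
    have i2: "integrable lebesgue (\<lambda>x. \<phi> x *\<^sub>R (\<psi> x *\<^sub>R G x))"
      by (rule integrable_test_function_mult[OF \<phi>(1) square_integrable_locally_integrable[OF s2]])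
    have i3: "integrable lebesgue (\<lambda>x. (\<psi> x * v x) *\<^sub>R g x)"
      by (rule integrable_mult_test_function_gradient[OF \<phi> square_integrable_locally_integrable[OF s1]])
    have "(LINT x|lebesgue. v x *\<^sub>R (\<psi> x *\<^sub>R g x + \<phi> x *\<^sub>R h x)) = - (LINT x|lebesgue. (\<psi> x * \<phi> x) *\<^sub>R G x)"
      by (rule weak_gradient_test[OF v t]) (rule GDERIV_mult[OF \<psi>(2) \<phi>(2)])
    moreover have "(\<lambda>x. v x *\<^sub>R (\<psi> x *\<^sub>R g x + \<phi> x *\<^sub>R h x)) = (\<lambda>x. (\<psi> x * v x) *\<^sub>R g x + \<phi> x *\<^sub>R (v x *\<^sub>R h x))"
      by (simp add: fun_eq_iff scaleR_add_right mult.commute)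
    moreover have "(\<lambda>x. (\<psi> x * \<phi> x) *\<^sub>R G x) = (\<lambda>x. \<phi> x *\<^sub>R (\<psi> x *\<^sub>R G x))"
      by (simp add: fun_eq_iff mult.commute)
    ultimately have "(LINT x|lebesgue. (\<psi> x * v x) *\<^sub>R g x) + (LINT x|lebesgue. \<phi> x *\<^sub>R (v x *\<^sub>R h x))
        = - (LINT x|lebesgue. \<phi> x *\<^sub>R (\<psi> x *\<^sub>R G x))"
      using i1 i3 Bochner_Integration.integral_add[OF i3 i1] by metis
    moreover have "(LINT x|lebesgue. \<phi> x *\<^sub>R (\<psi> x *\<^sub>R G x + v x *\<^sub>R h x))
        = (LINT x|lebesgue. \<phi> x *\<^sub>R (\<psi> x *\<^sub>R G x)) + (LINT x|lebesgue. \<phi> x *\<^sub>R (v x *\<^sub>R h x))"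
      unfolding scaleR_add_right[of "\<phi> _"] by (rule Bochner_Integration.integral_add[OF i2 i1])
    ultimately show ?thesis by (simp add: algebra_simps eq_neg_iff_add_eq_0)
  qed
  then show ?thesis
    unfolding has_weak_gradient_def using s1 square_integrable_add(1)[OF s2 s3] by blast
qed

text \<open>Integration by parts without smoothness: by translation invariance every difference
  quotient of \<open>P\<close> has integral zero, and the Lipschitz bound lets the quotients pass to
  the limit by dominated convergence. One-sided derivatives almost everywhere suffice, so kinks
  across an interface are allowed.\<close>

lemma integral_directional_derivative_eq_0:
  fixes P :: "'a::euclidean_space \<Rightarrow> real"
  assumes P[measurable]: "P \<in> borel_measurable lebesgue" and supp: "\<And>x. norm x > r \<Longrightarrow> P x = 0"
    and lip: "\<And>x t. \<bar>P (x + t *\<^sub>R b) - P x\<bar> \<le> K * \<bar>t\<bar>" and b: "norm b \<le> 1"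
    and bound: "\<And>x. \<bar>P x\<bar> \<le> M"
    and deriv: "AE x in lebesgue. ((\<lambda>t. (P (x + t *\<^sub>R b) - P x) / t) \<longlongrightarrow> p x) (at_right 0)"
    and p[measurable]: "p \<in> borel_measurable lebesgue"
  shows "integrable lebesgue p" "(LINT x|lebesgue. p x) = 0"
proof -
  define t where "t n = inverse (real (Suc n))" for n
  have t: "t n > 0" "t n \<le> 1" for n by (auto simp: t_def field_simps)
  have "t \<longlonglongrightarrow> 0" unfolding t_def by (rule LIMSEQ_inverse_real_of_nat)
  then have tr: "filterlim t (at_right 0) sequentially"
    using t(1) by (simp add: filterlim_at eventually_sequentially less_imp_neq[symmetric] exI[of _ 0])
  define q where "q n x = (P (x + t n *\<^sub>R b) - P x) / t n" for n x
  have Pi: "integrable lebesgue P" by (rule integrable_lebesgue_bounded_support[OF P _ supp]) (use bound in auto)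
  have shift: "integrable lebesgue (\<lambda>x. P (x + s *\<^sub>R b))" "(LINT x|lebesgue. P (x + s *\<^sub>R b)) = (LINT x|lebesgue. P x)" for s
    using integrable_lebesgue_affine[of 1 P "s *\<^sub>R b"] integral_lebesgue_affine[of 1 P "s *\<^sub>R b"] Pi
    by (auto simp: add.commute)
  have q0: "(LINT x|lebesgue. q n x) = 0" for n unfolding q_def using shift Pi by simp
  have qm: "q n \<in> borel_measurable lebesgue" for n
    unfolding q_def using shift(1)[of "t n"] by (intro borel_measurable_divide borel_measurable_diff) auto
  have lim: "AE x in lebesgue. (\<lambda>n. q n x) \<longlonglongrightarrow> p x"
    using deriv by eventually_elim (auto simp: q_def intro: filterlim_compose[OF _ tr])
  have bd: "AE x in lebesgue. norm (q n x) \<le> K * indicat_real (cball 0 (r + 1)) x" for n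
  proof (rule AE_I2)
    fix x
    have K: "norm (q n x) \<le> K" using lip[of x "t n"] t(1)[of n] by (simp add: q_def field_simps)
    show "norm (q n x) \<le> K * indicat_real (cball 0 (r + 1)) x"
    proof (cases "norm x \<le> r + 1")
      case False
      have "norm (t n *\<^sub>R b) \<le> 1" using t(1,2)[of n] b mult_mono[of "t n" 1 "norm b" 1] by simp
      then have "norm (x + t n *\<^sub>R b) > r" using False norm_triangle_ineq4[of "x + t n *\<^sub>R b" "t n *\<^sub>R b"] by simp
      then show ?thesis using False supp by (simp add: q_def)
    qed (use K in simp)
  qed
  note dom = qm p integrable_const_indicator_cball[of K 0 "r + 1"] lim bd
  have "(\<lambda>n. LINT x|lebesgue. q n x) \<longlonglongrightarrow> (LINT x|lebesgue. p x)"
    by (rule integral_dominated_convergence[OF p qm integrable_const_indicator_cball lim bd])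
  then show "(LINT x|lebesgue. p x) = 0" by (simp add: q0 LIMSEQ_const_iff)
  show "integrable lebesgue p"
    by (rule integrable_dominated_convergence[OF p qm integrable_const_indicator_cball lim bd])
qed

lemma GDERIV_imp_directional:
  assumes "GDERIV f x :> g"
  shows "((\<lambda>t. (f (x + t *\<^sub>R b) - f x) / t) \<longlongrightarrow> g \<bullet> b) (at_right 0)"
proof -
  have "((\<lambda>t. x + t *\<^sub>R b) has_derivative (\<lambda>t. t *\<^sub>R b)) (at 0)" by (auto intro!: derivative_eq_intros)
  from has_derivative_compose[OF this, of f "\<lambda>h. h \<bullet> g"] assms
  have "((\<lambda>t. f (x + t *\<^sub>R b)) has_derivative (\<lambda>t. t * (b \<bullet> g))) (at 0)" by (simp add: gderiv_def)
  then have "((\<lambda>t. f (x + t *\<^sub>R b)) has_real_derivative (g \<bullet> b)) (at 0)"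
    by (simp add: has_field_derivative_def inner_commute mult.commute[of "b \<bullet> g"] mult_commute_abs)
  then show ?thesis unfolding DERIV_def by (simp add: filterlim_at_split)
qed

lemma has_weak_gradientI_componentwise:
  assumes s: "square_integrable u" "square_integrable G"
    and eq: "\<And>\<phi> g b. test_function \<phi> \<Longrightarrow> (\<And>x. GDERIV \<phi> x :> g x) \<Longrightarrow> b \<in> Basis \<Longrightarrow>
        (LINT x|lebesgue. u x * (g x \<bullet> b) + \<phi> x * (G x \<bullet> b)) = 0"
  shows "has_weak_gradient u G"
  unfolding has_weak_gradient_def
proof (intro conjI allI impI s)
  fix \<phi> :: "'a \<Rightarrow> real" and g assume "test_function \<phi> \<and> (\<forall>x. GDERIV \<phi> x :> g x)"
  then have \<phi>: "test_function \<phi>" "\<And>x. GDERIV \<phi> x :> g x" by auto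
  have i1: "integrable lebesgue (\<lambda>x. \<phi> x *\<^sub>R G x)"
    by (rule integrable_test_function_mult[OF \<phi>(1) square_integrable_locally_integrable[OF s(2)]])
  have ib: "integrable lebesgue (\<lambda>x. u x * (g x \<bullet> b))" for b
    using integrable_test_function_mult[OF test_function_gderiv[OF \<phi>, of b] square_integrable_locally_integrable[OF s(1)]]
    by (simp add: mult.commute)
  have i2: "integrable lebesgue (\<lambda>x. u x *\<^sub>R g x)"
    by (rule integrable_mult_test_function_gradient[OF \<phi> square_integrable_locally_integrable[OF s(1)]])
  show "(LINT x|lebesgue. u x *\<^sub>R g x) = - (LINT x|lebesgue. \<phi> x *\<^sub>R G x)"
  proof (rule euclidean_eqI)
    fix b :: 'a assume b: "b \<in> Basis"
    have i1b: "integrable lebesgue (\<lambda>x. \<phi> x * (G x \<bullet> b))"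
      using integrable_inner_left[of b lebesgue "\<lambda>x. \<phi> x *\<^sub>R G x"] i1 by simp
    have "(LINT x|lebesgue. u x * (g x \<bullet> b)) + (LINT x|lebesgue. \<phi> x * (G x \<bullet> b)) = 0"
      using eq[OF \<phi> b] Bochner_Integration.integral_add[OF ib i1b] by simp
    moreover have "(LINT x|lebesgue. u x *\<^sub>R g x) \<bullet> b = (LINT x|lebesgue. u x * (g x \<bullet> b))"
      using integral_inner_left[of b lebesgue "\<lambda>x. u x *\<^sub>R g x"] i2 by simp
    moreover have "(LINT x|lebesgue. \<phi> x *\<^sub>R G x) \<bullet> b = (LINT x|lebesgue. \<phi> x * (G x \<bullet> b))"
      using integral_inner_left[of b lebesgue "\<lambda>x. \<phi> x *\<^sub>R G x"] i1 by simp
    ultimately show "(LINT x|lebesgue. u x *\<^sub>R g x) \<bullet> b = - (LINT x|lebesgue. \<phi> x *\<^sub>R G x) \<bullet> b"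
      by (simp add: inner_minus_left)
  qed
qed

lemma directional_derivative_mult:
  fixes f g :: "'a::euclidean_space \<Rightarrow> real"
  assumes f: "((\<lambda>t. (f (x + t *\<^sub>R b) - f x) / t) \<longlongrightarrow> f') (at_right 0)"
    and g: "((\<lambda>t. (g (x + t *\<^sub>R b) - g x) / t) \<longlongrightarrow> g') (at_right 0)"
  shows "((\<lambda>t. (f (x + t *\<^sub>R b) * g (x + t *\<^sub>R b) - f x * g x) / t) \<longlongrightarrow> f' * g x + f x * g') (at_right 0)"
proof -
  have id: "((\<lambda>t. t) \<longlongrightarrow> 0) (at_right (0::real))" by (rule tendsto_ident_at)
  have "((\<lambda>t. ((f (x + t *\<^sub>R b) - f x) / t) * g x + f x * ((g (x + t *\<^sub>R b) - g x) / t)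
      + t * (((f (x + t *\<^sub>R b) - f x) / t) * ((g (x + t *\<^sub>R b) - g x) / t))) \<longlongrightarrow> f' * g x + f x * g' + 0 * (f' * g')) (at_right 0)"
    by (intro tendsto_intros f g id)
  moreover have "\<forall>\<^sub>F t in at_right 0. ((f (x + t *\<^sub>R b) - f x) / t) * g x + f x * ((g (x + t *\<^sub>R b) - g x) / t)
      + t * (((f (x + t *\<^sub>R b) - f x) / t) * ((g (x + t *\<^sub>R b) - g x) / t))
      = (f (x + t *\<^sub>R b) * g (x + t *\<^sub>R b) - f x * g x) / t"
    by (rule eventually_mono[OF eventually_at_right_less[of 0]]) (simp add: field_simps)
  ultimately show ?thesis using Lim_transform_eventually by fastforce
qed

text \<open>The product with a test function is of class C^1 with compact support, hence its
  derivatives integrate to zero.\<close>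

lemma has_weak_gradient_C1:
  fixes u :: "'a::euclidean_space \<Rightarrow> real"
  assumes s: "square_integrable u" "square_integrable G"
    and deriv: "\<And>x. GDERIV u x :> G x" and cont: "continuous_on UNIV G"
  shows "has_weak_gradient u G"
proof (rule has_weak_gradientI_componentwise[OF s])
  fix \<phi> :: "'a \<Rightarrow> real" and g and b :: 'a assume \<phi>: "test_function \<phi>" "\<And>x. GDERIV \<phi> x :> g x" and b: "b \<in> Basis"
  obtain r where r: "r > 0" "\<And>x. norm x > r \<Longrightarrow> \<phi> x = 0" using test_function_bounded_support[OF \<phi>(1)] by metis
  have uc: "continuous_on UNIV u"
    using deriv by (auto simp: gderiv_def intro!: continuous_at_imp_continuous_on has_derivative_continuous)
  have gc: "continuous_on UNIV g" by (rule lebesgue_measurable_gradient[OF \<phi>(2)]) (use \<phi>(1) in \<open>simp add: test_function_def del: Ck.simps\<close>)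
  define P where "P x = u x * \<phi> x" for x
  define P' where "P' x = u x *\<^sub>R g x + \<phi> x *\<^sub>R G x" for x
  have PD: "GDERIV P x :> P' x" for x unfolding P_def P'_def by (rule GDERIV_mult[OF deriv \<phi>(2)])
  have Pc: "continuous_on UNIV P'" "continuous_on UNIV P"
    unfolding P'_def P_def by (intro continuous_intros uc gc cont test_function_continuous \<phi>(1))+
  have g0: "g z = 0" if "norm z > r" for z by (rule GDERIV_0_outside[OF r(2) that \<phi>(2)])
  have "compact (P' ` cball 0 r)" "compact (P ` cball 0 r)" using Pc continuous_on_subset by (auto intro!: compact_continuous_image)
  then obtain B C where B: "B > 0" "\<forall>y\<in>P' ` cball 0 r. norm y \<le> B" and C: "C > 0" "\<forall>y\<in>P ` cball 0 r. norm y \<le> C"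
    using compact_imp_bounded bounded_pos by metis
  have PB: "norm (P' x) \<le> B" for x using B g0[of x] r(2)[of x] by (cases "norm x > r") (auto simp: P'_def)
  have PC: "\<bar>P x\<bar> \<le> C" for x using C r(2)[of x] by (cases "norm x > r") (auto simp: P_def)
  have "(LINT x|lebesgue. P' x \<bullet> b) = 0"
  proof (rule integral_directional_derivative_eq_0(2)[where P=P and r=r and b=b and M=C and K=B])
    show "P \<in> borel_measurable lebesgue" by (rule continuous_imp_lebesgue_measurable[OF Pc(2)])
    show "(\<lambda>x. P' x \<bullet> b) \<in> borel_measurable lebesgue" by (intro continuous_imp_lebesgue_measurable continuous_intros Pc)
    show "\<bar>P (x + t *\<^sub>R b) - P x\<bar> \<le> B * \<bar>t\<bar>" for x t
      using gderiv_lipschitz[of UNIV P P' B "x + t *\<^sub>R b" x] PD PB b by simp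
    show "AE x in lebesgue. ((\<lambda>t. (P (x + t *\<^sub>R b) - P x) / t) \<longlongrightarrow> P' x \<bullet> b) (at_right 0)"
      by (rule AE_I2) (rule GDERIV_imp_directional[OF PD])
  qed (use r b PC in \<open>auto simp: P_def\<close>)
  then show "(LINT x|lebesgue. u x * (g x \<bullet> b) + \<phi> x * (G x \<bullet> b)) = 0"
    by (simp add: P'_def inner_add_left)
qed

lemma conv_bounded:
  assumes \<rho>: "mollifier \<delta> \<rho>" and F: "locally_integrable F" and M: "\<And>x. norm (F x) \<le> M"
  shows "norm (conv \<rho> F x) \<le> M"
proof -
  note i = mollifier_integral_reflect[OF \<rho>, of x]
  have i1: "integrable lebesgue (\<lambda>y. \<rho> (x - y) *\<^sub>R F y)" by (rule integrable_conv[OF mollifierD(1)[OF \<rho>] F])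
  have "norm (conv \<rho> F x) \<le> (LINT y|lebesgue. norm (\<rho> (x - y) *\<^sub>R F y))"
    unfolding conv_def by (rule integral_norm_bound)
  also have "\<dots> \<le> (LINT y|lebesgue. M * \<rho> (x - y))"
  proof (rule integral_mono)
    show "integrable lebesgue (\<lambda>y. norm (\<rho> (x - y) *\<^sub>R F y))" by (rule integrable_norm[OF i1])
    show "integrable lebesgue (\<lambda>y. M * \<rho> (x - y))" using i by simp
    show "norm (\<rho> (x - y) *\<^sub>R F y) \<le> M * \<rho> (x - y)" for y
      using mult_left_mono[OF M[of y] mollifierD(2)[OF \<rho>, of "x - y"]] mollifierD(2)[OF \<rho>, of "x - y"]
      by (simp add: mult.commute)
  qed
  also have "\<dots> = M" using i by simp
  finally show ?thesis .
qed

lemma test_function_conv: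
  assumes \<rho>: "mollifier \<delta> \<rho>" and F: "locally_integrable F" "\<And>x. norm x > r \<Longrightarrow> F x = (0::real)"
  shows "test_function (conv \<rho> F)"
proof (rule test_functionI)
  show "Ck k (conv \<rho> F)" for k by (rule Ck_conv[OF mollifierD(1)[OF \<rho>] F(1)])
  show "conv \<rho> F x = 0" if "norm x > \<delta> + r" for x
    using mollifierD(3)[OF \<rho>] by (intro conv_bounded_support[OF _ F(2) that]) auto
qed

text \<open>Of \<open>F\<close> only a lower bound on the increments is known, so upward jumps can
  make the difference quotients unbounded above. Truncating them at a level above the limit
  \<open>F'\<close> restores domination and only decreases the integrals, which leaves an
  inequality.\<close>

lemma conv_directional_ge:
  fixes F F' :: "'a::euclidean_space \<Rightarrow> real"
  assumes \<rho>: "mollifier \<delta> \<rho>"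
    and F: "F \<in> borel_measurable lebesgue" "\<And>x. \<bar>F x\<bar> \<le> M"
    and F': "F' \<in> borel_measurable lebesgue" "\<And>x. \<bar>F' x\<bar> \<le> M'"
    and jump: "\<And>x t. 0 < t \<Longrightarrow> F (x + t *\<^sub>R b) - F x \<ge> - (K * t)" "K \<ge> 0"
    and deriv: "AE x in lebesgue. ((\<lambda>t. (F (x + t *\<^sub>R b) - F x) / t) \<longlongrightarrow> F' x) (at_right 0)"
    and g: "GDERIV (conv \<rho> F) x :> g"
  shows "conv \<rho> F' x \<le> g \<bullet> b"
proof -
  note t\<rho> = mollifierD(1)[OF \<rho>]
  have lF: "locally_integrable F" and lF': "locally_integrable F'"
    using locally_integrable_bounded F F' by (metis real_norm_def)+
  define t where "t n = inverse (real (Suc n))" for n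
  have t: "t n > 0" for n by (auto simp: t_def)
  have "t \<longlonglongrightarrow> 0" unfolding t_def by (rule LIMSEQ_inverse_real_of_nat)
  then have tr: "filterlim t (at_right 0) sequentially"
    using t by (simp add: filterlim_at eventually_sequentially less_imp_neq[symmetric] exI[of _ 0])
  \<comment> \<open>The level is at least \<open>\<bar>F'\<bar>\<close>, so that truncation does not
    change the limit, and at least \<open>K\<close>, so that \<open>K0\<close> bounds the truncated
    quotients on both sides.\<close>
  define K0 where "K0 = max K M'"
  define q where "q n y = (F (y + t n *\<^sub>R b) - F y) / t n" for n y
  define qh where "qh n y = min (q n y) K0" for n y
  have M'0: "0 \<le> M'" using F'(2)[of 0] by linarith
  have Fs: "(\<lambda>y. F (y + s *\<^sub>R b)) \<in> borel_measurable lebesgue" for s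
    using measurable_lebesgue_comp_affine[of 1 F "s *\<^sub>R b"] F(1) by (simp add: add.commute)
  have qm: "q n \<in> borel_measurable lebesgue" for n
    unfolding q_def by (intro borel_measurable_divide borel_measurable_diff Fs F(1)) auto
  have qhm: "qh n \<in> borel_measurable lebesgue" for n
    unfolding qh_def by (intro borel_measurable_min qm) auto
  have qge: "q n y \<ge> - K" for n y
    using jump(1)[OF t[of n], of y] t[of n] by (simp add: q_def field_simps)
  have qhb: "\<bar>qh n y\<bar> \<le> K0" for n y
    using qge[of n y] jump(2) M'0 by (auto simp: qh_def K0_def)
  have lFs: "locally_integrable (\<lambda>y. F (y + s *\<^sub>R b))" for s
    using locally_integrable_bounded[OF Fs] F(2) by (metis real_norm_def)
  have lq: "locally_integrable (q n)" for n
  proof (rule locally_integrable_bounded[OF qm])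
    show "norm (q n y) \<le> 2 * M / t n" for y
      using F(2)[of y] F(2)[of "y + t n *\<^sub>R b"] t[of n] by (simp add: q_def divide_right_mono)
  qed
  have lqh: "locally_integrable (qh n)" for n
    using locally_integrable_bounded[OF qhm] qhb by (metis real_norm_def)
  have cq: "(conv \<rho> F (x + t n *\<^sub>R b) - conv \<rho> F x) / t n = conv \<rho> (q n) x" for n
  proof -
    have "(\<lambda>y. \<rho> (x + t n *\<^sub>R b - y) *\<^sub>R F y) \<in> borel_measurable lebesgue"
      using integrable_conv[OF t\<rho> lF] by (rule borel_measurable_integrable)
    from integral_lebesgue_affine[OF _ this, of 1 "t n *\<^sub>R b"]
    have "conv \<rho> F (x + t n *\<^sub>R b) = conv \<rho> (\<lambda>y. F (y + t n *\<^sub>R b)) x"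
      by (simp add: conv_def add.commute)
    then have "(conv \<rho> F (x + t n *\<^sub>R b) - conv \<rho> F x) / t n
        = ((LINT y|lebesgue. \<rho> (x - y) *\<^sub>R F (y + t n *\<^sub>R b)) - (LINT y|lebesgue. \<rho> (x - y) *\<^sub>R F y)) / t n"
      by (simp add: conv_def)
    also have "\<dots> = (LINT y|lebesgue. (\<rho> (x - y) *\<^sub>R F (y + t n *\<^sub>R b) - \<rho> (x - y) *\<^sub>R F y) / t n)"
      using integrable_conv[OF t\<rho> lFs, of x "t n"] integrable_conv[OF t\<rho> lF, of x] by simp
    also have "\<dots> = conv \<rho> (q n) x"
      unfolding conv_def q_def by (intro Bochner_Integration.integral_cong) (auto simp: diff_divide_distrib right_diff_distrib)
    finally show ?thesis .
  qed
  have ge: "conv \<rho> (qh n) x \<le> conv \<rho> (q n) x" for n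
    unfolding conv_def
    by (rule integral_mono[OF integrable_conv[OF t\<rho> lqh] integrable_conv[OF t\<rho> lq]])
      (auto simp: qh_def intro: mult_left_mono mollifierD(2)[OF \<rho>])
  have lim1: "(\<lambda>n. (conv \<rho> F (x + t n *\<^sub>R b) - conv \<rho> F x) / t n) \<longlonglongrightarrow> g \<bullet> b"
    by (rule filterlim_compose[OF GDERIV_imp_directional[OF g] tr])
  have lim2: "(\<lambda>n. conv \<rho> (qh n) x) \<longlonglongrightarrow> conv \<rho> F' x"
    unfolding conv_def
  proof (rule integral_dominated_convergence)
    show "integrable lebesgue (\<lambda>y. K0 * \<rho> (x - y))" using mollifier_integral_reflect[OF \<rho>, of x] by simp
    show "(\<lambda>y. \<rho> (x - y) *\<^sub>R F' y) \<in> borel_measurable lebesgue"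
      using integrable_conv[OF t\<rho> lF'] by (rule borel_measurable_integrable)
    show "(\<lambda>y. \<rho> (x - y) *\<^sub>R qh n y) \<in> borel_measurable lebesgue" for n
      using integrable_conv[OF t\<rho> lqh] by (rule borel_measurable_integrable)
    show "AE y in lebesgue. norm (\<rho> (x - y) *\<^sub>R qh n y) \<le> K0 * \<rho> (x - y)" for n
      using mollifierD(2)[OF \<rho>] qhb by (intro AE_I2) (simp add: abs_mult mult.commute mult_right_mono)
    show "AE y in lebesgue. (\<lambda>n. \<rho> (x - y) *\<^sub>R qh n y) \<longlonglongrightarrow> \<rho> (x - y) *\<^sub>R F' y"
      using deriv
    proof eventually_elim
      case (elim y)
      have "(\<lambda>n. q n y) \<longlonglongrightarrow> F' y" unfolding q_def by (rule filterlim_compose[OF elim tr])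
      then have "(\<lambda>n. qh n y) \<longlonglongrightarrow> min (F' y) K0" unfolding qh_def by (intro tendsto_min tendsto_const)
      moreover have "min (F' y) K0 = F' y" using F'(2)[of y] by (auto simp: K0_def min_def)
      ultimately show ?case by (intro tendsto_scaleR tendsto_const) simp
    qed
  qed
  show ?thesis by (rule LIMSEQ_le[OF lim2 lim1]) (use ge cq in auto)
qed

lemma conv_tendsto_isCont:
  assumes \<rho>: "\<And>n. mollifier (inverse (real (Suc n))) (\<rho> n)" and F: "locally_integrable F" and x: "isCont F x"
  shows "(\<lambda>n. conv (\<rho> n) F x) \<longlonglongrightarrow> F x"
proof (rule LIMSEQ_I)
  fix e :: real assume "e > 0"
  then obtain d where d: "d > 0" "\<And>y. dist y x < d \<Longrightarrow> dist (F y) (F x) < e / 2"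
    using x unfolding continuous_at_eps_delta by (meson half_gt_zero)
  obtain N where N: "inverse (real (Suc N)) < d" using d(1) reals_Archimedean by blast
  have "norm (conv (\<rho> n) F x - F x) < e" if "n \<ge> N" for n
  proof -
    have "inverse (real (Suc n)) \<le> inverse (real (Suc N))" using that by (simp add: le_imp_inverse_le)
    then have "norm (F y - F x) \<le> e / 2" if "norm (x - y) < inverse (real (Suc n))" for y
    proof -
      have "norm (x - y) < d" using that N \<open>inverse (real (Suc n)) \<le> inverse (real (Suc N))\<close> by linarith
      then have "dist y x < d" by (simp add: dist_norm norm_minus_commute)
      then show ?thesis using d(2)[of y] by (simp add: dist_norm less_imp_le)
    qed
    then have "norm (conv (\<rho> n) F x - F x) \<le> e / 2" by (rule norm_conv_diff_le[OF \<rho> F])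
    then show ?thesis using \<open>e > 0\<close> by simp
  qed
  then show "\<exists>no. \<forall>n\<ge>no. norm (conv (\<rho> n) F x - F x) < e" by blast
qed

text \<open>Upward jumps of \<open>F\<close> in direction \<open>b\<close> only help, since \<open>v\<close> is nonnegative.\<close>

lemma weak_gradient_partial_integration_le:
  fixes F F' :: "'a::euclidean_space \<Rightarrow> real"
  assumes v: "has_weak_gradient v G" "AE x in lebesgue. v x \<ge> 0"
    and F: "F \<in> borel_measurable lebesgue" "\<And>x. \<bar>F x\<bar> \<le> M" "\<And>x. norm x > r \<Longrightarrow> F x = 0"
    and F': "F' \<in> borel_measurable lebesgue" "\<And>x. \<bar>F' x\<bar> \<le> M" "\<And>x. norm x > r \<Longrightarrow> F' x = 0"
    and jump: "\<And>x t. 0 < t \<Longrightarrow> F (x + t *\<^sub>R b) - F x \<ge> - (K * t)" "K \<ge> 0"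
    and deriv: "AE x in lebesgue. ((\<lambda>t. (F (x + t *\<^sub>R b) - F x) / t) \<longlongrightarrow> F' x) (at_right 0)"
    and cont: "AE x in lebesgue. isCont F x" "AE x in lebesgue. isCont F' x"
  shows "(LINT x|lebesgue. F x * (G x \<bullet> b)) \<le> - (LINT x|lebesgue. F' x * v x)"
proof -
  have "\<exists>\<rho>. \<forall>n. mollifier (inverse (real (Suc n))) (\<rho> n :: 'a \<Rightarrow> real)"
    by (rule choice) (metis mollifier_exists inverse_positive_iff_positive of_nat_0_less_iff zero_less_Suc)
  then obtain \<rho> where \<rho>: "\<And>n. mollifier (inverse (real (Suc n))) (\<rho> n :: 'a \<Rightarrow> real)" by auto
  have sv: "square_integrable v" and sG: "square_integrable G" using v(1) by (auto simp: has_weak_gradient_def)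
  have lv: "locally_integrable v" and lG: "locally_integrable (\<lambda>x. G x \<bullet> b)"
    using sv sG square_integrable_locally_integrable locally_integrable_inner by blast+
  have lF: "locally_integrable F" and lF': "locally_integrable F'"
    using locally_integrable_bounded F F' by (metis real_norm_def)+
  have test: "test_function (conv (\<rho> n) F)" "test_function (conv (\<rho> n) F')" for n
    by (rule test_function_conv[OF \<rho> lF F(3)], assumption, rule test_function_conv[OF \<rho> lF' F'(3)], assumption)
  have le: "(LINT x|lebesgue. conv (\<rho> n) F x * (G x \<bullet> b)) \<le> - (LINT x|lebesgue. conv (\<rho> n) F' x * v x)" for n
  proof -
    obtain g where g: "\<And>x. GDERIV (conv (\<rho> n) F) x :> g x" using test_function_obtain_gradient[OF test(1)] by metis
    have gt: "test_function (\<lambda>x. g x \<bullet> b)" by (rule test_function_gderiv[OF test(1) g])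
    have i1: "integrable lebesgue (\<lambda>x. (g x \<bullet> b) *\<^sub>R v x)" by (rule integrable_test_function_mult[OF gt lv])
    have i2: "integrable lebesgue (\<lambda>x. conv (\<rho> n) F' x *\<^sub>R v x)" by (rule integrable_test_function_mult[OF test(2) lv])
    have i3: "integrable lebesgue (\<lambda>x. conv (\<rho> n) F x *\<^sub>R G x)"
      by (rule integrable_test_function_mult[OF test(1) square_integrable_locally_integrable[OF sG]])
    have gB: "integrable lebesgue (\<lambda>x. v x *\<^sub>R g x)" by (rule integrable_mult_test_function_gradient[OF test(1) g lv])
    have "(LINT x|lebesgue. v x *\<^sub>R g x) \<bullet> b = - (LINT x|lebesgue. conv (\<rho> n) F x *\<^sub>R G x) \<bullet> b"
      using weak_gradient_test[OF v(1) test(1) g] by simp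
    moreover have "(LINT x|lebesgue. v x *\<^sub>R g x) \<bullet> b = (LINT x|lebesgue. (g x \<bullet> b) * v x)"
      using integral_inner_left[of b lebesgue "\<lambda>x. v x *\<^sub>R g x"] gB by (simp add: mult.commute)
    moreover have "(LINT x|lebesgue. conv (\<rho> n) F x *\<^sub>R G x) \<bullet> b = (LINT x|lebesgue. conv (\<rho> n) F x * (G x \<bullet> b))"
      using integral_inner_left[of b lebesgue "\<lambda>x. conv (\<rho> n) F x *\<^sub>R G x"] i3 by simp
    \<comment> \<open>Here the sign of \<open>v\<close> enters: the derivative of the mollified
      \<open>F\<close> dominates the mollified \<open>F'\<close>, and the inequality survives
      multiplication by \<open>v\<close>.\<close>
    moreover have "(LINT x|lebesgue. conv (\<rho> n) F' x * v x) \<le> (LINT x|lebesgue. (g x \<bullet> b) * v x)"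
    proof (rule integral_mono_AE)
      show "AE x in lebesgue. conv (\<rho> n) F' x * v x \<le> (g x \<bullet> b) * v x"
        using v(2)
      proof eventually_elim
        case (elim x)
        then show ?case
          by (intro mult_right_mono conv_directional_ge[OF \<rho> F(1,2) F'(1,2) jump deriv g])
      qed
    qed (use i1 i2 in auto)
    ultimately show ?thesis by (simp add: inner_minus_left)
  qed
  have bound: "norm (conv (\<rho> n) H x) \<le> M * indicat_real (cball 0 (r + 1)) x"
    if "locally_integrable H" "\<And>x. \<bar>H x\<bar> \<le> M" "\<And>x. norm x > r \<Longrightarrow> H x = 0" for n x and H :: "'a \<Rightarrow> real"
  proof (cases "norm x > r + 1")
    case True
    have "inverse (real (Suc n)) \<le> 1" by (simp add: field_simps)
    then have "conv (\<rho> n) H x = 0"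
      using mollifierD(3)[OF \<rho>[of n]] True
      by (intro conv_bounded_support[of "inverse (real (Suc n))" "\<rho> n" r H x] that(3)) auto
    then show ?thesis using True by simp
  next
    case False
    then show ?thesis using conv_bounded[OF \<rho> that(1), where M=M and x=x] that(2) by simp
  qed
  have iind: "integrable lebesgue (\<lambda>x. M * indicat_real (cball 0 (r + 1)) x * \<bar>w x\<bar>)"
    if "locally_integrable w" for w :: "'a \<Rightarrow> real"
  proof -
    have "integrable lebesgue (\<lambda>x. M * norm (indicat_real (cball 0 (r + 1)) x *\<^sub>R w x))"
      using that unfolding locally_integrable_def by (intro integrable_mult_right integrable_norm) auto
    then show ?thesis by (simp add: abs_mult mult.assoc)
  qed
  have lim: "(\<lambda>n. LINT x|lebesgue. conv (\<rho> n) H x * w x) \<longlonglongrightarrow> (LINT x|lebesgue. H x * w x)"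
    if H: "locally_integrable H" "\<And>x. \<bar>H x\<bar> \<le> M" "\<And>x. norm x > r \<Longrightarrow> H x = 0" "AE x in lebesgue. isCont H x"
      and w: "locally_integrable w" for H w :: "'a \<Rightarrow> real"
  proof (rule integral_dominated_convergence[OF _ _ iind[OF w]])
    show "(\<lambda>x. H x * w x) \<in> borel_measurable lebesgue"
      by (intro borel_measurable_times locally_integrable_measurable H w)
    show "(\<lambda>x. conv (\<rho> n) H x * w x) \<in> borel_measurable lebesgue" for n
      by (intro borel_measurable_times locally_integrable_measurable w continuous_imp_lebesgue_measurable
          continuous_on_conv mollifierD(1)[OF \<rho>] H)
    show "AE x in lebesgue. norm (conv (\<rho> n) H x * w x) \<le> M * indicat_real (cball 0 (r + 1)) x * \<bar>w x\<bar>" for n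
      using bound[OF H(1-3)] by (intro AE_I2) (simp add: abs_mult mult_right_mono)
    show "AE x in lebesgue. (\<lambda>n. conv (\<rho> n) H x * w x) \<longlonglongrightarrow> H x * w x"
      using H(4)
    proof eventually_elim
      case (elim x)
      show ?case by (intro tendsto_mult tendsto_const conv_tendsto_isCont[OF \<rho> H(1) elim])
    qed
  qed
  show ?thesis
    by (rule LIMSEQ_le[OF lim[OF lF F(2,3) cont(1) lG] tendsto_minus[OF lim[OF lF' F'(2,3) cont(2) lv]]])
      (use le in auto)
qed

section \<open>Weak solutions\<close>

lemma square_integrable_inner:
  fixes u w :: "'a::euclidean_space \<Rightarrow> 'b::euclidean_space"
  assumes u: "square_integrable u" and w: "square_integrable w"
  shows "integrable lebesgue (\<lambda>x. u x \<bullet> w x)"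
    and "\<bar>LINT x|lebesgue. u x \<bullet> w x\<bar> \<le> sqrt (LINT x|lebesgue. (norm (u x))\<^sup>2) * sqrt (LINT x|lebesgue. (norm (w x))\<^sup>2)"
proof -
  have [measurable]: "u \<in> borel_measurable lebesgue" "w \<in> borel_measurable lebesgue"
    and iu: "integrable lebesgue (\<lambda>x. (norm (u x))\<^sup>2)" and iw: "integrable lebesgue (\<lambda>x. (norm (w x))\<^sup>2)"
    using u w by (auto simp: square_integrable_def)
  have pt: "\<bar>u x \<bullet> w x\<bar> \<le> (norm (u x))\<^sup>2 + (norm (w x))\<^sup>2" for x
    using Cauchy_Schwarz_ineq2[of "u x" "w x"] sum_squares_bound[of "norm (u x)" "norm (w x)"]
      mult_nonneg_nonneg[OF norm_ge_zero[of "u x"] norm_ge_zero[of "w x"]] by linarith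
  show i: "integrable lebesgue (\<lambda>x. u x \<bullet> w x)"
    by (rule Bochner_Integration.integrable_bound[OF Bochner_Integration.integrable_add[OF iu iw]])
      (use pt in \<open>auto intro!: AE_I2\<close>)
  define A where "A = (LINT x|lebesgue. (norm (u x))\<^sup>2)"
  define B where "B = (LINT x|lebesgue. (norm (w x))\<^sup>2)"
  define C where "C = (LINT x|lebesgue. u x \<bullet> w x)"
  have AB: "A \<ge> 0" "B \<ge> 0" by (auto simp: A_def B_def integral_nonneg_AE)
  have quad: "0 \<le> s\<^sup>2 * A - 2 * s * C + B" for s
  proof -
    have "0 \<le> (LINT x|lebesgue. (norm (s *\<^sub>R u x - w x))\<^sup>2)" by (intro integral_nonneg_AE) simp
    also have "(\<lambda>x. (norm (s *\<^sub>R u x - w x))\<^sup>2) = (\<lambda>x. s\<^sup>2 * (norm (u x))\<^sup>2 - (2 * s) * (u x \<bullet> w x) + (norm (w x))\<^sup>2)"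
      unfolding power2_norm_eq_inner by (simp add: fun_eq_iff inner_diff inner_commute power2_eq_square algebra_simps)
    also have "(LINT x|lebesgue. \<dots> x) = s\<^sup>2 * A - 2 * s * C + B"
      using iu iw i by (simp add: A_def B_def C_def)
    finally show ?thesis .
  qed
  have "C\<^sup>2 \<le> A * B"
  proof (cases "A = 0")
    case True
    have "C = 0"
    proof (rule ccontr)
      assume "C \<noteq> 0"
      \<comment> \<open>With \<open>A = 0\<close> the polynomial is affine in \<open>s\<close> and
        equals \<open>- 1\<close> at this value.\<close>
      then show False using quad[of "(B + 1) / (2 * C)"] True by (simp add: field_simps)
    qed
    then show ?thesis using True by simp
  next
    case False
    then show ?thesis using quad[of "C / A"] AB by (simp add: field_simps power2_eq_square)
  qed
  then have "\<bar>C\<bar> \<le> sqrt (A * B)" by (metis real_sqrt_abs real_sqrt_le_mono)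
  then show "\<bar>LINT x|lebesgue. u x \<bullet> w x\<bar> \<le> sqrt (LINT x|lebesgue. (norm (u x))\<^sup>2) * sqrt (LINT x|lebesgue. (norm (w x))\<^sup>2)"
    by (simp add: A_def B_def C_def real_sqrt_mult)
qed

lemma square_integrable_bounded_mult:
  fixes u :: "'a::euclidean_space \<Rightarrow> 'b::euclidean_space" and \<gamma> :: "'a \<Rightarrow> real"
  assumes u: "square_integrable u" and \<gamma>: "\<gamma> \<in> borel_measurable lebesgue" "\<And>x. \<bar>\<gamma> x\<bar> \<le> M"
  shows "square_integrable (\<lambda>x. \<gamma> x *\<^sub>R u x)"
proof (rule square_integrable_bound[OF u])
  have "u \<in> borel_measurable lebesgue" using u by (simp add: square_integrable_def)
  then show "(\<lambda>x. \<gamma> x *\<^sub>R u x) \<in> borel_measurable lebesgue" by (intro borel_measurable_scaleR \<gamma>(1))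
  show "norm (\<gamma> x *\<^sub>R u x) \<le> M * norm (u x)" for x using \<gamma>(2)[of x] by (simp add: mult_right_mono)
qed

text \<open>The gradient \<open>G\<close> is an explicit argument, and tests are made with any weak
  gradient. Multiples and products can then be given the gradients computed for them, without
  comparing these with an arbitrary choice of gradient.\<close>

definition wsol :: "('a::euclidean_space \<Rightarrow> real) \<Rightarrow> ('a \<Rightarrow> real) \<Rightarrow> real \<Rightarrow> ('a \<Rightarrow> real) \<Rightarrow> ('a \<Rightarrow> 'a) \<Rightarrow> bool" where
  "wsol \<gamma> f \<tau> v G \<longleftrightarrow> has_weak_gradient v G \<and>
     (\<forall>\<phi> g. has_weak_gradient \<phi> g \<longrightarrow>
        (LINT x|lebesgue. \<gamma> x * (G x \<bullet> g x) + \<tau>\<^sup>2 * v x * \<phi> x) = (LINT x|lebesgue. f x * \<phi> x))"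

lemma weak_solution_wsol:
  assumes "weak_solution \<gamma> f \<tau> v" and [measurable]: "\<gamma> \<in> borel_measurable lebesgue"
  shows "wsol \<gamma> f \<tau> v (weak_gradient v)"
proof -
  have wg: "has_weak_gradient u (weak_gradient u)" if "H1 u" for u :: "'a \<Rightarrow> real"
    using that unfolding H1_def weak_gradient_def by (rule someI_ex)
  have v: "has_weak_gradient v (weak_gradient v)" using assms(1) by (intro wg) (simp add: weak_solution_def)
  have "(LINT x|lebesgue. \<gamma> x * (weak_gradient v x \<bullet> g x) + \<tau>\<^sup>2 * v x * \<phi> x) = (LINT x|lebesgue. f x * \<phi> x)"
    if \<phi>: "has_weak_gradient \<phi> g" for \<phi> g
  proof -
    have H: "H1 \<phi>" using \<phi> by (auto simp: H1_def)
    have [measurable]: "g \<in> borel_measurable lebesgue" "weak_gradient \<phi> \<in> borel_measurable lebesgue"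
      "weak_gradient v \<in> borel_measurable lebesgue" "v \<in> borel_measurable lebesgue" "\<phi> \<in> borel_measurable lebesgue"
      using \<phi> wg[OF H] v by (auto simp: has_weak_gradient_def square_integrable_def)
    have "(LINT x|lebesgue. \<gamma> x * (weak_gradient v x \<bullet> g x) + \<tau>\<^sup>2 * v x * \<phi> x)
        = (LINT x|lebesgue. \<gamma> x * (weak_gradient v x \<bullet> weak_gradient \<phi> x) + \<tau>\<^sup>2 * v x * \<phi> x)"
    proof (rule integral_cong_AE)
      show "AE x in lebesgue. \<gamma> x * (weak_gradient v x \<bullet> g x) + \<tau>\<^sup>2 * v x * \<phi> x
          = \<gamma> x * (weak_gradient v x \<bullet> weak_gradient \<phi> x) + \<tau>\<^sup>2 * v x * \<phi> x"
        using weak_gradient_unique[OF \<phi> wg[OF H]] by eventually_elim simp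
    qed measurable
    then show ?thesis using assms(1) H by (simp add: weak_solution_def)
  qed
  with v show ?thesis by (simp add: wsol_def)
qed

lemma wsol_uminus: "wsol \<gamma> f \<tau> v G \<Longrightarrow> wsol \<gamma> (\<lambda>x. - f x) \<tau> (\<lambda>x. - v x) (\<lambda>x. - G x)"
proof -
  assume w: "wsol \<gamma> f \<tau> v G"
  have "has_weak_gradient (\<lambda>x. - v x) (\<lambda>x. - G x)"
    using w by (auto simp: wsol_def has_weak_gradient_def square_integrable_minus)
  moreover have "(LINT x|lebesgue. \<gamma> x * (- G x \<bullet> g x) + \<tau>\<^sup>2 * - v x * \<phi> x) = (LINT x|lebesgue. - f x * \<phi> x)"
    if "has_weak_gradient \<phi> g" for \<phi> g
  proof -
    have eq: "(\<lambda>x. \<gamma> x * (- G x \<bullet> g x) + \<tau>\<^sup>2 * - v x * \<phi> x) = (\<lambda>x. - (\<gamma> x * (G x \<bullet> g x) + \<tau>\<^sup>2 * v x * \<phi> x))"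
      by (simp add: fun_eq_iff)
    have "(LINT x|lebesgue. \<gamma> x * (G x \<bullet> g x) + \<tau>\<^sup>2 * v x * \<phi> x) = (LINT x|lebesgue. f x * \<phi> x)"
      using w that by (simp add: wsol_def)
    then show ?thesis unfolding eq by (simp only: Bochner_Integration.integral_minus mult_minus_left)
  qed
  ultimately show ?thesis by (simp add: wsol_def)
qed

text \<open>The equation is tested with \<open>v\<close> itself. Cauchy-Schwarz on the right and
  division by the norm of \<open>v\<close> give the first bound, which fed back into the right-hand
  side gives the other two.\<close>

lemma wsol_energy:
  assumes w: "wsol \<gamma> f \<tau> v G" and \<tau>: "\<tau> > 0" and f: "square_integrable f"
    and \<gamma>: "\<gamma> \<in> borel_measurable lebesgue" "\<And>x. \<gamma>0 \<le> \<gamma> x" "\<And>x. \<gamma> x \<le> \<Gamma>" "\<gamma>0 > 0"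
  shows "sqrt (LINT x|lebesgue. (v x)\<^sup>2) \<le> sqrt (LINT x|lebesgue. (f x)\<^sup>2) / \<tau>\<^sup>2"
    and "\<gamma>0 * (LINT x|lebesgue. (norm (G x))\<^sup>2) \<le> (LINT x|lebesgue. (f x)\<^sup>2) / \<tau>\<^sup>2"
    and "(LINT x|lebesgue. f x * v x) \<le> (LINT x|lebesgue. (f x)\<^sup>2) / \<tau>\<^sup>2"
proof -
  have vG: "has_weak_gradient v G" and sv: "square_integrable v" and sG: "square_integrable G"
    using w by (auto simp: wsol_def has_weak_gradient_def)
  define A where "A = sqrt (LINT x|lebesgue. (v x)\<^sup>2)"
  define B where "B = sqrt (LINT x|lebesgue. (f x)\<^sup>2)"
  define I where "I = (LINT x|lebesgue. (norm (G x))\<^sup>2)"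
  have nn: "A \<ge> 0" "B \<ge> 0" "I \<ge> 0" by (auto simp: A_def B_def I_def integral_nonneg_AE)
  have iv: "integrable lebesgue (\<lambda>x. (v x)\<^sup>2)" and iG: "integrable lebesgue (\<lambda>x. (norm (G x))\<^sup>2)"
    using sv sG by (auto simp: square_integrable_def)
  have "\<bar>\<gamma> x\<bar> \<le> \<Gamma>" for x using \<gamma>(2,3)[of x] \<gamma>(4) by linarith
  then have "square_integrable (\<lambda>x. \<gamma> x *\<^sub>R G x)" using square_integrable_bounded_mult[OF sG \<gamma>(1)] by blast
  from square_integrable_inner(1)[OF this sG] have i1: "integrable lebesgue (\<lambda>x. \<gamma> x * (G x \<bullet> G x))" by simp
  have "\<gamma>0 * I + \<tau>\<^sup>2 * A\<^sup>2 = (LINT x|lebesgue. \<gamma>0 * (norm (G x))\<^sup>2 + \<tau>\<^sup>2 * (v x)\<^sup>2)"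
    using iv iG by (simp add: A_def I_def integral_nonneg_AE)
  also have "\<dots> \<le> (LINT x|lebesgue. \<gamma> x * (G x \<bullet> G x) + \<tau>\<^sup>2 * v x * v x)"
  proof (rule integral_mono)
    show "\<gamma>0 * (norm (G x))\<^sup>2 + \<tau>\<^sup>2 * (v x)\<^sup>2 \<le> \<gamma> x * (G x \<bullet> G x) + \<tau>\<^sup>2 * v x * v x" for x
      using mult_right_mono[OF \<gamma>(2)[of x] zero_le_power2[of "norm (G x)"]]
      by (simp add: power2_eq_square[of "v x"] power2_norm_eq_inner mult.assoc)
    show "integrable lebesgue (\<lambda>x. \<gamma> x * (G x \<bullet> G x) + \<tau>\<^sup>2 * v x * v x)"
      using i1 iv by (simp add: power2_eq_square mult.assoc)
  qed (use iv iG in auto)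
  also have "\<dots> = (LINT x|lebesgue. f x * v x)" using w vG by (simp add: wsol_def)
  finally have e: "\<gamma>0 * I + \<tau>\<^sup>2 * A\<^sup>2 \<le> (LINT x|lebesgue. f x * v x)" .
  have cs: "(LINT x|lebesgue. f x * v x) \<le> B * A"
    using square_integrable_inner(2)[OF f sv] by (simp add: A_def B_def)
  have \<tau>2: "\<tau>\<^sup>2 > 0" using \<tau> by simp
  have "\<gamma>0 * I \<ge> 0" using nn \<gamma>(4) by simp
  then have "\<tau>\<^sup>2 * A * A \<le> B * A" using e cs by (simp add: power2_eq_square mult.assoc)
  then have A: "\<tau>\<^sup>2 * A \<le> B" using nn by (cases "A = 0") (auto simp: mult_le_cancel_right)
  then show "sqrt (LINT x|lebesgue. (v x)\<^sup>2) \<le> sqrt (LINT x|lebesgue. (f x)\<^sup>2) / \<tau>\<^sup>2"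
    using \<tau>2 by (simp add: A_def[symmetric] B_def[symmetric] field_simps)
  have "B * A \<le> B * (B / \<tau>\<^sup>2)" using A \<tau>2 nn by (intro mult_left_mono) (auto simp: field_simps)
  also have "B * (B / \<tau>\<^sup>2) = (LINT x|lebesgue. (f x)\<^sup>2) / \<tau>\<^sup>2"
    by (simp add: B_def integral_nonneg_AE)
  finally show fv: "(LINT x|lebesgue. f x * v x) \<le> (LINT x|lebesgue. (f x)\<^sup>2) / \<tau>\<^sup>2" using cs by linarith
  have "\<gamma>0 * I \<le> (LINT x|lebesgue. f x * v x)"
  proof -
    have "0 \<le> \<tau>\<^sup>2 * A\<^sup>2" by simp
    then show ?thesis using e by linarith
  qed
  then show "\<gamma>0 * (LINT x|lebesgue. (norm (G x))\<^sup>2) \<le> (LINT x|lebesgue. (f x)\<^sup>2) / \<tau>\<^sup>2"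
    using fv by (simp add: I_def)
qed

section \<open>Nonnegative sources give nonnegative solutions\<close>

lemma max0_power2_DERIV: "((\<lambda>t. (max 0 t)\<^sup>2) has_real_derivative 2 * max 0 t) (at (t::real))"
proof -
  have "\<bar>((max 0 (t + h))\<^sup>2 - (max 0 t)\<^sup>2) / h - 2 * max 0 t\<bar> \<le> \<bar>h\<bar>" if "h \<noteq> 0" for h
  proof -
    have "\<bar>(max 0 (t + h))\<^sup>2 - (max 0 t)\<^sup>2 - 2 * max 0 t * h\<bar> \<le> h\<^sup>2"
    proof (cases "t \<ge> 0"; cases "t + h \<ge> 0")
      assume "t \<ge> 0" "\<not> t + h \<ge> 0"
      then have "0 \<le> t * - (t + 2 * h)" by (intro mult_nonneg_nonneg) auto
      then show ?thesis using \<open>t \<ge> 0\<close> \<open>\<not> t + h \<ge> 0\<close> zero_le_power2[of "t + h"] by (simp add: max_def power2_eq_square algebra_simps)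
    next
      assume "\<not> t \<ge> 0" "t + h \<ge> 0"
      then show ?thesis using power_mono[of "t + h" h 2] by (simp add: max_def)
    qed (simp_all add: max_def power2_eq_square algebra_simps)
    moreover have "((max 0 (t + h))\<^sup>2 - (max 0 t)\<^sup>2) / h - 2 * max 0 t = ((max 0 (t + h))\<^sup>2 - (max 0 t)\<^sup>2 - 2 * max 0 t * h) / h"
      using that by (simp add: diff_divide_distrib)
    ultimately show ?thesis using that by (simp add: abs_divide divide_le_eq power2_eq_square)
  qed
  then have "\<forall>\<^sub>F h in at 0. norm (((max 0 (t + h))\<^sup>2 - (max 0 t)\<^sup>2) / h - 2 * max 0 t) \<le> \<bar>h\<bar>"
    unfolding real_norm_def eventually_at_filter by (intro always_eventually) blast
  from Lim_null_comparison[OF this tendsto_rabs_zero[OF tendsto_ident_at]]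
  have "((\<lambda>h. ((max 0 (t + h))\<^sup>2 - (max 0 t)\<^sup>2) / h - 2 * max 0 t) \<longlongrightarrow> 0) (at 0)" .
  then show ?thesis unfolding DERIV_def by (rule Lim_null[THEN iffD2])
qed

text \<open>A bounded C^1 substitute for the negative part: zero on \<open>s \<ge> 0\<close>,
  strictly negative on \<open>s < 0\<close>, nondecreasing, with slope at most one. Being C^1 it can
  be composed with a mollified function, which gives an admissible test function by elementary
  calculus.\<close>

definition negpart :: "real \<Rightarrow> real" where
  "negpart s = - ((max 0 (- s))\<^sup>2 / (1 + (max 0 (- s))\<^sup>2))"

definition negpart' :: "real \<Rightarrow> real" where
  "negpart' s = 2 * max 0 (- s) / (1 + (max 0 (- s))\<^sup>2)\<^sup>2"

lemma one_add_power2_pos: "0 < 1 + (x::real)\<^sup>2"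
  by (simp add: add_pos_nonneg)

lemma negpart_DERIV: "(negpart has_real_derivative negpart' s) (at s)"
proof -
  have m: "((\<lambda>s. (max 0 (- s))\<^sup>2) has_real_derivative 2 * max 0 (- s) * - 1) (at s)"
    by (rule DERIV_chain2[OF max0_power2_DERIV]) (auto intro!: derivative_eq_intros)
  have num: "2 * M * - 1 * (1 + M\<^sup>2) - M\<^sup>2 * (0 + 2 * M * - 1) = - (2 * M)" for M :: real
    by (simp add: power2_eq_square algebra_simps)
  show ?thesis unfolding negpart_def[abs_def] negpart'_def
    by (rule DERIV_cong[OF DERIV_minus[OF DERIV_divide[OF m DERIV_add[OF DERIV_const m] less_imp_neq[OF one_add_power2_pos, symmetric]]]])
      (unfold num, simp add: power2_eq_square)
qed

lemma negpart'_bounds: "0 \<le> negpart' s" "negpart' s \<le> 1"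
proof -
  define m where "m = max 0 (- s)"
  have "2 * m \<le> 1 + m\<^sup>2" using sum_squares_bound[of 1 m] by simp
  also have "\<dots> \<le> (1 + m\<^sup>2)\<^sup>2" by (intro self_le_power) auto
  finally show "negpart' s \<le> 1" unfolding negpart'_def m_def[symmetric] by (simp add: divide_le_eq)
qed (simp add: negpart'_def)

lemma negpart_lipschitz: "\<bar>negpart s - negpart t\<bar> \<le> \<bar>s - t\<bar>"
  using gderiv_lipschitz[of UNIV negpart negpart' 1 s t] negpart_DERIV negpart'_bounds by simp

lemma negpart_le_0: "negpart s \<le> 0" and negpart_abs_le: "\<bar>negpart s\<bar> \<le> \<bar>s\<bar>"
  using negpart_lipschitz[of s 0] by (auto simp: negpart_def intro: divide_nonneg_nonneg)

lemma mult_negpart: "s * negpart s \<ge> 0" "s * negpart s = 0 \<Longrightarrow> s \<ge> 0"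
proof -
  show "s * negpart s \<ge> 0"
  proof (cases "s < 0")
    case True
    then show ?thesis using negpart_le_0[of s] by (intro mult_nonpos_nonpos) auto
  qed (simp add: negpart_def)
  show "s * negpart s = 0 \<Longrightarrow> s \<ge> 0"
    using one_add_power2_pos[of "max 0 (- s)"] by (auto simp: negpart_def max_def split: if_splits)
qed

lemma continuous_negpart': "continuous_on UNIV negpart'"
  unfolding negpart'_def[abs_def] using one_add_power2_pos by (intro continuous_intros) (auto simp: less_imp_neq[symmetric])

text \<open>The equation is tested with a smooth nonpositive function of the mollified solution.\<close>

lemma wsol_nonneg:
  assumes w: "wsol \<gamma> f \<tau> v G" and \<tau>: "\<tau> > 0" and f: "square_integrable f" "AE x in lebesgue. f x \<ge> 0"
    and \<gamma>: "\<gamma> \<in> borel_measurable lebesgue" "\<And>x. 0 \<le> \<gamma> x" "\<And>x. \<gamma> x \<le> \<Gamma>"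
  shows "AE x in lebesgue. v x \<ge> 0"
proof -
  have vG: "has_weak_gradient v G" and sv: "square_integrable v" and sG: "square_integrable G"
    using w by (auto simp: wsol_def has_weak_gradient_def)
  have \<Gamma>: "0 \<le> \<Gamma>" using \<gamma>(2,3)[of 0] by linarith
  have vm[measurable]: "v \<in> borel_measurable lebesgue" and Gm[measurable]: "G \<in> borel_measurable lebesgue"
    using sv sG by (auto simp: square_integrable_def)
  have npc: "continuous_on UNIV negpart"
    using negpart_DERIV by (intro continuous_at_imp_continuous_on ballI) (rule DERIV_isCont)
  have npm[measurable]: "negpart \<in> borel_measurable borel" by (rule borel_measurable_continuous_onI[OF npc])
  have sn: "square_integrable (\<lambda>x. negpart (u x))" if u: "square_integrable u" for u :: "'a \<Rightarrow> real"
  proof (rule square_integrable_bound[OF u, of _ 1])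
    have [measurable]: "u \<in> borel_measurable lebesgue" using u by (simp add: square_integrable_def)
    show "(\<lambda>x. negpart (u x)) \<in> borel_measurable lebesgue" by measurable
  qed (use negpart_abs_le in auto)
  define A where "A = (LINT x|lebesgue. (norm (G x))\<^sup>2)"
  define A' where "A' = (LINT x|lebesgue. (norm (v x))\<^sup>2)"
  define C where "C = \<Gamma> * (A + 1) + \<tau>\<^sup>2 * (A' + 1)"
  have nn: "A \<ge> 0" "A' \<ge> 0" by (auto simp: A_def A'_def integral_nonneg_AE)
  have i0: "integrable lebesgue (\<lambda>x. \<tau>\<^sup>2 * (v x * negpart (v x)))"
    using square_integrable_inner(1)[OF sv sn[OF sv]] by simp
  \<comment> \<open>Testing with a function of the mollification \<open>conv \<rho> v\<close>
    instead of \<open>v\<close> causes errors whose squared norms are at most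
    \<open>\<theta>\<^sup>2\<close>. The weighted inequality
    \<open>a b \<le> \<theta> a^2 + b^2 / \<theta>\<close> turns them into a multiple of
    \<open>\<theta>\<close>, which is arbitrary.\<close>
  have main: "(LINT x|lebesgue. \<tau>\<^sup>2 * (v x * negpart (v x))) \<le> \<theta> * C" if \<theta>: "\<theta> > 0" for \<theta>
  proof -
    have \<theta>2: "\<theta>\<^sup>2 > 0" using \<theta> by simp
    obtain \<delta>1 where d1: "\<delta>1 > 0" "\<And>\<rho>. mollifier \<delta>1 \<rho> \<Longrightarrow> (LINT x|lebesgue. (norm (conv \<rho> v x - v x))\<^sup>2) \<le> \<theta>\<^sup>2"
      using conv_L2_convergence[OF sv \<theta>2] by metis
    obtain \<delta>2 where d2: "\<delta>2 > 0" "\<And>\<rho>. mollifier \<delta>2 \<rho> \<Longrightarrow> (LINT x|lebesgue. (norm (conv \<rho> G x - G x))\<^sup>2) \<le> \<theta>\<^sup>2"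
      using conv_L2_convergence[OF sG \<theta>2] by metis
    obtain \<rho> :: "'a \<Rightarrow> real" where \<rho>: "mollifier (min \<delta>1 \<delta>2) \<rho>"
      using mollifier_exists[of "min \<delta>1 \<delta>2"] d1 d2 by auto
    note t = mollifierD(1)[OF \<rho>]
    have E1: "(LINT x|lebesgue. (norm (conv \<rho> v x - v x))\<^sup>2) \<le> \<theta>\<^sup>2"
      by (rule d1(2)[OF mollifier_mono[OF \<rho>]]) simp
    have E2: "(LINT x|lebesgue. (norm (conv \<rho> G x - G x))\<^sup>2) \<le> \<theta>\<^sup>2"
      by (rule d2(2)[OF mollifier_mono[OF \<rho>]]) simp
    define u where "u x = negpart (conv \<rho> v x)" for x
    define H where "H x = negpart' (conv \<rho> v x) *\<^sub>R conv \<rho> G x" for x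
    have sc: "square_integrable (conv \<rho> v)" "square_integrable (conv \<rho> G)"
      by (rule square_integrable_conv(1)[OF \<rho> sv], rule square_integrable_conv(1)[OF \<rho> sG])
    have cc: "continuous_on UNIV (conv \<rho> v)" "continuous_on UNIV (conv \<rho> G)"
      by (intro continuous_on_conv t square_integrable_locally_integrable sv sG)+
    have ncc: "continuous_on UNIV (\<lambda>x. negpart' (conv \<rho> v x))"
      by (rule continuous_on_compose2[OF continuous_negpart' cc(1)]) auto
    have nm: "(\<lambda>x. negpart' (conv \<rho> v x)) \<in> borel_measurable lebesgue"
      by (rule continuous_imp_lebesgue_measurable[OF ncc])
    have sH: "square_integrable H" unfolding H_def
      by (rule square_integrable_bounded_mult[OF sc(2) nm, of 1]) (use negpart'_bounds in auto)
    have su: "square_integrable u" unfolding u_def by (rule sn[OF sc(1)])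
    have uH: "has_weak_gradient u H"
    proof (rule has_weak_gradient_C1[OF su sH])
      show "GDERIV u x :> H x" for x
        unfolding u_def H_def by (rule GDERIV_DERIV_compose[OF GDERIV_conv_weak[OF vG t] negpart_DERIV])
      show "continuous_on UNIV H" unfolding H_def by (intro continuous_intros ncc cc)
    qed
    have s\<gamma>: "square_integrable (\<lambda>x. \<gamma> x *\<^sub>R H x)"
      by (rule square_integrable_bounded_mult[OF sH \<gamma>(1), of \<Gamma>]) (use \<gamma> in auto)
    have i1: "integrable lebesgue (\<lambda>x. \<gamma> x * (G x \<bullet> H x) + \<tau>\<^sup>2 * v x * u x)"
      using square_integrable_inner(1)[OF sG s\<gamma>] square_integrable_inner(1)[OF sv su] by (simp add: mult.assoc)
    have "(LINT x|lebesgue. \<gamma> x * (G x \<bullet> H x) + \<tau>\<^sup>2 * v x * u x) = (LINT x|lebesgue. f x * u x)"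
      using w uH by (simp add: wsol_def)
    also have "\<dots> \<le> 0"
    proof -
      have "0 \<le> (LINT x|lebesgue. - (f x * u x))"
      proof (rule integral_nonneg_AE)
        show "AE x in lebesgue. 0 \<le> - (f x * u x)"
          using f(2) by eventually_elim (use negpart_le_0 in \<open>simp add: u_def mult_nonneg_nonpos\<close>)
      qed
      then show ?thesis by simp
    qed
    finally have le0: "(LINT x|lebesgue. \<gamma> x * (G x \<bullet> H x) + \<tau>\<^sup>2 * v x * u x) \<le> 0" .
    define R where "R x = \<Gamma> * (\<theta> * (norm (G x))\<^sup>2 + (norm (conv \<rho> G x - G x))\<^sup>2 / \<theta>)
        + \<tau>\<^sup>2 * (\<theta> * (norm (v x))\<^sup>2 + (norm (conv \<rho> v x - v x))\<^sup>2 / \<theta>)" for x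
    have d: "square_integrable (\<lambda>x. conv \<rho> G x - G x)" "square_integrable (\<lambda>x. conv \<rho> v x - v x)"
      by (intro square_integrable_diff sc sv sG)+
    have ints: "integrable lebesgue (\<lambda>x. (norm (G x))\<^sup>2)" "integrable lebesgue (\<lambda>x. (norm (conv \<rho> G x - G x))\<^sup>2)"
      "integrable lebesgue (\<lambda>x. (norm (v x))\<^sup>2)" "integrable lebesgue (\<lambda>x. (norm (conv \<rho> v x - v x))\<^sup>2)"
      using d sv sG unfolding square_integrable_def by blast+
    have iR: "integrable lebesgue R" unfolding R_def
      by (intro Bochner_Integration.integrable_add integrable_mult_right integrable_divide ints)
    have pt: "\<tau>\<^sup>2 * (v x * negpart (v x)) \<le> (\<gamma> x * (G x \<bullet> H x) + \<tau>\<^sup>2 * v x * u x) + R x" for x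
    proof -
      have amgm: "a * b \<le> \<theta> * a\<^sup>2 + b\<^sup>2 / \<theta>" if "a \<ge> 0" "b \<ge> 0" for a b :: real
      proof -
        have "2 * (\<theta> * a) * b \<le> (\<theta> * a)\<^sup>2 + b\<^sup>2" by (rule sum_squares_bound)
        then have "2 * (a * b) \<le> \<theta> * a\<^sup>2 + b\<^sup>2 / \<theta>" using \<theta> by (simp add: field_simps power2_eq_square)
        moreover have "a * b \<ge> 0" using that by simp
        ultimately show ?thesis by linarith
      qed
      let ?n = "negpart' (conv \<rho> v x)"
      \<comment> \<open>The gradient of the test function is \<open>negpart'\<close> times the
        mollified gradient. Replacing the latter by \<open>G x\<close> gives a nonnegative term,
        which is dropped, and a remainder controlled by the mollification error.\<close>
      have "\<gamma> x * (G x \<bullet> H x) = \<gamma> x * ?n * (norm (G x))\<^sup>2 + \<gamma> x * ?n * (G x \<bullet> (conv \<rho> G x - G x))"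
        by (simp add: H_def inner_diff_right power2_norm_eq_inner algebra_simps)
      moreover have "\<gamma> x * ?n * (norm (G x))\<^sup>2 \<ge> 0" using \<gamma>(2) negpart'_bounds by simp
      moreover have "\<gamma> x * ?n * (G x \<bullet> (conv \<rho> G x - G x)) \<ge> - (\<Gamma> * (norm (G x) * norm (conv \<rho> G x - G x)))"
      proof -
        have "\<gamma> x * ?n \<le> \<Gamma> * 1" using \<gamma> negpart'_bounds \<Gamma> by (intro mult_mono) auto
        then have "\<bar>\<gamma> x * ?n * (G x \<bullet> (conv \<rho> G x - G x))\<bar> \<le> \<Gamma> * (norm (G x) * norm (conv \<rho> G x - G x))"
          unfolding abs_mult[of "\<gamma> x * ?n"]
          using \<gamma>(2) negpart'_bounds Cauchy_Schwarz_ineq2 \<Gamma> by (intro mult_mono) auto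
        then show ?thesis by linarith
      qed
      moreover have "\<Gamma> * (norm (G x) * norm (conv \<rho> G x - G x)) \<le> \<Gamma> * (\<theta> * (norm (G x))\<^sup>2 + (norm (conv \<rho> G x - G x))\<^sup>2 / \<theta>)"
        by (intro mult_left_mono amgm \<Gamma>) auto
      moreover have "\<tau>\<^sup>2 * (v x * negpart (v x)) - \<tau>\<^sup>2 * v x * u x \<le> \<tau>\<^sup>2 * (\<theta> * (norm (v x))\<^sup>2 + (norm (conv \<rho> v x - v x))\<^sup>2 / \<theta>)"
      proof -
        have "v x * (negpart (v x) - u x) \<le> \<bar>v x * (negpart (v x) - u x)\<bar>" by (rule abs_ge_self)
        also have "\<dots> \<le> \<bar>v x\<bar> * \<bar>conv \<rho> v x - v x\<bar>"
          using negpart_lipschitz[of "v x" "conv \<rho> v x"] by (simp add: abs_mult u_def mult_left_mono abs_minus_commute)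
        also have "\<dots> \<le> \<theta> * (norm (v x))\<^sup>2 + (norm (conv \<rho> v x - v x))\<^sup>2 / \<theta>"
          using amgm[of "\<bar>v x\<bar>" "\<bar>conv \<rho> v x - v x\<bar>"] by simp
        finally have "\<tau>\<^sup>2 * (v x * (negpart (v x) - u x)) \<le> \<tau>\<^sup>2 * (\<theta> * (norm (v x))\<^sup>2 + (norm (conv \<rho> v x - v x))\<^sup>2 / \<theta>)"
          by (intro mult_left_mono) auto
        then show ?thesis by (simp add: right_diff_distrib mult.assoc)
      qed
      ultimately show ?thesis unfolding R_def by linarith
    qed
    have "(LINT x|lebesgue. \<tau>\<^sup>2 * (v x * negpart (v x))) \<le> (LINT x|lebesgue. (\<gamma> x * (G x \<bullet> H x) + \<tau>\<^sup>2 * v x * u x) + R x)"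
      by (intro integral_mono i0 Bochner_Integration.integrable_add i1 iR pt)
    also have "\<dots> = (LINT x|lebesgue. \<gamma> x * (G x \<bullet> H x) + \<tau>\<^sup>2 * v x * u x) + (LINT x|lebesgue. R x)"
      by (rule Bochner_Integration.integral_add[OF i1 iR])
    also have "\<dots> \<le> (LINT x|lebesgue. R x)" using le0 by simp
    also have "(LINT x|lebesgue. R x) = \<Gamma> * (\<theta> * A + (LINT x|lebesgue. (norm (conv \<rho> G x - G x))\<^sup>2) / \<theta>)
        + \<tau>\<^sup>2 * (\<theta> * A' + (LINT x|lebesgue. (norm (conv \<rho> v x - v x))\<^sup>2) / \<theta>)"
      unfolding R_def A_def A'_def using ints by simp
    also have "\<dots> \<le> \<Gamma> * (\<theta> * A + \<theta>\<^sup>2 / \<theta>) + \<tau>\<^sup>2 * (\<theta> * A' + \<theta>\<^sup>2 / \<theta>)"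
      using \<Gamma> \<theta> E1 E2 by (intro add_mono mult_left_mono divide_right_mono) auto
    also have "\<dots> = \<theta> * C" using \<theta> by (simp add: C_def power2_eq_square algebra_simps)
    finally show ?thesis .
  qed
  have C: "C \<ge> 0" unfolding C_def using nn \<Gamma> by (intro add_nonneg_nonneg mult_nonneg_nonneg) auto
  have "(LINT x|lebesgue. \<tau>\<^sup>2 * (v x * negpart (v x))) \<le> 0"
  proof (rule field_le_epsilon)
    fix e :: real assume "e > 0"
    then have "e / (C + 1) > 0" "e / (C + 1) * C \<le> e" using C by (auto simp: field_simps)
    then show "(LINT x|lebesgue. \<tau>\<^sup>2 * (v x * negpart (v x))) \<le> 0 + e" using main[of "e / (C + 1)"] by linarith
  qed
  moreover have "(LINT x|lebesgue. \<tau>\<^sup>2 * (v x * negpart (v x))) \<ge> 0"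
    using mult_negpart(1) by (intro integral_nonneg_AE) simp
  ultimately have "(LINT x|lebesgue. \<tau>\<^sup>2 * (v x * negpart (v x))) = 0" by linarith
  then have "AE x in lebesgue. \<tau>\<^sup>2 * (v x * negpart (v x)) = 0"
    using integral_nonneg_eq_0_iff_AE[OF i0] mult_negpart(1) by simp
  then show ?thesis
  proof eventually_elim
    case (elim x)
    then show ?case using \<tau> mult_negpart(2)[of "v x"] by simp
  qed
qed

text \<open>The open sets in the definition form an uncountable family; by Lindelof countably many
  of them have the same union, and countably many null sets may be discarded.\<close>

lemma ess_support_AE_0:
  fixes f :: "'a::euclidean_space \<Rightarrow> real"
  assumes "ess_support f \<subseteq> S"
  shows "AE x in lebesgue. x \<notin> S \<longrightarrow> f x = 0"
proof -
  let ?F = "{U. open U \<and> (AE x in lebesgue. x \<in> U \<longrightarrow> f x = 0)}"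
  obtain F' where F': "F' \<subseteq> ?F" "countable F'" "\<Union>F' = \<Union>?F"
    using Lindelof[of ?F] by auto
  have "AE x in lebesgue. \<forall>U\<in>F'. x \<in> U \<longrightarrow> f x = 0"
    using F'(1) by (subst AE_ball_countable[OF F'(2)]) auto
  then show ?thesis
  proof eventually_elim
    case (elim x)
    then show ?case using assms F'(3) by (auto simp: ess_support_def)
  qed
qed

lemma conv_ge:
  fixes F :: "'a::euclidean_space \<Rightarrow> real"
  assumes \<rho>: "mollifier \<delta> \<rho>" and F: "locally_integrable F" and c: "\<And>y. norm (x - y) < \<delta> \<Longrightarrow> c \<le> F y"
  shows "c \<le> conv \<rho> F x"
proof -
  note i = mollifier_integral_reflect[OF \<rho>, of x]
  have "c = (LINT y|lebesgue. \<rho> (x - y) * c)" using i by simp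
  also have "\<dots> \<le> conv \<rho> F x" unfolding conv_def
  proof (rule integral_mono)
    show "integrable lebesgue (\<lambda>y. \<rho> (x - y) * c)" using i by simp
    show "integrable lebesgue (\<lambda>y. \<rho> (x - y) *\<^sub>R F y)" by (rule integrable_conv[OF mollifierD(1)[OF \<rho>] F])
    show "\<rho> (x - y) * c \<le> \<rho> (x - y) *\<^sub>R F y" for y
      using c[of y] mollifierD(2,3)[OF \<rho>, of "x - y"]
      by (cases "norm (x - y) < \<delta>") (auto intro: mult_left_mono)
  qed
  finally show ?thesis .
qed

lemma conv_uminus: "conv \<rho> (\<lambda>x. - F x) x = - conv \<rho> F x"
  by (simp add: conv_def)

lemma conv_le:
  fixes F :: "'a::euclidean_space \<Rightarrow> real"
  assumes \<rho>: "mollifier \<delta> \<rho>" and F: "locally_integrable F" and c: "\<And>y. norm (x - y) < \<delta> \<Longrightarrow> F y \<le> c"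
  shows "conv \<rho> F x \<le> c"
proof -
  have "locally_integrable (\<lambda>x. - F x)" using F by (simp add: locally_integrable_def)
  from conv_ge[OF \<rho> this, of x "-c"] c show ?thesis by (simp add: conv_uminus)
qed

text \<open>An Agmon estimate: the test function is \<open>W * v\<close>. By the eikonal inequality
  the cross term \<open>\<gamma> v (G \<bullet> h)\<close> is at most the fraction
  \<open>(\<tau> - s) / \<tau>\<close> of the weighted energy density \<open>W * A\<close>, so the
  fraction \<open>s / \<tau>\<close> is left to be bounded by the source.\<close>

lemma wsol_weighted_energy:
  fixes W :: "'a::euclidean_space \<Rightarrow> real"
  assumes w: "wsol \<gamma> f \<tau> v G" and \<tau>: "\<tau> > 0" and f: "square_integrable f"
    and \<gamma>: "\<gamma> \<in> borel_measurable lebesgue" "\<And>x. \<gamma>0 \<le> \<gamma> x" "\<And>x. \<gamma> x \<le> \<Gamma>" "\<gamma>0 > 0"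
    and W: "\<And>k. Ck k W" "\<And>x. GDERIV W x :> h x" "\<And>x. 0 \<le> W x" "\<And>x. W x \<le> M" "\<And>x. norm (h x) \<le> M"
    and eik: "\<And>x. sqrt (\<gamma> x) * norm (h x) \<le> 2 * (\<tau> - s) * W x" and s: "0 < s"
    and D: "D \<in> sets lebesgue" "\<And>x. x \<in> D \<Longrightarrow> w0 \<le> W x" "w0 > 0"
    and B: "AE x in lebesgue. x \<notin> B \<longrightarrow> f x = 0" "\<And>x. x \<in> B \<Longrightarrow> W x \<le> w1" "w1 \<ge> 0"
  shows "(LINT x|lebesgue. indicator D x * (norm (G x))\<^sup>2) \<le> w1 / (w0 * \<gamma>0 * s * \<tau>) * (LINT x|lebesgue. (f x)\<^sup>2)"
proof -
  have vG: "has_weak_gradient v G" and sv: "square_integrable v" and sG: "square_integrable G"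
    using w by (auto simp: wsol_def has_weak_gradient_def)
  have [measurable]: "v \<in> borel_measurable lebesgue" "G \<in> borel_measurable lebesgue" "f \<in> borel_measurable lebesgue"
    using sv sG f by (auto simp: square_integrable_def)
  have \<gamma>abs: "\<bar>\<gamma> x\<bar> \<le> \<Gamma>" for x using \<gamma>(2,3)[of x] \<gamma>(4) by linarith
  have Wabs: "\<bar>W x\<bar> \<le> M" for x using W(3,4) by simp
  have WmR: "W \<in> borel_measurable lebesgue" by (rule continuous_imp_lebesgue_measurable[OF Ck_continuous[OF W(1)]])
  note wW = has_weak_gradient_mult_smooth[OF vG W(1,2) Wabs W(5)]
  define A where "A x = \<gamma> x * (norm (G x))\<^sup>2 + \<tau>\<^sup>2 * (v x)\<^sup>2" for x
  have s1: "square_integrable (\<lambda>x. W x *\<^sub>R G x)" by (rule square_integrable_bounded_mult[OF sG WmR Wabs])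
  have s2: "square_integrable (\<lambda>x. W x * v x)" using square_integrable_bounded_mult[OF sv WmR Wabs] by simp
  have s3: "square_integrable (\<lambda>x. \<gamma> x *\<^sub>R G x)" by (rule square_integrable_bounded_mult[OF sG \<gamma>(1) \<gamma>abs])
  have iA: "integrable lebesgue (\<lambda>x. W x * A x)"
  proof -
    have "integrable lebesgue (\<lambda>x. (\<gamma> x *\<^sub>R G x) \<bullet> (W x *\<^sub>R G x) + \<tau>\<^sup>2 * (v x \<bullet> (W x * v x)))"
      by (intro Bochner_Integration.integrable_add integrable_mult_right square_integrable_inner(1) s1 s2 s3 sv)
    also have "(\<lambda>x. (\<gamma> x *\<^sub>R G x) \<bullet> (W x *\<^sub>R G x) + \<tau>\<^sup>2 * (v x \<bullet> (W x * v x))) = (\<lambda>x. W x * A x)"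
    proof
      fix x
      show "(\<gamma> x *\<^sub>R G x) \<bullet> (W x *\<^sub>R G x) + \<tau>\<^sup>2 * (v x \<bullet> (W x * v x)) = W x * A x"
        by (simp add: A_def power2_norm_eq_inner power2_eq_square[of "v x"] algebra_simps)
    qed
    finally show ?thesis .
  qed
  have iT: "integrable lebesgue (\<lambda>x. \<gamma> x * (G x \<bullet> (W x *\<^sub>R G x + v x *\<^sub>R h x)) + \<tau>\<^sup>2 * v x * (W x * v x))"
  proof -
    have "square_integrable (\<lambda>x. W x *\<^sub>R G x + v x *\<^sub>R h x)" using wW by (simp add: has_weak_gradient_def)
    then have "integrable lebesgue (\<lambda>x. (\<gamma> x *\<^sub>R G x) \<bullet> (W x *\<^sub>R G x + v x *\<^sub>R h x) + \<tau>\<^sup>2 * (v x \<bullet> (W x * v x)))"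
      by (intro Bochner_Integration.integrable_add integrable_mult_right square_integrable_inner(1) s2 s3 sv)
    then show ?thesis by (simp add: mult.assoc)
  qed
  have pt: "(s / \<tau>) * (W x * A x) \<le> \<gamma> x * (G x \<bullet> (W x *\<^sub>R G x + v x *\<^sub>R h x)) + \<tau>\<^sup>2 * v x * (W x * v x)" for x
  proof -
    define a where "a = sqrt (\<gamma> x) * norm (G x)"
    define b where "b = \<tau> * \<bar>v x\<bar>"
    have \<gamma>x: "\<gamma> x \<ge> 0" using \<gamma>(2,4) by (meson less_le_trans less_imp_le)
    have a2: "a\<^sup>2 = \<gamma> x * (norm (G x))\<^sup>2" using \<gamma>x by (simp add: a_def power_mult_distrib)
    have b2: "b\<^sup>2 = \<tau>\<^sup>2 * (v x)\<^sup>2" by (simp add: b_def power_mult_distrib)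
    have ab: "a \<ge> 0" "b \<ge> 0" using \<gamma>x \<tau> by (auto simp: a_def b_def)
    have "\<bar>\<gamma> x * (v x * (G x \<bullet> h x))\<bar> \<le> \<gamma> x * (\<bar>v x\<bar> * (norm (G x) * norm (h x)))"
      unfolding abs_mult using \<gamma>x Cauchy_Schwarz_ineq2[of "G x" "h x"] by (intro mult_mono) auto
    also have "\<dots> = a * \<bar>v x\<bar> * (sqrt (\<gamma> x) * norm (h x))"
      using \<gamma>x real_sqrt_mult_self[of "\<gamma> x"] by (simp add: a_def)
    also have "\<dots> \<le> a * \<bar>v x\<bar> * (2 * (\<tau> - s) * W x)" using ab by (intro mult_left_mono eik) auto
    also have "\<dots> = ((\<tau> - s) / \<tau>) * W x * (2 * a * b)" using \<tau> by (simp add: b_def)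
    also have "\<dots> \<le> ((\<tau> - s) / \<tau>) * W x * (a\<^sup>2 + b\<^sup>2)"
    \<comment> \<open>That \<open>s \<le> \<tau>\<close> follows from the eikonal inequality, but
      only at a point where \<open>W\<close> is positive.\<close>
    proof (cases "W x = 0")
      case False
      have "0 \<le> 2 * (\<tau> - s) * W x" using order_trans[OF _ eik[of x], of 0] \<gamma>x by simp
      then have "0 \<le> \<tau> - s" using False W(3)[of x] by (simp add: zero_le_mult_iff)
      then show ?thesis using \<tau> W(3)[of x] sum_squares_bound[of a b] by (intro mult_left_mono) auto
    qed simp
    finally have "\<gamma> x * (v x * (G x \<bullet> h x)) \<ge> - (((\<tau> - s) / \<tau>) * W x * (a\<^sup>2 + b\<^sup>2))" by linarith
    moreover have "\<gamma> x * (G x \<bullet> (W x *\<^sub>R G x + v x *\<^sub>R h x)) + \<tau>\<^sup>2 * v x * (W x * v x)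
        = W x * (a\<^sup>2 + b\<^sup>2) + \<gamma> x * (v x * (G x \<bullet> h x))"
      unfolding a2 b2 by (simp add: inner_add_right power2_norm_eq_inner power2_eq_square[of "v x"] algebra_simps)
    moreover have "(s / \<tau>) * (W x * A x) = W x * (a\<^sup>2 + b\<^sup>2) - ((\<tau> - s) / \<tau>) * W x * (a\<^sup>2 + b\<^sup>2)"
      using \<tau> by (simp add: A_def a2 b2 field_simps)
    ultimately show ?thesis by linarith
  qed
  define E where "E = (LINT x|lebesgue. (f x)\<^sup>2)"
  have E0: "E \<ge> 0" by (simp add: E_def integral_nonneg_AE)
  \<comment> \<open>The weight is taken at its bound \<open>w1\<close> on the support of the source,
    while \<open>v\<close> is measured by its global norm, of order
    \<open>\<tau>^-2\<close>.\<close>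
  have fv: "(LINT x|lebesgue. f x * (W x * v x)) \<le> w1 * (E / \<tau>\<^sup>2)"
  proof -
    have sf: "square_integrable (\<lambda>x. W x * f x)" using square_integrable_bounded_mult[OF f WmR Wabs] by simp
    have "(LINT x|lebesgue. (W x * f x) \<bullet> v x) \<le> sqrt (LINT x|lebesgue. (norm (W x * f x))\<^sup>2) * sqrt (LINT x|lebesgue. (norm (v x))\<^sup>2)"
      using square_integrable_inner(2)[OF sf sv] by linarith
    also have "\<dots> \<le> (w1 * sqrt E) * (sqrt E / \<tau>\<^sup>2)"
    proof (intro mult_mono)
      have "(LINT x|lebesgue. (norm (W x * f x))\<^sup>2) \<le> (LINT x|lebesgue. w1\<^sup>2 * (f x)\<^sup>2)"
      proof (rule integral_mono_AE)
        show "integrable lebesgue (\<lambda>x. (norm (W x * f x))\<^sup>2)" using sf by (simp add: square_integrable_def)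
        show "integrable lebesgue (\<lambda>x. w1\<^sup>2 * (f x)\<^sup>2)" using f by (simp add: square_integrable_def)
        show "AE x in lebesgue. (norm (W x * f x))\<^sup>2 \<le> w1\<^sup>2 * (f x)\<^sup>2"
          using B(1)
        proof eventually_elim
          case (elim x)
          show ?case
          proof (cases "x \<in> B")
            case True
            then show ?thesis using B(2)[OF True] W(3)[of x]
              by (simp add: power_mult_distrib) (intro mult_right_mono power_mono, auto)
          qed (use elim in simp)
        qed
      qed
      also have "\<dots> = w1\<^sup>2 * E" by (simp add: E_def)
      finally have "sqrt (LINT x|lebesgue. (norm (W x * f x))\<^sup>2) \<le> sqrt (w1\<^sup>2 * E)" by (rule real_sqrt_le_mono)
      then show "sqrt (LINT x|lebesgue. (norm (W x * f x))\<^sup>2) \<le> w1 * sqrt E"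
        using B(3) by (simp add: real_sqrt_mult)
      show "sqrt (LINT x|lebesgue. (norm (v x))\<^sup>2) \<le> sqrt E / \<tau>\<^sup>2"
        using wsol_energy(1)[OF w \<tau> f \<gamma>] by (simp add: E_def)
    qed (use B(3) E0 in \<open>auto simp: integral_nonneg_AE\<close>)
    also have "(w1 * sqrt E) * (sqrt E / \<tau>\<^sup>2) = w1 * (E / \<tau>\<^sup>2)" using E0 by simp
    finally show ?thesis by (simp add: mult_ac)
  qed
  have sD: "square_integrable (\<lambda>x. indicat_real D x *\<^sub>R G x)"
    by (rule square_integrable_bounded_mult[OF sG, of _ 1]) (use D(1) in auto)
  have iD: "integrable lebesgue (\<lambda>x. indicat_real D x * (norm (G x))\<^sup>2)"
  proof -
    have "integrable lebesgue (\<lambda>x. (norm (indicat_real D x *\<^sub>R G x))\<^sup>2)" using sD by (simp add: square_integrable_def)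
    also have "(\<lambda>x. (norm (indicat_real D x *\<^sub>R G x))\<^sup>2) = (\<lambda>x. indicat_real D x * (norm (G x))\<^sup>2)"
      by (auto simp: fun_eq_iff indicator_def)
    finally show ?thesis .
  qed
  have "(s / \<tau>) * (w0 * \<gamma>0 * (LINT x|lebesgue. indicat_real D x * (norm (G x))\<^sup>2))
      = (s / \<tau>) * (LINT x|lebesgue. w0 * \<gamma>0 * (indicat_real D x * (norm (G x))\<^sup>2))" using iD by simp
  also have "\<dots> \<le> (s / \<tau>) * (LINT x|lebesgue. W x * A x)"
  proof (intro mult_left_mono integral_mono)
    show "integrable lebesgue (\<lambda>x. w0 * \<gamma>0 * (indicat_real D x * (norm (G x))\<^sup>2))" using iD by simp
    fix x
    have "\<gamma>0 * (norm (G x))\<^sup>2 \<le> \<gamma> x * (norm (G x))\<^sup>2" using \<gamma>(2) by (intro mult_right_mono) auto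
    then have A: "\<gamma>0 * (norm (G x))\<^sup>2 \<le> A x" unfolding A_def by (simp add: add_increasing2)
    have A0: "0 \<le> A x" using A \<gamma>(4) order_trans[OF mult_nonneg_nonneg A] by simp
    show "w0 * \<gamma>0 * (indicat_real D x * (norm (G x))\<^sup>2) \<le> W x * A x"
    proof (cases "x \<in> D")
      case True
      then show ?thesis using mult_mono[OF D(2)[OF True] A W(3)] \<gamma>(4) by (simp add: mult.assoc)
    qed (use A0 W(3) in simp)
  qed (use iA s \<tau> in auto)
  also have "\<dots> = (LINT x|lebesgue. (s / \<tau>) * (W x * A x))" using iA by simp
  also have "\<dots> \<le> (LINT x|lebesgue. \<gamma> x * (G x \<bullet> (W x *\<^sub>R G x + v x *\<^sub>R h x)) + \<tau>\<^sup>2 * v x * (W x * v x))"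
    by (intro integral_mono iT pt integrable_mult_right iA)
  also have "\<dots> = (LINT x|lebesgue. f x * (W x * v x))" using w wW by (simp add: wsol_def)
  also have "\<dots> \<le> w1 * (E / \<tau>\<^sup>2)" by (rule fv)
  finally have "(s / \<tau>) * (w0 * \<gamma>0 * (LINT x|lebesgue. indicat_real D x * (norm (G x))\<^sup>2)) \<le> w1 * (E / \<tau>\<^sup>2)" .
  then show ?thesis using \<tau> s D(3) \<gamma>(4) by (simp add: E_def field_simps power2_eq_square)
qed

section \<open>The optical distance to the obstacle\<close>

text \<open>The norm of \<open>\<nabla>s\<close> for a wave \<open>exp (- \<tau> * s)\<close> that
  solves the homogeneous equation to leading order; a reciprocal speed.\<close>

definition slow :: "real \<Rightarrow> real" where "slow \<gamma> = 1 / sqrt \<gamma>"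

abbreviation lower_closed :: "(real^3) set" where "lower_closed \<equiv> {z. z $ 3 \<le> 0}"

text \<open>For \<open>nm \<le> np\<close> this is the optical distance from \<open>x\<close> to
  \<open>D\<close>. The first leg may end anywhere in the closed lower half-space, not only on the
  interface: travelling below at the larger slowness \<open>np\<close> brings no advantage, and the
  formula makes the Lipschitz bound \<open>np\<close> on the whole space immediate.\<close>

definition obstacle_dist :: "real \<Rightarrow> real \<Rightarrow> (real^3) set \<Rightarrow> real^3 \<Rightarrow> real" where
  "obstacle_dist np nm D x = (INF z\<in>lower_closed. np * norm (x - z) + nm * infdist z D)"

lemma optical_dist_sets_le:
  assumes \<gamma>: "\<gamma>p > 0" "\<gamma>m > 0" and u: "u \<in> D" "y \<in> B" and z: "z $ 3 = 0"
  shows "optical_dist_sets \<gamma>p \<gamma>m D B \<le> slow \<gamma>m * norm (z - u) + slow \<gamma>p * norm (z - y)"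
proof -
  have nn: "optical_length \<gamma>p \<gamma>m a b z' \<ge> 0" for a b z'
    using \<gamma> by (simp add: optical_length_def Let_def)
  have bd: "bdd_below (range (optical_length \<gamma>p \<gamma>m a b))" for a b using nn by (intro bdd_belowI[of _ 0]) auto
  have nn2: "optical_dist \<gamma>p \<gamma>m a b \<ge> 0" for a b
    unfolding optical_dist_def by (rule cINF_greatest) (use nn in auto)
  have "optical_dist_sets \<gamma>p \<gamma>m D B \<le> optical_dist \<gamma>p \<gamma>m u y"
    unfolding optical_dist_sets_def
    by (rule cINF_lower2[of _ _ "(u, y)"]) (use u nn2 in \<open>auto intro!: bdd_belowI[of _ 0]\<close>)
  also have "\<dots> \<le> optical_length \<gamma>p \<gamma>m u y (vector [z $ 1, z $ 2])"
    unfolding optical_dist_def by (rule cINF_lower[OF bd]) simp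
  also have "vector [z $ 1, z $ 2, 0] = z" using z by (simp add: vec_eq_iff forall_3)
  then have "optical_length \<gamma>p \<gamma>m u y (vector [z $ 1, z $ 2]) = slow \<gamma>m * norm (z - u) + slow \<gamma>p * norm (z - y)"
    by (simp add: optical_length_def Let_def slow_def)
  finally show ?thesis .
qed

lemma optical_dist_sets_nonneg:
  assumes \<gamma>: "\<gamma>p > 0" "\<gamma>m > 0" and "D \<noteq> {}" "B \<noteq> {}"
  shows "optical_dist_sets \<gamma>p \<gamma>m D B \<ge> 0"
proof -
  have nn: "optical_length \<gamma>p \<gamma>m a b z' \<ge> 0" for a b z'
    using \<gamma> by (simp add: optical_length_def Let_def)
  have nn2: "optical_dist \<gamma>p \<gamma>m a b \<ge> 0" for a b
    unfolding optical_dist_def by (rule cINF_greatest) (use nn in auto)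
  show ?thesis unfolding optical_dist_sets_def by (rule cINF_greatest) (use assms nn2 in auto)
qed

context
  fixes np nm :: real and D :: "(real^3) set"
  assumes n: "0 < nm" "nm \<le> np" and D: "D \<noteq> {}"
begin

lemma obstacle_dist_bdd: "bdd_below ((\<lambda>z. np * norm (x - z) + nm * infdist z D) ` lower_closed)"
  using n by (intro bdd_belowI[of _ 0]) (auto simp: infdist_nonneg)

lemma lower_closed_nonempty: "lower_closed \<noteq> {}"
  using exI[of "\<lambda>z. z \<in> lower_closed" 0] by auto

lemma obstacle_dist_nonneg: "obstacle_dist np nm D x \<ge> 0"
  unfolding obstacle_dist_def by (rule cINF_greatest[OF lower_closed_nonempty]) (use n in \<open>simp add: infdist_nonneg\<close>)

lemma obstacle_dist_lipschitz: "obstacle_dist np nm D x \<le> obstacle_dist np nm D y + np * norm (x - y)"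
proof -
  have "obstacle_dist np nm D x - np * norm (x - y) \<le> obstacle_dist np nm D y"
    unfolding obstacle_dist_def[of np nm D y]
  proof (rule cINF_greatest[OF lower_closed_nonempty])
    fix z :: "real^3" assume z: "z \<in> lower_closed"
    have "obstacle_dist np nm D x \<le> np * norm (x - z) + nm * infdist z D"
      unfolding obstacle_dist_def by (rule cINF_lower[OF obstacle_dist_bdd z])
    moreover have "np * norm (x - z) \<le> np * (norm (x - y) + norm (y - z))"
      using n norm_triangle_ineq[of "x - y" "y - z"] by (intro mult_left_mono) auto
    ultimately show "obstacle_dist np nm D x - np * norm (x - y) \<le> np * norm (y - z) + nm * infdist z D"
      by (simp add: distrib_left)
  qed
  then show ?thesis by simp
qed

text \<open>The choice \<open>z = x\<close> is optimal: any other first leg costs at least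
  \<open>nm\<close> times its length, and the distance to \<open>D\<close> shrinks by at most that
  length.\<close>

lemma obstacle_dist_lower:
  assumes "x $ 3 \<le> 0"
  shows "obstacle_dist np nm D x = nm * infdist x D"
proof (rule antisym)
  show "obstacle_dist np nm D x \<le> nm * infdist x D"
    unfolding obstacle_dist_def by (rule cINF_lower2[OF obstacle_dist_bdd, of x]) (use assms in auto)
  show "nm * infdist x D \<le> obstacle_dist np nm D x"
    unfolding obstacle_dist_def
  proof (rule cINF_greatest[OF lower_closed_nonempty])
    fix z :: "real^3"
    have "nm * infdist x D \<le> nm * (infdist z D + norm (x - z))"
      using n infdist_triangle[of x D z] by (intro mult_left_mono) (auto simp: dist_norm)
    also have "\<dots> \<le> np * norm (x - z) + nm * infdist z D"
      using n mult_right_mono[of nm np "norm (x - z)"] by (simp add: distrib_left)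
    finally show "nm * infdist x D \<le> np * norm (x - z) + nm * infdist z D" .
  qed
qed

lemma obstacle_dist_lipschitz_lower:
  assumes "x $ 3 \<le> 0" "y $ 3 \<le> 0"
  shows "obstacle_dist np nm D x \<le> obstacle_dist np nm D y + nm * norm (x - y)"
  using mult_left_mono[OF infdist_triangle[of x D y], of nm] n
  by (simp add: obstacle_dist_lower assms dist_norm distrib_left)

text \<open>The leg from \<open>y\<close> to \<open>z\<close> meets the interface in a point
  \<open>p\<close>. Its part below the interface does not become dearer when travelled at slowness
  \<open>nm\<close>, so the path through \<open>p\<close> bounds the expression from below.\<close>

lemma obstacle_dist_ge:
  assumes y: "y $ 3 \<ge> 0" and l: "\<And>u z. u \<in> D \<Longrightarrow> z $ 3 = 0 \<Longrightarrow> l \<le> nm * norm (z - u) + np * norm (z - y)"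
  shows "l \<le> obstacle_dist np nm D y"
  unfolding obstacle_dist_def
proof (rule cINF_greatest[OF lower_closed_nonempty])
  fix z :: "real^3" assume z: "z \<in> lower_closed"
  have main: "l \<le> np * norm (y - z) + nm * norm (z - u)" if u: "u \<in> D" for u
  proof -
    \<comment> \<open>At \<open>y $ 3 = 0\<close> the crossing point is \<open>y\<close> itself; the
      quotient used otherwise would have denominator zero if \<open>z\<close> lay on the interface
      as well.\<close>
    have "\<exists>s. 0 \<le> s \<and> s \<le> 1 \<and> y $ 3 + s * (z $ 3 - y $ 3) = 0"
    proof (cases "y $ 3 = 0")
      case True
      then show ?thesis by (intro exI[of _ 0]) simp
    next
      case False
      then have "y $ 3 - z $ 3 > 0" using y z by simp
      then show ?thesis using y z by (intro exI[of _ "y $ 3 / (y $ 3 - z $ 3)"]) (auto simp: field_simps)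
    qed
    then obtain s where s: "0 \<le> s" "s \<le> 1" "y $ 3 + s * (z $ 3 - y $ 3) = 0" by blast
    define p where "p = y + s *\<^sub>R (z - y)"
    have "p $ 3 = 0" using s by (simp add: p_def)
    then have "l \<le> nm * norm (p - u) + np * norm (p - y)" by (rule l[OF u])
    also have "\<dots> \<le> nm * (norm (p - z) + norm (z - u)) + np * norm (p - y)"
      using n norm_triangle_ineq[of "p - z" "z - u"] by (intro add_right_mono mult_left_mono) auto
    also have "\<dots> \<le> np * norm (p - z) + nm * norm (z - u) + np * norm (p - y)"
      using n mult_right_mono[of nm np "norm (p - z)"] by (simp add: distrib_left)
    also have "\<dots> = np * (norm (p - z) + norm (p - y)) + nm * norm (z - u)" by (simp add: distrib_left)
    also have "norm (p - z) = (1 - s) * norm (y - z)"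
    proof -
      have "p - z = (1 - s) *\<^sub>R (y - z)" by (simp add: p_def algebra_simps)
      then show ?thesis using s by simp
    qed
    also have "norm (p - y) = s * norm (y - z)" using s by (simp add: p_def norm_minus_commute)
    finally show ?thesis by (simp add: algebra_simps)
  qed
  have "(l - np * norm (y - z)) / nm \<le> infdist z D"
    unfolding infdist_notempty[OF D]
  proof (rule cINF_greatest[OF D])
    fix u assume "u \<in> D"
    then show "(l - np * norm (y - z)) / nm \<le> dist z u" using main n by (simp add: dist_norm field_simps)
  qed
  then show "l \<le> np * norm (y - z) + nm * infdist z D" using n by (simp add: field_simps)
qed

end

section \<open>Exponential weights and the upper bound\<close>

lemma exp_diff_bound:
  fixes a b c s :: real
  assumes "\<bar>a - b\<bar> \<le> c" "s \<ge> 0"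
  shows "\<bar>exp (- (s * a)) - exp (- (s * b))\<bar> \<le> (exp (s * c) - 1) * exp (- (s * b))"
proof -
  have "\<bar>s * a - s * b\<bar> \<le> s * c" using mult_left_mono[OF assms] assms(2) by (simp add: abs_mult right_diff_distrib[symmetric])
  then have "exp (s * b - s * a) \<le> exp (s * c)" "exp (- (s * c)) \<le> exp (s * b - s * a)" by (auto simp: abs_le_iff)
  moreover have "1 - exp (- (s * c)) \<le> exp (s * c) - 1"
  proof -
    define t where "t = exp (s * c)"
    have t: "t > 0" by (simp add: t_def)
    have "2 \<le> t + inverse t" using sum_squares_bound[of t 1] t by (simp add: field_simps power2_eq_square)
    then show ?thesis by (simp add: t_def exp_minus)
  qed
  ultimately have "\<bar>exp (s * b - s * a) - 1\<bar> \<le> exp (s * c) - 1" by linarith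
  then have "\<bar>exp (s * b - s * a) - 1\<bar> * exp (- (s * b)) \<le> (exp (s * c) - 1) * exp (- (s * b))"
    by (rule mult_right_mono) simp
  moreover have "\<bar>exp (s * b - s * a) - 1\<bar> * exp (- (s * b)) = \<bar>(exp (s * b - s * a) - 1) * exp (- (s * b))\<bar>"
    by (simp add: abs_mult)
  moreover have "(exp (s * b - s * a) - 1) * exp (- (s * b)) = exp (- (s * a)) - exp (- (s * b))"
    by (simp add: left_diff_distrib exp_add[symmetric] exp_diff exp_minus field_simps)
  ultimately show ?thesis by simp
qed

text \<open>Mollification preserves one-sided local Lipschitz bounds, hence the eikonal inequality for weights.\<close>

lemma conv_exp_gradient_bound:
  fixes e :: "'a::euclidean_space \<Rightarrow> real"
  assumes \<rho>: "mollifier \<delta> \<rho>" and F: "locally_integrable (\<lambda>y. exp (- (s * e y)))" and s: "s \<ge> 0" and d: "d > 0"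
    and lip: "\<And>y h. norm (x - y) < \<delta> \<Longrightarrow> norm h < d \<Longrightarrow> \<bar>e (y + h) - e y\<bar> \<le> n * norm h"
    and n: "n \<ge> 0" and e: "\<And>y. e y \<ge> 0"
    and g: "GDERIV (conv \<rho> (\<lambda>y. exp (- (s * e y)))) x :> g"
  shows "norm g \<le> s * n * conv \<rho> (\<lambda>y. exp (- (s * e y))) x"
proof (cases "g = 0")
  case True
  have "0 \<le> conv \<rho> (\<lambda>y. exp (- (s * e y))) x" by (rule conv_ge[OF \<rho> F]) simp
  then show ?thesis using True s n by simp
next
  case False
  define F where "F y = exp (- (s * e y))" for y
  have lF: "locally_integrable F" using F by (simp add: F_def[abs_def])
  note t\<rho> = mollifierD(1)[OF \<rho>]
  \<comment> \<open>Only increments in the direction of the gradient matter, since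
    \<open>norm g = g \<bullet> b\<close>; a one-sided estimate of them is enough.\<close>
  define b where "b = g /\<^sub>R norm g"
  have b: "norm b = 1" using False by (simp add: b_def)
  have incr: "conv \<rho> F (x + t *\<^sub>R b) - conv \<rho> F x \<le> (exp (s * (n * t)) - 1) * conv \<rho> F x" if t: "0 < t" "t < d" for t
  proof -
    have Fs: "locally_integrable (\<lambda>y. F (y + t *\<^sub>R b))"
    proof (rule locally_integrable_bounded[of _ 1])
      show "(\<lambda>y. F (y + t *\<^sub>R b)) \<in> borel_measurable lebesgue"
        using measurable_lebesgue_comp_affine[of 1 F "t *\<^sub>R b"] locally_integrable_measurable[OF lF] by (simp add: add.commute)
    qed (use s e in \<open>simp add: F_def\<close>)
    have i1: "integrable lebesgue (\<lambda>y. \<rho> (x - y) *\<^sub>R F (y + t *\<^sub>R b))" by (rule integrable_conv[OF t\<rho> Fs])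
    have i2: "integrable lebesgue (\<lambda>y. \<rho> (x - y) *\<^sub>R F y)" by (rule integrable_conv[OF t\<rho> lF])
    have "(\<lambda>y. \<rho> (x + t *\<^sub>R b - y) *\<^sub>R F y) \<in> borel_measurable lebesgue"
      using integrable_conv[OF t\<rho> lF] by (rule borel_measurable_integrable)
    from integral_lebesgue_affine[OF _ this, of 1 "t *\<^sub>R b"]
    have "conv \<rho> F (x + t *\<^sub>R b) = (LINT y|lebesgue. \<rho> (x - y) *\<^sub>R F (y + t *\<^sub>R b))"
      by (simp add: conv_def add.commute)
    also have "\<dots> \<le> (LINT y|lebesgue. \<rho> (x - y) *\<^sub>R F y + (exp (s * (n * t)) - 1) * (\<rho> (x - y) *\<^sub>R F y))"
    proof (rule integral_mono[OF i1])
      show "integrable lebesgue (\<lambda>y. \<rho> (x - y) *\<^sub>R F y + (exp (s * (n * t)) - 1) * (\<rho> (x - y) *\<^sub>R F y))"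
        by (intro Bochner_Integration.integrable_add i2 integrable_mult_right)
      fix y
      show "\<rho> (x - y) *\<^sub>R F (y + t *\<^sub>R b) \<le> \<rho> (x - y) *\<^sub>R F y + (exp (s * (n * t)) - 1) * (\<rho> (x - y) *\<^sub>R F y)"
      proof (cases "norm (x - y) < \<delta>")
        case True
        have "\<bar>e (y + t *\<^sub>R b) - e y\<bar> \<le> n * t" using lip[OF True, of "t *\<^sub>R b"] t b by simp
        from exp_diff_bound[OF this s] have "F (y + t *\<^sub>R b) \<le> F y + (exp (s * (n * t)) - 1) * F y"
          by (simp add: F_def)
        from mult_left_mono[OF this mollifierD(2)[OF \<rho>, of "x - y"]] show ?thesis by (simp add: algebra_simps)
      next
        case False
        then show ?thesis using mollifierD(3)[OF \<rho>, of "x - y"] by simp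
      qed
    qed
    also have "\<dots> = conv \<rho> F x + (exp (s * (n * t)) - 1) * conv \<rho> F x"
      using i2 by (simp add: conv_def)
    finally show ?thesis by simp
  qed
  have lim1: "((\<lambda>t. (conv \<rho> F (x + t *\<^sub>R b) - conv \<rho> F x) / t) \<longlongrightarrow> g \<bullet> b) (at_right 0)"
    by (rule GDERIV_imp_directional) (use g in \<open>simp add: F_def[abs_def]\<close>)
  have "((\<lambda>t. exp (s * (n * t))) has_real_derivative s * n) (at 0)"
    by (auto intro!: derivative_eq_intros)
  then have "((\<lambda>t. (exp (s * (n * t)) - 1) / t) \<longlongrightarrow> s * n) (at_right 0)"
    unfolding DERIV_def by (simp add: filterlim_at_split)
  then have lim2: "((\<lambda>t. (exp (s * (n * t)) - 1) / t * conv \<rho> F x) \<longlongrightarrow> s * n * conv \<rho> F x) (at_right 0)"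
    by (intro tendsto_intros)
  have "g \<bullet> b \<le> s * n * conv \<rho> F x"
  proof (rule tendsto_le[OF _ lim2 lim1])
    have "\<forall>\<^sub>F t in at_right 0. t \<in> {0<..<d}" using d by (intro eventually_at_right_real)
    then show "\<forall>\<^sub>F t in at_right 0. (conv \<rho> F (x + t *\<^sub>R b) - conv \<rho> F x) / t \<le> (exp (s * (n * t)) - 1) / t * conv \<rho> F x"
    proof eventually_elim
      case (elim t)
      then show ?case using incr[of t] by (simp add: divide_right_mono)
    qed
  qed simp
  moreover have "g \<bullet> b = norm g" using False by (simp add: b_def power2_norm_eq_inner[symmetric] power2_eq_square)
  ultimately show ?thesis by (simp add: F_def[abs_def])
qed

lemma two_layer_measurable: "two_layer \<gamma>p \<gamma>m \<in> borel_measurable lebesgue"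
proof -
  have "open {x::real^3. x $ 3 > 0}" by (intro open_Collect_less continuous_intros)
  then have [measurable]: "{x::real^3. x $ 3 > 0} \<in> sets borel" by simp
  have "two_layer \<gamma>p \<gamma>m = (\<lambda>x. if x \<in> {x. x $ 3 > 0} then \<gamma>p else \<gamma>m)"
    by (auto simp: two_layer_def fun_eq_iff)
  also have "\<dots> \<in> borel_measurable borel" by measurable
  finally show ?thesis by (intro measurable_completion) simp
qed

lemma optical_dist_sets_le_closure:
  assumes \<gamma>: "\<gamma>p > 0" "\<gamma>m > 0" and u: "u \<in> closure D" "y \<in> closure B" and z: "z $ 3 = 0"
  shows "optical_dist_sets \<gamma>p \<gamma>m D B \<le> slow \<gamma>m * norm (z - u) + slow \<gamma>p * norm (z - y)"
proof -
  have 1: "optical_dist_sets \<gamma>p \<gamma>m D B \<le> slow \<gamma>m * norm (z - u') + slow \<gamma>p * norm (z - y)" if u': "u' \<in> D" for u'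
    by (rule continuous_ge_on_closure[OF _ u(2), of "\<lambda>y. slow \<gamma>m * norm (z - u') + slow \<gamma>p * norm (z - y)"])
      (auto intro!: continuous_intros optical_dist_sets_le[OF \<gamma> u' _ z])
  show ?thesis
    by (rule continuous_ge_on_closure[OF _ u(1), of "\<lambda>u. slow \<gamma>m * norm (z - u) + slow \<gamma>p * norm (z - y)"])
      (auto intro!: continuous_intros 1)
qed

lemma upper_bound:
  fixes f :: "real^3 \<Rightarrow> real"
  assumes \<gamma>: "\<gamma>p > 0" "\<gamma>m > 0" "\<gamma>p < \<gamma>m"
    and D: "D \<noteq> {}" "open D" "D \<subseteq> lower_half" and B: "B \<noteq> {}" "closure B \<subseteq> upper_half"
    and f: "square_integrable f" "AE x in lebesgue. x \<notin> closure B \<longrightarrow> f x = 0"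
  obtains C where "C > 0" "\<And>\<tau> v G. \<tau> \<ge> 2 \<Longrightarrow> wsol (two_layer \<gamma>p \<gamma>m) f \<tau> v G \<Longrightarrow>
      (LINT x|lebesgue. indicator D x * (norm (G x))\<^sup>2) \<le> C * \<tau>\<^sup>2 * exp (- 2 * \<tau> * optical_dist_sets \<gamma>p \<gamma>m D B)"
proof -
  define np where "np = slow \<gamma>p"
  define nm where "nm = slow \<gamma>m"
  define l where "l = optical_dist_sets \<gamma>p \<gamma>m D B"
  define E where "E = (LINT x|lebesgue. (f x)\<^sup>2)"
  define C where "C = exp (2 * l + 8 * np) / \<gamma>p * E + 1"
  have E0: "E \<ge> 0" by (simp add: E_def integral_nonneg_AE)
  have C: "C > 0" using E0 \<gamma> by (simp add: C_def add_nonneg_pos)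
  have n: "0 < nm" "nm \<le> np" using \<gamma> by (auto simp: nm_def np_def slow_def field_simps)
  have l0: "l \<ge> 0" unfolding l_def by (rule optical_dist_sets_nonneg[OF \<gamma>(1,2) D(1) B(1)])
  have "(LINT x|lebesgue. indicator D x * (norm (G x))\<^sup>2) \<le> C * \<tau>\<^sup>2 * exp (- 2 * \<tau> * l)"
    if \<tau>: "\<tau> \<ge> 2" and w: "wsol (two_layer \<gamma>p \<gamma>m) f \<tau> v G" for \<tau> v G
  proof -
    \<comment> \<open>On the scale \<open>1/\<tau>\<close> the weight changes by a bounded factor,
      so shifting and mollifying at this scale costs only constants.\<close>
    define \<eta> where "\<eta> = 1 / \<tau>"
    have \<eta>: "\<eta> > 0" using \<tau> by (simp add: \<eta>_def)
    \<comment> \<open>Staying below the critical exponent \<open>2 * \<tau>\<close> by 2 leaves the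
      margin 1 in the eikonal inequality of the weighted estimate, at the price of the factor
      \<open>exp (2 * l)\<close>.\<close>
    define s where "s = 2 * (\<tau> - 1)"
    have s: "s \<ge> 0" "s * \<eta> \<le> 2" using \<tau> by (auto simp: s_def \<eta>_def field_simps)
    define od where "od = obstacle_dist np nm D"
    define a where "a = \<eta> *\<^sub>R (axis 3 1 :: real^3)"
    have a3: "a $ 3 = \<eta>" and na: "norm a = \<eta>" using \<eta> by (auto simp: a_def norm_axis_1)
    \<comment> \<open>Evaluating the distance at \<open>y - a\<close> lifts the interface of the
      weight to height \<open>\<eta>\<close>. Below that height the Lipschitz constant is the
      smaller \<open>nm\<close>, so after mollification with radius \<open>\<eta> / 2\<close> it is
      still \<open>nm\<close> on the whole lower half-space.\<close>
    define e where "e y = min (od (y - a)) l" for y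
    have od_lip: "\<bar>od x - od y\<bar> \<le> np * norm (x - y)" for x y
      using obstacle_dist_lipschitz[OF n D(1), of x y] obstacle_dist_lipschitz[OF n D(1), of y x]
      by (simp add: od_def norm_minus_commute abs_le_iff)
    have od_lip_lower: "\<bar>od x - od y\<bar> \<le> nm * norm (x - y)" if "x $ 3 \<le> 0" "y $ 3 \<le> 0" for x y
      using obstacle_dist_lipschitz_lower[OF n D(1) that] obstacle_dist_lipschitz_lower[OF n D(1) that(2,1)]
      by (simp add: od_def norm_minus_commute abs_le_iff)
    have min_lip: "\<bar>min x l - min y l\<bar> \<le> \<bar>x - y\<bar>" for x y by (auto simp: min_def)
    have e_lip: "\<bar>e x - e y\<bar> \<le> np * norm (x - y)" for x y
      using order_trans[OF min_lip od_lip[of "x - a" "y - a"]] by (simp add: e_def)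
    have e_lip_lower: "\<bar>e x - e y\<bar> \<le> nm * norm (x - y)" if "x $ 3 \<le> \<eta>" "y $ 3 \<le> \<eta>" for x y
      using order_trans[OF min_lip od_lip_lower[of "x - a" "y - a"]] that a3 by (simp add: e_def)
    have e0: "e y \<ge> 0" for y unfolding e_def od_def using obstacle_dist_nonneg[OF n D(1)] l0 by simp
    have ec: "continuous_on UNIV e"
    proof (rule continuous_on_iff[THEN iffD2], intro ballI allI impI)
      fix x :: "real^3" and \<epsilon> :: real assume \<epsilon>: "\<epsilon> > 0"
      have "dist (e y) (e x) < \<epsilon>" if "dist y x < \<epsilon> / np" for y
      proof -
        have "np * norm (y - x) < \<epsilon>" using that n by (simp add: dist_norm field_simps)
        then show ?thesis using e_lip[of y x] by (simp add: dist_real_def)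
      qed
      then show "\<exists>d>0. \<forall>x'\<in>UNIV. dist x' x < d \<longrightarrow> dist (e x') (e x) < \<epsilon>"
        using \<epsilon> n by (intro exI[of _ "\<epsilon> / np"]) auto
    qed
    define F where "F y = exp (- (s * e y))" for y
    have Fc: "continuous_on UNIV F" unfolding F_def by (intro continuous_intros ec)
    have F01: "0 \<le> F y" "F y \<le> 1" for y using s e0[of y] by (auto simp: F_def)
    have lF: "locally_integrable F"
      by (rule locally_integrable_bounded[OF continuous_imp_lebesgue_measurable[OF Fc], of 1]) (use F01 in auto)
    obtain \<rho> :: "real^3 \<Rightarrow> real" where \<rho>: "mollifier (\<eta> / 2) \<rho>" using mollifier_exists[of "\<eta> / 2"] \<eta> by auto
    note t\<rho> = mollifierD(1)[OF \<rho>]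
    define W where "W = conv \<rho> F"
    have WCk: "Ck k W" for k unfolding W_def by (rule Ck_conv[OF t\<rho> lF])
    obtain h where h: "\<And>x. GDERIV W x :> h x" using WCk[of "Suc 0"] Ck_SucE by metis
    have W0: "0 \<le> W x" for x unfolding W_def by (rule conv_ge[OF \<rho> lF]) (rule F01)
    have W1: "W x \<le> 1" for x unfolding W_def by (rule conv_le[OF \<rho> lF]) (rule F01)
    have comp: "y $ 3 \<le> x $ 3 + norm (x - y)" for x y :: "real^3"
      using component_le_norm_cart[of "x - y" 3] by (simp add: abs_le_iff)
    have gb: "norm (h x) \<le> s * m * W x"
      if m: "m \<ge> 0" and lip: "\<And>y k. norm (x - y) < \<eta> / 2 \<Longrightarrow> norm k < \<eta> / 2 \<Longrightarrow> \<bar>e (y + k) - e y\<bar> \<le> m * norm k" for x m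
      using conv_exp_gradient_bound[OF \<rho> lF[unfolded F_def[abs_def]] s(1), of "\<eta> / 2" x m "h x"] \<eta> m lip h[of x] e0
      by (simp add: W_def F_def[abs_def])
    have gbp: "norm (h x) \<le> s * np * W x" for x
      using n e_lip[of "_ + _"] by (intro gb) (auto simp: add_diff_cancel_left' intro: order_trans[OF e_lip])
    have gbm: "norm (h x) \<le> s * nm * W x" if "x $ 3 \<le> 0" for x
    proof (rule gb)
      fix y k :: "real^3" assume "norm (x - y) < \<eta> / 2" "norm k < \<eta> / 2"
      then have "y $ 3 \<le> \<eta>" "(y + k) $ 3 \<le> \<eta>"
        using comp[of y x] comp[of x "y"] component_le_norm_cart[of k 3] that \<eta> by (auto simp: norm_minus_commute)
      then show "\<bar>e (y + k) - e y\<bar> \<le> nm * norm k" using e_lip_lower[of "y + k" y] by simp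
    qed (use n in simp)
    have eik: "sqrt (two_layer \<gamma>p \<gamma>m x) * norm (h x) \<le> 2 * (\<tau> - 1) * W x" for x
    proof (cases "x $ 3 > 0")
      case True
      have "sqrt \<gamma>p * norm (h x) \<le> sqrt \<gamma>p * (s * np * W x)" by (intro mult_left_mono gbp) (use \<gamma> in auto)
      also have "\<dots> = s * W x" using \<gamma> by (simp add: np_def slow_def)
      finally show ?thesis using True by (simp add: two_layer_def s_def)
    next
      case False
      have "sqrt \<gamma>m * norm (h x) \<le> sqrt \<gamma>m * (s * nm * W x)" by (intro mult_left_mono gbm) (use \<gamma> False in auto)
      also have "\<dots> = s * W x" using \<gamma> by (simp add: nm_def slow_def)
      finally show ?thesis using False by (simp add: two_layer_def s_def)
    qed
    have shift: "norm (y - a - x) \<le> 2 * \<eta>" if "norm (x - y) < \<eta> / 2" for x y :: "real^3"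
      using norm_triangle_ineq4[of "y - x" a] that na \<eta> by (simp add: norm_minus_commute algebra_simps)
    have seta: "s * (np * (2 * \<eta>)) \<le> 4 * np" using mult_left_mono[OF s(2), of "2 * np"] n by (simp add: mult_ac)
    \<comment> \<open>On \<open>D\<close> the distance is zero, and the shift and the mollification
      change it by at most \<open>np * (2 * \<eta>)\<close>; times \<open>s\<close> this is at most
      \<open>4 * np\<close>. The same loss occurs on the closure of \<open>B\<close> below.\<close>
    have wD: "exp (- (4 * np)) \<le> W x" if x: "x \<in> D" for x
      unfolding W_def
    proof (rule conv_ge[OF \<rho> lF])
      fix y assume y: "norm (x - y) < \<eta> / 2"
      have "x $ 3 \<le> 0" using D(3) x by (auto simp: lower_half_def)
      then have "od x = 0" unfolding od_def by (simp add: obstacle_dist_lower[OF n D(1)] x)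
      then have "od (y - a) \<le> np * norm (y - a - x)" using od_lip[of "y - a" x] by simp
      also have "\<dots> \<le> np * (2 * \<eta>)" using n by (intro mult_left_mono shift y) auto
      finally have "e y \<le> np * (2 * \<eta>)" by (simp add: e_def)
      from mult_left_mono[OF this s(1)] have "s * e y \<le> 4 * np" using seta by linarith
      then show "exp (- (4 * np)) \<le> F y" by (simp add: F_def)
    qed
    have wB: "W x \<le> exp (2 * l + 4 * np) * exp (- 2 * \<tau> * l)" if x: "x \<in> closure B" for x
      unfolding W_def
    proof (rule conv_le[OF \<rho> lF])
      fix y assume y: "norm (x - y) < \<eta> / 2"
      have x3: "x $ 3 \<ge> 0" using B(2) x by (auto simp: upper_half_def)
      have "l \<le> nm * norm (z - u) + np * norm (z - x)" if "u \<in> D" "z $ 3 = 0" for u z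
        unfolding l_def nm_def np_def
        by (rule optical_dist_sets_le_closure[OF \<gamma>(1,2) _ x that(2)]) (use that closure_subset in auto)
      then have "l \<le> od x" unfolding od_def by (intro obstacle_dist_ge[OF n D(1) x3])
      moreover have "od x - od (y - a) \<le> np * (2 * \<eta>)"
      proof -
        have "od x - od (y - a) \<le> np * norm (y - a - x)" using od_lip[of x "y - a"] by (simp add: norm_minus_commute)
        also have "\<dots> \<le> np * (2 * \<eta>)" using n by (intro mult_left_mono shift y) auto
        finally show ?thesis .
      qed
      ultimately have "l - np * (2 * \<eta>) \<le> od (y - a)" by linarith
      then have "l - np * (2 * \<eta>) \<le> e y" using n \<eta> by (simp add: e_def)
      from mult_left_mono[OF this s(1)] have "s * l - 4 * np \<le> s * e y" using seta unfolding right_diff_distrib by linarith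
      then have "- (s * e y) \<le> (2 * l + 4 * np) + (- 2 * \<tau> * l)" by (simp add: s_def algebra_simps)
      then show "F y \<le> exp (2 * l + 4 * np) * exp (- 2 * \<tau> * l)" by (simp add: F_def exp_add[symmetric])
    qed
    have snp: "s * np \<ge> 0" using s n by simp
    have "(LINT x|lebesgue. indicator D x * (norm (G x))\<^sup>2)
        \<le> (exp (2 * l + 4 * np) * exp (- 2 * \<tau> * l)) / (exp (- (4 * np)) * \<gamma>p * 1 * \<tau>) * (LINT x|lebesgue. (f x)\<^sup>2)"
    proof (rule wsol_weighted_energy[OF w _ f(1) two_layer_measurable, where \<Gamma>=\<gamma>m and W=W and h=h and M="1 + s * np" and B="closure B"])
      show "norm (h x) \<le> 1 + s * np" for x
        using gbp[of x] mult_left_mono[OF W1[of x] snp] by simp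
      show "W x \<le> 1 + s * np" for x using W1[of x] snp by linarith
      show "D \<in> sets lebesgue" using D(2) by auto
    qed (use \<tau> \<gamma> eik WCk h W0 wD wB f(2) in \<open>auto simp: two_layer_def\<close>)
    also have "\<dots> = (exp (2 * l + 4 * np) * exp (4 * np) / \<gamma>p * E) * exp (- 2 * \<tau> * l) / \<tau>"
      by (simp add: E_def exp_minus field_simps)
    also have "exp (2 * l + 4 * np) * exp (4 * np) = exp (2 * l + 8 * np)" by (simp add: exp_add[symmetric])
    \<comment> \<open>The weighted estimate yields the factor \<open>1/\<tau>\<close>, which is
      coarsened to 1 here and to \<open>\<tau>\<^sup>2\<close> in the next step.\<close>
    also have "(exp (2 * l + 8 * np) / \<gamma>p * E) * exp (- 2 * \<tau> * l) / \<tau> \<le> C * exp (- 2 * \<tau> * l) / 1"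
      using \<tau> \<gamma> E0 by (intro frac_le mult_right_mono) (auto simp: C_def)
    also have "\<dots> \<le> C * \<tau>\<^sup>2 * exp (- 2 * \<tau> * l)"
      using \<tau> C one_le_power[of \<tau> 2] by simp
    finally show ?thesis .
  qed
  then show ?thesis using that[OF C] unfolding l_def by blast
qed

section \<open>Geometry of the shortest optical path\<close>

lemma norm_add_eq_imp_parallel:
  fixes a b :: "'a::euclidean_space"
  assumes "norm (a + b) = norm a + norm b"
  shows "norm a *\<^sub>R b = norm b *\<^sub>R a"
  using assms norm_triangle_eq by metis

text \<open>The second derivatives are continuous, hence bounded on the unit ball around
  \<open>x0\<close>; the components of the gradient are Lipschitz there and their constants are
  summed.\<close>

lemma C2_gradient_lipschitz:
  fixes h :: "'a::euclidean_space \<Rightarrow> real"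
  assumes "Ck 2 h"
  obtains g K where "\<And>x. GDERIV h x :> g x" "K \<ge> 0" "\<And>x. x \<in> cball x0 1 \<Longrightarrow> norm (g x - g x0) \<le> K * norm (x - x0)"
proof -
  obtain g where g: "\<And>x. GDERIV h x :> g x" "\<And>b. b \<in> Basis \<Longrightarrow> Ck (Suc 0) (\<lambda>x. g x \<bullet> b)"
    using assms Ck_SucE[of "Suc 0" h] unfolding numeral_2_eq_2 by metis
  have "\<exists>M\<ge>0. \<forall>x\<in>cball x0 1. \<bar>(g x - g x0) \<bullet> b\<bar> \<le> M * norm (x - x0)" if b: "b \<in> Basis" for b
  proof -
    obtain G where G: "\<And>x. GDERIV (\<lambda>x. g x \<bullet> b) x :> G x" using Ck_SucE[OF g(2)[OF b]] by metis
    have "continuous_on UNIV G" by (rule lebesgue_measurable_gradient[OF G g(2)[OF b]])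
    then have "compact (G ` cball x0 1)" using continuous_on_subset by (intro compact_continuous_image) auto
    then obtain M where M: "M > 0" "\<forall>y\<in>G ` cball x0 1. norm y \<le> M" using compact_imp_bounded bounded_pos by metis
    have "\<bar>g x \<bullet> b - g x0 \<bullet> b\<bar> \<le> M * norm (x - x0)" if "x \<in> cball x0 1" for x
      by (rule gderiv_lipschitz[of "cball x0 1" _ G]) (use G M that in auto)
    then show ?thesis using M by (intro exI[of _ M]) (auto simp: inner_diff_left)
  qed
  then obtain M where M: "\<And>b. b \<in> Basis \<Longrightarrow> M b \<ge> 0"
    "\<And>b x. b \<in> Basis \<Longrightarrow> x \<in> cball x0 1 \<Longrightarrow> \<bar>(g x - g x0) \<bullet> b\<bar> \<le> M b * norm (x - x0)" by metis
  have "norm (g x - g x0) \<le> (\<Sum>b\<in>Basis. M b) * norm (x - x0)" if "x \<in> cball x0 1" for x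
    unfolding sum_distrib_right by (rule norm_le_sum_Basis_bound) (use M(2) that in auto)
  moreover have "(\<Sum>b\<in>Basis. M b) \<ge> 0" using M(1) by (rule sum_nonneg)
  ultimately show ?thesis using that g(1) by blast
qed

text \<open>For \<open>d = x - p\<close> Taylor gives
  \<open>A x \<ge> d \<bullet> w - K * (norm d)\<^sup>2\<close>, with \<open>w\<close> an inner
  normal. In a ball of radius \<open>\<rho>\<close> touching the tangent plane at \<open>p\<close>
  one has \<open>(norm d)\<^sup>2 < 2 * \<rho> * (d \<bullet> \<nu>)\<close>, so the linear term
  wins as soon as \<open>2 * \<rho> * (K + 1) \<le> 1\<close>.\<close>

lemma C2_boundary_interior_ball:
  fixes D :: "(real^3) set"
  assumes D: "open D" "C2_boundary D" and p: "p \<in> frontier D"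
  obtains \<nu> \<rho> where "norm \<nu> = 1" "\<rho> > 0" "ball (p + \<rho> *\<^sub>R \<nu>) \<rho> \<subseteq> D"
proof -
  obtain r and T :: "real^3 \<Rightarrow> real^3" and h :: "real^2 \<Rightarrow> real" where r: "r > 0" and T: "orthogonal_transformation T" and h: "Ck 2 h"
    and Dr: "D \<inter> ball p r = {x \<in> ball p r. T x $ 3 > h (vector [T x $ 1, T x $ 2])}"
    using D(2) p unfolding C2_boundary_def by blast
  define \<pi> :: "real^3 \<Rightarrow> real^2" where "\<pi> x = vector [T x $ 1, T x $ 2]" for x
  have lin: "linear T" using T by (rule orthogonal_transformation_linear)
  have \<pi>_add: "\<pi> (x + y) = \<pi> x + \<pi> y" for x y
    by (simp add: \<pi>_def vec_eq_iff forall_2 linear_add[OF lin])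
  have Tc: "continuous_on S T" for S using lin by (rule linear_continuous_on[OF linear_conv_bounded_linear[THEN iffD1]])
  have \<pi>c: "continuous_on S \<pi>" for S
  proof -
    have "linear \<pi>"
      by (rule linearI) (simp_all add: \<pi>_def vec_eq_iff forall_2 linear_add[OF lin] linear_scale[OF lin])
    then show ?thesis by (rule linear_continuous_on[OF linear_conv_bounded_linear[THEN iffD1]])
  qed
  have \<pi>_norm: "norm (\<pi> d) \<le> norm d" for d
  proof -
    have "(norm (\<pi> d))\<^sup>2 \<le> (norm (T d))\<^sup>2"
      unfolding power2_norm_eq_inner by (simp add: \<pi>_def inner_vec_def sum_2 sum_3)
    then have "norm (\<pi> d) \<le> norm (T d)" by (rule power2_le_imp_le) simp
    then show ?thesis using T by (simp add: orthogonal_transformation_norm)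
  qed
  define A where "A x = T x $ 3 - h (\<pi> x)" for x
  have hc: "continuous_on UNIV h" by (rule Ck_continuous[OF h])
  have Ac: "continuous_on UNIV A"
    unfolding A_def by (intro continuous_intros Tc continuous_on_compose2[OF hc \<pi>c]) auto
  have DA: "x \<in> D \<longleftrightarrow> A x > 0" if "x \<in> ball p r" for x
    using Dr that by (auto simp: A_def \<pi>_def set_eq_iff)
  have pD: "p \<in> closure D" "p \<notin> D" using p D(1) by (auto simp: frontier_def interior_open)
  have "A p \<le> 0" using DA[of p] pD r by simp
  \<comment> \<open>Were \<open>A p\<close> negative, then so would be \<open>A\<close> near
    \<open>p\<close>, and the graph condition would exclude points of \<open>D\<close> there,
    although \<open>p\<close> is in the closure.\<close>
  moreover have "A p \<ge> 0"
  proof (rule ccontr)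
    assume "\<not> A p \<ge> 0"
    moreover have "open {x. A x < 0}" by (intro open_Collect_less Ac continuous_intros)
    ultimately have "open ({x. A x < 0} \<inter> ball p r)" "p \<in> {x. A x < 0} \<inter> ball p r" using r by auto
    then have "({x. A x < 0} \<inter> ball p r) \<inter> D \<noteq> {}" using pD(1) open_Int_closure_eq_empty by blast
    then obtain x where "x \<in> D" "A x < 0" "x \<in> ball p r" by auto
    then show False using DA[of x] by simp
  qed
  ultimately have Ap: "A p = 0" by simp
  obtain g K where g: "\<And>x. GDERIV h x :> g x" and K: "K \<ge> 0" "\<And>x. x \<in> cball (\<pi> p) 1 \<Longrightarrow> norm (g x - g (\<pi> p)) \<le> K * norm (x - \<pi> p)"
    using C2_gradient_lipschitz[OF h] by metis
  \<comment> \<open>In the rotated coordinates this is the normal of the graph, with third component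
    one; \<open>w\<close> is its preimage under \<open>T\<close>, which gives
    \<open>norm w \<ge> 1\<close>.\<close>
  define m :: "real^3" where "m = vector [- g (\<pi> p) $ 1, - g (\<pi> p) $ 2, 1]"
  obtain w where w: "T w = m" using orthogonal_transformation_surj[OF T] by (metis surjD)
  have "norm w = norm m" using T w orthogonal_transformation_norm by metis
  then have w1: "norm w \<ge> 1" using component_le_norm_cart[of m 3] by (simp add: m_def)
  have N: "T d $ 3 - \<pi> d \<bullet> g (\<pi> p) = d \<bullet> w" for d
  proof -
    have "d \<bullet> w = T d \<bullet> T w" using T by (simp add: orthogonal_transformation_def)
    then show ?thesis unfolding w by (simp add: m_def \<pi>_def inner_vec_def sum_2 sum_3)
  qed
  define \<nu> where "\<nu> = w /\<^sub>R norm w"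
  \<comment> \<open>The first two bounds keep the ball inside the graph neighbourhood and inside the
    unit ball of the Taylor estimate.\<close>
  define \<rho> where "\<rho> = min (min (r / 2) (1 / 2)) (1 / (2 * (K + 1)))"
  have \<rho>: "\<rho> > 0" "2 * \<rho> \<le> r" "2 * \<rho> \<le> 1" using r K by (auto simp: \<rho>_def)
  have \<rho>K: "2 * \<rho> * (K + 1) \<le> 1"
  proof -
    have "\<rho> \<le> 1 / (2 * (K + 1))" by (simp add: \<rho>_def)
    then show ?thesis using K(1) by (simp add: field_simps)
  qed
  have w0: "w \<noteq> 0" using w1 by auto
  have \<nu>: "norm \<nu> = 1" using w0 by (simp add: \<nu>_def)
  have "x \<in> D" if x: "x \<in> ball (p + \<rho> *\<^sub>R \<nu>) \<rho>" for x
  proof -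
    define d where "d = x - p"
    have "norm (d - \<rho> *\<^sub>R \<nu>) < \<rho>" using x by (simp add: d_def dist_norm norm_minus_commute algebra_simps)
    then have "(norm (d - \<rho> *\<^sub>R \<nu>))\<^sup>2 < \<rho>\<^sup>2" by (intro power_strict_mono) auto
    moreover have "(norm (d - \<rho> *\<^sub>R \<nu>))\<^sup>2 = (norm d)\<^sup>2 - 2 * \<rho> * (d \<bullet> \<nu>) + \<rho>\<^sup>2 * (norm \<nu>)\<^sup>2"
      unfolding power2_norm_eq_inner by (simp add: inner_diff inner_commute power2_eq_square algebra_simps)
    ultimately have d1: "(norm d)\<^sup>2 < 2 * \<rho> * (d \<bullet> \<nu>)" using \<nu> by simp
    have "norm d < 2 * \<rho>"
    proof -
      have "norm d \<le> norm (d - \<rho> *\<^sub>R \<nu>) + norm (\<rho> *\<^sub>R \<nu>)" using norm_triangle_ineq[of "d - \<rho> *\<^sub>R \<nu>" "\<rho> *\<^sub>R \<nu>"] by simp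
      then show ?thesis using \<open>norm (d - \<rho> *\<^sub>R \<nu>) < \<rho>\<close> \<nu> \<rho>(1) by simp
    qed
    then have dr: "norm d < r" "norm d < 1" using \<rho> by auto
    have dv: "d \<bullet> \<nu> > 0"
    proof -
      have "0 < 2 * \<rho> * (d \<bullet> \<nu>)" using d1 zero_le_power2[of "norm d"] by linarith
      then show ?thesis using \<rho>(1) by (simp add: zero_less_mult_iff)
    qed
    have "\<bar>h (\<pi> p + \<pi> d) - h (\<pi> p) - \<pi> d \<bullet> g (\<pi> p)\<bar> \<le> K * (norm (\<pi> d))\<^sup>2"
    proof (rule gderiv_taylor_bound[of "cball (\<pi> p) 1"])
      show "\<pi> p + \<pi> d \<in> cball (\<pi> p) 1" using \<pi>_norm[of d] dr by (simp add: dist_norm)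
    qed (use g K in auto)
    also have "K * (norm (\<pi> d))\<^sup>2 \<le> K * (norm d)\<^sup>2" using K \<pi>_norm[of d] by (intro mult_left_mono power_mono) auto
    finally have hb: "h (\<pi> p + \<pi> d) \<le> h (\<pi> p) + \<pi> d \<bullet> g (\<pi> p) + K * (norm d)\<^sup>2" by linarith
    have xd: "x = p + d" by (simp add: d_def)
    have "A x = T p $ 3 + T d $ 3 - h (\<pi> p + \<pi> d)" unfolding A_def xd \<pi>_add by (simp add: linear_add[OF lin])
    also have "\<dots> \<ge> A p + d \<bullet> w - K * (norm d)\<^sup>2" using hb N[of d] by (simp add: A_def)
    finally have "A x \<ge> d \<bullet> w - K * (norm d)\<^sup>2" using Ap by simp
    moreover have "d \<bullet> w = norm w * (d \<bullet> \<nu>)" using w0 by (simp add: \<nu>_def)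
    moreover have "norm w * (d \<bullet> \<nu>) \<ge> 1 * (d \<bullet> \<nu>)" using w1 dv by (intro mult_right_mono) auto
    moreover have "K * (norm d)\<^sup>2 < d \<bullet> \<nu>"
    proof -
      have "K * (norm d)\<^sup>2 \<le> (K + 1) * (norm d)\<^sup>2" by (intro mult_right_mono) auto
      also have "\<dots> < (K + 1) * (2 * \<rho> * (d \<bullet> \<nu>))" using d1 K by (intro mult_strict_left_mono) auto
      also have "\<dots> = (2 * \<rho> * (K + 1)) * (d \<bullet> \<nu>)" by simp
      also have "\<dots> \<le> 1 * (d \<bullet> \<nu>)" using \<rho>K dv by (intro mult_right_mono) auto
      finally show ?thesis by simp
    qed
    ultimately have "A x > 0" by linarith
    moreover have "x \<in> ball p r" using dr by (simp add: xd dist_norm)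
    ultimately show "x \<in> D" using DA by blast
  qed
  then show ?thesis using that[OF \<nu> \<rho>(1)] by blast
qed

text \<open>The infimum over the open sets becomes a minimum over their closures. A near-optimal
  path has bounded length, which confines the crossing point \<open>z\<close> to the compact set
  \<open>S\<close>; \<open>ge\<close> ensures that the closures allow nothing shorter.\<close>

lemma optical_dist_sets_attained:
  fixes D :: "(real^3) set"
  assumes \<gamma>: "\<gamma>p > 0" "\<gamma>m > 0" and D: "D \<noteq> {}" "bounded D" and B: "B \<noteq> {}" "bounded B"
    and ge: "\<And>u y z. u \<in> closure D \<Longrightarrow> y \<in> closure B \<Longrightarrow> z $ 3 = 0 \<Longrightarrow>
      optical_dist_sets \<gamma>p \<gamma>m D B \<le> slow \<gamma>m * norm (z - u) + slow \<gamma>p * norm (z - y)"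
  obtains u y z where "u \<in> closure D" "y \<in> closure B" "z $ 3 = 0"
    "slow \<gamma>m * norm (z - u) + slow \<gamma>p * norm (z - y) = optical_dist_sets \<gamma>p \<gamma>m D B"
proof -
  define l where "l = optical_dist_sets \<gamma>p \<gamma>m D B"
  define J :: "(real^3) \<times> (real^3) \<times> (real^3) \<Rightarrow> real" where "J = (\<lambda>(u, y, z). slow \<gamma>m * norm (z - u) + slow \<gamma>p * norm (z - y))"
  have n: "slow \<gamma>m > 0" "slow \<gamma>p > 0" using \<gamma> by (auto simp: slow_def)
  have nn: "optical_length \<gamma>p \<gamma>m a b z' \<ge> 0" for a b z'
    using \<gamma> by (simp add: optical_length_def Let_def)
  have bd: "bdd_below (range (optical_length \<gamma>p \<gamma>m a b))" for a b using nn by (intro bdd_belowI[of _ 0]) auto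
  have nn2: "optical_dist \<gamma>p \<gamma>m a b \<ge> 0" for a b
    unfolding optical_dist_def by (rule cINF_greatest) (use nn in auto)
  have near: "\<exists>u\<in>D. \<exists>y\<in>B. \<exists>z. z $ 3 = 0 \<and> J (u, y, z) < l + e" if e: "e > 0" for e
  proof -
    have "(INF (x, y)\<in>D \<times> B. optical_dist \<gamma>p \<gamma>m x y) < l + e"
      using e by (simp add: l_def optical_dist_sets_def)
    then obtain u y where u: "u \<in> D" "y \<in> B" and "optical_dist \<gamma>p \<gamma>m u y < l + e"
      by (subst (asm) cINF_less_iff) (use D B nn2 in \<open>auto intro!: bdd_belowI[of _ 0]\<close>)
    then obtain z' where z': "optical_length \<gamma>p \<gamma>m u y z' < l + e"
      unfolding optical_dist_def by (subst (asm) cINF_less_iff) (use bd in auto)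
    define z :: "real^3" where "z = vector [z' $ 1, z' $ 2, 0]"
    have "z $ 3 = 0" "J (u, y, z) < l + e" using z' by (auto simp: z_def J_def optical_length_def Let_def slow_def)
    then show ?thesis using u by blast
  qed
  obtain R where R: "\<And>u. u \<in> D \<Longrightarrow> norm u \<le> R" using D(2) by (auto simp: bounded_iff)
  define S where "S = cball (0::real^3) (R + (l + 1) / slow \<gamma>m) \<inter> {z. z $ 3 = 0}"
  have "closed {z::real^3. z $ 3 = 0}" by (intro closed_Collect_eq continuous_intros)
  then have S: "compact S" unfolding S_def by (intro compact_Int_closed) auto
  have K: "compact (closure D \<times> closure B \<times> S)"
    using D B S by (intro compact_Times) (auto simp: compact_closure)
  have in_S: "z \<in> S" if "u \<in> D" "z $ 3 = 0" "J (u, y, z) < l + 1" for u y z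
  proof -
    have "0 \<le> slow \<gamma>p * norm (z - y)" using n by simp
    moreover have "slow \<gamma>m * norm (z - u) + slow \<gamma>p * norm (z - y) < l + 1" using that(3) by (simp add: J_def)
    ultimately have "slow \<gamma>m * norm (z - u) \<le> l + 1" by linarith
    then have "norm (z - u) \<le> (l + 1) / slow \<gamma>m" using n by (simp add: field_simps)
    then show ?thesis using R[OF that(1)] norm_triangle_ineq[of "z - u" u] that(2) by (simp add: S_def)
  qed
  have Jc: "continuous_on (closure D \<times> closure B \<times> S) J"
    unfolding J_def case_prod_beta by (intro continuous_intros)
  obtain u1 y1 z1 where 1: "u1 \<in> D" "y1 \<in> B" "z1 $ 3 = 0" "J (u1, y1, z1) < l + 1" using near[of 1] by auto
  have ne: "closure D \<times> closure B \<times> S \<noteq> {}"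
    using 1 in_S[OF 1(1,3,4)] closure_subset[of D] closure_subset[of B] by blast
  obtain m where m: "m \<in> closure D \<times> closure B \<times> S" "\<And>x. x \<in> closure D \<times> closure B \<times> S \<Longrightarrow> J m \<le> J x"
    using continuous_attains_inf[OF K ne Jc] by blast
  obtain u y z where uyz: "m = (u, y, z)" by (cases m)
  have "J m \<le> l"
  proof (rule field_le_epsilon)
    fix e :: real assume "e > 0"
    then obtain u' y' z' where *: "u' \<in> D" "y' \<in> B" "z' $ 3 = 0" "J (u', y', z') < l + min e 1" using near[of "min e 1"] by auto
    then have "J (u', y', z') < l + 1" "J (u', y', z') < l + e" by linarith+
    moreover have "J m \<le> J (u', y', z')"
      using in_S[OF *(1,3) \<open>J (u', y', z') < l + 1\<close>] * closure_subset[of D] closure_subset[of B]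
      by (intro m(2)) auto
    ultimately show "J m \<le> l + e" by linarith
  qed
  moreover have "z $ 3 = 0" "u \<in> closure D" "y \<in> closure B" using m(1) uyz by (auto simp: S_def)
  moreover then have "l \<le> J m" using ge[of u y z] by (simp add: J_def uyz l_def)
  ultimately show ?thesis using that[of u y z] by (simp add: J_def uyz l_def)
qed

text \<open>At the optimum \<open>p\<close> is a point of the closure of \<open>D\<close> nearest to
  \<open>z\<close>, and \<open>y\<close> one of the closure of \<open>B\<close>. Equality in a
  triangle inequality then puts the centre of an interior ball at \<open>p\<close> on the ray from
  \<open>z\<close> through \<open>p\<close>, and the centre \<open>c\<close> on the ray from
  \<open>z\<close> through \<open>y\<close>.\<close>

lemma shortest_path:
  fixes D :: "(real^3) set"
  assumes \<gamma>: "\<gamma>p > 0" "\<gamma>m > 0" and D: "D \<noteq> {}" "bounded D" "open D" "C2_boundary D" "closure D \<subseteq> lower_half"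
    and B: "r > 0" "B = ball c r" "closure B \<subseteq> upper_half"
    and ge: "\<And>u y z. u \<in> closure D \<Longrightarrow> y \<in> closure B \<Longrightarrow> z $ 3 = 0 \<Longrightarrow>
      optical_dist_sets \<gamma>p \<gamma>m D B \<le> slow \<gamma>m * norm (z - u) + slow \<gamma>p * norm (z - y)"
  obtains p y z \<rho> where "p $ 3 < 0" "y $ 3 > 0" "z $ 3 = 0"
    "slow \<gamma>m * norm (z - p) + slow \<gamma>p * norm (z - y) = optical_dist_sets \<gamma>p \<gamma>m D B"
    "\<forall>z'. z' $ 3 = 0 \<longrightarrow> slow \<gamma>m * norm (z - p) + slow \<gamma>p * norm (z - y) \<le> slow \<gamma>m * norm (z' - p) + slow \<gamma>p * norm (z' - y)"
    "\<rho> > 0" "ball (p + (\<rho> / norm (p - z)) *\<^sub>R (p - z)) \<rho> \<subseteq> D"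
    "c = y + (r / norm (y - z)) *\<^sub>R (y - z)"
proof -
  let ?l = "optical_dist_sets \<gamma>p \<gamma>m D B"
  have n: "slow \<gamma>m > 0" "slow \<gamma>p > 0" using \<gamma> by (auto simp: slow_def)
  have cB: "closure B = cball c r" using B by simp
  obtain p y z where p: "p \<in> closure D" and y: "y \<in> closure B" and z: "z $ 3 = 0"
    and eq: "slow \<gamma>m * norm (z - p) + slow \<gamma>p * norm (z - y) = ?l"
    by (rule optical_dist_sets_attained[OF \<gamma> D(1,2) _ _ ge]) (use B in auto)
  have p3: "p $ 3 < 0" and y3: "y $ 3 > 0" using p y D(5) B(3) by (auto simp: lower_half_def upper_half_def)
  have pz: "p \<noteq> z" "y \<noteq> z" using p3 y3 z by auto
  define d where "d = norm (p - z)"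
  have d: "d > 0" using pz by (simp add: d_def)
  have far: "d \<le> norm (u - z)" if "u \<in> closure D" for u
  proof -
    have "slow \<gamma>m * norm (z - p) \<le> slow \<gamma>m * norm (z - u)" using ge[OF that y z] eq by linarith
    then show ?thesis using n by (simp add: d_def norm_minus_commute)
  qed
  \<comment> \<open>Otherwise a small step from \<open>p\<close> towards \<open>z\<close> would stay
    in \<open>D\<close> and shorten the path.\<close>
  have "p \<notin> D"
  proof
    assume "p \<in> D"
    then obtain e where e: "e > 0" "ball p e \<subseteq> D" using D(3) open_contains_ball by blast
    define s where "s = min (1 / 2) (e / (2 * d))"
    have s: "s > 0" "s \<le> 1 / 2" "s * d < e" using e d by (auto simp: s_def min_def field_simps)
    define u where "u = p + s *\<^sub>R (z - p)"
    have "u \<in> ball p e" using s by (simp add: u_def dist_norm d_def norm_minus_commute)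
    then have "u \<in> closure D" using e closure_subset by blast
    moreover have "norm (u - z) = (1 - s) * d"
    proof -
      have "u - z = (1 - s) *\<^sub>R (p - z)" by (simp add: u_def algebra_simps)
      then show ?thesis using s by (simp add: d_def)
    qed
    ultimately have "d \<le> (1 - s) * d" using far by metis
    moreover have "s * d > 0" using s d by simp
    ultimately show False by (simp add: left_diff_distrib)
  qed
  then have "p \<in> frontier D" using p D(3) by (simp add: frontier_def interior_open)
  then obtain \<nu> \<rho> where \<nu>: "norm \<nu> = 1" and \<rho>: "\<rho> > 0" "ball (p + \<rho> *\<^sub>R \<nu>) \<rho> \<subseteq> D"
    using C2_boundary_interior_ball[OF D(3,4)] by metis
  define q where "q = p + \<rho> *\<^sub>R \<nu>"
  \<comment> \<open>If the centre were closer, the point of the segment from \<open>q\<close> to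
    \<open>z\<close> at the fraction \<open>\<rho> / (\<rho> + d)\<close> would lie in the interior
    ball and be nearer to \<open>z\<close> than \<open>p\<close>.\<close>
  have "norm (q - z) \<ge> \<rho> + d"
  proof (rule ccontr)
    assume "\<not> norm (q - z) \<ge> \<rho> + d"
    then have L: "norm (q - z) < \<rho> + d" by simp
    define t where "t = \<rho> / (\<rho> + d)"
    have t: "0 \<le> t" "t \<le> 1" "1 - t = d / (\<rho> + d)" using \<rho> d by (auto simp: t_def field_simps)
    define x where "x = q + t *\<^sub>R (z - q)"
    have "dist q x = t * norm (q - z)" using t by (simp add: x_def dist_norm norm_minus_commute)
    also have "\<dots> < \<rho>" using mult_strict_left_mono[OF L \<rho>(1)] \<rho>(1) d by (simp add: t_def field_simps)
    finally have "x \<in> D" using \<rho>(2) by (auto simp: q_def)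
    have "x - z = (1 - t) *\<^sub>R (q - z)" by (simp add: x_def algebra_simps)
    then have "norm (x - z) = (1 - t) * norm (q - z)" using t(1,2) by simp
    also have "\<dots> < d" unfolding t(3) using mult_strict_left_mono[OF L d] \<rho>(1) d by (simp add: field_simps)
    finally show False using far[of x] \<open>x \<in> D\<close> closure_subset by force
  qed
  moreover have "norm ((q - p) + (p - z)) \<le> norm (q - p) + norm (p - z)" by (rule norm_triangle_ineq)
  moreover have qp: "norm (q - p) = \<rho>" using \<nu> \<rho> by (simp add: q_def)
  ultimately have "norm ((q - p) + (p - z)) = norm (q - p) + norm (p - z)" by (simp add: d_def)
  from norm_add_eq_imp_parallel[OF this] have "\<rho> *\<^sub>R (p - z) = d *\<^sub>R (\<rho> *\<^sub>R \<nu>)" using qp by (simp add: d_def q_def)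
  then have "(1 / d) *\<^sub>R (\<rho> *\<^sub>R (p - z)) = (1 / d) *\<^sub>R (d *\<^sub>R (\<rho> *\<^sub>R \<nu>))" by simp
  then have "(\<rho> / norm (p - z)) *\<^sub>R (p - z) = \<rho> *\<^sub>R \<nu>" using d by (simp add: d_def)
  then have ball: "ball (p + (\<rho> / norm (p - z)) *\<^sub>R (p - z)) \<rho> \<subseteq> D" using \<rho>(2) by simp
  have cz: "norm (c - z) > r"
  proof (rule ccontr)
    assume "\<not> norm (c - z) > r"
    then have "z \<in> closure B" by (simp add: cB dist_norm)
    then show False using B(3) z by (auto simp: upper_half_def)
  qed
  have cz0: "c \<noteq> z" using cz B(1) by auto
  \<comment> \<open>The point of the closed ball nearest to \<open>z\<close>, against which the
    optimal \<open>y\<close> is compared.\<close>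
  define y1 where "y1 = c + (r / norm (c - z)) *\<^sub>R (z - c)"
  have "norm (y1 - c) = r" using cz0 B(1) by (simp add: y1_def norm_minus_commute)
  then have y1: "y1 \<in> closure B" by (simp add: cB dist_norm norm_minus_commute)
  have "z - y1 = (1 - r / norm (c - z)) *\<^sub>R (z - c)" by (simp add: y1_def algebra_simps)
  then have "norm (z - y1) = \<bar>1 - r / norm (c - z)\<bar> * norm (c - z)" by (simp add: norm_minus_commute)
  also have "\<bar>1 - r / norm (c - z)\<bar> = 1 - r / norm (c - z)"
  proof (rule abs_of_nonneg)
    show "0 \<le> 1 - r / norm (c - z)" using cz B(1) by (simp add: divide_le_eq)
  qed
  also have "\<dots> * norm (c - z) = norm (c - z) - r" using cz0 by (simp add: field_simps)
  finally have "norm (z - y1) = norm (c - z) - r" .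
  moreover have "slow \<gamma>p * norm (z - y) \<le> slow \<gamma>p * norm (z - y1)" using ge[OF p y1 z] eq by linarith
  ultimately have "norm (z - y) \<le> norm (c - z) - r" using n by simp
  moreover have "norm (c - y) \<le> r" using y by (simp add: cB dist_norm)
  moreover have "norm ((c - y) + (y - z)) \<le> norm (c - y) + norm (y - z)" by (rule norm_triangle_ineq)
  ultimately have e1: "norm ((c - y) + (y - z)) = norm (c - y) + norm (y - z)" "norm (c - y) = r"
    by (simp_all add: norm_minus_commute)
  from norm_add_eq_imp_parallel[OF e1(1)] have "r *\<^sub>R (y - z) = norm (y - z) *\<^sub>R (c - y)" using e1(2) by simp
  then have "(1 / norm (y - z)) *\<^sub>R (r *\<^sub>R (y - z)) = (1 / norm (y - z)) *\<^sub>R (norm (y - z) *\<^sub>R (c - y))" by simp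
  then have "(r / norm (y - z)) *\<^sub>R (y - z) = c - y" using pz by simp
  then have c: "c = y + (r / norm (y - z)) *\<^sub>R (y - z)" by simp
  show ?thesis
    by (rule that[OF p3 y3 z eq _ \<rho>(1) ball c]) (use ge[OF p y] eq in auto)
qed

section \<open>Functions smooth on both sides of the interface\<close>

text \<open>The product with a test function is Lipschitz along the axes, has compact support and is
  differentiable almost everywhere, which is what the vanishing of integrated derivatives asks for.
  The gradient may therefore jump across the interface.\<close>

lemma has_weak_gradient_directional:
  fixes u :: "'a::euclidean_space \<Rightarrow> real"
  assumes supp: "\<And>x. norm x > r \<Longrightarrow> u x = 0" "\<And>x. norm x > r \<Longrightarrow> G x = 0"
    and u: "u \<in> borel_measurable lebesgue" "\<And>x. \<bar>u x\<bar> \<le> M"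
    and lip: "\<And>b x t. b \<in> Basis \<Longrightarrow> \<bar>u (x + t *\<^sub>R b) - u x\<bar> \<le> K * \<bar>t\<bar>"
    and G: "G \<in> borel_measurable lebesgue" "\<And>x. norm (G x) \<le> M"
    and deriv: "\<And>b. b \<in> Basis \<Longrightarrow> AE x in lebesgue. ((\<lambda>t. (u (x + t *\<^sub>R b) - u x) / t) \<longlongrightarrow> G x \<bullet> b) (at_right 0)"
  shows "has_weak_gradient u G"
proof (rule has_weak_gradientI_componentwise)
  have K0: "K \<ge> 0" using lip[OF SOME_Basis, of 0 1] by simp
  have M0: "M \<ge> 0" using u(2)[of 0] by linarith
  show "square_integrable u" by (rule square_integrable_bounded_support[OF u(1) _ supp(1)]) (use u in auto)
  show "square_integrable G" by (rule square_integrable_bounded_support[OF G supp(2)])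
  fix \<phi> :: "'a \<Rightarrow> real" and g and b :: 'a assume \<phi>: "test_function \<phi>" "\<And>x. GDERIV \<phi> x :> g x" and b: "b \<in> Basis"
  obtain A where A: "A > 0" "\<And>x. \<bar>\<phi> x\<bar> \<le> A" using test_function_bounded[OF \<phi>(1)] by metis
  obtain A' where A': "A' > 0" "\<And>x. norm (g x) \<le> A'" using test_function_gradient_bounded[OF \<phi>] by metis
  have gm: "(\<lambda>x. g x \<bullet> b) \<in> borel_measurable lebesgue"
    by (rule test_function_measurable[OF test_function_gderiv[OF \<phi>]])
  have pm: "(\<lambda>x. u x * (g x \<bullet> b) + \<phi> x * (G x \<bullet> b)) \<in> borel_measurable lebesgue"
  proof -
    have "(\<lambda>x. G x \<bullet> b) \<in> borel_measurable lebesgue" using G(1) by measurable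
    then show ?thesis
      by (intro borel_measurable_add borel_measurable_times u(1) gm test_function_measurable[OF \<phi>(1)])
  qed
  have Plip: "\<bar>u (x + t *\<^sub>R b) * \<phi> (x + t *\<^sub>R b) - u x * \<phi> x\<bar> \<le> (M * A' + K * A) * \<bar>t\<bar>" for x t
  proof -
    have 1: "\<bar>\<phi> (x + t *\<^sub>R b) - \<phi> x\<bar> \<le> A' * \<bar>t\<bar>"
      using gderiv_lipschitz[of UNIV \<phi> g A' "x + t *\<^sub>R b" x] \<phi>(2) A'(2) b by simp
    note 2 = lip[OF b, of x t]
    have "u (x + t *\<^sub>R b) * \<phi> (x + t *\<^sub>R b) - u x * \<phi> x =
        u (x + t *\<^sub>R b) * (\<phi> (x + t *\<^sub>R b) - \<phi> x) + (u (x + t *\<^sub>R b) - u x) * \<phi> x" by (simp add: algebra_simps)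
    also have "\<bar>\<dots>\<bar> \<le> M * (A' * \<bar>t\<bar>) + (K * \<bar>t\<bar>) * A"
      by (rule order_trans[OF abs_triangle_ineq]) (unfold abs_mult, intro add_mono mult_mono 1 2 u(2) A(2), use M0 A A' K0 in auto)
    finally show ?thesis by (simp add: algebra_simps)
  qed
  show "(LINT x|lebesgue. u x * (g x \<bullet> b) + \<phi> x * (G x \<bullet> b)) = 0"
  proof (rule integral_directional_derivative_eq_0(2)[where P="\<lambda>x. u x * \<phi> x" and r=r and b=b and M="M * A", OF _ _ Plip])
    show "(\<lambda>x. u x * \<phi> x) \<in> borel_measurable lebesgue"
      by (intro borel_measurable_times u(1) test_function_measurable \<phi>(1))
    show "AE x in lebesgue. ((\<lambda>t. (u (x + t *\<^sub>R b) * \<phi> (x + t *\<^sub>R b) - u x * \<phi> x) / t)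
        \<longlongrightarrow> u x * (g x \<bullet> b) + \<phi> x * (G x \<bullet> b)) (at_right 0)"
      using deriv[OF b]
    proof eventually_elim
      case (elim x)
      show ?case using directional_derivative_mult[OF elim GDERIV_imp_directional[OF \<phi>(2)[of x]]]
        by (simp add: algebra_simps)
    qed
    show "\<bar>u x * \<phi> x\<bar> \<le> M * A" for x unfolding abs_mult using u(2) A(2) M0 by (intro mult_mono) auto
  qed (use supp b pm in auto)
qed

lemma continuous_compact_support_bounded:
  fixes F :: "'a::euclidean_space \<Rightarrow> real"
  assumes "continuous_on UNIV F" "\<And>x. norm x > r \<Longrightarrow> F x = 0"
  obtains M where "M > 0" "\<And>x. \<bar>F x\<bar> \<le> M"
proof -
  have "compact (F ` cball 0 r)" using assms(1) continuous_on_subset by (intro compact_continuous_image) auto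
  then obtain M where M: "M > 0" "\<forall>y\<in>F ` cball 0 r. norm y \<le> M" using compact_imp_bounded bounded_pos by metis
  have "\<bar>F x\<bar> \<le> M" for x using M assms(2)[of x] by (cases "norm x > r") auto
  then show ?thesis using that M(1) by blast
qed

text \<open>Only derivatives along lines in a given direction are recorded. This is what the
  integrations by parts consume, and it reduces the explicit derivatives to one-variable
  computations.\<close>

definition has_dir_deriv :: "(real^3 \<Rightarrow> real) \<Rightarrow> (real^3 \<Rightarrow> real) \<Rightarrow> real^3 \<Rightarrow> bool" where
  "has_dir_deriv F F' b \<longleftrightarrow> (\<forall>x. ((\<lambda>t. F (x + t *\<^sub>R b)) has_real_derivative F' x) (at 0))"

lemma has_dir_deriv_line:
  assumes "has_dir_deriv F F' b"
  shows "((\<lambda>t. F (x + t *\<^sub>R b)) has_real_derivative F' (x + s *\<^sub>R b)) (at s)"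
proof -
  have "((\<lambda>t. F ((x + s *\<^sub>R b) + t *\<^sub>R b)) has_real_derivative F' (x + s *\<^sub>R b)) (at (s + - s))"
    using assms by (simp add: has_dir_deriv_def)
  then have "((\<lambda>t. F ((x + s *\<^sub>R b) + (t + - s) *\<^sub>R b)) has_real_derivative F' (x + s *\<^sub>R b)) (at s)"
    by (subst (asm) DERIV_shift)
  moreover have "(\<lambda>t. F ((x + s *\<^sub>R b) + (t + - s) *\<^sub>R b)) = (\<lambda>t. F (x + t *\<^sub>R b))"
    by (simp add: algebra_simps)
  ultimately show ?thesis by simp
qed

lemma has_dir_deriv_lipschitz:
  assumes "has_dir_deriv F F' b" "\<And>x. \<bar>F' x\<bar> \<le> K"
  shows "\<bar>F (x + t *\<^sub>R b) - F x\<bar> \<le> K * \<bar>t\<bar>"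
  using field_differentiable_bound[of UNIV "\<lambda>t. F (x + t *\<^sub>R b)" "\<lambda>s. F' (x + s *\<^sub>R b)" K t 0]
    has_dir_deriv_line[OF assms(1)] assms(2) by simp

definition layer :: "(real^3 \<Rightarrow> real) \<Rightarrow> (real^3 \<Rightarrow> real) \<Rightarrow> real^3 \<Rightarrow> real" where
  "layer A B x = (if x $ 3 > 0 then A x else B x)"

lemma open_upper: "open {x::real^3. x $ 3 > 0}" and open_lower: "open {x::real^3. x $ 3 < 0}"
  by (intro open_Collect_less continuous_intros)+

lemma layer_isCont:
  assumes "continuous_on UNIV A" "continuous_on UNIV B" "x $ 3 \<noteq> 0"
  shows "isCont (layer A B) x"
proof (cases "x $ 3 > 0")
  case True
  have "isCont A x" using assms(1) by (simp add: continuous_on_eq_continuous_at)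
  moreover have "\<forall>\<^sub>F y in nhds x. layer A B y = A y"
    by (rule eventually_mono[OF eventually_nhds_in_open[OF open_upper]]) (use True in \<open>auto simp: layer_def\<close>)
  ultimately show ?thesis using isCont_cong by metis
next
  case False
  then have "x $ 3 < 0" using assms(3) by simp
  have "isCont B x" using assms(2) by (simp add: continuous_on_eq_continuous_at)
  moreover have "\<forall>\<^sub>F y in nhds x. layer A B y = B y"
    by (rule eventually_mono[OF eventually_nhds_in_open[OF open_lower]]) (use \<open>x $ 3 < 0\<close> in \<open>auto simp: layer_def\<close>)
  ultimately show ?thesis using isCont_cong by metis
qed

lemma AE_off_interface: "AE x in lebesgue. (x::real^3) $ 3 \<noteq> 0"
proof (rule AE_I')
  show "{x::real^3. x $ 3 = 0} \<in> null_sets lebesgue"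
    using negligible_standard_hyperplane_cart[of "3::3"] by (simp add: negligible_iff_null_sets)
qed auto

lemma layer_measurable:
  assumes "A \<in> borel_measurable lebesgue" "B \<in> borel_measurable lebesgue"
  shows "layer A B \<in> borel_measurable lebesgue"
proof -
  have [measurable]: "{x::real^3. x $ 3 > 0} \<in> sets lebesgue" using open_upper by auto
  have [measurable]: "A \<in> borel_measurable lebesgue" "B \<in> borel_measurable lebesgue" by fact+
  have "layer A B = (\<lambda>x. if x \<in> {x. x $ 3 > 0} then A x else B x)" by (simp add: layer_def fun_eq_iff)
  also have "\<dots> \<in> borel_measurable lebesgue" by measurable
  finally show ?thesis .
qed

lemma layer_dir_limit:
  assumes "has_dir_deriv A A' b" "has_dir_deriv B B' b" "x $ 3 \<noteq> 0"
  shows "((\<lambda>t. (layer A B (x + t *\<^sub>R b) - layer A B x) / t) \<longlongrightarrow> layer A' B' x) (at_right 0)"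
proof -
  have lim: "((\<lambda>t. (F (x + t *\<^sub>R b) - F x) / t) \<longlongrightarrow> F' x) (at_right 0)" if "has_dir_deriv F F' b" for F F'
  proof -
    have "((\<lambda>t. F (x + t *\<^sub>R b)) has_real_derivative F' x) (at 0)" using that by (simp add: has_dir_deriv_def)
    then show ?thesis unfolding DERIV_def by (simp add: filterlim_at_split)
  qed
  have c: "((\<lambda>t. x + t *\<^sub>R b) \<longlongrightarrow> x) (at_right 0)"
  proof -
    have "((\<lambda>t. x + t *\<^sub>R b) \<longlongrightarrow> x + 0 *\<^sub>R b) (at_right 0)" by (intro tendsto_intros)
    then show ?thesis by simp
  qed
  show ?thesis
  proof (cases "x $ 3 > 0")
    case True
    have "\<forall>\<^sub>F t in at_right 0. x + t *\<^sub>R b \<in> {x. x $ 3 > 0}"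
      using topological_tendstoD[OF c open_upper] True by simp
    then have "\<forall>\<^sub>F t in at_right 0. (A (x + t *\<^sub>R b) - A x) / t = (layer A B (x + t *\<^sub>R b) - layer A B x) / t"
      by eventually_elim (use True in \<open>simp add: layer_def\<close>)
    from Lim_transform_eventually[OF lim[OF assms(1)] this] show ?thesis using True by (simp add: layer_def)
  next
    case False
    then have neg: "x $ 3 < 0" using assms(3) by simp
    have "\<forall>\<^sub>F t in at_right 0. x + t *\<^sub>R b \<in> {x. x $ 3 < 0}"
      using topological_tendstoD[OF c open_lower] neg by simp
    then have "\<forall>\<^sub>F t in at_right 0. (B (x + t *\<^sub>R b) - B x) / t = (layer A B (x + t *\<^sub>R b) - layer A B x) / t"
      by eventually_elim (use neg in \<open>simp add: layer_def\<close>)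
    from Lim_transform_eventually[OF lim[OF assms(2)] this] show ?thesis using neg by (simp add: layer_def)
  qed
qed

text \<open>A segment in direction \<open>b\<close> crosses the interface at most once and upwards.
  On each side \<open>K\<close> bounds the rate of change, and at the crossing the value passes from
  \<open>B\<close> to \<open>A\<close>, which by assumption is no decrease; for
  \<open>b $ 3 = 0\<close> there is no crossing.\<close>

lemma layer_jump:
  assumes A: "has_dir_deriv A A' b" "\<And>x. \<bar>A' x\<bar> \<le> K" and B: "has_dir_deriv B B' b" "\<And>x. \<bar>B' x\<bar> \<le> K"
    and b: "b $ 3 = 0 \<or> b $ 3 > 0 \<and> (\<forall>x. x $ 3 = 0 \<longrightarrow> B x \<le> A x)" and t: "t > 0"
  shows "layer A B (x + t *\<^sub>R b) - layer A B x \<ge> - (K * t)"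
proof (cases "x $ 3 \<le> 0 \<and> x $ 3 + t * b $ 3 > 0")
  case True
  then have b3: "b $ 3 > 0" "\<And>x. x $ 3 = 0 \<Longrightarrow> B x \<le> A x" using b t by auto
  define s where "s = - (x $ 3) / b $ 3"
  have s: "0 \<le> s" "s < t" using True b3(1) by (auto simp: s_def field_simps)
  define y where "y = x + s *\<^sub>R b"
  have y3: "y $ 3 = 0" using b3(1) by (simp add: y_def s_def)
  have "x + t *\<^sub>R b = y + (t - s) *\<^sub>R b" by (simp add: y_def algebra_simps)
  then have "\<bar>A (x + t *\<^sub>R b) - A y\<bar> \<le> K * (t - s)" using has_dir_deriv_lipschitz[OF A, of y "t - s"] s by simp
  moreover have "\<bar>B y - B x\<bar> \<le> K * s" using has_dir_deriv_lipschitz[OF B, of x s] s by (simp add: y_def)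
  ultimately have "A (x + t *\<^sub>R b) - B x \<ge> - (K * (t - s) + K * s)" using b3(2)[OF y3] by linarith
  then show ?thesis using True by (simp add: layer_def algebra_simps)
next
  case False
  then have same: "x $ 3 > 0 \<longleftrightarrow> x $ 3 + t * b $ 3 > 0" using b t by (auto simp: add_pos_nonneg)
  then show ?thesis
    using has_dir_deriv_lipschitz[OF A, of x t] has_dir_deriv_lipschitz[OF B, of x t] t
    by (simp add: layer_def abs_le_iff split: if_splits)
qed

lemma has_dir_deriv_minus: "has_dir_deriv A A' b \<Longrightarrow> has_dir_deriv (\<lambda>x. - A x) (\<lambda>x. - A' x) b"
  by (auto simp: has_dir_deriv_def intro: DERIV_minus)

text \<open>The one-sided bound is applied to the layered function and to its negative, both without
  a jump at the interface.\<close>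

lemma layer_lipschitz:
  assumes A: "has_dir_deriv A A' b" "\<And>x. \<bar>A' x\<bar> \<le> K" and B: "has_dir_deriv B B' b" "\<And>x. \<bar>B' x\<bar> \<le> K"
    and b: "b $ 3 \<ge> 0" and eq: "\<And>x. x $ 3 = 0 \<Longrightarrow> B x = A x"
  shows "\<bar>layer A B (x + t *\<^sub>R b) - layer A B x\<bar> \<le> K * \<bar>t\<bar>"
proof -
  have pos: "\<bar>layer A B (x + t *\<^sub>R b) - layer A B x\<bar> \<le> K * t" if t: "t > 0" for x t
  proof -
    have "layer A B (x + t *\<^sub>R b) - layer A B x \<ge> - (K * t)"
      using b eq by (intro layer_jump[OF A B _ t]) auto
    moreover have "layer (\<lambda>x. - A x) (\<lambda>x. - B x) (x + t *\<^sub>R b) - layer (\<lambda>x. - A x) (\<lambda>x. - B x) x \<ge> - (K * t)"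
      using b eq A(2) B(2) by (intro layer_jump[OF has_dir_deriv_minus[OF A(1)] _ has_dir_deriv_minus[OF B(1)] _ _ t]) auto
    moreover have "layer (\<lambda>x. - A x) (\<lambda>x. - B x) y = - layer A B y" for y by (simp add: layer_def)
    ultimately show ?thesis by (simp add: abs_le_iff)
  qed
  consider "t > 0" | "t = 0" | "t < 0" by linarith
  then show ?thesis
  proof cases
    case 3
    then show ?thesis using pos[of "- t" "x + t *\<^sub>R b"] by (simp add: abs_minus_commute)
  qed (use pos in auto)
qed

text \<open>Meant for \<open>A\<close>, \<open>B\<close> the components of a flux: in the two
  horizontal directions no condition arises at the interface, in the vertical one the jump must be
  upward.\<close>

lemma layered_partial_integration_le:
  assumes v: "has_weak_gradient v G" "AE x in lebesgue. v x \<ge> 0"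
    and A: "has_dir_deriv A A' b" "continuous_on UNIV A" "continuous_on UNIV A'" "\<And>x. norm x > r \<Longrightarrow> A x = 0" "\<And>x. norm x > r \<Longrightarrow> A' x = 0"
    and B: "has_dir_deriv B B' b" "continuous_on UNIV B" "continuous_on UNIV B'" "\<And>x. norm x > r \<Longrightarrow> B x = 0" "\<And>x. norm x > r \<Longrightarrow> B' x = 0"
    and b: "b $ 3 = 0 \<or> b $ 3 > 0 \<and> (\<forall>x. x $ 3 = 0 \<longrightarrow> B x \<le> A x)"
  shows "(LINT x|lebesgue. layer A B x * (G x \<bullet> b)) \<le> - (LINT x|lebesgue. layer A' B' x * v x)"
proof -
  obtain MA where MA: "MA > 0" "\<And>x. \<bar>A x\<bar> \<le> MA" using continuous_compact_support_bounded[OF A(2,4)] by metis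
  obtain MB where MB: "MB > 0" "\<And>x. \<bar>B x\<bar> \<le> MB" using continuous_compact_support_bounded[OF B(2,4)] by metis
  obtain MA' where MA': "MA' > 0" "\<And>x. \<bar>A' x\<bar> \<le> MA'" using continuous_compact_support_bounded[OF A(3,5)] by metis
  obtain MB' where MB': "MB' > 0" "\<And>x. \<bar>B' x\<bar> \<le> MB'" using continuous_compact_support_bounded[OF B(3,5)] by metis
  define M where "M = MA + MB + MA' + MB'"
  have M: "M \<ge> 0" using MA(1) MB(1) MA'(1) MB'(1) by (simp add: M_def)
  have bd: "\<bar>A x\<bar> \<le> M" "\<bar>B x\<bar> \<le> M" "\<bar>A' x\<bar> \<le> M" "\<bar>B' x\<bar> \<le> M" for x
    using MA(1) MB(1) MA'(1) MB'(1) MA(2)[of x] MB(2)[of x] MA'(2)[of x] MB'(2)[of x] by (auto simp: M_def)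
  note meas = continuous_imp_lebesgue_measurable
  show ?thesis
  proof (rule weak_gradient_partial_integration_le[OF v, where M=M and r=r and K=M])
    show "layer A B \<in> borel_measurable lebesgue" "layer A' B' \<in> borel_measurable lebesgue"
      by (intro layer_measurable meas A B)+
    show "\<bar>layer A B x\<bar> \<le> M" "\<bar>layer A' B' x\<bar> \<le> M" for x using bd by (auto simp: layer_def)
    show "layer A B x = 0" "layer A' B' x = 0" if "norm x > r" for x using A B that by (auto simp: layer_def)
    show "- (M * t) \<le> layer A B (x + t *\<^sub>R b) - layer A B x" if "0 < t" for x t
      by (rule layer_jump[OF A(1) bd(3) B(1) bd(4) b that])
    show "AE x in lebesgue. ((\<lambda>t. (layer A B (x + t *\<^sub>R b) - layer A B x) / t) \<longlongrightarrow> layer A' B' x) (at_right 0)"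
      using AE_off_interface by eventually_elim (rule layer_dir_limit[OF A(1) B(1)])
    show "AE x in lebesgue. isCont (layer A B) x"
      using AE_off_interface by eventually_elim (rule layer_isCont[OF A(2) B(2)])
    show "AE x in lebesgue. isCont (layer A' B') x"
      using AE_off_interface by eventually_elim (rule layer_isCont[OF A(3) B(3)])
  qed (use M in auto)
qed

lemma Basis_real3: "(Basis :: (real^3) set) = {axis 1 1, axis 2 1, axis 3 1}"
  by (auto simp: Basis_vec_def UNIV_3)

lemma inner_axis_real3: "(x::real^3) \<bullet> axis i 1 = x $ i"
  by (simp add: inner_axis)

lemma norm_real3_le: "norm (x::real^3) \<le> \<bar>x $ 1\<bar> + \<bar>x $ 2\<bar> + \<bar>x $ 3\<bar>"
  using norm_le_l1_cart[of x] by (simp add: sum_3)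

text \<open>Two smooth pieces that agree on the interface form a function that is Lipschitz along
  the axes; off the interface, a null set, the derivative is that of the respective piece.\<close>

lemma layered_weak_gradient:
  fixes A B :: "real^3 \<Rightarrow> real" and A' B' :: "real^3 \<Rightarrow> real^3"
  assumes A: "\<And>i. has_dir_deriv A (\<lambda>x. A' x $ i) (axis i 1)" "continuous_on UNIV A" "continuous_on UNIV A'" "\<And>x. norm x > r \<Longrightarrow> A x = 0" "\<And>x. norm x > r \<Longrightarrow> A' x = 0"
    and B: "\<And>i. has_dir_deriv B (\<lambda>x. B' x $ i) (axis i 1)" "continuous_on UNIV B" "continuous_on UNIV B'" "\<And>x. norm x > r \<Longrightarrow> B x = 0" "\<And>x. norm x > r \<Longrightarrow> B' x = 0"
    and eq: "\<And>x. x $ 3 = 0 \<Longrightarrow> B x = A x"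
  shows "has_weak_gradient (layer A B) (\<lambda>x. if x $ 3 > 0 then A' x else B' x)"
proof -
  let ?G = "\<lambda>x. if x $ 3 > 0 then A' x else B' x"
  obtain MA where MA: "MA > 0" "\<And>x. \<bar>A x\<bar> \<le> MA" using continuous_compact_support_bounded[OF A(2,4)] by metis
  obtain MB where MB: "MB > 0" "\<And>x. \<bar>B x\<bar> \<le> MB" using continuous_compact_support_bounded[OF B(2,4)] by metis
  have "continuous_on UNIV (\<lambda>x. norm (A' x))" "continuous_on UNIV (\<lambda>x. norm (B' x))" by (intro continuous_intros A B)+
  note c = this
  have z: "norm (A' x) = 0" "norm (B' x) = 0" if "norm x > r" for x using that A(5) B(5) by auto
  obtain MA' where MA': "MA' > 0" "\<And>x. \<bar>norm (A' x)\<bar> \<le> MA'"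
    using continuous_compact_support_bounded[OF c(1) z(1)] by metis
  obtain MB' where MB': "MB' > 0" "\<And>x. \<bar>norm (B' x)\<bar> \<le> MB'"
    using continuous_compact_support_bounded[OF c(2) z(2)] by metis
  define M where "M = MA + MB + MA' + MB'"
  have bd: "\<bar>A x\<bar> \<le> M" "\<bar>B x\<bar> \<le> M" "norm (A' x) \<le> M" "norm (B' x) \<le> M" for x
    using MA(1) MB(1) MA'(1) MB'(1) MA(2)[of x] MB(2)[of x] MA'(2)[of x] MB'(2)[of x] by (auto simp: M_def)
  have bd': "\<bar>A' x $ i\<bar> \<le> M" "\<bar>B' x $ i\<bar> \<le> M" for x i
    using bd(3,4)[of x] component_le_norm_cart order_trans by blast+
  have [measurable]: "{x::real^3. x $ 3 > 0} \<in> sets lebesgue" using open_upper by auto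
  have [measurable]: "A' \<in> borel_measurable lebesgue" "B' \<in> borel_measurable lebesgue"
    by (intro continuous_imp_lebesgue_measurable A B)+
  have Gm: "?G \<in> borel_measurable lebesgue"
  proof -
    have "?G = (\<lambda>x. if x \<in> {x. x $ 3 > 0} then A' x else B' x)" by (simp add: fun_eq_iff)
    also have "\<dots> \<in> borel_measurable lebesgue" by measurable
    finally show ?thesis .
  qed
  show ?thesis
  proof (rule has_weak_gradient_directional[where r=r and M=M and K=M])
    show "layer A B \<in> borel_measurable lebesgue"
      by (intro layer_measurable continuous_imp_lebesgue_measurable A B)
    fix b :: "real^3" assume "b \<in> Basis"
    then obtain i where i: "b = axis i 1" by (auto simp: Basis_real3)
    show "\<bar>layer A B (x + t *\<^sub>R b) - layer A B x\<bar> \<le> M * \<bar>t\<bar>" for x t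
      unfolding i by (rule layer_lipschitz[OF A(1) bd'(1) B(1) bd'(2) _ eq]) (simp_all add: axis_def)
    show "AE x in lebesgue. ((\<lambda>t. (layer A B (x + t *\<^sub>R b) - layer A B x) / t) \<longlongrightarrow> ?G x \<bullet> b) (at_right 0)"
      using AE_off_interface
    proof eventually_elim
      case (elim x)
      have "layer (\<lambda>x. A' x $ i) (\<lambda>x. B' x $ i) x = ?G x \<bullet> b" by (simp add: layer_def i inner_axis_real3)
      then show ?case using layer_dir_limit[OF A(1)[of i] B(1)[of i] elim] by (simp add: i)
    qed
  qed (use bd A B Gm in \<open>auto simp: layer_def\<close>)
qed

text \<open>A cutoff of class C^1 is enough, since the integrations by parts differentiate cutoffs
  only once. The denominator never vanishes, as \<open>t\<close> and \<open>1 - t\<close> are not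
  both nonpositive.\<close>

definition smoothstep :: "real \<Rightarrow> real" where
  "smoothstep t = (max 0 t)\<^sup>2 / ((max 0 t)\<^sup>2 + (max 0 (1 - t))\<^sup>2)"

definition smoothstep' :: "real \<Rightarrow> real" where
  "smoothstep' t = 2 * max 0 t * max 0 (1 - t) * (max 0 t + max 0 (1 - t)) / ((max 0 t)\<^sup>2 + (max 0 (1 - t))\<^sup>2)\<^sup>2"

lemma smoothstep_simps: "t \<le> 0 \<Longrightarrow> smoothstep t = 0" "t \<ge> 1 \<Longrightarrow> smoothstep t = 1"
  "t \<le> 0 \<Longrightarrow> smoothstep' t = 0" "t \<ge> 1 \<Longrightarrow> smoothstep' t = 0"
  by (auto simp: smoothstep_def smoothstep'_def)

lemma smoothstep_denom: "0 < (max 0 t)\<^sup>2 + (max 0 (1 - t))\<^sup>2" for t :: real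
  by (cases "t > 0") (auto simp: max_def add_pos_nonneg)

lemma smoothstep_bounds: "0 \<le> smoothstep t" "smoothstep t \<le> 1" "0 \<le> smoothstep' t" "smoothstep' t \<le> 2"
proof -
  show "0 \<le> smoothstep t" "0 \<le> smoothstep' t" by (simp_all add: smoothstep_def smoothstep'_def)
  show "smoothstep t \<le> 1" using smoothstep_denom[of t] by (simp add: smoothstep_def divide_le_eq)
  show "smoothstep' t \<le> 2"
  proof (cases "0 < t \<and> t < 1")
    case True
    define d where "d = t\<^sup>2 + (1 - t)\<^sup>2"
    have d: "2 * t * (1 - t) \<le> d" "1 / 2 \<le> d"
      using sum_squares_bound[of t "1 - t"] zero_le_power2[of "2 * t - 1"] by (auto simp: d_def power2_eq_square algebra_simps)
    then have "d \<le> 2 * d\<^sup>2" using mult_left_mono[of "1 / 2" d d] by (simp add: power2_eq_square)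
    then have "2 * t * (1 - t) / d\<^sup>2 \<le> 2" using d by (simp add: divide_le_eq)
    then show ?thesis using True by (simp add: smoothstep'_def d_def)
  qed (auto simp: smoothstep_simps not_less)
qed

lemma smoothstep_DERIV: "(smoothstep has_real_derivative smoothstep' t) (at t)"
proof -
  have m: "((\<lambda>t. (max 0 (1 - t))\<^sup>2) has_real_derivative 2 * max 0 (1 - t) * - 1) (at t)"
    by (rule DERIV_chain2[OF max0_power2_DERIV]) (auto intro!: derivative_eq_intros)
  show ?thesis unfolding smoothstep_def[abs_def] smoothstep'_def
    by (rule DERIV_cong[OF DERIV_divide[OF max0_power2_DERIV DERIV_add[OF max0_power2_DERIV m] less_imp_neq[OF smoothstep_denom, symmetric]]])
      (simp add: power2_eq_square algebra_simps)
qed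

lemma continuous_on_smoothstep' [continuous_intros]: "continuous_on S f \<Longrightarrow> continuous_on S (\<lambda>x. smoothstep' (f x))"
  unfolding smoothstep'_def using smoothstep_denom by (intro continuous_intros) (auto simp: less_imp_neq[symmetric])

lemma continuous_on_smoothstep [continuous_intros]: "continuous_on S f \<Longrightarrow> continuous_on S (\<lambda>x. smoothstep (f x))"
  unfolding smoothstep_def using smoothstep_denom by (intro continuous_intros) (auto simp: less_imp_neq[symmetric])

text \<open>The factor \<open>h\<close> may be singular off \<open>U\<close>, as the derivatives of
  a radial wave are at its centre. The product is continuous on \<open>U\<close> and zero on the
  complement of \<open>K\<close>, and these two open sets cover the space.\<close>

lemma cutoff_continuous:
  fixes \<zeta> :: "'a::euclidean_space \<Rightarrow> real" and h :: "'a \<Rightarrow> 'b::real_normed_vector"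
  assumes \<zeta>: "continuous_on UNIV \<zeta>" "\<And>x. x \<notin> K \<Longrightarrow> \<zeta> x = 0"
    and h: "continuous_on U h" and U: "open U" "closed K" "K \<subseteq> U"
  shows "continuous_on UNIV (\<lambda>x. \<zeta> x *\<^sub>R h x)"
proof -
  have "continuous_on U (\<lambda>x. \<zeta> x *\<^sub>R h x)"
    using \<zeta>(1) continuous_on_subset by (intro continuous_on_scaleR h) auto
  moreover have "continuous_on (- K) (\<lambda>x. \<zeta> x *\<^sub>R h x)"
    by (rule continuous_on_eq[OF continuous_on_const[of _ 0]]) (use \<zeta>(2) in auto)
  ultimately have "continuous_on (U \<union> - K) (\<lambda>x. \<zeta> x *\<^sub>R h x)"
    using U by (intro continuous_on_open_Un) auto
  moreover have "U \<union> - K = UNIV" using U(3) by auto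
  ultimately show ?thesis by simp
qed

lemma cutoff_dir_deriv:
  assumes \<zeta>: "has_dir_deriv \<zeta> \<zeta>' b" "\<And>x. x \<notin> K \<Longrightarrow> \<zeta> x = 0" "\<And>x. x \<notin> K \<Longrightarrow> \<zeta>' x = 0"
    and h: "\<And>x. x \<in> U \<Longrightarrow> ((\<lambda>t. h (x + t *\<^sub>R b)) has_real_derivative h' x) (at 0)" and K: "closed K" "K \<subseteq> U"
  shows "has_dir_deriv (\<lambda>x. \<zeta> x * h x) (\<lambda>x. \<zeta>' x * h x + \<zeta> x * h' x) b"
  unfolding has_dir_deriv_def
proof
  fix x
  show "((\<lambda>t. \<zeta> (x + t *\<^sub>R b) * h (x + t *\<^sub>R b)) has_real_derivative \<zeta>' x * h x + \<zeta> x * h' x) (at 0)"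
  proof (cases "x \<in> K")
    case True
    then have x: "x \<in> U" using K(2) by auto
    have "((\<lambda>t. \<zeta> (x + t *\<^sub>R b)) has_real_derivative \<zeta>' x) (at 0)" using \<zeta>(1) by (simp add: has_dir_deriv_def)
    from DERIV_mult[OF this h[OF x]] show ?thesis by (simp add: algebra_simps)
  next
    case False
    have "((\<lambda>t. x + t *\<^sub>R b) \<longlongrightarrow> x + 0 *\<^sub>R b) (nhds 0)" by (intro tendsto_intros filterlim_ident)
    then have "\<forall>\<^sub>F t in nhds 0. x + t *\<^sub>R b \<in> - K"
      using topological_tendstoD[of _ "x + 0 *\<^sub>R b" "nhds 0" "- K"] K(1) False by auto
    then have "\<forall>\<^sub>F t in nhds 0. \<zeta> (x + t *\<^sub>R b) * h (x + t *\<^sub>R b) = 0"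
      by eventually_elim (simp add: \<zeta>(2))
    from DERIV_cong_ev[OF refl this refl] show ?thesis using \<zeta>(2,3)[OF False] by simp
  qed
qed

lemma layer_mult_integrable:
  assumes "continuous_on UNIV A" "\<And>x. norm x > r \<Longrightarrow> A x = 0" "continuous_on UNIV B" "\<And>x. norm x > r \<Longrightarrow> B x = 0"
    and w: "locally_integrable (w :: real^3 \<Rightarrow> real)"
  shows "integrable lebesgue (\<lambda>x. layer A B x * w x)"
proof -
  obtain MA where MA: "MA > 0" "\<And>x. \<bar>A x\<bar> \<le> MA" using continuous_compact_support_bounded[OF assms(1,2)] by metis
  obtain MB where MB: "MB > 0" "\<And>x. \<bar>B x\<bar> \<le> MB" using continuous_compact_support_bounded[OF assms(3,4)] by metis
  have "\<bar>layer A B x\<bar> \<le> MA + MB" for x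
    using MA(1) MB(1) MA(2)[of x] MB(2)[of x] by (auto simp: layer_def)
  moreover have "layer A B x = 0" if "norm x > r" for x using assms that by (simp add: layer_def)
  moreover have "layer A B \<in> borel_measurable lebesgue"
    by (intro layer_measurable continuous_imp_lebesgue_measurable assms)
  ultimately show ?thesis
    using integrable_bounded_mult_locally_integrable[OF w, of "layer A B" "MA + MB" r] by simp
qed

lemma inner_real3: "(x::real^3) \<bullet> y = x $ 1 * y $ 1 + x $ 2 * y $ 2 + x $ 3 * y $ 3"
  by (simp add: inner_vec_def sum_3)

text \<open>Here \<open>\<zeta>\<close> is a cutoff and \<open>layer Wu Wl\<close> a subsolution wherever the cutoff is positive.\<close>

lemma subsolution_test:
  fixes dl du :: "real^3 \<Rightarrow> real^3" and gz :: "real^3 \<Rightarrow> real^3"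
  assumes w: "wsol (two_layer \<gamma>p \<gamma>m) f \<tau> v G" and v: "AE x in lebesgue. v x \<ge> 0"
    and U: "open U" "closed K" "K \<subseteq> U"
    and l: "\<And>i x. x \<in> U \<Longrightarrow> ((\<lambda>t. Wl (x + t *\<^sub>R axis i 1)) has_real_derivative dl x $ i) (at 0)"
      "\<And>i x. x \<in> U \<Longrightarrow> ((\<lambda>t. dl (x + t *\<^sub>R axis i 1) $ i) has_real_derivative sl i x) (at 0)"
      "continuous_on U Wl" "continuous_on U dl" "\<And>i. continuous_on U (sl i)"
    and u: "\<And>i x. x \<in> U \<Longrightarrow> ((\<lambda>t. Wu (x + t *\<^sub>R axis i 1)) has_real_derivative du x $ i) (at 0)"
      "\<And>i x. x \<in> U \<Longrightarrow> ((\<lambda>t. du (x + t *\<^sub>R axis i 1) $ i) has_real_derivative su i x) (at 0)"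
      "continuous_on U Wu" "continuous_on U du" "\<And>i. continuous_on U (su i)"
    and \<zeta>: "\<And>i. has_dir_deriv \<zeta> (\<lambda>x. gz x $ i) (axis i 1)" "continuous_on UNIV \<zeta>" "continuous_on UNIV gz"
      "\<And>x. x \<notin> K \<Longrightarrow> \<zeta> x = 0" "\<And>x. x \<notin> K \<Longrightarrow> gz x = 0" "\<And>x. norm x > r \<Longrightarrow> \<zeta> x = 0" "\<And>x. norm x > r \<Longrightarrow> gz x = 0"
      "\<And>x. \<zeta> x \<ge> 0"
    and interface: "\<And>x. x $ 3 = 0 \<Longrightarrow> Wl x = Wu x" "\<And>x. x $ 3 = 0 \<Longrightarrow> \<zeta> x > 0 \<Longrightarrow> \<gamma>m * dl x $ 3 \<le> \<gamma>p * du x $ 3"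
    and sub: "\<And>x. x $ 3 > 0 \<Longrightarrow> \<zeta> x > 0 \<Longrightarrow> \<tau>\<^sup>2 * Wu x \<le> \<gamma>p * (su 1 x + su 2 x + su 3 x)"
      "\<And>x. x $ 3 \<le> 0 \<Longrightarrow> \<zeta> x > 0 \<Longrightarrow> \<tau>\<^sup>2 * Wl x \<le> \<gamma>m * (sl 1 x + sl 2 x + sl 3 x)"
  shows "(LINT x|lebesgue. f x * (\<zeta> x * layer Wu Wl x)) \<le>
      (LINT x|lebesgue. two_layer \<gamma>p \<gamma>m x * (layer Wu Wl x * (G x \<bullet> gz x) - ((if x $ 3 > 0 then du x else dl x) \<bullet> gz x) * v x))"
proof -
  have vG: "has_weak_gradient v G" and sv: "square_integrable v" and sG: "square_integrable G"
    using w by (auto simp: wsol_def has_weak_gradient_def)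
  have lv: "locally_integrable v" and lG: "locally_integrable (\<lambda>x. G x $ i)" for i
    using square_integrable_locally_integrable[OF sv] locally_integrable_inner[OF square_integrable_locally_integrable[OF sG], of "axis i 1"]
    by (auto simp: inner_axis_real3)
  note cc = cutoff_continuous[OF _ _ _ U]
  have cgz: "continuous_on UNIV (\<lambda>x. gz x $ i)" for i by (intro continuous_intros \<zeta>)
  have gz0: "gz x $ i = 0" if "x \<notin> K" for x i using \<zeta>(5)[OF that] by simp
  have cdl: "continuous_on U (\<lambda>x. dl x $ i)" and cdu: "continuous_on U (\<lambda>x. du x $ i)" for i by (intro continuous_intros l u)+
  have c1: "continuous_on UNIV (\<lambda>x. \<zeta> x * h x)" if "continuous_on U h" for h :: "real^3 \<Rightarrow> real"
    using cc[OF \<zeta>(2,4) that] by simp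
  have c2: "continuous_on UNIV (\<lambda>x. gz x $ i * h x)" if "continuous_on U h" for h :: "real^3 \<Rightarrow> real" and i
    using cc[OF cgz gz0 that] by simp
  have cv: "continuous_on UNIV (\<lambda>x. \<zeta> x *\<^sub>R h x + W x *\<^sub>R gz x)" if "continuous_on U h" "continuous_on U W" for h :: "real^3 \<Rightarrow> real^3" and W
  proof (intro continuous_on_add)
    show "continuous_on UNIV (\<lambda>x. \<zeta> x *\<^sub>R h x)" by (rule cc[OF \<zeta>(2,4) that(1)])
    show "continuous_on UNIV (\<lambda>x. W x *\<^sub>R gz x)"
    proof -
      have eq: "(\<lambda>x. W x *\<^sub>R gz x) = (\<lambda>x. \<chi> i. gz x $ i * W x)" by (simp add: fun_eq_iff vec_eq_iff)
      show ?thesis unfolding eq by (intro continuous_on_vec_lambda c2 that(2))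
    qed
  qed
  have dW: "has_dir_deriv (\<lambda>x. \<zeta> x * W x) (\<lambda>x. (\<zeta> x *\<^sub>R d x + W x *\<^sub>R gz x) $ i) (axis i 1)"
    if "\<And>x. x \<in> U \<Longrightarrow> ((\<lambda>t. W (x + t *\<^sub>R axis i 1)) has_real_derivative d x $ i) (at 0)" for W and d :: "real^3 \<Rightarrow> real^3" and i
    using cutoff_dir_deriv[OF \<zeta>(1,4) gz0 that U(2,3)] by (simp add: add.commute mult.commute)
  have ww: "has_weak_gradient (layer (\<lambda>x. \<zeta> x * Wu x) (\<lambda>x. \<zeta> x * Wl x))
      (\<lambda>x. if x $ 3 > 0 then \<zeta> x *\<^sub>R du x + Wu x *\<^sub>R gz x else \<zeta> x *\<^sub>R dl x + Wl x *\<^sub>R gz x)"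
    by (rule layered_weak_gradient[where r=r])
      (use dW[OF u(1)] dW[OF l(1)] c1[OF u(3)] c1[OF l(3)] cv[OF u(4,3)] cv[OF l(4,3)] \<zeta>(6,7) interface(1) in auto)
  define \<gamma> where "\<gamma> = two_layer \<gamma>p \<gamma>m"
  define W where "W = layer Wu Wl"
  define D where "D x = (if x $ 3 > 0 then du x else dl x)" for x
  \<comment> \<open>The gradient of the test function \<open>\<zeta> W\<close> has two parts.
    \<open>F\<close> is the flux \<open>\<zeta> \<gamma> \<nabla>W\<close>, which is integrated by
    parts and has the derivatives \<open>F'\<close>; \<open>H\<close> contains the derivatives of
    the cutoff and remains as an error; \<open>V\<close> is the zeroth-order term.\<close>
  define F where "F i = layer (\<lambda>x. \<gamma>p * (\<zeta> x * du x $ i)) (\<lambda>x. \<gamma>m * (\<zeta> x * dl x $ i))" for i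
  define F' where "F' i = layer (\<lambda>x. \<gamma>p * (gz x $ i * du x $ i + \<zeta> x * su i x)) (\<lambda>x. \<gamma>m * (gz x $ i * dl x $ i + \<zeta> x * sl i x))" for i
  define H where "H i = layer (\<lambda>x. \<gamma>p * (gz x $ i * Wu x)) (\<lambda>x. \<gamma>m * (gz x $ i * Wl x))" for i
  define V where "V = layer (\<lambda>x. \<tau>\<^sup>2 * (\<zeta> x * Wu x)) (\<lambda>x. \<tau>\<^sup>2 * (\<zeta> x * Wl x))"
  have cm: "continuous_on UNIV (\<lambda>x. c * h x)" if "continuous_on UNIV h" for c and h :: "real^3 \<Rightarrow> real"
    using that by (intro continuous_intros)
  have iF: "integrable lebesgue (\<lambda>x. F i x * G x $ i)" for i
    unfolding F_def by (rule layer_mult_integrable[OF cm[OF c1[OF cdu]] _ cm[OF c1[OF cdl]] _ lG, where r=r]) (use \<zeta>(6) in auto)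
  have iH: "integrable lebesgue (\<lambda>x. H i x * G x $ i)" for i
    unfolding H_def by (rule layer_mult_integrable[OF cm[OF c2[OF u(3)]] _ cm[OF c2[OF l(3)]] _ lG, where r=r]) (use \<zeta>(7) in auto)
  have iV: "integrable lebesgue (\<lambda>x. V x * v x)"
    unfolding V_def by (rule layer_mult_integrable[OF cm[OF c1[OF u(3)]] _ cm[OF c1[OF l(3)]] _ lv, where r=r]) (use \<zeta>(6) in auto)
  have cF'u: "continuous_on UNIV (\<lambda>x. \<gamma>p * (gz x $ i * du x $ i + \<zeta> x * su i x))" for i
    by (intro cm continuous_on_add c1 c2 u cdu)
  have cF'l: "continuous_on UNIV (\<lambda>x. \<gamma>m * (gz x $ i * dl x $ i + \<zeta> x * sl i x))" for i
    by (intro cm continuous_on_add c1 c2 l cdl)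
  have iF': "integrable lebesgue (\<lambda>x. F' i x * v x)" for i
    unfolding F'_def by (rule layer_mult_integrable[OF cF'u _ cF'l _ lv, where r=r]) (use \<zeta>(6,7) in auto)
  have ibp: "(LINT x|lebesgue. F i x * G x $ i) \<le> - (LINT x|lebesgue. F' i x * v x)" for i
  proof -
    have dd: "has_dir_deriv (\<lambda>x. c * (\<zeta> x * h x)) (\<lambda>x. c * (gz x $ i * h x + \<zeta> x * h' x)) (axis i 1)"
      if "\<And>x. x \<in> U \<Longrightarrow> ((\<lambda>t. h (x + t *\<^sub>R axis i 1)) has_real_derivative h' x) (at 0)" for c h h'
      using cutoff_dir_deriv[OF \<zeta>(1,4) gz0 that U(2,3)] unfolding has_dir_deriv_def by (auto intro!: DERIV_cmult)
    \<comment> \<open>Only the vertical direction sees the interface; there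
      \<open>interface(2)\<close> supplies the upward jump of the flux.\<close>
    have b: "axis i 1 $ 3 = (0::real) \<or> axis i 1 $ 3 > (0::real) \<and>
        (\<forall>x. x $ 3 = 0 \<longrightarrow> \<gamma>m * (\<zeta> x * dl x $ i) \<le> \<gamma>p * (\<zeta> x * du x $ i))"
    proof (cases "i = 3")
      case True
      have "\<gamma>m * (\<zeta> x * dl x $ 3) \<le> \<gamma>p * (\<zeta> x * du x $ 3)" if "x $ 3 = 0" for x
      proof (cases "\<zeta> x > 0")
        case True
        then show ?thesis using mult_left_mono[OF interface(2)[OF that True] \<zeta>(8)[of x]] by (simp add: mult_ac)
      qed (use \<zeta>(8)[of x] in simp)
      then show ?thesis using True by (simp add: axis_def)
    qed (simp add: axis_def)
    have "(LINT x|lebesgue. F i x * (G x \<bullet> axis i 1)) \<le> - (LINT x|lebesgue. F' i x * v x)"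
      unfolding F_def F'_def
      by (rule layered_partial_integration_le[OF vG v dd[OF u(2)] cm[OF c1[OF cdu]] cF'u _ _ dd[OF l(2)] cm[OF c1[OF cdl]] cF'l _ _ b, where r=r])
        (use \<zeta>(6,7) in auto)
    then show ?thesis by (simp add: inner_axis_real3)
  qed
  have e1: "\<gamma> x * (G x \<bullet> (if x $ 3 > 0 then \<zeta> x *\<^sub>R du x + Wu x *\<^sub>R gz x else \<zeta> x *\<^sub>R dl x + Wl x *\<^sub>R gz x))
      + \<tau>\<^sup>2 * v x * layer (\<lambda>x. \<zeta> x * Wu x) (\<lambda>x. \<zeta> x * Wl x) x
      = (F 1 x * G x $ 1 + F 2 x * G x $ 2 + F 3 x * G x $ 3) + ((H 1 x * G x $ 1 + H 2 x * G x $ 2 + H 3 x * G x $ 3) + V x * v x)" for x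
    by (simp add: \<gamma>_def two_layer_def F_def H_def V_def layer_def inner_real3 algebra_simps)
  have "(LINT x|lebesgue. f x * layer (\<lambda>x. \<zeta> x * Wu x) (\<lambda>x. \<zeta> x * Wl x) x)
      = (LINT x|lebesgue. (F 1 x * G x $ 1 + F 2 x * G x $ 2 + F 3 x * G x $ 3) + ((H 1 x * G x $ 1 + H 2 x * G x $ 2 + H 3 x * G x $ 3) + V x * v x))"
  proof -
    have wt: "\<And>\<phi> g. has_weak_gradient \<phi> g \<Longrightarrow>
        (LINT x|lebesgue. \<gamma> x * (G x \<bullet> g x) + \<tau>\<^sup>2 * v x * \<phi> x) = (LINT x|lebesgue. f x * \<phi> x)"
      using w by (simp add: wsol_def \<gamma>_def)
    show ?thesis using wt[OF ww] unfolding e1 by (rule sym)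
  qed
  also have "\<dots> = ((LINT x|lebesgue. F 1 x * G x $ 1) + (LINT x|lebesgue. F 2 x * G x $ 2) + (LINT x|lebesgue. F 3 x * G x $ 3))
      + (LINT x|lebesgue. ((H 1 x * G x $ 1 + H 2 x * G x $ 2 + H 3 x * G x $ 3) + V x * v x))"
    using iF iH iV by simp
  also have "\<dots> \<le> (- (LINT x|lebesgue. F' 1 x * v x) + - (LINT x|lebesgue. F' 2 x * v x) + - (LINT x|lebesgue. F' 3 x * v x))
      + (LINT x|lebesgue. ((H 1 x * G x $ 1 + H 2 x * G x $ 2 + H 3 x * G x $ 3) + V x * v x))"
    by (intro add_mono ibp order_refl)
  also have "\<dots> = (LINT x|lebesgue. ((H 1 x * G x $ 1 + H 2 x * G x $ 2 + H 3 x * G x $ 3) + V x * v x) - (F' 1 x * v x + F' 2 x * v x + F' 3 x * v x))"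
    using iF' iH iV by simp
  also have "\<dots> \<le> (LINT x|lebesgue. \<gamma> x * (W x * (G x \<bullet> gz x) - (D x \<bullet> gz x) * v x))"
  proof (rule integral_mono_AE)
    show "integrable lebesgue (\<lambda>x. ((H 1 x * G x $ 1 + H 2 x * G x $ 2 + H 3 x * G x $ 3) + V x * v x) - (F' 1 x * v x + F' 2 x * v x + F' 3 x * v x))"
      using iF' iH iV by simp
    show "integrable lebesgue (\<lambda>x. \<gamma> x * (W x * (G x \<bullet> gz x) - (D x \<bullet> gz x) * v x))"
    proof -
      define E where "E i = layer (\<lambda>x. \<gamma>p * (gz x $ i * du x $ i)) (\<lambda>x. \<gamma>m * (gz x $ i * dl x $ i))" for i
      have iE: "integrable lebesgue (\<lambda>x. E i x * v x)" for i
        unfolding E_def by (rule layer_mult_integrable[OF cm[OF c2[OF cdu]] _ cm[OF c2[OF cdl]] _ lv, where r=r]) (use \<zeta>(7) in auto)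
      have "integrable lebesgue (\<lambda>x. (H 1 x * G x $ 1 + H 2 x * G x $ 2 + H 3 x * G x $ 3) - (E 1 x * v x + E 2 x * v x + E 3 x * v x))"
        using iE iH by simp
      also have "(\<lambda>x. (H 1 x * G x $ 1 + H 2 x * G x $ 2 + H 3 x * G x $ 3) - (E 1 x * v x + E 2 x * v x + E 3 x * v x))
          = (\<lambda>x. \<gamma> x * (W x * (G x \<bullet> gz x) - (D x \<bullet> gz x) * v x))"
        by (simp add: fun_eq_iff \<gamma>_def two_layer_def H_def E_def W_def D_def layer_def inner_real3 algebra_simps)
      finally show ?thesis .
    qed
    \<comment> \<open>The terms in which \<open>\<zeta>\<close> is not differentiated combine to
      \<open>\<zeta> v\<close> times the difference of \<open>\<tau>\<^sup>2 W\<close> and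
      \<open>\<gamma>\<close> times the Laplacian of \<open>W\<close>. This is nonpositive and is
      dropped.\<close>
    show "AE x in lebesgue. ((H 1 x * G x $ 1 + H 2 x * G x $ 2 + H 3 x * G x $ 3) + V x * v x) - (F' 1 x * v x + F' 2 x * v x + F' 3 x * v x)
        \<le> \<gamma> x * (W x * (G x \<bullet> gz x) - (D x \<bullet> gz x) * v x)"
      using v
    proof eventually_elim
      case (elim x)
      show ?case
      proof (cases "x $ 3 > 0")
        case True
        have "\<tau>\<^sup>2 * (\<zeta> x * Wu x) \<le> \<gamma>p * (\<zeta> x * (su 1 x + su 2 x + su 3 x))"
        proof (cases "\<zeta> x > 0")
          case T: True
          then show ?thesis using mult_left_mono[OF sub(1)[OF True T] \<zeta>(8)[of x]] by (simp add: mult_ac)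
        qed (use \<zeta>(8)[of x] in simp)
        from mult_right_mono[OF this elim] show ?thesis
          using True by (simp add: \<gamma>_def two_layer_def H_def V_def F'_def W_def D_def layer_def inner_real3 algebra_simps)
      next
        case False
        have "\<tau>\<^sup>2 * (\<zeta> x * Wl x) \<le> \<gamma>m * (\<zeta> x * (sl 1 x + sl 2 x + sl 3 x))"
        proof (cases "\<zeta> x > 0")
          case T: True
          then show ?thesis using mult_left_mono[OF sub(2)[OF _ T] \<zeta>(8)[of x]] False by (simp add: mult_ac)
        qed (use \<zeta>(8)[of x] in simp)
        from mult_right_mono[OF this elim] show ?thesis
          using False by (simp add: \<gamma>_def two_layer_def H_def V_def F'_def W_def D_def layer_def inner_real3 algebra_simps)
      qed
    qed
  qed
  also have "(\<lambda>x. layer (\<lambda>x. \<zeta> x * Wu x) (\<lambda>x. \<zeta> x * Wl x) x) = (\<lambda>x. \<zeta> x * W x)"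
    by (simp add: fun_eq_iff W_def layer_def)
  finally show ?thesis by (simp add: \<gamma>_def W_def D_def layer_def cong: if_cong)
qed

section \<open>The beam\<close>

lemma norm_line_DERIV:
  fixes y c :: "'a::euclidean_space"
  assumes "y \<noteq> 0"
  shows "((\<lambda>t. norm (y + t *\<^sub>R c)) has_real_derivative (y \<bullet> c) / norm y) (at 0)"
    and "((\<lambda>t. ((y + t *\<^sub>R c) \<bullet> c) / norm (y + t *\<^sub>R c)) has_real_derivative
      ((norm c)\<^sup>2 - ((y \<bullet> c) / norm y)\<^sup>2) / norm y) (at 0)"
proof -
  have eq: "norm (y + t *\<^sub>R c) = sqrt ((norm y)\<^sup>2 + 2 * t * (y \<bullet> c) + t\<^sup>2 * (norm c)\<^sup>2)" for t
    unfolding norm_eq_sqrt_inner[of "y + t *\<^sub>R c"] power2_norm_eq_inner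
    by (simp add: inner_add inner_commute power2_eq_square algebra_simps)
  have pos: "norm y > 0" using assms by simp
  show 1: "((\<lambda>t. norm (y + t *\<^sub>R c)) has_real_derivative (y \<bullet> c) / norm y) (at 0)"
    unfolding eq using pos by (auto intro!: derivative_eq_intros simp: field_simps)
  have 2: "((\<lambda>t. (y + t *\<^sub>R c) \<bullet> c) has_real_derivative (norm c)\<^sup>2) (at 0)"
    by (auto intro!: derivative_eq_intros simp: inner_add_left power2_norm_eq_inner)
  have "((\<lambda>t. ((y + t *\<^sub>R c) \<bullet> c) / norm (y + t *\<^sub>R c)) has_real_derivative
      ((norm c)\<^sup>2 * norm (y + 0 *\<^sub>R c) - ((y + 0 *\<^sub>R c) \<bullet> c) * ((y \<bullet> c) / norm y)) / (norm (y + 0 *\<^sub>R c) * norm (y + 0 *\<^sub>R c))) (at 0)"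
    by (rule DERIV_divide[OF 2 1]) (use pos in simp)
  then show "((\<lambda>t. ((y + t *\<^sub>R c) \<bullet> c) / norm (y + t *\<^sub>R c)) has_real_derivative
      ((norm c)\<^sup>2 - ((y \<bullet> c) / norm y)\<^sup>2) / norm y) (at 0)"
    by (rule DERIV_cong) (use pos in \<open>simp add: field_simps power2_eq_square\<close>)
qed

context
  fixes k sg kap rho lm m1 m2 :: real and q :: "real^3"
begin

definition lower_exp :: "real^3 \<Rightarrow> real" where
  "lower_exp x = exp (- (k * (norm (x - q) - rho)))"

text \<open>The last factor is a boundary layer on the radial wave: it tends to one below the
  interface on the scale \<open>1/sg\<close> and falls to \<open>1 - kap\<close> at the interface,
  with a slope of order \<open>sg\<close> that supplies the flux.\<close>

definition lower_wave :: "real^3 \<Rightarrow> real" where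
  "lower_wave x = lower_exp x * (1 - kap * exp (sg * x $ 3))"

definition lower_grad :: "real^3 \<Rightarrow> real^3" where
  "lower_grad x = (\<chi> i. - k * (((x - q) \<bullet> axis i 1) / norm (x - q)) * lower_wave x
     - (if i = 3 then kap * sg * exp (sg * x $ 3) * lower_exp x else 0))"

definition lower_second :: "3 \<Rightarrow> real^3 \<Rightarrow> real" where
  "lower_second i x = (let u = ((x - q) \<bullet> axis i 1) / norm (x - q) in
     (k\<^sup>2 * u\<^sup>2 - k * ((1 - u\<^sup>2) / norm (x - q))) * lower_wave x
     + (if i = 3 then kap * sg * exp (sg * x $ 3) * (2 * k * u - sg) * lower_exp x else 0))"

lemma axis_line_component: "(x + t *\<^sub>R axis i 1) $ 3 = (x::real^3) $ 3 + (if i = 3 then t else 0)"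
  by (simp add: axis_def)

lemma lower_DERIV:
  assumes "x \<noteq> q"
  shows "((\<lambda>t. lower_wave (x + t *\<^sub>R axis i 1)) has_real_derivative lower_grad x $ i) (at 0)"
    and "((\<lambda>t. lower_grad (x + t *\<^sub>R axis i 1) $ i) has_real_derivative lower_second i x) (at 0)"
proof -
  let ?e = "axis i 1 :: real^3"
  define u where "u = ((x - q) \<bullet> ?e) / norm (x - q)"
  have y: "x - q \<noteq> 0" using assms by simp
  have R: "((\<lambda>t. norm (x + t *\<^sub>R ?e - q)) has_real_derivative u) (at 0)"
    using norm_line_DERIV(1)[OF y, of ?e] by (simp add: u_def algebra_simps)
  have dU: "((\<lambda>t. ((x + t *\<^sub>R ?e - q) \<bullet> ?e) / norm (x + t *\<^sub>R ?e - q)) has_real_derivative (1 - u\<^sup>2) / norm (x - q)) (at 0)"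
    using norm_line_DERIV(2)[OF y, of ?e] by (simp add: u_def algebra_simps norm_axis_1)
  have E: "((\<lambda>t. lower_exp (x + t *\<^sub>R ?e)) has_real_derivative - k * u * lower_exp x) (at 0)"
    unfolding lower_exp_def by (auto intro!: derivative_eq_intros R)
  define d :: real where "d = (if i = 3 then 1 else 0)"
  have S: "((\<lambda>t. exp (sg * (x + t *\<^sub>R ?e) $ 3)) has_real_derivative sg * d * exp (sg * x $ 3)) (at 0)"
    unfolding axis_line_component by (cases "i = 3") (auto intro!: derivative_eq_intros simp: d_def)
  have W: "((\<lambda>t. lower_wave (x + t *\<^sub>R ?e)) has_real_derivative
      - k * u * lower_wave x - d * (kap * sg * exp (sg * x $ 3) * lower_exp x)) (at 0)"
    unfolding lower_wave_def by (rule derivative_eq_intros E S refl)+ (simp add: algebra_simps)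
  then show "((\<lambda>t. lower_wave (x + t *\<^sub>R ?e)) has_real_derivative lower_grad x $ i) (at 0)"
    by (rule DERIV_cong) (simp add: lower_grad_def u_def d_def)
  define Uf where "Uf t = ((x + t *\<^sub>R ?e - q) \<bullet> ?e) / norm (x + t *\<^sub>R ?e - q)" for t
  have dUf: "(Uf has_real_derivative (1 - u\<^sup>2) / norm (x - q)) (at 0)" using dU by (simp add: Uf_def[abs_def])
  have Uf0: "Uf 0 = u" by (simp add: Uf_def u_def)
  have "((\<lambda>t. - k * Uf t * lower_wave (x + t *\<^sub>R ?e)
      - d * (kap * sg * exp (sg * (x + t *\<^sub>R ?e) $ 3) * lower_exp (x + t *\<^sub>R ?e))) has_real_derivative
      - k * ((1 - u\<^sup>2) / norm (x - q)) * lower_wave x - k * u * (- k * u * lower_wave x - d * (kap * sg * exp (sg * x $ 3) * lower_exp x))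
      - d * (kap * sg * (sg * d * exp (sg * x $ 3)) * lower_exp x + kap * sg * exp (sg * x $ 3) * (- k * u * lower_exp x))) (at 0)"
    by (rule dUf W E S refl derivative_eq_intros)+ (simp add: Uf0 algebra_simps)
  moreover have "(\<lambda>t. - k * Uf t * lower_wave (x + t *\<^sub>R ?e)
      - d * (kap * sg * exp (sg * (x + t *\<^sub>R ?e) $ 3) * lower_exp (x + t *\<^sub>R ?e))) = (\<lambda>t. lower_grad (x + t *\<^sub>R ?e) $ i)"
    by (simp add: fun_eq_iff lower_grad_def d_def Uf_def)
  moreover have "- k * ((1 - u\<^sup>2) / norm (x - q)) * lower_wave x - k * u * (- k * u * lower_wave x - d * (kap * sg * exp (sg * x $ 3) * lower_exp x))
      - d * (kap * sg * (sg * d * exp (sg * x $ 3)) * lower_exp x + kap * sg * exp (sg * x $ 3) * (- k * u * lower_exp x)) = lower_second i x"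
    unfolding lower_second_def Let_def u_def[symmetric]
    by (cases "i = 3") (simp_all add: d_def power2_eq_square divide_inverse algebra_simps)
  ultimately show "((\<lambda>t. lower_grad (x + t *\<^sub>R ?e) $ i) has_real_derivative lower_second i x) (at 0)" by simp
qed

lemma lower_continuous:
  "continuous_on (- {q}) lower_wave" "continuous_on (- {q}) lower_grad" "continuous_on (- {q}) (lower_second i)"
proof -
  have E: "continuous_on (- {q}) lower_exp" unfolding lower_exp_def by (intro continuous_intros)
  show W: "continuous_on (- {q}) lower_wave" unfolding lower_wave_def by (intro continuous_intros E)
  have c: "continuous_on (- {q}) (\<lambda>x. ((x - q) \<bullet> axis j 1) / norm (x - q))" for j
    by (intro continuous_intros) auto
  show "continuous_on (- {q}) lower_grad" unfolding lower_grad_def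
  proof (intro continuous_on_vec_lambda)
    fix j :: 3
    show "continuous_on (- {q}) (\<lambda>x. - k * (((x - q) \<bullet> axis j 1) / norm (x - q)) * lower_wave x
        - (if j = 3 then kap * sg * exp (sg * x $ 3) * lower_exp x else 0))"
      by (cases "j = 3") (auto intro!: continuous_intros E W c)
  qed
  have n: "continuous_on (- {q}) (\<lambda>x. (1 - (((x - q) \<bullet> axis i 1) / norm (x - q))\<^sup>2) / norm (x - q))"
    by (intro continuous_on_divide continuous_on_diff continuous_on_power continuous_on_const c continuous_intros) auto
  show "continuous_on (- {q}) (lower_second i)" unfolding lower_second_def Let_def
    by (cases "i = 3") (auto intro!: continuous_on_add continuous_on_mult continuous_on_diff continuous_on_power continuous_on_const n c E W continuous_intros)
qed

text \<open>The squares of the direction cosines add up to one. The term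
  \<open>2 * k / norm (x - q)\<close> is the curvature of the spherical fronts, and the last summand
  is the contribution of the boundary layer, with the cross term between the two
  exponentials.\<close>

lemma lower_laplacian:
  assumes "x \<noteq> q"
  shows "lower_second 1 x + lower_second 2 x + lower_second 3 x =
    (k\<^sup>2 - 2 * k / norm (x - q)) * lower_wave x
    + kap * sg * exp (sg * x $ 3) * (2 * k * ((x $ 3 - q $ 3) / norm (x - q)) - sg) * lower_exp x"
proof -
  define R where "R = norm (x - q)"
  have R: "R > 0" using assms by (simp add: R_def)
  have "(x $ 1 - q $ 1)\<^sup>2 + (x $ 2 - q $ 2)\<^sup>2 + (x $ 3 - q $ 3)\<^sup>2 = R\<^sup>2"
    unfolding R_def power2_norm_eq_inner by (simp add: inner_vec_def sum_3 power2_eq_square)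
  then have s: "((x $ 1 - q $ 1) / R)\<^sup>2 + ((x $ 2 - q $ 2) / R)\<^sup>2 + ((x $ 3 - q $ 3) / R)\<^sup>2 = 1"
    using R by (simp add: power_divide add_divide_distrib[symmetric])
  define u1 where "u1 = (x $ 1 - q $ 1) / R"
  define u2 where "u2 = (x $ 2 - q $ 2) / R"
  define u3 where "u3 = (x $ 3 - q $ 3) / R"
  have s': "u1\<^sup>2 + u2\<^sup>2 + u3\<^sup>2 = 1" using s by (simp add: u1_def u2_def u3_def)
  have "lower_second 1 x + lower_second 2 x + lower_second 3 x =
      (k\<^sup>2 * (u1\<^sup>2 + u2\<^sup>2 + u3\<^sup>2) - k * ((3 - (u1\<^sup>2 + u2\<^sup>2 + u3\<^sup>2)) / R)) * lower_wave x
      + kap * sg * exp (sg * x $ 3) * (2 * k * u3 - sg) * lower_exp x"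
  proof -
    have eqs: "((x - q) \<bullet> axis 1 1) / R = u1" "((x - q) \<bullet> axis 2 1) / R = u2" "((x - q) \<bullet> axis 3 1) / R = u3"
      by (simp_all add: inner_axis_real3 u1_def u2_def u3_def)
    show ?thesis unfolding lower_second_def Let_def R_def[symmetric] eqs by (simp add: divide_inverse algebra_simps)
  qed
  then show ?thesis unfolding s' by (simp add: u3_def R_def)
qed

text \<open>The vector from \<open>q\<close> to the foot of \<open>x\<close> on the interface,
  reached along the direction \<open>(m1, m2, 1)\<close>. Its third component is constant, so it
  never vanishes for \<open>q\<close> off the interface.\<close>

definition upper_vec :: "real^3 \<Rightarrow> real^3" where
  "upper_vec x = vector [x $ 1 - m1 * x $ 3 - q $ 1, x $ 2 - m2 * x $ 3 - q $ 2, - q $ 3]"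

text \<open>The derivative of \<open>upper_vec\<close> along the \<open>i\<close>-th coordinate
  axis.\<close>

definition upper_dir :: "3 \<Rightarrow> real^3" where
  "upper_dir i = (if i = 3 then vector [- m1, - m2, 0] else axis i 1)"

text \<open>The trace of the lower wave at the foot of \<open>x\<close>, damped at the rate
  \<open>lm\<close> per unit of height. The transport is along parallel lines, with one fixed
  direction for the whole beam.\<close>

definition upper_wave :: "real^3 \<Rightarrow> real" where
  "upper_wave x = (1 - kap) * exp (- (k * (norm (upper_vec x) - rho)) - lm * x $ 3)"

definition upper_grad :: "real^3 \<Rightarrow> real^3" where
  "upper_grad x = (\<chi> i. - (k * ((upper_vec x \<bullet> upper_dir i) / norm (upper_vec x)) + (if i = 3 then lm else 0)) * upper_wave x)"

definition upper_second :: "3 \<Rightarrow> real^3 \<Rightarrow> real" where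
  "upper_second i x = (let u = (upper_vec x \<bullet> upper_dir i) / norm (upper_vec x) in
     ((k * u + (if i = 3 then lm else 0))\<^sup>2 - k * (((norm (upper_dir i))\<^sup>2 - u\<^sup>2) / norm (upper_vec x))) * upper_wave x)"

lemma upper_vec_line: "upper_vec (x + t *\<^sub>R axis i 1) = upper_vec x + t *\<^sub>R upper_dir i"
proof -
  consider "i = 1" | "i = 2" | "i = 3" using exhaust_3 by blast
  then show ?thesis
    by cases (simp_all add: upper_vec_def upper_dir_def vec_eq_iff forall_3 axis_def algebra_simps)
qed

lemma upper_DERIV:
  assumes "q $ 3 \<noteq> 0"
  shows "((\<lambda>t. upper_wave (x + t *\<^sub>R axis i 1)) has_real_derivative upper_grad x $ i) (at 0)"
    and "((\<lambda>t. upper_grad (x + t *\<^sub>R axis i 1) $ i) has_real_derivative upper_second i x) (at 0)"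
proof -
  let ?e = "axis i 1 :: real^3"
  define u where "u = (upper_vec x \<bullet> upper_dir i) / norm (upper_vec x)"
  have "upper_vec x $ 3 \<noteq> 0" using assms by (simp add: upper_vec_def)
  then have y: "upper_vec x \<noteq> 0" by auto
  note R = norm_line_DERIV(1)[OF y, of "upper_dir i", folded u_def]
  note dU = norm_line_DERIV(2)[OF y, of "upper_dir i", folded u_def]
  define d where "d = (if i = 3 then lm else 0)"
  have L: "lm * (x + t *\<^sub>R ?e) $ 3 = lm * x $ 3 + t * d" for t by (simp add: axis_def d_def algebra_simps)
  have W: "((\<lambda>t. upper_wave (x + t *\<^sub>R ?e)) has_real_derivative - (k * u + d) * upper_wave x) (at 0)"
    unfolding upper_wave_def upper_vec_line L
    by (rule derivative_eq_intros R refl)+ (simp add: L[of 0, simplified] algebra_simps)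
  then show "((\<lambda>t. upper_wave (x + t *\<^sub>R ?e)) has_real_derivative upper_grad x $ i) (at 0)"
    by (rule DERIV_cong) (simp add: upper_grad_def u_def d_def)
  define Uf where "Uf t = ((upper_vec x + t *\<^sub>R upper_dir i) \<bullet> upper_dir i) / norm (upper_vec x + t *\<^sub>R upper_dir i)" for t
  have dUf: "(Uf has_real_derivative ((norm (upper_dir i))\<^sup>2 - u\<^sup>2) / norm (upper_vec x)) (at 0)" using dU by (simp add: Uf_def[abs_def])
  have Uf0: "Uf 0 = u" by (simp add: Uf_def u_def)
  have "((\<lambda>t. - (k * Uf t + d) * upper_wave (x + t *\<^sub>R ?e))
      has_real_derivative - (k * (((norm (upper_dir i))\<^sup>2 - u\<^sup>2) / norm (upper_vec x))) * upper_wave x + - (k * u + d) * (- (k * u + d) * upper_wave x)) (at 0)"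
    by (rule dUf W refl derivative_eq_intros)+ (simp add: Uf0 algebra_simps)
  moreover have "(\<lambda>t. - (k * Uf t + d) * upper_wave (x + t *\<^sub>R ?e))
      = (\<lambda>t. upper_grad (x + t *\<^sub>R ?e) $ i)"
    by (simp add: fun_eq_iff upper_grad_def upper_vec_line d_def Uf_def)
  moreover have "- (k * (((norm (upper_dir i))\<^sup>2 - u\<^sup>2) / norm (upper_vec x))) * upper_wave x + - (k * u + d) * (- (k * u + d) * upper_wave x) = upper_second i x"
    unfolding upper_second_def Let_def u_def[symmetric] d_def[symmetric] by (simp add: power2_eq_square algebra_simps)
  ultimately show "((\<lambda>t. upper_grad (x + t *\<^sub>R ?e) $ i) has_real_derivative upper_second i x) (at 0)" by simp
qed

lemma upper_continuous:
  assumes "q $ 3 \<noteq> 0"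
  shows "continuous_on S upper_wave" "continuous_on S upper_grad" "continuous_on S (upper_second i)"
proof -
  have "upper_vec x $ 3 \<noteq> 0" for x using assms by (simp add: upper_vec_def)
  then have nz: "norm (upper_vec x) \<noteq> 0" for x by (metis norm_eq_zero zero_index)
  have V: "continuous_on S upper_vec"
  proof -
    have "upper_vec = (\<lambda>x. \<chi> i. if i = 1 then x $ 1 - m1 * x $ 3 - q $ 1 else if i = 2 then x $ 2 - m2 * x $ 3 - q $ 2 else - q $ 3)"
      by (simp add: fun_eq_iff upper_vec_def vec_eq_iff forall_3)
    moreover have "continuous_on S (\<lambda>x. if i = 1 then x $ 1 - m1 * x $ 3 - q $ 1 else if i = 2 then x $ 2 - m2 * x $ 3 - q $ 2 else - q $ 3)" for i :: 3
      by (cases "i = 1"; cases "i = 2") (auto intro!: continuous_intros)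
    ultimately show ?thesis by (simp add: continuous_on_vec_lambda)
  qed
  show W: "continuous_on S upper_wave" unfolding upper_wave_def by (intro continuous_intros V)
  have c: "continuous_on S (\<lambda>x. (upper_vec x \<bullet> upper_dir j) / norm (upper_vec x))" for j
    using nz by (intro continuous_intros V) auto
  show "continuous_on S upper_grad" unfolding upper_grad_def
    by (intro continuous_on_vec_lambda continuous_on_mult continuous_on_minus continuous_on_add continuous_on_const c W)
  have n: "continuous_on S (\<lambda>x. ((norm (upper_dir i))\<^sup>2 - ((upper_vec x \<bullet> upper_dir i) / norm (upper_vec x))\<^sup>2) / norm (upper_vec x))"
    using nz by (intro continuous_on_divide continuous_on_diff continuous_on_power continuous_on_const c continuous_on_norm V) auto
  show "continuous_on S (upper_second i)" unfolding upper_second_def Let_def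
    by (intro continuous_on_mult continuous_on_diff continuous_on_power continuous_on_add continuous_on_const n c W)
qed

text \<open>The Cauchy-Schwarz inequality for \<open>lm = (lm - k s) + k s\<close> makes the beam direction \<open>(m1, m2, 1)\<close> optimal.\<close>

lemma upper_laplacian_ge:
  assumes q: "q $ 3 < 0" and k: "k \<ge> 0" and kap: "kap \<le> 1"
  shows "(lm\<^sup>2 / (1 + m1\<^sup>2 + m2\<^sup>2) - k * (2 + m1\<^sup>2 + m2\<^sup>2) / \<bar>q $ 3\<bar>) * upper_wave x
      \<le> upper_second 1 x + upper_second 2 x + upper_second 3 x"
proof -
  define P where "P = norm (upper_vec x)"
  \<comment> \<open>This bounds the denominator of the curvature term below by
    \<open>\<bar>q $ 3\<bar>\<close>, uniformly in \<open>x\<close>.\<close>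
  have "\<bar>upper_vec x $ 3\<bar> \<le> P" unfolding P_def by (rule component_le_norm_cart)
  then have P: "P \<ge> \<bar>q $ 3\<bar>" "P > 0" using q by (auto simp: upper_vec_def)
  define a1 where "a1 = (x $ 1 - m1 * x $ 3 - q $ 1) / P"
  define a2 where "a2 = (x $ 2 - m2 * x $ 3 - q $ 2) / P"
  define s where "s = m1 * a1 + m2 * a2"
  have u: "(upper_vec x \<bullet> upper_dir 1) / P = a1" "(upper_vec x \<bullet> upper_dir 2) / P = a2" "(upper_vec x \<bullet> upper_dir 3) / P = - s"
    by (simp_all add: upper_vec_def upper_dir_def inner_vec_def sum_3 axis_def a1_def a2_def s_def divide_inverse algebra_simps)
  have nd: "(norm (upper_dir 1))\<^sup>2 = 1" "(norm (upper_dir 2))\<^sup>2 = 1" "(norm (upper_dir 3))\<^sup>2 = m1\<^sup>2 + m2\<^sup>2"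
    unfolding power2_norm_eq_inner by (simp_all add: upper_dir_def inner_vec_def sum_3 axis_def power2_eq_square)
  have sum: "upper_second 1 x + upper_second 2 x + upper_second 3 x =
      (k\<^sup>2 * (a1\<^sup>2 + a2\<^sup>2) + (lm - k * s)\<^sup>2 - k * ((2 + m1\<^sup>2 + m2\<^sup>2 - (a1\<^sup>2 + a2\<^sup>2 + s\<^sup>2)) / P)) * upper_wave x"
    unfolding upper_second_def Let_def P_def[symmetric] u nd
    by (simp add: power2_eq_square divide_inverse algebra_simps)
  define M where "M = 1 + m1\<^sup>2 + m2\<^sup>2"
  have M: "M > 0" by (simp add: M_def add_pos_nonneg)
  have cs: "lm\<^sup>2 \<le> M * (k\<^sup>2 * (a1\<^sup>2 + a2\<^sup>2) + (lm - k * s)\<^sup>2)"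
  proof -
    let ?X = "vector [1, m1, m2] :: real^3" and ?Y = "vector [lm - k * s, k * a1, k * a2] :: real^3"
    have "?X \<bullet> ?Y = lm" by (simp add: inner_vec_def sum_3 s_def algebra_simps)
    moreover have "?X \<bullet> ?X = M" by (simp add: inner_vec_def sum_3 M_def power2_eq_square)
    moreover have "?Y \<bullet> ?Y = k\<^sup>2 * (a1\<^sup>2 + a2\<^sup>2) + (lm - k * s)\<^sup>2"
      by (simp add: inner_vec_def sum_3 power2_eq_square algebra_simps)
    ultimately show ?thesis using Cauchy_Schwarz_ineq[of ?X ?Y] by simp
  qed
  have "k * ((2 + m1\<^sup>2 + m2\<^sup>2 - (a1\<^sup>2 + a2\<^sup>2 + s\<^sup>2)) / P) \<le> k * ((2 + m1\<^sup>2 + m2\<^sup>2) / \<bar>q $ 3\<bar>)"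
  proof (intro mult_left_mono k)
    have "(2 + m1\<^sup>2 + m2\<^sup>2 - (a1\<^sup>2 + a2\<^sup>2 + s\<^sup>2)) / P \<le> (2 + m1\<^sup>2 + m2\<^sup>2) / P"
    proof (rule divide_right_mono)
      have "0 \<le> a1\<^sup>2 + a2\<^sup>2 + s\<^sup>2" by (intro add_nonneg_nonneg zero_le_power2)
      then show "2 + m1\<^sup>2 + m2\<^sup>2 - (a1\<^sup>2 + a2\<^sup>2 + s\<^sup>2) \<le> 2 + m1\<^sup>2 + m2\<^sup>2" by linarith
    qed (use P in linarith)
    also have "\<dots> \<le> (2 + m1\<^sup>2 + m2\<^sup>2) / \<bar>q $ 3\<bar>"
    proof (rule divide_left_mono[OF P(1)])
      show "0 \<le> 2 + m1\<^sup>2 + m2\<^sup>2" by (intro add_nonneg_nonneg zero_le_power2) simp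
      show "0 < P * \<bar>q $ 3\<bar>" by (rule mult_pos_pos) (use P(2) q in auto)
    qed
    finally show "(2 + m1\<^sup>2 + m2\<^sup>2 - (a1\<^sup>2 + a2\<^sup>2 + s\<^sup>2)) / P \<le> (2 + m1\<^sup>2 + m2\<^sup>2) / \<bar>q $ 3\<bar>" .
  qed
  moreover have "lm\<^sup>2 / M \<le> k\<^sup>2 * (a1\<^sup>2 + a2\<^sup>2) + (lm - k * s)\<^sup>2" using cs M by (simp add: divide_le_eq mult.commute)
  moreover have "upper_wave x \<ge> 0" using kap by (simp add: upper_wave_def)
  ultimately show ?thesis unfolding sum M_def[symmetric]
    by (intro mult_right_mono) (auto simp: M_def)
qed

lemma interface_wave: "x $ 3 = 0 \<Longrightarrow> lower_wave x = upper_wave x"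
proof -
  assume x: "x $ 3 = 0"
  have "upper_vec x = x - q" using x by (simp add: upper_vec_def vec_eq_iff forall_3)
  then show ?thesis using x by (simp add: lower_wave_def upper_wave_def lower_exp_def)
qed

text \<open>Below the interface the radial part of the wave decreases upwards and only helps, so
  just the slope of the boundary layer is kept. Above, the wave falls at most at the relative rate
  \<open>k * sqrt (m1\<^sup>2 + m2\<^sup>2) + lm\<close>; the hypothesis \<open>flux\<close> lets
  the layer outweigh this.\<close>

lemma interface_flux:
  assumes x: "x $ 3 = 0" and q: "q $ 3 < 0" and k: "k \<ge> 0" and kap: "kap \<le> 1" and g: "\<gamma>p > 0" "\<gamma>m > 0"
    and flux: "\<gamma>p * (1 - kap) * (k * sqrt (m1\<^sup>2 + m2\<^sup>2) + lm) \<le> \<gamma>m * kap * sg"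
  shows "\<gamma>m * lower_grad x $ 3 \<le> \<gamma>p * upper_grad x $ 3"
proof -
  have v: "upper_vec x = x - q" using x by (simp add: upper_vec_def vec_eq_iff forall_3)
  have R: "norm (x - q) > 0" using x q by auto
  define E where "E = lower_exp x"
  have E: "E > 0" by (simp add: E_def lower_exp_def)
  have "lower_grad x $ 3 \<le> - (kap * sg) * E"
  proof -
    have "k * (((x - q) \<bullet> axis 3 1) / norm (x - q)) * lower_wave x \<ge> 0"
      using x q k kap R by (intro mult_nonneg_nonneg divide_nonneg_nonneg) (auto simp: inner_axis_real3 lower_wave_def lower_exp_def)
    then show ?thesis using x by (simp add: lower_grad_def E_def)
  qed
  then have 1: "\<gamma>m * lower_grad x $ 3 \<le> \<gamma>m * (- (kap * sg) * E)" using g by (intro mult_left_mono) auto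
  have "(x - q) \<bullet> upper_dir 3 \<le> norm (x - q) * norm (upper_dir 3)" by (rule norm_cauchy_schwarz)
  moreover have "norm (upper_dir 3) = sqrt (m1\<^sup>2 + m2\<^sup>2)"
    by (simp add: upper_dir_def norm_eq_sqrt_inner inner_vec_def sum_3 power2_eq_square)
  ultimately have "((x - q) \<bullet> upper_dir 3) / norm (x - q) \<le> sqrt (m1\<^sup>2 + m2\<^sup>2)" using R by (simp add: divide_le_eq mult.commute)
  then have "k * (((x - q) \<bullet> upper_dir 3) / norm (x - q)) \<le> k * sqrt (m1\<^sup>2 + m2\<^sup>2)" by (intro mult_left_mono k)
  moreover have W: "upper_wave x = (1 - kap) * E" using interface_wave[OF x] x by (simp add: lower_wave_def E_def mult.commute)
  ultimately have "upper_grad x $ 3 \<ge> - (k * sqrt (m1\<^sup>2 + m2\<^sup>2) + lm) * ((1 - kap) * E)"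
    unfolding upper_grad_def v W using kap E by (auto intro!: mult_right_mono)
  then have 2: "\<gamma>p * upper_grad x $ 3 \<ge> \<gamma>p * (- (k * sqrt (m1\<^sup>2 + m2\<^sup>2) + lm) * ((1 - kap) * E))" using g by (intro mult_left_mono) auto
  have "\<gamma>p * (1 - kap) * (k * sqrt (m1\<^sup>2 + m2\<^sup>2) + lm) * E \<le> \<gamma>m * kap * sg * E" using flux E by (intro mult_right_mono) auto
  then have "\<gamma>m * (- (kap * sg) * E) \<le> \<gamma>p * (- (k * sqrt (m1\<^sup>2 + m2\<^sup>2) + lm) * ((1 - kap) * E))" by (simp add: algebra_simps)
  then show ?thesis using 1 2 by linarith
qed

end

section \<open>Anisotropic boxes\<close>

lemma rotation_to:
  assumes "norm (\<nu>::real^3) = 1"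
  obtains F :: "real^3 \<Rightarrow> real^3" where "orthogonal_transformation F" "F (axis 3 1) = \<nu>"
  using orthogonal_transformation_exists[of "axis 3 1" \<nu>] assms by (auto simp: norm_axis_1)

lemma box_measure:
  assumes "a \<ge> 0" "b1 \<le> b2"
  shows "measure lebesgue (cbox (vector [-a, -a, b1]) (vector [a, a, b2] :: real^3)) = 4 * a\<^sup>2 * (b2 - b1)"
proof -
  let ?Q = "cbox (vector [-a, -a, b1]) (vector [a, a, b2] :: real^3)"
  have "measure lebesgue ?Q = measure lborel ?Q" by (rule measure_completion) simp
  also have "\<dots> = (\<Prod>i\<in>UNIV. (vector [a, a, b2] :: real^3) $ i - (vector [-a, -a, b1] :: real^3) $ i)"
    by (rule content_cbox_cart) (use assms in \<open>auto simp: interval_ne_empty_cart forall_3\<close>)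
  also have "\<dots> = (\<Prod>i\<in>{1, 2, 3}. (vector [a, a, b2] :: real^3) $ i - (vector [-a, -a, b1] :: real^3) $ i)"
    by (simp only: UNIV_3)
  also have "\<dots> = 4 * a\<^sup>2 * (b2 - b1)" by (simp add: power2_eq_square)
  finally show ?thesis .
qed

lemma slab_measure:
  assumes \<nu>: "norm (\<nu>::real^3) = 1" and ab: "a \<ge> 0" "b \<ge> 0"
  shows "emeasure lebesgue {x. norm (x - p) \<le> a \<and> \<bar>\<nu> \<bullet> (x - p)\<bar> \<le> b} \<le> ennreal (8 * a\<^sup>2 * b)"
proof -
  obtain F :: "real^3 \<Rightarrow> real^3" where F: "orthogonal_transformation F" "F (axis 3 1) = \<nu>" using rotation_to[OF \<nu>] .
  define Q :: "(real^3) set" where "Q = cbox (vector [-a, -a, -b]) (vector [a, a, b])"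
  have "{x. norm (x - p) \<le> a \<and> \<bar>\<nu> \<bullet> (x - p)\<bar> \<le> b} \<subseteq> (+) p ` (F ` Q)"
  proof
    fix x assume x: "x \<in> {x. norm (x - p) \<le> a \<and> \<bar>\<nu> \<bullet> (x - p)\<bar> \<le> b}"
    obtain \<xi> where \<xi>: "F \<xi> = x - p" using orthogonal_transformation_surj[OF F(1)] by (metis surjD)
    have "norm \<xi> \<le> a" using x \<xi> orthogonal_transformation_norm[OF F(1), of \<xi>] by simp
    then have c: "\<bar>\<xi> $ i\<bar> \<le> a" for i using component_le_norm_cart[of \<xi> i] by linarith
    have "\<xi> $ 3 = F \<xi> \<bullet> F (axis 3 1)"
      using F(1) by (simp add: orthogonal_transformation_def inner_axis_real3)
    then have "\<bar>\<xi> $ 3\<bar> \<le> b" using x by (simp add: \<xi> F(2) inner_commute)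
    then have "\<xi> \<in> Q" using c[of 1] c[of 2] by (auto simp: Q_def mem_box_cart forall_3 abs_le_iff)
    moreover have "x = p + F \<xi>" by (simp add: \<xi>)
    ultimately show "x \<in> (+) p ` (F ` Q)" by blast
  qed
  moreover have Qm: "Q \<in> lmeasurable" by (simp add: Q_def)
  then have FQ: "F ` Q \<in> lmeasurable" "measure lebesgue (F ` Q) = measure lebesgue Q"
    using measurable_orthogonal_image[OF F(1)] measure_orthogonal_image[OF F(1)] by auto
  then have T: "(+) p ` (F ` Q) \<in> lmeasurable" "measure lebesgue ((+) p ` (F ` Q)) = measure lebesgue Q"
    using measurable_translation measure_translation by metis+
  have "measure lebesgue Q = 8 * a\<^sup>2 * b"
    using box_measure[of a "-b" b] ab by (simp add: Q_def)
  ultimately have "emeasure lebesgue {x. norm (x - p) \<le> a \<and> \<bar>\<nu> \<bullet> (x - p)\<bar> \<le> b} \<le> emeasure lebesgue ((+) p ` (F ` Q))"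
    using T by (intro emeasure_mono) auto
  also have "\<dots> = ennreal (8 * a\<^sup>2 * b)"
    using T \<open>measure lebesgue Q = 8 * a\<^sup>2 * b\<close> by (simp add: emeasure_eq_measure2)
  finally show ?thesis .
qed

text \<open>A rotated box with square cross-section of half-width \<open>a\<close>; the last clause
  bounds the transversal distance by the half-diagonal of that square.\<close>

lemma tube_measure:
  assumes \<nu>: "norm (\<nu>::real^3) = 1" and ab: "a \<ge> 0" "b1 \<le> b2"
  obtains S where "S \<in> lmeasurable" "measure lebesgue S = 4 * a\<^sup>2 * (b2 - b1)"
    "\<And>x. x \<in> S \<Longrightarrow> b1 \<le> \<nu> \<bullet> (x - p) \<and> \<nu> \<bullet> (x - p) \<le> b2 \<and> (norm (x - p))\<^sup>2 \<le> 2 * a\<^sup>2 + (\<nu> \<bullet> (x - p))\<^sup>2"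
proof -
  obtain F :: "real^3 \<Rightarrow> real^3" where F: "orthogonal_transformation F" "F (axis 3 1) = \<nu>" using rotation_to[OF \<nu>] .
  define Q :: "(real^3) set" where "Q = cbox (vector [-a, -a, b1]) (vector [a, a, b2])"
  have Qm: "Q \<in> lmeasurable" by (simp add: Q_def)
  then have FQ: "F ` Q \<in> lmeasurable" "measure lebesgue (F ` Q) = measure lebesgue Q"
    using measurable_orthogonal_image[OF F(1)] measure_orthogonal_image[OF F(1)] by auto
  then have T: "(+) p ` (F ` Q) \<in> lmeasurable" "measure lebesgue ((+) p ` (F ` Q)) = measure lebesgue Q"
    using measurable_translation measure_translation by metis+
  have mQ: "measure lebesgue Q = 4 * a\<^sup>2 * (b2 - b1)"
    using box_measure[of a b1 b2] ab by (simp add: Q_def)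
  have "b1 \<le> \<nu> \<bullet> (x - p) \<and> \<nu> \<bullet> (x - p) \<le> b2 \<and> (norm (x - p))\<^sup>2 \<le> 2 * a\<^sup>2 + (\<nu> \<bullet> (x - p))\<^sup>2"
    if "x \<in> (+) p ` (F ` Q)" for x
  proof -
    obtain \<xi> where \<xi>: "\<xi> \<in> Q" "x - p = F \<xi>" using \<open>x \<in> (+) p ` (F ` Q)\<close> by auto
    have s: "\<nu> \<bullet> (x - p) = \<xi> $ 3"
    proof -
      have "F \<xi> \<bullet> F (axis 3 1) = \<xi> $ 3" using F(1) by (simp add: orthogonal_transformation_def inner_axis_real3)
      then show ?thesis by (simp add: \<xi>(2) F(2) inner_commute)
    qed
    have "norm (x - p) = norm \<xi>" using orthogonal_transformation_norm[OF F(1)] \<xi>(2) by simp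
    then have n: "(norm (x - p))\<^sup>2 = (\<xi> $ 1)\<^sup>2 + (\<xi> $ 2)\<^sup>2 + (\<xi> $ 3)\<^sup>2"
      using power2_norm_eq_inner[of \<xi>] unfolding inner_real3 by (simp add: power2_eq_square)
    have b: "\<bar>\<xi> $ 1\<bar> \<le> a" "\<bar>\<xi> $ 2\<bar> \<le> a" "b1 \<le> \<xi> $ 3" "\<xi> $ 3 \<le> b2"
      using \<xi>(1) by (auto simp: Q_def mem_box_cart forall_3 abs_le_iff)
    have "(\<xi> $ 1)\<^sup>2 \<le> a\<^sup>2" "(\<xi> $ 2)\<^sup>2 \<le> a\<^sup>2"
      using b(1,2) power_mono[of "\<bar>\<xi> $ 1\<bar>" a 2] power_mono[of "\<bar>\<xi> $ 2\<bar>" a 2] by auto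
    then show ?thesis using b n s by simp
  qed
  then show ?thesis using that[OF T(1)] T(2) mQ by simp
qed

lemma power2_exp_le: "x \<ge> 0 \<Longrightarrow> x\<^sup>2 / 2 \<le> exp (x::real)"
  using exp_lower_Taylor_quadratic[of x] by simp

lemma summable_square_exp:
  assumes "c > 0"
  shows "summable (\<lambda>n. (real n + 1)\<^sup>2 * exp (- (c * real n)))"
proof (rule summable_comparison_test')
  have "summable (\<lambda>n. exp (- (c / 2)) ^ n)" using assms by (intro summable_geometric) simp
  then show "summable (\<lambda>n. (8 / c\<^sup>2 * exp (c / 2)) * exp (- (c / 2)) ^ n)" by (rule summable_mult)
  fix n :: nat
  have "(c * (real n + 1) / 2)\<^sup>2 / 2 \<le> exp (c * (real n + 1) / 2)" using assms by (intro power2_exp_le) simp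
  then have "(real n + 1)\<^sup>2 \<le> 8 / c\<^sup>2 * exp (c * (real n + 1) / 2)"
    using assms by (simp add: field_simps power2_eq_square)
  then have "(real n + 1)\<^sup>2 * exp (- (c * real n)) \<le> 8 / c\<^sup>2 * exp (c * (real n + 1) / 2) * exp (- (c * real n))"
    by (intro mult_right_mono) auto
  also have "\<dots> = 8 / c\<^sup>2 * exp (c / 2) * exp (- (c / 2)) ^ n"
    by (simp add: exp_of_nat_mult[symmetric] exp_add[symmetric] mult.assoc field_simps)
  finally show "norm ((real n + 1)\<^sup>2 * exp (- (c * real n))) \<le> 8 / c\<^sup>2 * exp (c / 2) * exp (- (c / 2)) ^ n"
    by (simp add: abs_mult)
qed

text \<open>Where \<open>\<tau>\<close> times the inner bracket lies between \<open>n\<close> and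
  \<open>n + 1\<close>, the point is in a slab of radius \<open>sqrt ((n + 1) / \<tau>)\<close> and
  thickness of order \<open>(n + 1) / \<tau>\<close>, whose volume is of order
  \<open>(n + 1)\<^sup>2 / \<tau>\<^sup>2\<close>; the exponential makes the sum over
  \<open>n\<close> finite. This anisotropy is the source of the \<open>1/\<tau>\<close> in the norm
  of the beam.\<close>

lemma beam_profile_integral:
  assumes c: "c > 0"
  obtains A where "A > 0" "\<And>\<tau> \<nu> (p::real^3). \<tau> > 0 \<Longrightarrow> norm \<nu> = 1 \<Longrightarrow>
    (\<integral>\<^sup>+x. ennreal (exp (- (c * \<tau> * ((norm (x - p))\<^sup>2 + \<bar>\<nu> \<bullet> (x - p)\<bar>)))) \<partial>lebesgue) \<le> ennreal (A / \<tau>\<^sup>2)"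
proof -
  define a where "a n = 8 * ((real n + 1)\<^sup>2 * exp (- (c * real n)))" for n
  have a0: "a n \<ge> 0" for n by (simp add: a_def)
  have sa: "summable a" unfolding a_def by (intro summable_mult summable_square_exp c)
  define A where "A = (\<Sum>n. a n) + 1"
  have A: "A > 0" using suminf_nonneg[OF sa a0] by (simp add: A_def)
  have "(\<integral>\<^sup>+x. ennreal (exp (- (c * \<tau> * ((norm (x - p))\<^sup>2 + \<bar>\<nu> \<bullet> (x - p)\<bar>)))) \<partial>lebesgue) \<le> ennreal (A / \<tau>\<^sup>2)"
    if \<tau>: "\<tau> > 0" and \<nu>: "norm \<nu> = 1" for \<tau> \<nu> and p :: "real^3"
  proof -
    define S where "S n = {x. norm (x - p) \<le> sqrt ((real n + 1) / \<tau>) \<and> \<bar>\<nu> \<bullet> (x - p)\<bar> \<le> (real n + 1) / \<tau>}" for n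
    have Sm: "S n \<in> sets lebesgue" for n
    proof -
      have "closed (S n)" unfolding S_def
        by (intro closed_Collect_conj closed_Collect_le continuous_intros)
      then show ?thesis by auto
    qed
    have Sem: "emeasure lebesgue (S n) \<le> ennreal (8 * (real n + 1)\<^sup>2 / \<tau>\<^sup>2)" for n
    proof -
      have "emeasure lebesgue (S n) \<le> ennreal (8 * (sqrt ((real n + 1) / \<tau>))\<^sup>2 * ((real n + 1) / \<tau>))"
        unfolding S_def using \<tau> by (intro slab_measure \<nu>) auto
      also have "8 * (sqrt ((real n + 1) / \<tau>))\<^sup>2 * ((real n + 1) / \<tau>) = 8 * (real n + 1)\<^sup>2 / \<tau>\<^sup>2"
        using \<tau> by (simp add: power2_eq_square)
      finally show ?thesis .
    qed
    have pt: "ennreal (exp (- (c * \<tau> * ((norm (x - p))\<^sup>2 + \<bar>\<nu> \<bullet> (x - p)\<bar>)))) \<le> (\<Sum>n. ennreal (exp (- (c * real n))) * indicator (S n) x)" for x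
    proof -
      define t where "t = \<tau> * ((norm (x - p))\<^sup>2 + \<bar>\<nu> \<bullet> (x - p)\<bar>)"
      have t0: "t \<ge> 0" using \<tau> by (simp add: t_def)
      define n where "n = nat \<lfloor>t\<rfloor>"
      have n: "real n \<le> t" "t < real n + 1" using t0 by (auto simp: n_def)
      have "\<tau> * (norm (x - p))\<^sup>2 \<le> real n + 1" "\<tau> * \<bar>\<nu> \<bullet> (x - p)\<bar> \<le> real n + 1"
      proof -
        have "0 \<le> \<tau> * (norm (x - p))\<^sup>2" "0 \<le> \<tau> * \<bar>\<nu> \<bullet> (x - p)\<bar>" using \<tau> by auto
        then show "\<tau> * (norm (x - p))\<^sup>2 \<le> real n + 1" "\<tau> * \<bar>\<nu> \<bullet> (x - p)\<bar> \<le> real n + 1"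
          using n(2) unfolding t_def distrib_left by linarith+
      qed
      then have "(norm (x - p))\<^sup>2 \<le> (real n + 1) / \<tau>" "\<bar>\<nu> \<bullet> (x - p)\<bar> \<le> (real n + 1) / \<tau>"
        using \<tau> by (auto simp: field_simps)
      then have "x \<in> S n" by (simp add: S_def real_le_rsqrt)
      have "ennreal (exp (- (c * \<tau> * ((norm (x - p))\<^sup>2 + \<bar>\<nu> \<bullet> (x - p)\<bar>)))) \<le> ennreal (exp (- (c * real n)))"
        using mult_left_mono[OF n(1), of c] c by (intro ennreal_leI) (simp add: t_def mult.assoc)
      also have "\<dots> = ennreal (exp (- (c * real n))) * indicator (S n) x" using \<open>x \<in> S n\<close> by simp
      also have "\<dots> \<le> (\<Sum>n. ennreal (exp (- (c * real n))) * indicator (S n) x)"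
      proof -
        let ?g = "\<lambda>n. ennreal (exp (- (c * real n))) * indicator (S n) x"
        have "sum ?g {n} \<le> suminf ?g" by (rule sum_le_suminf[OF summableI]) auto
        then show ?thesis by (simp only: sum.insert[OF finite.emptyI] empty_iff not_False_eq_True sum.empty add_0_right)
      qed
      finally show ?thesis .
    qed
    have "(\<integral>\<^sup>+x. ennreal (exp (- (c * \<tau> * ((norm (x - p))\<^sup>2 + \<bar>\<nu> \<bullet> (x - p)\<bar>)))) \<partial>lebesgue)
        \<le> (\<integral>\<^sup>+x. (\<Sum>n. ennreal (exp (- (c * real n))) * indicator (S n) x) \<partial>lebesgue)"
      by (intro nn_integral_mono pt)
    also have "\<dots> = (\<Sum>n. \<integral>\<^sup>+x. ennreal (exp (- (c * real n))) * indicator (S n) x \<partial>lebesgue)"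
      using Sm by (intro nn_integral_suminf) auto
    also have "\<dots> = (\<Sum>n. ennreal (exp (- (c * real n))) * emeasure lebesgue (S n))"
      using Sm by (simp add: nn_integral_cmult_indicator)
    also have "\<dots> \<le> (\<Sum>n. ennreal (a n / \<tau>\<^sup>2))"
    proof (rule suminf_le)
      fix n
      have "ennreal (exp (- (c * real n))) * emeasure lebesgue (S n) \<le> ennreal (exp (- (c * real n))) * ennreal (8 * (real n + 1)\<^sup>2 / \<tau>\<^sup>2)"
        by (intro mult_left_mono Sem) auto
      also have "\<dots> = ennreal (a n / \<tau>\<^sup>2)" by (simp add: a_def ennreal_mult[symmetric] mult_ac)
      finally show "ennreal (exp (- (c * real n))) * emeasure lebesgue (S n) \<le> ennreal (a n / \<tau>\<^sup>2)" .
    qed auto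
    also have "\<dots> = ennreal (\<Sum>n. a n / \<tau>\<^sup>2)"
      using a0 \<tau> by (intro suminf_ennreal2 summable_divide sa) auto
    also have "(\<Sum>n. a n / \<tau>\<^sup>2) = (\<Sum>n. a n) / \<tau>\<^sup>2" by (rule suminf_divide[OF sa])
    also have "ennreal ((\<Sum>n. a n) / \<tau>\<^sup>2) \<le> ennreal (A / \<tau>\<^sup>2)"
      by (intro ennreal_leI divide_right_mono) (auto simp: A_def)
    finally show ?thesis .
  qed
  then show ?thesis using that[OF A] by blast
qed

lemma exp_neg_le:
  assumes a: "a > 0" and e: "\<epsilon> > 0" and t: "\<tau> > 0" "\<tau> \<ge> 2 / (a\<^sup>2 * \<epsilon>)"
  shows "\<tau> * exp (- (a * \<tau>)) \<le> (\<epsilon>::real)"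
proof -
  have "(a * \<tau>)\<^sup>2 / 2 \<le> exp (a * \<tau>)" using a t by (intro power2_exp_le) auto
  then have "exp (- (a * \<tau>)) \<le> 2 / (a * \<tau>)\<^sup>2" using a t by (simp add: exp_minus field_simps)
  then have "\<tau> * exp (- (a * \<tau>)) \<le> \<tau> * (2 / (a * \<tau>)\<^sup>2)" using t by (intro mult_left_mono) auto
  also have "\<dots> = 2 / (a\<^sup>2 * \<tau>)" using t a by (simp add: power2_eq_square)
  also have "\<dots> \<le> \<epsilon>" using t e a by (simp add: field_simps)
  finally show ?thesis .
qed

section \<open>The beam along a shortest path\<close>

text \<open>The data of a shortest path, freed from \<open>D\<close> and \<open>B\<close>: what
  remains of these is the interior ball at \<open>p\<close>, the ball around \<open>c\<close>, and
  the half-spaces that contain them.\<close>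

locale beam =
  fixes \<gamma>p \<gamma>m r \<rho> :: real and p y z c :: "real^3"
  assumes \<gamma>: "\<gamma>p > 0" "\<gamma>m > 0" and r: "r > 0" and \<rho>: "\<rho> > 0"
    and p3: "p $ 3 < 0" and y3: "y $ 3 > 0" and z3: "z $ 3 = 0"
    and shortest: "\<And>z'. z' $ 3 = 0 \<Longrightarrow> slow \<gamma>m * norm (z - p) + slow \<gamma>p * norm (z - y) \<le> slow \<gamma>m * norm (z' - p) + slow \<gamma>p * norm (z' - y)"
    and c: "c = y + (r / norm (y - z)) *\<^sub>R (y - z)"
    and ball_lower: "ball (p + (\<rho> / norm (p - z)) *\<^sub>R (p - z)) \<rho> \<subseteq> lower_half"
    and ball_upper: "cball c r \<subseteq> upper_half"
begin

text \<open>
  The constants are chosen as follows: \<open>mu\<close> and \<open>kc\<close> absorb the lower-order terms of the two Laplacians,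
  beyond radius \<open>rc\<close> the beam is at most \<open>exp (- \<tau> (path_length + 1))\<close>, \<open>\<sigma>\<close> keeps the boundary layer a
  subsolution above height \<open>q\<^sub>3/2\<close>, and \<open>kap\<close> balances the fluxes at the interface.
\<close>

definition "nm = slow \<gamma>m"
definition "np = slow \<gamma>p"
definition "path_length = nm * norm (z - p) + np * norm (z - y)"
definition "\<nu> = (1 / norm (p - z)) *\<^sub>R (p - z)"
definition "\<omega> = (1 / norm (y - z)) *\<^sub>R (y - z)"
definition "b0 = p + \<rho> *\<^sub>R \<nu>"
text \<open>Halfway between \<open>p\<close> and the centre \<open>b0\<close>. The sphere of radius
  \<open>\<rho> / 2\<close> around \<open>q\<close> touches the sphere of radius
  \<open>\<rho>\<close> around \<open>b0\<close> from inside at \<open>p\<close>; the difference of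
  the two curvatures localises the beam in the shell.\<close>

definition "q = p + (\<rho> / 2) *\<^sub>R \<nu>"
definition "m1 = \<omega> $ 1 / \<omega> $ 3"
definition "m2 = \<omega> $ 2 / \<omega> $ 3"
definition "M2 = 1 + m1\<^sup>2 + m2\<^sup>2"
text \<open>Optical length per unit of height along \<open>\<omega>\<close>: slowness
  \<open>np\<close> times the arc length \<open>1 / \<omega> $ 3\<close>.\<close>

definition "lam = np / \<omega> $ 3"
definition "kc = 8 / \<rho>"
definition "mu = (nm + kc) * (1 + M2) * M2 / (2 * lam * \<bar>q $ 3\<bar>)"
definition "rc = norm q + \<rho> + (path_length + 1 + nm * \<rho>) / min nm np + norm b0 + norm c + r"
definition "\<sigma> = nm * \<bar>q $ 3\<bar> / (2 * rc + norm q)"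
definition "Lam = (nm + kc) * sqrt (m1\<^sup>2 + m2\<^sup>2) + lam + mu"
definition "kap = \<gamma>p * Lam / (\<gamma>p * Lam + \<gamma>m * \<sigma>)"
definition "k \<tau> = nm * \<tau> + kc" for \<tau>
definition "lm \<tau> = \<tau> * lam + mu" for \<tau>

abbreviation "El \<tau> \<equiv> lower_exp (k \<tau>) (\<rho> / 2) q"
abbreviation "Wl \<tau> \<equiv> lower_wave (k \<tau>) (\<sigma> * \<tau>) kap (\<rho> / 2) q"
abbreviation "dl \<tau> \<equiv> lower_grad (k \<tau>) (\<sigma> * \<tau>) kap (\<rho> / 2) q"
abbreviation "sl \<tau> \<equiv> lower_second (k \<tau>) (\<sigma> * \<tau>) kap (\<rho> / 2) q"
abbreviation "Wu \<tau> \<equiv> upper_wave (k \<tau>) kap (\<rho> / 2) (lm \<tau>) m1 m2 q"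
abbreviation "du \<tau> \<equiv> upper_grad (k \<tau>) kap (\<rho> / 2) (lm \<tau>) m1 m2 q"
abbreviation "su \<tau> \<equiv> upper_second (k \<tau>) kap (\<rho> / 2) (lm \<tau>) m1 m2 q"

lemma nm: "nm > 0" "\<gamma>m * nm\<^sup>2 = 1" and np: "np > 0" "\<gamma>p * np\<^sup>2 = 1"
  using \<gamma> by (auto simp: nm_def np_def slow_def power_divide)

lemma pz: "p \<noteq> z" "y \<noteq> z" using p3 y3 z3 by auto

lemma norm_\<nu>: "norm \<nu> = 1" and norm_\<omega>: "norm \<omega> = 1"
  using pz by (auto simp: \<nu>_def \<omega>_def)

lemma pz_eq: "p = z + norm (z - p) *\<^sub>R \<nu>" and yz_eq: "y = z + norm (z - y) *\<^sub>R \<omega>"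
  using pz by (auto simp: \<nu>_def \<omega>_def norm_minus_commute)

lemma \<nu>3: "\<nu> $ 3 < 0" and \<omega>3: "\<omega> $ 3 > 0"
  using p3 y3 z3 pz by (auto simp: \<nu>_def \<omega>_def divide_less_0_iff)

lemma q3: "q $ 3 < 0"
  using p3 \<nu>3 \<rho> mult_pos_neg[of "\<rho> / 2" "\<nu> $ 3"] by (simp add: q_def)

lemma b0_eq: "b0 = p + (\<rho> / norm (p - z)) *\<^sub>R (p - z)" by (simp add: b0_def \<nu>_def)

lemma c_eq: "c = y + r *\<^sub>R \<omega>" by (simp add: c \<omega>_def)

lemma M2: "M2 = 1 / (\<omega> $ 3)\<^sup>2" "M2 \<ge> 1"
proof -
  have "(\<omega> $ 1)\<^sup>2 + (\<omega> $ 2)\<^sup>2 + (\<omega> $ 3)\<^sup>2 = 1"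
    using power2_norm_eq_inner[of \<omega>] norm_\<omega> unfolding inner_real3 by (simp add: power2_eq_square)
  then show "M2 = 1 / (\<omega> $ 3)\<^sup>2" using \<omega>3 by (simp add: M2_def m1_def m2_def field_simps)
  show "M2 \<ge> 1" by (simp add: M2_def)
qed

lemma lam: "lam > 0" "lam\<^sup>2 = np\<^sup>2 * M2" "lam * \<omega> $ 3 = np"
  using np \<omega>3 by (auto simp: lam_def M2 power_divide)

lemma kc: "kc > 0" using \<rho> by (simp add: kc_def)

lemma mu: "mu > 0"
  unfolding mu_def using nm(1) kc M2(2) lam(1) q3 by (intro divide_pos_pos mult_pos_pos add_pos_pos) auto

lemma path_length: "path_length > 0"
  using nm np pz by (auto simp: path_length_def intro!: add_pos_pos mult_pos_pos)

text \<open>From radius \<open>rc\<close> on, a path from \<open>q\<close> has optical length at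
  least \<open>path_length + 1\<close>; the spare \<open>nm * \<rho>\<close> absorbs the
  normalisation of the wave at distance \<open>\<rho> / 2\<close> from \<open>q\<close>.\<close>

lemma rc: "rc \<ge> norm b0 + \<rho>" "rc \<ge> norm c + r" "rc > 0" "min nm np * (rc - norm q) - nm * \<rho> \<ge> path_length + 1"
  "nm * (rc - norm q - \<rho>) \<ge> path_length + 1"
proof -
  let ?e = "(path_length + 1 + nm * \<rho>) / min nm np"
  have e: "?e > 0" using path_length nm np \<rho> by (intro divide_pos_pos add_pos_pos mult_pos_pos) auto
  show 1: "rc \<ge> norm b0 + \<rho>" "rc \<ge> norm c + r" "rc > 0"
    using e \<rho> r norm_ge_zero[of q] norm_ge_zero[of b0] norm_ge_zero[of c] unfolding rc_def by linarith+
  have "rc - norm q \<ge> ?e + \<rho>" using r norm_ge_zero[of b0] norm_ge_zero[of c] unfolding rc_def by linarith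
  then have "min nm np * (rc - norm q) \<ge> min nm np * ?e" "nm * (rc - norm q - \<rho>) \<ge> nm * ?e"
    using nm np \<rho> by (intro mult_left_mono; linarith)+
  moreover have "min nm np * ?e = path_length + 1 + nm * \<rho>" using nm np by simp
  moreover have "nm * ?e \<ge> min nm np * ?e" using e by (intro mult_right_mono) auto
  moreover have "nm * \<rho> > 0" using nm \<rho> by simp
  ultimately show "min nm np * (rc - norm q) - nm * \<rho> \<ge> path_length + 1" "nm * (rc - norm q - \<rho>) \<ge> path_length + 1"
    by linarith+
qed

lemma \<sigma>: "\<sigma> > 0" and Lam: "Lam > 0" and kap: "kap > 0" "kap < 1"
proof -
  show \<sigma>: "\<sigma> > 0" using nm q3 rc(3) norm_ge_zero[of q] unfolding \<sigma>_def by (intro divide_pos_pos mult_pos_pos) linarith+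
  show Lam: "Lam > 0" unfolding Lam_def using lam(1) mu nm(1) kc by (simp add: add_nonneg_pos)
  show "kap > 0" using \<gamma> Lam \<sigma> by (auto simp: kap_def intro!: divide_pos_pos add_pos_pos)
  show "kap < 1" using \<gamma> Lam \<sigma> by (simp add: kap_def add_pos_pos)
qed

lemma upper_vec_eq: "upper_vec m1 m2 q x = x - q - (x $ 3 / \<omega> $ 3) *\<^sub>R \<omega>"
  using \<omega>3 by (simp add: upper_vec_def vec_eq_iff forall_3 m1_def m2_def)

lemma k_bounds: "\<tau> \<ge> 1 \<Longrightarrow> nm * \<tau> \<le> k \<tau>" "\<tau> \<ge> 1 \<Longrightarrow> k \<tau> \<le> (nm + kc) * \<tau>" "\<tau> \<ge> 1 \<Longrightarrow> k \<tau> > 0"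
proof -
  assume \<tau>: "\<tau> \<ge> 1"
  show "nm * \<tau> \<le> k \<tau>" using kc by (simp add: k_def)
  have "kc * 1 \<le> kc * \<tau>" using kc \<tau> by (intro mult_left_mono) auto
  then show "k \<tau> \<le> (nm + kc) * \<tau>" by (simp add: k_def algebra_simps)
  show "k \<tau> > 0" using nm kc \<tau> by (simp add: k_def add_pos_pos)
qed

text \<open>The leading part \<open>\<tau>\<^sup>2 * lam\<^sup>2 / M2\<close> of the squared rate is
  exactly the critical value \<open>\<tau>\<^sup>2 * np\<^sup>2\<close>. The curvature loss is of
  order \<open>\<tau>\<close> and is paid by the mixed term \<open>2 * \<tau> * lam * mu\<close>;
  this requirement is the equation that defines \<open>mu\<close>.\<close>

lemma upper_sub:
  assumes \<tau>: "\<tau> \<ge> 1"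
  shows "\<tau>\<^sup>2 * Wu \<tau> x \<le> \<gamma>p *
    (su \<tau> 1 x + su \<tau> 2 x + su \<tau> 3 x)" (is "_ * ?W \<le> _ * ?S")
proof -
  let ?h = "\<bar>q $ 3\<bar>"
  have h: "?h > 0" using q3 by simp
  have W: "?W \<ge> 0" using kap by (simp add: upper_wave_def)
  have "\<tau>\<^sup>2 * np\<^sup>2 + \<tau> * (nm + kc) * (1 + M2) / ?h \<le> (lm \<tau>)\<^sup>2 / M2"
  proof -
    have "2 * lam * mu = (nm + kc) * (1 + M2) * M2 / ?h" using lam(1) h by (simp add: mu_def)
    then have "(\<tau>\<^sup>2 * np\<^sup>2 + \<tau> * (nm + kc) * (1 + M2) / ?h) * M2 = \<tau>\<^sup>2 * lam\<^sup>2 + \<tau> * (2 * lam * mu)"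
      unfolding lam(2) by (simp add: algebra_simps)
    also have "\<dots> \<le> (lm \<tau>)\<^sup>2" by (simp add: lm_def power2_eq_square algebra_simps)
    finally show ?thesis using M2(2) by (simp add: le_divide_eq)
  qed
  moreover have "k \<tau> * (1 + M2) / ?h \<le> \<tau> * (nm + kc) * (1 + M2) / ?h"
    using k_bounds(2)[OF \<tau>] h M2(2) by (intro divide_right_mono mult_right_mono) (auto simp: mult.commute)
  ultimately have "\<tau>\<^sup>2 * np\<^sup>2 \<le> (lm \<tau>)\<^sup>2 / M2 - k \<tau> * (1 + M2) / ?h" by linarith
  then have "\<tau>\<^sup>2 * np\<^sup>2 * ?W \<le> ((lm \<tau>)\<^sup>2 / M2 - k \<tau> * (1 + M2) / ?h) * ?W" using W by (rule mult_right_mono)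
  also have "\<dots> \<le> ?S"
  proof -
    have eq: "2 + m1\<^sup>2 + m2\<^sup>2 = 1 + M2" by (simp add: M2_def)
    show ?thesis
      by (rule upper_laplacian_ge[OF q3, of "k \<tau>" kap "lm \<tau>" m1 m2 "\<rho> / 2" x, folded M2_def, unfolded eq])
        (use k_bounds(3)[OF \<tau>] kap in auto)
  qed
  finally have "\<gamma>p * (\<tau>\<^sup>2 * np\<^sup>2 * ?W) \<le> \<gamma>p * ?S" using \<gamma> by (intro mult_left_mono) auto
  moreover have "\<gamma>p * (\<tau>\<^sup>2 * np\<^sup>2 * ?W) = (\<gamma>p * np\<^sup>2) * (\<tau>\<^sup>2 * ?W)" by (simp only: mult_ac)
  ultimately show ?thesis by (simp add: np(2))
qed

text \<open>The bound \<open>8 / \<rho>\<close> keeps the shell away from \<open>q\<close>. The last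
  one makes the boundary layer at depth \<open>\<bar>q $ 3\<bar> / 2\<close> so small that its
  contribution to the Laplacian stays below the gain
  \<open>nm * kc * (1 - kap) * \<tau>\<close>.\<close>

definition "tau_low = max 1 (max (8 / \<rho>) (2 / ((\<sigma> * \<bar>q $ 3\<bar> / 2)\<^sup>2 * (nm * kc * (1 - kap) / (\<sigma> * (2 * (nm + kc) + \<sigma>))))))"

lemma lower_sub:
  assumes \<tau>: "\<tau> \<ge> tau_low" and x: "x $ 3 \<le> 0" "norm x \<le> 2 * rc" "norm (x - q) \<ge> \<rho> / 4"
  shows "\<tau>\<^sup>2 * Wl \<tau> x \<le> \<gamma>m *
    (sl \<tau> 1 x + sl \<tau> 2 x + sl \<tau> 3 x)" (is "_ * ?W \<le> _ * ?S")
proof -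
  have t1: "\<tau> \<ge> 1" using \<tau> by (simp add: tau_low_def)
  note k = k_bounds[OF t1]
  define h where "h = \<bar>q $ 3\<bar>"
  have h: "h > 0" using q3 by (simp add: h_def)
  define R where "R = norm (x - q)"
  have R: "R > 0" "R \<ge> \<rho> / 4" using x \<rho> by (auto simp: R_def)
  define u where "u = (x $ 3 - q $ 3) / R"
  define E where "E = El \<tau> x"
  define e where "e = exp (\<sigma> * \<tau> * x $ 3)"
  have E: "E > 0" by (simp add: E_def lower_exp_def)
  have e: "e > 0" "e \<le> 1" using x \<sigma> t1 by (auto simp: e_def mult_nonneg_nonpos)
  have W: "?W = E * (1 - kap * e)" by (simp add: lower_wave_def E_def e_def)
  have S: "?S = ((k \<tau>)\<^sup>2 - 2 * k \<tau> / R) * ?W + kap * (\<sigma> * \<tau>) * e * (2 * k \<tau> * u - \<sigma> * \<tau>) * E"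
    using lower_laplacian[of x q "k \<tau>" "\<sigma> * \<tau>" kap "\<rho> / 2"] R by (simp add: R_def u_def E_def e_def)
  have ke: "1 - kap * e \<ge> 1 - kap" using e kap mult_left_mono[OF e(2), of kap] by simp
  have W0: "?W \<ge> 0" unfolding W using E ke kap by (intro mult_nonneg_nonneg; linarith)
  have "2 / R \<le> kc"
  proof -
    have "2 / R \<le> 2 / (\<rho> / 4)" using R \<rho> by (intro divide_left_mono) auto
    then show ?thesis by (simp add: kc_def)
  qed
  then have kR: "k \<tau> * (2 / R) \<le> k \<tau> * kc" using k by (intro mult_left_mono) auto
  \<comment> \<open>Since \<open>k \<tau>\<close> exceeds \<open>nm * \<tau>\<close> by
    \<open>kc\<close>, and \<open>kc\<close> bounds the curvature \<open>2 / R\<close> off the ball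
    of radius \<open>\<rho> / 4\<close>, a surplus \<open>nm * kc * \<tau>\<close> over the critical
    value is left to pay for the boundary layer.\<close>
  have "nm\<^sup>2 * \<tau>\<^sup>2 + nm * kc * \<tau> \<le> (k \<tau>)\<^sup>2 - 2 * k \<tau> / R"
  proof -
    have "2 * k \<tau> / R = k \<tau> * (2 / R)" by simp
    moreover have "(k \<tau>)\<^sup>2 - k \<tau> * kc = nm\<^sup>2 * \<tau>\<^sup>2 + nm * kc * \<tau>" by (simp add: k_def power2_eq_square algebra_simps)
    ultimately show ?thesis using kR by linarith
  qed
  then have 1: "(nm\<^sup>2 * \<tau>\<^sup>2 + nm * kc * \<tau>) * ?W \<le> ((k \<tau>)\<^sup>2 - 2 * k \<tau> / R) * ?W" using W0 by (rule mult_right_mono)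
  \<comment> \<open>Near the interface the wave travels upwards, and \<open>\<sigma>\<close> is
    small enough for \<open>2 * k \<tau> * u \<ge> \<sigma> * \<tau>\<close>, so the layer term has
    the good sign. Deeper down the sign may fail, for instance below \<open>q\<close>, but there the
    layer is exponentially small.\<close>
  have 2: "0 \<le> nm * kc * \<tau> * (1 - kap * e) + kap * (\<sigma> * \<tau>) * e * (2 * k \<tau> * u - \<sigma> * \<tau>)"
  proof (cases "x $ 3 \<ge> q $ 3 / 2")
    case True
    have "R \<le> 2 * rc + norm q" using norm_triangle_ineq4[of x q] x(2) by (simp add: R_def)
    moreover have "x $ 3 - q $ 3 \<ge> h / 2" using True q3 by (simp add: h_def)
    ultimately have "u \<ge> (h / 2) / (2 * rc + norm q)" unfolding u_def using R h by (intro frac_le) auto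
    then have "2 * (nm * \<tau>) * ((h / 2) / (2 * rc + norm q)) \<le> 2 * k \<tau> * u"
      using k nm t1 rc h by (intro mult_mono) auto
    moreover have "2 * (nm * \<tau>) * ((h / 2) / X) = nm * h / X * \<tau>" for X by simp
    then have "2 * (nm * \<tau>) * ((h / 2) / (2 * rc + norm q)) = \<sigma> * \<tau>" unfolding \<sigma>_def h_def[symmetric] .
    ultimately have "\<sigma> * \<tau> \<le> 2 * k \<tau> * u" by linarith
    moreover have "0 \<le> 1 - kap * e" using ke kap by linarith
    ultimately show ?thesis using nm(1) kc t1 kap \<sigma> e by (intro add_nonneg_nonneg mult_nonneg_nonneg) auto
  next
    case False
    let ?b = "2 * (nm + kc) + \<sigma>"
    have b: "?b > 0" using nm(1) kc \<sigma> by (simp add: add_pos_pos)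
    have "\<bar>x $ 3 - q $ 3\<bar> \<le> R" using component_le_norm_cart[of "x - q" 3] by (simp add: R_def)
    then have "\<bar>u\<bar> \<le> 1" using R by (simp add: u_def)
    then have "2 * k \<tau> * u \<ge> 2 * k \<tau> * (-1)" using k by (intro mult_left_mono) auto
    moreover have "?b * \<tau> = 2 * ((nm + kc) * \<tau>) + \<sigma> * \<tau>" by (simp only: distrib_right mult.assoc)
    ultimately have l: "2 * k \<tau> * u - \<sigma> * \<tau> \<ge> - (?b * \<tau>)" using k(2) by linarith
    have small: "\<tau> * exp (- (\<sigma> * h / 2 * \<tau>)) \<le> nm * kc * (1 - kap) / (\<sigma> * ?b)"
    proof (rule exp_neg_le)
      show "0 < nm * kc * (1 - kap) / (\<sigma> * ?b)" using nm kc kap \<sigma> b by (intro divide_pos_pos mult_pos_pos) auto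
      show "2 / ((\<sigma> * h / 2)\<^sup>2 * (nm * kc * (1 - kap) / (\<sigma> * ?b))) \<le> \<tau>" using \<tau> by (simp add: tau_low_def h_def)
    qed (use \<sigma> h t1 in auto)
    have "e \<le> exp (- (\<sigma> * h / 2 * \<tau>))"
    proof -
      have "x $ 3 \<le> - (h / 2)" using False q3 by (simp add: h_def)
      then have "\<sigma> * \<tau> * x $ 3 \<le> \<sigma> * \<tau> * - (h / 2)" using \<sigma> t1 by (intro mult_left_mono) auto
      then show ?thesis by (simp add: e_def mult_ac)
    qed
    then have "\<tau> * e \<le> \<tau> * exp (- (\<sigma> * h / 2 * \<tau>))" using t1 by (intro mult_left_mono) linarith+
    from order_trans[OF this small] have "\<tau> * e * (\<sigma> * ?b) \<le> nm * kc * (1 - kap)" using \<sigma> b by (simp add: le_divide_eq)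
    then have "\<tau> * (\<tau> * e * (\<sigma> * ?b)) \<le> \<tau> * (nm * kc * (1 - kap))" using t1 by (intro mult_left_mono) auto
    moreover have "\<tau> * (nm * kc * (1 - kap)) \<le> \<tau> * (nm * kc * (1 - kap * e))"
      using t1 nm kc ke by (intro mult_left_mono) auto
    moreover have "kap * (\<sigma> * \<tau>) * e * (2 * k \<tau> * u - \<sigma> * \<tau>) \<ge> kap * (\<sigma> * \<tau>) * e * (- (?b * \<tau>))"
      using kap \<sigma> t1 e by (intro mult_left_mono l) auto
    moreover have "kap * (\<sigma> * \<tau> * e * (?b * \<tau>)) \<le> 1 * (\<sigma> * \<tau> * e * (?b * \<tau>))"
      using kap \<sigma> t1 e b by (intro mult_right_mono) auto
    ultimately show ?thesis by (simp add: mult_ac)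
  qed
  have "nm\<^sup>2 * \<tau>\<^sup>2 * ?W \<le> ?S"
  proof -
    have "0 \<le> (nm * kc * \<tau> * (1 - kap * e) + kap * (\<sigma> * \<tau>) * e * (2 * k \<tau> * u - \<sigma> * \<tau>)) * E"
      using 2 E by (intro mult_nonneg_nonneg) auto
    then have "0 \<le> nm * kc * \<tau> * ?W + kap * (\<sigma> * \<tau>) * e * (2 * k \<tau> * u - \<sigma> * \<tau>) * E"
      unfolding W by (simp only: distrib_right distrib_left mult_ac)
    then show ?thesis using 1 unfolding S distrib_right by linarith
  qed
  then have "\<gamma>m * (nm\<^sup>2 * \<tau>\<^sup>2 * ?W) \<le> \<gamma>m * ?S" using \<gamma> by (intro mult_left_mono) auto
  moreover have "\<gamma>m * (nm\<^sup>2 * \<tau>\<^sup>2 * ?W) = (\<gamma>m * nm\<^sup>2) * (\<tau>\<^sup>2 * ?W)" by (simp only: mult_ac)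
  ultimately show ?thesis by (simp add: nm(2))
qed

text \<open>\<open>Lam * \<tau>\<close> dominates the slope of the upper wave for all
  \<open>\<tau> \<ge> 1\<close>, and the slope of the layer is proportional to \<open>\<tau>\<close>
  as well; so one \<open>kap\<close> independent of \<open>\<tau>\<close> serves them all.\<close>

lemma flux:
  assumes \<tau>: "\<tau> \<ge> 1" and x: "x $ 3 = 0"
  shows "\<gamma>m * dl \<tau> x $ 3 \<le> \<gamma>p * du \<tau> x $ 3"
proof (rule interface_flux[OF x q3 _ _ \<gamma>])
  show "k \<tau> \<ge> 0" "kap \<le> 1" using k_bounds(3)[OF \<tau>] kap by auto
  have "k \<tau> * sqrt (m1\<^sup>2 + m2\<^sup>2) \<le> (nm + kc) * \<tau> * sqrt (m1\<^sup>2 + m2\<^sup>2)"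
    by (intro mult_right_mono k_bounds \<tau>) auto
  moreover have "mu * 1 \<le> mu * \<tau>" using mu \<tau> by (intro mult_left_mono) auto
  ultimately have "k \<tau> * sqrt (m1\<^sup>2 + m2\<^sup>2) + lm \<tau> \<le> Lam * \<tau>" by (simp add: Lam_def lm_def algebra_simps)
  then have "\<gamma>p * (1 - kap) * (k \<tau> * sqrt (m1\<^sup>2 + m2\<^sup>2) + lm \<tau>) \<le> \<gamma>p * (1 - kap) * (Lam * \<tau>)"
    using \<gamma> kap by (intro mult_left_mono) auto
  also have "\<dots> = \<gamma>m * kap * (\<sigma> * \<tau>)"
  proof -
    have "\<gamma>p * Lam + \<gamma>m * \<sigma> > 0" using \<gamma> Lam \<sigma> by (intro add_pos_pos mult_pos_pos)
    then have "(1 - kap) * (\<gamma>p * Lam) = kap * (\<gamma>m * \<sigma>)" by (simp add: kap_def field_simps)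
    then have "(1 - kap) * (\<gamma>p * Lam) * \<tau> = kap * (\<gamma>m * \<sigma>) * \<tau>" by simp
    then show ?thesis by (simp only: mult_ac)
  qed
  finally show "\<gamma>p * (1 - kap) * (k \<tau> * sqrt (m1\<^sup>2 + m2\<^sup>2) + lm \<tau>) \<le> \<gamma>m * kap * (\<sigma> * \<tau>)" .
qed

text \<open>Stationarity of the optical length under horizontal shifts of the crossing point. The
  sign comes from the orientation: \<open>\<nu>\<close> points from \<open>z\<close> down to
  \<open>p\<close>, \<open>\<omega>\<close> from \<open>z\<close> up to \<open>y\<close>.\<close>

lemma snell: "i \<noteq> 3 \<Longrightarrow> - nm * \<nu> $ i = np * \<omega> $ i"
proof -
  assume i: "i \<noteq> 3"
  define F where "F t = nm * norm (z - p + t *\<^sub>R axis i 1) + np * norm (z - y + t *\<^sub>R axis i 1)" for t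
  have "(F has_real_derivative nm * (((z - p) \<bullet> axis i 1) / norm (z - p)) + np * (((z - y) \<bullet> axis i 1) / norm (z - y))) (at 0)"
    unfolding F_def using pz by (intro DERIV_add DERIV_cmult norm_line_DERIV(1)) auto
  moreover have "F 0 \<le> F t" for t
    using shortest[of "z + t *\<^sub>R axis i 1"] z3 i by (simp add: F_def nm_def np_def axis_def algebra_simps)
  ultimately have "nm * (((z - p) \<bullet> axis i 1) / norm (z - p)) + np * (((z - y) \<bullet> axis i 1) / norm (z - y)) = 0"
    using DERIV_local_min[of F _ 0 1] by auto
  moreover have "((z - p) \<bullet> axis i 1) / norm (z - p) = - \<nu> $ i" "((z - y) \<bullet> axis i 1) / norm (z - y) = - \<omega> $ i"
    by (simp_all add: inner_axis_real3 \<nu>_def \<omega>_def norm_minus_commute minus_divide_left)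
  ultimately show ?thesis by simp
qed

end

section \<open>Cutoffs and decay of the beam\<close>

lemma norm_power2_line_DERIV:
  "((\<lambda>t. (norm (y + t *\<^sub>R c))\<^sup>2) has_real_derivative 2 * (y \<bullet> (c::'a::euclidean_space))) (at 0)"
proof -
  have eq: "(norm (y + t *\<^sub>R c))\<^sup>2 = (norm y)\<^sup>2 + 2 * t * (y \<bullet> c) + t\<^sup>2 * (norm c)\<^sup>2" for t
    unfolding power2_norm_eq_inner
    by (simp add: inner_add inner_commute power2_eq_square algebra_simps)
  show ?thesis unfolding eq by (auto intro!: derivative_eq_intros)
qed

context beam
begin

text \<open>Near the boundary of the interior ball this is about \<open>2 * \<tau>\<close> times the
  depth, so fixed ranges of positive values are shells of thickness of order
  \<open>1/\<tau>\<close>. Being quadratic in \<open>x\<close> it has no singularity at the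
  centre.\<close>

definition "beta \<tau> x = \<tau> * (\<rho>\<^sup>2 - (norm (x - b0))\<^sup>2) / \<rho>" for \<tau> x

lemma b0_q: "norm (b0 - q) = \<rho> / 2"
proof -
  have "b0 - q = (\<rho> / 2) *\<^sub>R \<nu>" by (simp add: b0_def q_def scaleR_add_left[symmetric] algebra_simps)
  then show ?thesis using norm_\<nu> \<rho> by simp
qed

lemma beta_continuous: "continuous_on UNIV (beta \<tau>)"
  unfolding beta_def by (intro continuous_intros) (use \<rho> in auto)

lemma beta_pos_ball: "\<tau> \<ge> 1 \<Longrightarrow> beta \<tau> x > 0 \<Longrightarrow> norm (x - b0) < \<rho>"
  using \<rho> power_less_imp_less_base[of "norm (x - b0)" 2 \<rho>] by (simp add: beta_def zero_less_divide_iff zero_less_mult_iff)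

lemma beta_pos: "\<tau> \<ge> 1 \<Longrightarrow> beta \<tau> x > 0 \<Longrightarrow> x $ 3 < 0 \<and> norm x < rc"
proof -
  assume a: "\<tau> \<ge> 1" "beta \<tau> x > 0"
  have "norm (x - b0) < \<rho>" using beta_pos_ball[OF a] .
  then have "x \<in> ball b0 \<rho>" by (simp add: dist_norm norm_minus_commute)
  then have "x $ 3 < 0" using ball_lower by (auto simp: b0_eq lower_half_def)
  moreover have "norm x \<le> norm b0 + norm (x - b0)" using norm_triangle_ineq[of b0 "x - b0"] by simp
  ultimately show ?thesis using \<open>norm (x - b0) < \<rho>\<close> rc(1) by linarith
qed

lemma beta_DERIV: "((\<lambda>t. beta \<tau> (x + t *\<^sub>R b)) has_real_derivative - (2 * \<tau> / \<rho>) * ((x - b0) \<bullet> b)) (at 0)"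
proof -
  have eq: "beta \<tau> (x + t *\<^sub>R b) = \<tau> * \<rho> - \<tau> / \<rho> * (norm ((x - b0) + t *\<^sub>R b))\<^sup>2" for t
    using \<rho> by (simp add: beta_def power2_eq_square algebra_simps diff_divide_distrib)
  show ?thesis unfolding eq
    by (rule DERIV_cong[OF DERIV_diff[OF DERIV_const DERIV_cmult[OF norm_power2_line_DERIV]]]) simp
qed

lemma beta_far:
  assumes \<tau>: "\<tau> \<ge> 8 / \<rho>" and b: "beta \<tau> x \<le> 4"
  shows "norm (x - q) \<ge> \<rho> / 5" and "beta \<tau> x \<le> 3 \<Longrightarrow> norm (x - q) \<ge> \<rho> / 4"
proof -
  have t: "\<tau> > 0" "1 / \<tau> \<le> \<rho> / 8"
  proof -
    have "8 / \<rho> > 0" using \<rho> by simp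
    then show "\<tau> > 0" using \<tau> by linarith
    then show "1 / \<tau> \<le> \<rho> / 8" using \<tau> \<rho> by (simp add: field_simps)
  qed
  have d: "(norm (x - b0))\<^sup>2 = \<rho>\<^sup>2 - beta \<tau> x * \<rho> * (1 / \<tau>)" using t \<rho> by (simp add: beta_def field_simps)
  have far: "norm (x - q) \<ge> a * \<rho> - \<rho> / 2" if "beta \<tau> x \<le> n" "n \<ge> 0" "a \<ge> 0" "a\<^sup>2 \<le> 1 - n / 8" for n a
  proof -
    have "beta \<tau> x * \<rho> * (1 / \<tau>) \<le> n * \<rho> * (\<rho> / 8)"
    proof -
      have "beta \<tau> x * (\<rho> * (1 / \<tau>)) \<le> n * (\<rho> * (1 / \<tau>))" using that \<rho> t by (intro mult_right_mono) auto
      also have "\<dots> \<le> n * (\<rho> * (\<rho> / 8))" using that \<rho> t by (intro mult_left_mono) auto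
      finally show ?thesis by (simp only: mult.assoc)
    qed
    moreover have "(a * \<rho>)\<^sup>2 \<le> (1 - n / 8) * \<rho>\<^sup>2" using that unfolding power_mult_distrib by (intro mult_right_mono) auto
    moreover have "n * \<rho> * (\<rho> / 8) = n / 8 * \<rho>\<^sup>2" by (simp add: power2_eq_square)
    ultimately have "(a * \<rho>)\<^sup>2 \<le> (norm (x - b0))\<^sup>2" unfolding d left_diff_distrib by linarith
    then have "a * \<rho> \<le> norm (x - b0)" by (rule power2_le_imp_le) simp
    moreover have "norm (x - b0) \<le> norm (x - q) + norm (b0 - q)" using norm_triangle_ineq4[of "x - q" "b0 - q"] by simp
    ultimately show ?thesis using b0_q by linarith
  qed
  \<comment> \<open>The factors \<open>7/10\<close> and \<open>3/4\<close> lie just below the square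
    roots of \<open>1 - 4/8\<close> and \<open>1 - 3/8\<close>; half a radius is lost to the
    distance between \<open>b0\<close> and \<open>q\<close>.\<close>
  show "norm (x - q) \<ge> \<rho> / 5" using far[OF b, of "7/10"] by (simp add: power2_eq_square)
  assume "beta \<tau> x \<le> 3"
  from far[OF this, of "3/4"] show "norm (x - q) \<ge> \<rho> / 4" by (simp add: power2_eq_square)
qed

text \<open>The first factor is one up to radius \<open>rc\<close> and zero from
  \<open>sqrt 2 * rc\<close> on. The second is one where \<open>beta\<close> is at most 2 and zero
  where it is at least 3; it removes the inner part of the ball, with the singularity at
  \<open>q\<close>.\<close>

definition cut :: "real \<Rightarrow> real^3 \<Rightarrow> real" where
  "cut \<tau> x = smoothstep (2 - (norm x)\<^sup>2 / rc\<^sup>2) * smoothstep (3 - beta \<tau> x)"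

definition cut_grad :: "real \<Rightarrow> real^3 \<Rightarrow> real^3" where
  "cut_grad \<tau> x = (smoothstep (2 - (norm x)\<^sup>2 / rc\<^sup>2) * smoothstep' (3 - beta \<tau> x) * (2 * \<tau> / \<rho>)) *\<^sub>R (x - b0)
    - (smoothstep (3 - beta \<tau> x) * smoothstep' (2 - (norm x)\<^sup>2 / rc\<^sup>2) * (2 / rc\<^sup>2)) *\<^sub>R x"

lemma cut_dir_deriv: "has_dir_deriv (cut \<tau>) (\<lambda>x. cut_grad \<tau> x $ i) (axis i 1)"
  unfolding has_dir_deriv_def
proof
  fix x :: "real^3"
  have 1: "((\<lambda>t. smoothstep (3 - beta \<tau> (x + t *\<^sub>R axis i 1))) has_real_derivative
      smoothstep' (3 - beta \<tau> x) * ((2 * \<tau> / \<rho>) * (x - b0) $ i)) (at 0)"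
    by (rule DERIV_chain2[where g="\<lambda>t. 3 - beta \<tau> (x + t *\<^sub>R axis i 1)" and f=smoothstep])
      (auto intro!: derivative_eq_intros beta_DERIV smoothstep_DERIV simp: inner_axis_real3)
  have 2: "((\<lambda>t. smoothstep (2 - (norm (x + t *\<^sub>R axis i 1))\<^sup>2 / rc\<^sup>2)) has_real_derivative
      smoothstep' (2 - (norm x)\<^sup>2 / rc\<^sup>2) * (- (2 * x $ i / rc\<^sup>2))) (at 0)"
  proof -
    have "((\<lambda>t. 2 - (norm (x + t *\<^sub>R axis i 1))\<^sup>2 / rc\<^sup>2) has_real_derivative - (2 * x $ i / rc\<^sup>2)) (at 0)"
      by (rule DERIV_cong[OF DERIV_diff[OF DERIV_const DERIV_cdivide[OF norm_power2_line_DERIV]]])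
        (simp add: inner_axis_real3)
    moreover have "(smoothstep has_real_derivative smoothstep' (2 - (norm x)\<^sup>2 / rc\<^sup>2)) (at (2 - (norm (x + 0 *\<^sub>R axis i 1))\<^sup>2 / rc\<^sup>2))"
      using smoothstep_DERIV by simp
    ultimately show ?thesis by (rule DERIV_chain2[rotated])
  qed
  from DERIV_mult[OF 2 1] show "((\<lambda>t. cut \<tau> (x + t *\<^sub>R axis i 1)) has_real_derivative cut_grad \<tau> x $ i) (at 0)"
    unfolding cut_def by (rule DERIV_cong) (simp add: cut_grad_def algebra_simps)
qed

lemma cut_continuous: "continuous_on UNIV (cut \<tau>)" "continuous_on UNIV (cut_grad \<tau>)"
  unfolding cut_def cut_grad_def using rc(3) \<rho>
  by (auto intro!: continuous_intros beta_continuous)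

lemma cut_support:
  shows "beta \<tau> x > 3 \<Longrightarrow> cut \<tau> x = 0" "beta \<tau> x > 3 \<Longrightarrow> cut_grad \<tau> x = 0"
    "norm x > 2 * rc \<Longrightarrow> cut \<tau> x = 0" "norm x > 2 * rc \<Longrightarrow> cut_grad \<tau> x = 0" "cut \<tau> x \<ge> 0"
proof -
  show "beta \<tau> x > 3 \<Longrightarrow> cut \<tau> x = 0" "beta \<tau> x > 3 \<Longrightarrow> cut_grad \<tau> x = 0"
    by (simp_all add: cut_def cut_grad_def smoothstep_simps)
  have "2 - (norm x)\<^sup>2 / rc\<^sup>2 \<le> 0" if "norm x > 2 * rc"
  proof -
    have "(2 * rc)\<^sup>2 \<le> (norm x)\<^sup>2" using that rc by (intro power_mono) auto
    moreover have "(2 * rc)\<^sup>2 = 4 * rc\<^sup>2" by (simp add: power_mult_distrib)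
    ultimately have "2 * rc\<^sup>2 \<le> (norm x)\<^sup>2" using zero_le_power2[of rc] by linarith
    then show ?thesis using rc(3) by (simp add: field_simps)
  qed
  then show "norm x > 2 * rc \<Longrightarrow> cut \<tau> x = 0" "norm x > 2 * rc \<Longrightarrow> cut_grad \<tau> x = 0"
    by (simp_all add: cut_def cut_grad_def smoothstep_simps)
  show "cut \<tau> x \<ge> 0" by (simp add: cut_def smoothstep_bounds)
qed

lemma smoothstep_radial: "norm x < rc \<Longrightarrow> smoothstep (2 - (norm x)\<^sup>2 / rc\<^sup>2) = 1"
  "norm x < rc \<Longrightarrow> smoothstep' (2 - (norm x)\<^sup>2 / rc\<^sup>2) = 0"
proof -
  have "2 - (norm x)\<^sup>2 / rc\<^sup>2 \<ge> 1" if "norm x < rc"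
  proof -
    have "(norm x)\<^sup>2 \<le> rc\<^sup>2" using that by (intro power_mono) auto
    then show ?thesis using rc(3) by (simp add: field_simps)
  qed
  then show "norm x < rc \<Longrightarrow> smoothstep (2 - (norm x)\<^sup>2 / rc\<^sup>2) = 1"
    "norm x < rc \<Longrightarrow> smoothstep' (2 - (norm x)\<^sup>2 / rc\<^sup>2) = 0"
    by (simp_all add: smoothstep_simps)
qed

text \<open>The whole ball around \<open>b0\<close> lies within radius \<open>rc\<close>, so the two
  factors of the cutoff never vary at the same point. Each zone has its own cost: a factor
  \<open>\<tau>\<close> in the shell, a constant far away.\<close>

lemma cut_grad_cases:
  assumes \<tau>: "\<tau> \<ge> 1"
  obtains "cut_grad \<tau> x = 0"
  | "2 \<le> beta \<tau> x" "beta \<tau> x \<le> 3" "norm (cut_grad \<tau> x) \<le> 4 * \<tau>"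
  | "rc \<le> norm x" "norm x \<le> 2 * rc" "norm (cut_grad \<tau> x) \<le> 8 / rc"
proof -
  consider "beta \<tau> x > 3" | "2 \<le> beta \<tau> x" "beta \<tau> x \<le> 3" | "beta \<tau> x < 2" by linarith
  then show thesis
  proof cases
    case 1
    then show ?thesis using that(1) cut_support by blast
  next
    case 2
    then have n: "norm x < rc" "norm (x - b0) < \<rho>" using beta_pos[OF \<tau>, of x] beta_pos_ball[OF \<tau>, of x] by auto
    have "norm (cut_grad \<tau> x) = smoothstep' (3 - beta \<tau> x) * (2 * \<tau> / \<rho>) * norm (x - b0)"
      using smoothstep_radial[OF n(1)] smoothstep_bounds(3) \<tau> \<rho> by (simp add: cut_grad_def abs_mult)
    also have "\<dots> \<le> 2 * (2 * \<tau> / \<rho>) * \<rho>"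
      using n \<tau> \<rho> smoothstep_bounds by (intro mult_mono) auto
    finally show ?thesis using that(2) 2 \<rho> by simp
  next
    case 3
    then have s: "smoothstep (3 - beta \<tau> x) = 1" "smoothstep' (3 - beta \<tau> x) = 0" by (simp_all add: smoothstep_simps)
    consider "norm x < rc" | "norm x > 2 * rc" | "rc \<le> norm x" "norm x \<le> 2 * rc" by linarith
    then show ?thesis
    proof cases
      case 1
      then show ?thesis using that(1) s smoothstep_radial[OF 1] by (simp add: cut_grad_def)
    next
      case 2
      then show ?thesis using that(1) cut_support by blast
    next
      case 3
      have "norm (cut_grad \<tau> x) = smoothstep' (2 - (norm x)\<^sup>2 / rc\<^sup>2) * (2 / rc\<^sup>2) * norm x"
        using smoothstep_bounds(3) by (simp add: cut_grad_def s abs_mult)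
      also have "\<dots> \<le> 2 * (2 / rc\<^sup>2) * (2 * rc)"
        using 3 rc(3) smoothstep_bounds by (intro mult_mono) auto
      also have "\<dots> = 8 / rc" using rc(3) by (simp add: power2_eq_square)
      finally show ?thesis using that(3) 3 by blast
    qed
  qed
qed

lemma Wl_bounds:
  assumes \<tau>: "\<tau> \<ge> 1" and x: "x $ 3 \<le> 0"
  shows "0 \<le> Wl \<tau> x" "Wl \<tau> x \<le> El \<tau> x" "norm (dl \<tau> x) \<le> (3 * (nm + kc) + \<sigma>) * \<tau> * El \<tau> x"
proof -
  have E: "El \<tau> x > 0" by (simp add: lower_exp_def)
  have e: "0 < exp (\<sigma> * \<tau> * x $ 3)" "exp (\<sigma> * \<tau> * x $ 3) \<le> 1"
    using \<sigma> \<tau> x by (auto simp: mult_nonneg_nonpos)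
  have ke: "0 \<le> kap * exp (\<sigma> * \<tau> * x $ 3)" "kap * exp (\<sigma> * \<tau> * x $ 3) \<le> 1"
    using e kap mult_mono[of kap 1 "exp (\<sigma> * \<tau> * x $ 3)" 1] by auto
  show W: "0 \<le> Wl \<tau> x" "Wl \<tau> x \<le> El \<tau> x"
    using E ke mult_left_mono[of "1 - kap * exp (\<sigma> * \<tau> * x $ 3)" 1 "El \<tau> x"] by (auto simp: lower_wave_def)
  have k0: "k \<tau> > 0" using k_bounds(3)[OF \<tau>] .
  have u: "\<bar>((x - q) \<bullet> axis i 1) / norm (x - q)\<bar> \<le> 1" for i
    using component_le_norm_cart[of "x - q" i] by (cases "x = q") (auto simp: inner_axis_real3)
  have 1: "\<bar>k \<tau> * (((x - q) \<bullet> axis i 1) / norm (x - q)) * Wl \<tau> x\<bar> \<le> k \<tau> * El \<tau> x" for i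
  proof -
    have "\<bar>k \<tau> * (((x - q) \<bullet> axis i 1) / norm (x - q)) * Wl \<tau> x\<bar> = k \<tau> * (\<bar>((x - q) \<bullet> axis i 1) / norm (x - q)\<bar> * Wl \<tau> x)"
      using k0 W by (simp add: abs_mult)
    also have "\<dots> \<le> k \<tau> * (1 * El \<tau> x)" using k0 W u by (intro mult_left_mono mult_mono) auto
    finally show ?thesis by simp
  qed
  have 2: "\<bar>kap * (\<sigma> * \<tau>) * exp (\<sigma> * \<tau> * x $ 3) * El \<tau> x\<bar> \<le> \<sigma> * \<tau> * El \<tau> x"
  proof -
    have "\<bar>kap * (\<sigma> * \<tau>) * exp (\<sigma> * \<tau> * x $ 3) * El \<tau> x\<bar> = (kap * exp (\<sigma> * \<tau> * x $ 3)) * (\<sigma> * \<tau> * El \<tau> x)"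
      using kap \<sigma> \<tau> E by (simp add: abs_mult)
    also have "\<dots> \<le> 1 * (\<sigma> * \<tau> * El \<tau> x)" using ke \<sigma> \<tau> E by (intro mult_right_mono) auto
    finally show ?thesis by simp
  qed
  have c: "\<bar>dl \<tau> x $ i\<bar> \<le> k \<tau> * El \<tau> x + (if i = 3 then \<sigma> * \<tau> * El \<tau> x else 0)" for i
  proof -
    define A where "A = k \<tau> * (((x - q) \<bullet> axis i 1) / norm (x - q)) * Wl \<tau> x"
    define B where "B = kap * (\<sigma> * \<tau>) * exp (\<sigma> * \<tau> * x $ 3) * El \<tau> x"
    have "dl \<tau> x $ i = - A - (if i = 3 then B else 0)" by (simp add: lower_grad_def A_def B_def)
    then show ?thesis using 1[of i] 2 unfolding A_def[symmetric] B_def[symmetric]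
      by (cases "i = 3") (simp_all add: abs_le_iff)
  qed
  have "\<bar>dl \<tau> x $ 1\<bar> \<le> k \<tau> * El \<tau> x" "\<bar>dl \<tau> x $ 2\<bar> \<le> k \<tau> * El \<tau> x" "\<bar>dl \<tau> x $ 3\<bar> \<le> k \<tau> * El \<tau> x + \<sigma> * \<tau> * El \<tau> x"
    using c[of 1] c[of 2] c[of 3] by simp_all
  then have "norm (dl \<tau> x) \<le> (3 * k \<tau> + \<sigma> * \<tau>) * El \<tau> x" using norm_real3_le[of "dl \<tau> x"] by (simp add: algebra_simps)
  also have "\<dots> \<le> ((3 * (nm + kc) + \<sigma>) * \<tau>) * El \<tau> x"
    using k_bounds(2)[OF \<tau>] E by (intro mult_right_mono) (auto simp: algebra_simps)
  finally show "norm (dl \<tau> x) \<le> (3 * (nm + kc) + \<sigma>) * \<tau> * El \<tau> x" .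
qed

lemma Wu_bounds:
  assumes \<tau>: "\<tau> \<ge> 1"
  shows "0 \<le> Wu \<tau> x" "norm (du \<tau> x) \<le> ((nm + kc) * (2 + M2) + lam + mu) * \<tau> * Wu \<tau> x"
proof -
  show W: "0 \<le> Wu \<tau> x" using kap by (simp add: upper_wave_def)
  have k0: "k \<tau> > 0" using k_bounds(3)[OF \<tau>] .
  have lm0: "lm \<tau> \<ge> 0" using lam mu \<tau> by (simp add: lm_def)
  let ?u = "\<lambda>i. (upper_vec m1 m2 q x \<bullet> upper_dir m1 m2 i) / norm (upper_vec m1 m2 q x)"
  have u: "\<bar>?u i\<bar> \<le> norm (upper_dir m1 m2 i)" for i
    using Cauchy_Schwarz_ineq2[of "upper_vec m1 m2 q x" "upper_dir m1 m2 i"]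
    by (cases "upper_vec m1 m2 q x = 0") (auto simp: divide_le_eq mult.commute)
  have n: "norm (upper_dir m1 m2 1) = 1" "norm (upper_dir m1 m2 2) = 1" "norm (upper_dir m1 m2 3) \<le> M2"
  proof -
    show "norm (upper_dir m1 m2 1) = 1" "norm (upper_dir m1 m2 2) = 1" by (simp_all add: upper_dir_def norm_axis_1)
    have "(norm (upper_dir m1 m2 3))\<^sup>2 = m1\<^sup>2 + m2\<^sup>2"
      unfolding power2_norm_eq_inner by (simp add: upper_dir_def inner_vec_def sum_3 power2_eq_square)
    also have "\<dots> \<le> M2\<^sup>2" using M2(2) mult_left_mono[of 1 M2 M2] by (simp add: M2_def power2_eq_square)
    finally show "norm (upper_dir m1 m2 3) \<le> M2" by (rule power2_le_imp_le) (use M2(2) in simp)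
  qed
  have c: "\<bar>du \<tau> x $ i\<bar> \<le> (k \<tau> * norm (upper_dir m1 m2 i) + (if i = 3 then lm \<tau> else 0)) * Wu \<tau> x" for i
  proof -
    have "\<bar>du \<tau> x $ i\<bar> = \<bar>k \<tau> * ?u i + (if i = 3 then lm \<tau> else 0)\<bar> * Wu \<tau> x"
    proof -
      have "du \<tau> x $ i = - (k \<tau> * ?u i + (if i = 3 then lm \<tau> else 0)) * Wu \<tau> x" by (simp add: upper_grad_def)
      then show ?thesis by (simp only: abs_mult abs_minus_cancel abs_of_nonneg[OF W])
    qed
    also have "\<dots> \<le> (k \<tau> * norm (upper_dir m1 m2 i) + (if i = 3 then lm \<tau> else 0)) * Wu \<tau> x"
    proof (rule mult_right_mono[OF _ W])
      have "\<bar>k \<tau> * ?u i\<bar> \<le> k \<tau> * norm (upper_dir m1 m2 i)"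
        unfolding abs_mult using k0 u[of i] by (simp only: abs_of_pos mult_left_mono less_imp_le)
      then show "\<bar>k \<tau> * ?u i + (if i = 3 then lm \<tau> else 0)\<bar> \<le> k \<tau> * norm (upper_dir m1 m2 i) + (if i = 3 then lm \<tau> else 0)"
        using lm0 abs_triangle_ineq[of "k \<tau> * ?u i" "if i = 3 then lm \<tau> else 0"] by (auto split: if_splits)
    qed
    finally show ?thesis .
  qed
  have "norm (du \<tau> x) \<le> (k \<tau> * 1 + k \<tau> * 1 + (k \<tau> * norm (upper_dir m1 m2 3) + lm \<tau>)) * Wu \<tau> x"
    using norm_real3_le[of "du \<tau> x"] c[of 1] c[of 2] c[of 3] by (simp add: n algebra_simps)
  also have "\<dots> \<le> (((nm + kc) * (2 + M2) + lam + mu) * \<tau>) * Wu \<tau> x"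
  proof (rule mult_right_mono[OF _ W])
    have "k \<tau> * norm (upper_dir m1 m2 3) \<le> k \<tau> * M2" using k0 n by (intro mult_left_mono) auto
    moreover have "k \<tau> * (2 + M2) \<le> (nm + kc) * \<tau> * (2 + M2)" using k_bounds(2)[OF \<tau>] M2(2) by (intro mult_right_mono) auto
    moreover have "mu * 1 \<le> mu * \<tau>" using mu \<tau> by (intro mult_left_mono) auto
    ultimately show "k \<tau> * 1 + k \<tau> * 1 + (k \<tau> * norm (upper_dir m1 m2 3) + lm \<tau>) \<le> ((nm + kc) * (2 + M2) + lam + mu) * \<tau>"
      by (simp add: lm_def algebra_simps)
  qed
  finally show "norm (du \<tau> x) \<le> ((nm + kc) * (2 + M2) + lam + mu) * \<tau> * Wu \<tau> x" .
qed

lemma El_far: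
  assumes \<tau>: "\<tau> \<ge> 1" and x: "norm x \<ge> rc"
  shows "El \<tau> x \<le> exp (- (\<tau> * (path_length + 1)))"
proof -
  have "norm (x - q) - \<rho> / 2 \<ge> rc - norm q - \<rho>" using norm_triangle_ineq2[of x q] x \<rho> by linarith
  moreover have g: "rc - norm q - \<rho> > 0"
    using rc(5) path_length nm(1) zero_less_mult_pos[of nm "rc - norm q - \<rho>"] by linarith
  ultimately have "k \<tau> * (norm (x - q) - \<rho> / 2) \<ge> nm * \<tau> * (rc - norm q - \<rho>)"
    using k_bounds[OF \<tau>] nm \<tau> by (intro mult_mono) auto
  moreover have "\<tau> * (nm * (rc - norm q - \<rho>)) \<ge> \<tau> * (path_length + 1)" using rc(5) \<tau> by (intro mult_left_mono) auto
  ultimately show ?thesis by (simp add: lower_exp_def mult_ac)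
qed

text \<open>The broken line from \<open>q\<close> over the foot of \<open>x\<close> to
  \<open>x\<close> has length \<open>P + x $ 3 / \<omega> $ 3\<close>, at least
  \<open>rc - norm q\<close>, and each leg is weighted by at least the smaller slowness. The
  constant \<open>exp 4\<close> is the price of \<open>kc * (P - \<rho> / 2) \<ge> - 4\<close>,
  where \<open>kc = 8 / \<rho>\<close>.\<close>

lemma Wu_far:
  assumes \<tau>: "\<tau> \<ge> 1" and x: "norm x \<ge> rc" "x $ 3 \<ge> 0"
  shows "Wu \<tau> x \<le> exp 4 * exp (- (\<tau> * (path_length + 1)))"
proof -
  define P where "P = norm (upper_vec m1 m2 q x)"
  define c1 where "c1 = min nm np"
  have c1: "c1 \<ge> 0" "c1 \<le> nm" "c1 \<le> lam * \<omega> $ 3" using nm np lam(3) by (auto simp: c1_def)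
  have P: "rc - norm q \<le> P + x $ 3 / \<omega> $ 3"
  proof -
    have "norm (upper_vec m1 m2 q x + q + (x $ 3 / \<omega> $ 3) *\<^sub>R \<omega>) \<le> P + norm q + norm ((x $ 3 / \<omega> $ 3) *\<^sub>R \<omega>)"
      unfolding P_def by (intro norm_triangle_le add_mono norm_triangle_ineq order_refl)
    moreover have "norm ((x $ 3 / \<omega> $ 3) *\<^sub>R \<omega>) = x $ 3 / \<omega> $ 3" using norm_\<omega> \<omega>3 x by simp
    ultimately show ?thesis using x by (simp add: upper_vec_eq)
  qed
  have "nm * P + lam * x $ 3 \<ge> c1 * (P + x $ 3 / \<omega> $ 3)"
  proof -
    have "c1 * P \<le> nm * P" using c1 by (intro mult_right_mono) (auto simp: P_def)
    moreover have "c1 * (x $ 3 / \<omega> $ 3) \<le> lam * \<omega> $ 3 * (x $ 3 / \<omega> $ 3)" using c1 x \<omega>3 by (intro mult_right_mono) auto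
    ultimately show ?thesis using \<omega>3 by (simp add: distrib_left)
  qed
  moreover have "c1 * (P + x $ 3 / \<omega> $ 3) \<ge> c1 * (rc - norm q)" using c1 P by (intro mult_left_mono)
  ultimately have a: "nm * P + lam * x $ 3 - nm * \<rho> \<ge> path_length + 1" using rc(4) by (simp add: c1_def)
  have "nm * (P - \<rho> / 2) + lam * x $ 3 \<ge> path_length + 1"
  proof -
    have "nm * \<rho> \<ge> 0" using nm \<rho> by simp
    then show ?thesis using a by (simp add: right_diff_distrib)
  qed
  then have "\<tau> * (nm * (P - \<rho> / 2) + lam * x $ 3) \<ge> \<tau> * (path_length + 1)" using \<tau> by (intro mult_left_mono) auto
  moreover have "kc * (P - \<rho> / 2) \<ge> - 4"
  proof -
    have "kc * (P - \<rho> / 2) \<ge> kc * (- (\<rho> / 2))" using kc by (intro mult_left_mono) (auto simp: P_def)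
    then show ?thesis using \<rho> by (simp add: kc_def)
  qed
  moreover have "mu * x $ 3 \<ge> 0" using mu x by simp
  ultimately have "- (k \<tau> * (P - \<rho> / 2)) - lm \<tau> * x $ 3 \<le> 4 - \<tau> * (path_length + 1)"
    by (simp add: k_def lm_def algebra_simps)
  then have "exp (- (k \<tau> * (P - \<rho> / 2)) - lm \<tau> * x $ 3) \<le> exp 4 * exp (- (\<tau> * (path_length + 1)))"
    by (simp add: exp_diff[symmetric] exp_add[symmetric])
  moreover have "Wu \<tau> x \<le> 1 * exp (- (k \<tau> * (P - \<rho> / 2)) - lm \<tau> * x $ 3)"
    unfolding upper_wave_def P_def using kap by (intro mult_right_mono) auto
  ultimately show ?thesis by linarith
qed

definition "far_const = exp 4 * ((3 * (nm + kc) + \<sigma>) + ((nm + kc) * (2 + M2) + lam + mu) + 1)"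

lemma wave_far:
  assumes \<tau>: "\<tau> \<ge> 1" and x: "norm x \<ge> rc"
  shows "\<bar>layer (Wu \<tau>) (Wl \<tau>) x\<bar> \<le> far_const * \<tau> * exp (- (\<tau> * (path_length + 1)))"
    and "norm (if x $ 3 > 0 then du \<tau> x else dl \<tau> x) \<le> far_const * \<tau> * exp (- (\<tau> * (path_length + 1)))"
proof -
  define e where "e = exp (- (\<tau> * (path_length + 1)))"
  have e: "e > 0" by (simp add: e_def)
  define a where "a = 3 * (nm + kc) + \<sigma>"
  define b where "b = (nm + kc) * (2 + M2) + lam + mu"
  have ab: "a > 0" "b > 0" using nm(1) kc \<sigma> M2(2) lam(1) mu unfolding a_def b_def by (auto intro!: add_pos_pos mult_pos_pos)
  have fc: "far_const * \<tau> * e = exp 4 * (a + b + 1) * \<tau> * e" by (simp add: far_const_def a_def b_def)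
  have e4: "exp 4 \<ge> (1::real)" by simp
  have s: "w \<le> far_const * \<tau> * e" if "w \<le> d * \<tau> * E" "0 \<le> d" "d \<le> a + b + 1" "E \<le> exp 4 * e" "0 \<le> E" for w d E
  proof -
    have "d * \<tau> * E \<le> (a + b + 1) * \<tau> * (exp 4 * e)" using that \<tau> ab by (intro mult_mono) auto
    then show ?thesis using that(1) unfolding fc by (simp only: mult_ac)
  qed
  have El: "El \<tau> x \<le> exp 4 * e"
  proof -
    have "1 * e \<le> exp 4 * e" using e e4 by (intro mult_right_mono) auto
    then show ?thesis using El_far[OF assms] unfolding e_def[symmetric] by linarith
  qed
  have E0: "0 \<le> El \<tau> x" by (simp add: lower_exp_def)
  have w: "w \<le> 1 * \<tau> * E" if "w \<le> E" "0 \<le> E" for w E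
    using that \<tau> mult_right_mono[of 1 \<tau> E] by simp
  have "\<bar>layer (Wu \<tau>) (Wl \<tau>) x\<bar> \<le> far_const * \<tau> * e \<and> norm (if x $ 3 > 0 then du \<tau> x else dl \<tau> x) \<le> far_const * \<tau> * e"
  proof (cases "x $ 3 > 0")
    case True
    note W = Wu_bounds[OF \<tau>, of x]
    have F: "Wu \<tau> x \<le> exp 4 * e" using Wu_far[OF assms] True by (simp add: e_def)
    have "\<bar>Wu \<tau> x\<bar> \<le> far_const * \<tau> * e" by (rule s[OF w _ _ F W(1)]) (use W(1) ab in auto)
    moreover have "norm (du \<tau> x) \<le> far_const * \<tau> * e" by (rule s[OF _ _ _ F W(1), of _ b]) (use W(2) ab in \<open>auto simp: b_def\<close>)
    ultimately show ?thesis using True by (simp add: layer_def)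
  next
    case False
    then have "x $ 3 \<le> 0" by simp
    note W = Wl_bounds[OF \<tau> this]
    have "\<bar>Wl \<tau> x\<bar> \<le> far_const * \<tau> * e" by (rule s[OF w _ _ El E0]) (use W(1,2) E0 ab in auto)
    moreover have "norm (dl \<tau> x) \<le> far_const * \<tau> * e" by (rule s[OF _ _ _ El E0, of _ a]) (use W(3) ab in \<open>auto simp: a_def\<close>)
    ultimately show ?thesis using False by (simp add: layer_def)
  qed
  then show "\<bar>layer (Wu \<tau>) (Wl \<tau>) x\<bar> \<le> far_const * \<tau> * exp (- (\<tau> * (path_length + 1)))"
    "norm (if x $ 3 > 0 then du \<tau> x else dl \<tau> x) \<le> far_const * \<tau> * exp (- (\<tau> * (path_length + 1)))"
    by (auto simp: e_def)
qed

definition "shell_rate = min (nm / (4 * \<rho>)) (nm / 2)"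

lemma shell_rate: "shell_rate > 0" using nm \<rho> by (simp add: shell_rate_def)

text \<open>With \<open>d = x - p\<close> and \<open>s\<close> its component along
  \<open>\<nu>\<close>, the shell condition reads \<open>2 * \<rho> * s = (norm d)\<^sup>2\<close>
  up to order \<open>1/\<tau>\<close>. Inserted into the distance to \<open>q\<close> it gives
  \<open>norm (x - q) - \<rho> / 2 \<ge> (norm d)\<^sup>2 / (4 * \<rho>)\<close> up to the same
  order: fronts of half the radius leave the shell quadratically.\<close>

lemma El_shell:
  assumes \<tau>: "\<tau> \<ge> 1" and b: "0 < beta \<tau> x" "beta \<tau> x \<le> 4"
  shows "(El \<tau> x)\<^sup>2 \<le> exp (8 * (nm + kc) + nm) * exp (- (shell_rate * \<tau> * ((norm (x - p))\<^sup>2 + \<bar>\<nu> \<bullet> (x - p)\<bar>)))"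
proof -
  define d where "d = x - p"
  define s where "s = \<nu> \<bullet> d"
  define R where "R = norm (x - q)"
  define b where "b = beta \<tau> x"
  have b4: "0 < b" "b \<le> 4" using assms by (auto simp: b_def)
  have nn: "\<nu> \<bullet> \<nu> = 1" using norm_\<nu> by (simp add: norm_eq_1)
  have shift: "(norm (d - t *\<^sub>R \<nu>))\<^sup>2 = (norm d)\<^sup>2 - 2 * t * s + t\<^sup>2" for t
    unfolding power2_norm_eq_inner
    by (simp add: inner_diff inner_commute s_def nn power2_eq_square algebra_simps)
  have "x - b0 = d - \<rho> *\<^sub>R \<nu>" by (simp add: d_def b0_def)
  then have "(norm (x - b0))\<^sup>2 = (norm d)\<^sup>2 - 2 * \<rho> * s + \<rho>\<^sup>2" using shift[of \<rho>] by simp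
  moreover have "b * \<rho> / \<tau> = \<rho>\<^sup>2 - (norm (x - b0))\<^sup>2" using \<tau> \<rho> by (simp add: b_def beta_def)
  ultimately have 1: "2 * \<rho> * s = (norm d)\<^sup>2 + b * \<rho> / \<tau>" by linarith
  have "x - q = d - (\<rho> / 2) *\<^sub>R \<nu>" by (simp add: d_def q_def)
  then have R2: "R\<^sup>2 - (\<rho> / 2)\<^sup>2 = (norm d)\<^sup>2 / 2 - b * \<rho> / (2 * \<tau>)"
    using shift[of "\<rho> / 2"] 1 by (simp add: R_def)
  have s0: "s \<ge> 0"
  proof -
    have "0 \<le> 2 * \<rho> * s" unfolding 1 using b4 \<rho> \<tau> by simp
    then show ?thesis using \<rho> by (simp add: zero_le_mult_iff)
  qed
  have "R \<le> norm (x - b0) + norm (b0 - q)" unfolding R_def using norm_triangle_ineq[of "x - b0" "b0 - q"] by simp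
  then have Rr: "\<rho> / 2 \<le> R + \<rho> / 2" "R + \<rho> / 2 \<le> 2 * \<rho>" "0 < R + \<rho> / 2"
    using beta_pos_ball[OF \<tau> assms(2)] b0_q \<rho> norm_ge_zero[of "x - q"] unfolding R_def by linarith+
  have k: "k \<tau> > 0" "nm * \<tau> \<le> k \<tau>" "k \<tau> / \<tau> \<le> nm + kc" using k_bounds[OF \<tau>] \<tau> by (auto simp: divide_le_eq)
  have "R - \<rho> / 2 = (R\<^sup>2 - (\<rho> / 2)\<^sup>2) / (R + \<rho> / 2)"
    using Rr(3) by (simp add: eq_divide_eq power2_eq_square algebra_simps)
  also have "\<dots> = (norm d)\<^sup>2 / 2 / (R + \<rho> / 2) - b * \<rho> / (2 * \<tau>) / (R + \<rho> / 2)" unfolding R2 by (rule diff_divide_distrib)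
  also have "\<dots> \<ge> (norm d)\<^sup>2 / 2 / (2 * \<rho>) - 4 * \<rho> / (2 * \<tau>) / (\<rho> / 2)"
    by (intro diff_mono frac_le order_refl) (use Rr \<rho> \<tau> b4 in auto)
  finally have "R - \<rho> / 2 \<ge> (norm d)\<^sup>2 / (4 * \<rho>) - 4 / \<tau>" using \<rho> by simp
  then have "k \<tau> * (R - \<rho> / 2) \<ge> k \<tau> * ((norm d)\<^sup>2 / (4 * \<rho>)) - 4 * (k \<tau> / \<tau>)"
    using mult_left_mono[of _ "R - \<rho> / 2" "k \<tau>"] k(1) by (fastforce simp: right_diff_distrib)
  then have kR: "k \<tau> * (R - \<rho> / 2) \<ge> nm * \<tau> * ((norm d)\<^sup>2 / (4 * \<rho>)) - 4 * (nm + kc)"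
  proof -
    have lin: "a' - 4 * c' \<le> X \<Longrightarrow> b' \<le> a' \<Longrightarrow> c' \<le> d' \<Longrightarrow> b' - 4 * d' \<le> X" for a' b' c' d' X :: real by linarith
    show ?thesis
    proof (rule lin)
      show "k \<tau> * ((norm d)\<^sup>2 / (4 * \<rho>)) - 4 * (k \<tau> / \<tau>) \<le> k \<tau> * (R - \<rho> / 2)" by fact
      show "nm * \<tau> * ((norm d)\<^sup>2 / (4 * \<rho>)) \<le> k \<tau> * ((norm d)\<^sup>2 / (4 * \<rho>))" using k \<rho> by (intro mult_right_mono) auto
    qed (rule k(3))
  qed
  \<comment> \<open>In the shell the quadratic growth is at the same time linear growth in the
    normal component \<open>s\<close>.\<close>
  have "(norm d)\<^sup>2 / (4 * \<rho>) \<ge> s / 2 - 1 / \<tau>"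
  proof -
    have "(norm d)\<^sup>2 = 2 * \<rho> * s - b * \<rho> / \<tau>" using 1 by simp
    moreover have "b * (\<rho> / \<tau>) \<le> 4 * (\<rho> / \<tau>)" using b4 \<rho> \<tau> by (intro mult_right_mono) auto
    ultimately have "2 * \<rho> * s - 4 * (\<rho> / \<tau>) \<le> (norm d)\<^sup>2" by simp
    then have "(2 * \<rho> * s - 4 * (\<rho> / \<tau>)) / (4 * \<rho>) \<le> (norm d)\<^sup>2 / (4 * \<rho>)" using \<rho> by (intro divide_right_mono) auto
    moreover have "(2 * \<rho> * s - 4 * (\<rho> / \<tau>)) / (4 * \<rho>) = s / 2 - 1 / \<tau>" using \<rho> \<tau> by (simp add: field_simps)
    ultimately show ?thesis by simp
  qed
  then have "nm * \<tau> * ((norm d)\<^sup>2 / (4 * \<rho>)) \<ge> nm * \<tau> * (s / 2 - 1 / \<tau>)" using nm \<tau> by (intro mult_left_mono) auto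
  moreover have "nm * \<tau> * (s / 2 - 1 / \<tau>) = nm / 2 * (\<tau> * s) - nm" using \<tau> by (simp add: field_simps)
  ultimately have s2: "nm * \<tau> * ((norm d)\<^sup>2 / (4 * \<rho>)) \<ge> nm / 2 * (\<tau> * s) - nm" by linarith
  have "shell_rate * (\<tau> * (norm d)\<^sup>2) \<le> nm / (4 * \<rho>) * (\<tau> * (norm d)\<^sup>2)" "shell_rate * (\<tau> * s) \<le> nm / 2 * (\<tau> * s)"
    unfolding shell_rate_def using \<tau> s0 by (intro mult_right_mono; simp)+
  then have "shell_rate * \<tau> * ((norm d)\<^sup>2 + s) \<le> nm * \<tau> * ((norm d)\<^sup>2 / (4 * \<rho>)) + nm / 2 * (\<tau> * s)"
    by (simp add: algebra_simps)
  \<comment> \<open>Squaring the wave doubles the exponent: one copy is spent on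
    \<open>(norm d)\<^sup>2\<close>, the other on \<open>s\<close>.\<close>
  then have "- (2 * (k \<tau> * (R - \<rho> / 2))) \<le> (8 * (nm + kc) + nm) + - (shell_rate * \<tau> * ((norm d)\<^sup>2 + s))"
    using kR s2 by (simp add: algebra_simps)
  moreover have "(El \<tau> x)\<^sup>2 = exp (- (2 * (k \<tau> * (R - \<rho> / 2))))"
    by (simp add: lower_exp_def R_def exp_double[symmetric] algebra_simps)
  ultimately have "(El \<tau> x)\<^sup>2 \<le> exp (8 * (nm + kc) + nm) * exp (- (shell_rate * \<tau> * ((norm d)\<^sup>2 + s)))"
    by (simp only: exp_add[symmetric] exp_le_cancel_iff)
  then show ?thesis using s0 by (simp add: d_def s_def)
qed

end

section \<open>Cutoff errors\<close>

lemma square_integrable_norm: "square_integrable u \<Longrightarrow> square_integrable (\<lambda>x. norm (u x))"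
  unfolding square_integrable_def by auto

lemma integral_norm_indicator_le:
  fixes u :: "'a::euclidean_space \<Rightarrow> 'b::euclidean_space"
  assumes u: "square_integrable u" and S: "S \<in> lmeasurable"
  shows "integrable lebesgue (\<lambda>x. indicator S x * norm (u x))"
    and "(LINT x|lebesgue. indicator S x * norm (u x)) \<le> sqrt (measure lebesgue S) * sqrt (LINT x|lebesgue. (norm (u x))\<^sup>2)"
proof -
  have sq: "(norm (indicator S x :: real))\<^sup>2 = indicator S x" for x :: 'a by (simp add: indicator_def)
  have "square_integrable (indicator S :: 'a \<Rightarrow> real)"
    unfolding square_integrable_def sq using S by (auto simp: integrable_indicator_iff fmeasurable_def)
  from square_integrable_inner[OF this square_integrable_norm[OF u]]
  show "integrable lebesgue (\<lambda>x. indicator S x * norm (u x))"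
    "(LINT x|lebesgue. indicator S x * norm (u x)) \<le> sqrt (measure lebesgue S) * sqrt (LINT x|lebesgue. (norm (u x))\<^sup>2)"
    unfolding sq using S by (auto simp: abs_le_iff)
qed

context beam
begin

lemma El_continuous: "continuous_on UNIV (El \<tau>)"
  unfolding lower_exp_def by (intro continuous_intros)

text \<open>The range from 1 to 4 of \<open>beta\<close> is wider than the range from 2 to 3 on
  which the cutoff varies; the margin is used by \<open>shell_cut\<close>.\<close>

definition shell_wave :: "real \<Rightarrow> real^3 \<Rightarrow> real" where
  "shell_wave \<tau> x = (if 1 \<le> beta \<tau> x \<and> beta \<tau> x \<le> 4 then El \<tau> x else 0)"

lemma shell_closed: "closed {x. a \<le> beta \<tau> x \<and> beta \<tau> x \<le> b}"
  by (intro closed_Collect_conj closed_Collect_le beta_continuous continuous_intros)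

lemma shell_wave_square_integrable:
  assumes \<tau>: "\<tau> \<ge> 1"
  shows "square_integrable (shell_wave \<tau>)"
proof (rule square_integrable_bounded_support)
  have "shell_wave \<tau> = (\<lambda>x. indicator {x. 1 \<le> beta \<tau> x \<and> beta \<tau> x \<le> 4} x * El \<tau> x)"
    by (auto simp: shell_wave_def indicator_def)
  also have "\<dots> \<in> borel_measurable lebesgue"
    using shell_closed[of 1 \<tau> 4] continuous_imp_lebesgue_measurable[OF El_continuous]
    by (intro borel_measurable_times borel_measurable_indicator) auto
  finally show "shell_wave \<tau> \<in> borel_measurable lebesgue" .
  show "norm (shell_wave \<tau> x) \<le> exp (k \<tau> * (\<rho> / 2))" for x
    using mult_nonneg_nonneg[of "k \<tau>" "norm (x - q)"] k_bounds(3)[OF \<tau>] by (auto simp: shell_wave_def lower_exp_def algebra_simps)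
  show "shell_wave \<tau> x = 0" if "norm x > rc" for x
    using beta_pos[OF \<tau>, of x] that by (auto simp: shell_wave_def)
qed

lemma shell_wave_L2:
  obtains A where "A \<ge> 0" "\<And>\<tau>. \<tau> \<ge> 1 \<Longrightarrow> (LINT x|lebesgue. (norm (shell_wave \<tau> x))\<^sup>2) \<le> (A / \<tau>)\<^sup>2"
proof -
  show thesis
  proof (rule beam_profile_integral[OF shell_rate])
    fix A assume A: "A > 0" "\<And>\<tau> \<nu> (p::real^3). \<tau> > 0 \<Longrightarrow> norm \<nu> = 1 \<Longrightarrow>
      (\<integral>\<^sup>+x. ennreal (exp (- (shell_rate * \<tau> * ((norm (x - p))\<^sup>2 + \<bar>\<nu> \<bullet> (x - p)\<bar>)))) \<partial>lebesgue) \<le> ennreal (A / \<tau>\<^sup>2)"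
    define K where "K = exp (8 * (nm + kc) + nm)"
    have K: "K > 0" by (simp add: K_def)
    have "(LINT x|lebesgue. (norm (shell_wave \<tau> x))\<^sup>2) \<le> (sqrt (K * A) / \<tau>)\<^sup>2" if \<tau>: "\<tau> \<ge> 1" for \<tau>
    proof (rule integral_real_bounded)
      let ?e = "\<lambda>x. ennreal (exp (- (shell_rate * \<tau> * ((norm (x - p))\<^sup>2 + \<bar>\<nu> \<bullet> (x - p)\<bar>))))"
      have "ennreal ((norm (shell_wave \<tau> x))\<^sup>2) \<le> ennreal K * ?e x" for x
      proof (cases "1 \<le> beta \<tau> x \<and> beta \<tau> x \<le> 4")
        case True
        then show ?thesis using El_shell[OF \<tau>, of x, folded K_def] K by (simp add: shell_wave_def ennreal_mult[symmetric])
      qed (auto simp: shell_wave_def)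
      then have "(\<integral>\<^sup>+x. ennreal ((norm (shell_wave \<tau> x))\<^sup>2) \<partial>lebesgue) \<le> (\<integral>\<^sup>+x. ennreal K * ?e x \<partial>lebesgue)"
        by (rule nn_integral_mono)
      also have "\<dots> = ennreal K * (\<integral>\<^sup>+x. ?e x \<partial>lebesgue)"
      proof (rule nn_integral_cmult)
        have "continuous_on UNIV (\<lambda>x. exp (- (shell_rate * \<tau> * ((norm (x - p))\<^sup>2 + \<bar>\<nu> \<bullet> (x - p)\<bar>))))"
          by (intro continuous_intros)
        from continuous_imp_lebesgue_measurable[OF this] show "?e \<in> borel_measurable lebesgue" by simp
      qed
      also have "\<dots> \<le> ennreal K * ennreal (A / \<tau>\<^sup>2)" using \<tau> norm_\<nu> by (intro mult_left_mono A(2)) auto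
      also have "\<dots> = ennreal ((sqrt (K * A) / \<tau>)\<^sup>2)" using K A \<tau> by (simp add: ennreal_mult[symmetric] power_divide)
      finally show "(\<integral>\<^sup>+x. ennreal ((norm (shell_wave \<tau> x))\<^sup>2) \<partial>lebesgue) \<le> ennreal ((sqrt (K * A) / \<tau>)\<^sup>2)" .
    qed simp
    then show thesis using that[of "sqrt (K * A)"] K A(1) by simp
  qed
qed

lemma shell_wave_gradient:
  assumes \<tau>: "\<tau> \<ge> 1" and w: "square_integrable (G :: real^3 \<Rightarrow> real^3)"
  shows "integrable lebesgue (\<lambda>x. shell_wave \<tau> x * norm (G x))"
    and "(LINT x|lebesgue. shell_wave \<tau> x * norm (G x)) \<le>
      sqrt (LINT x|lebesgue. (norm (shell_wave \<tau> x))\<^sup>2) * sqrt (LINT x|lebesgue. indicator (ball b0 \<rho>) x * (norm (G x))\<^sup>2)"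
proof -
  have g: "square_integrable (\<lambda>x. indicator (ball b0 \<rho>) x *\<^sub>R G x)"
    by (rule square_integrable_bounded_mult[OF w borel_measurable_indicator, of _ 1]) (auto simp: indicator_def)
  have eq: "shell_wave \<tau> x * norm (indicator (ball b0 \<rho>) x *\<^sub>R G x) = shell_wave \<tau> x * norm (G x)" for x
    using beta_pos_ball[OF \<tau>, of x] by (auto simp: shell_wave_def indicator_def dist_norm norm_minus_commute)
  have sq: "(norm (norm (indicator (ball b0 \<rho>) x *\<^sub>R G x)))\<^sup>2 = indicator (ball b0 \<rho>) x * (norm (G x))\<^sup>2" for x
    by (simp add: indicator_def)
  from square_integrable_inner[OF shell_wave_square_integrable[OF \<tau>] square_integrable_norm[OF g]]
  show "integrable lebesgue (\<lambda>x. shell_wave \<tau> x * norm (G x))"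
    "(LINT x|lebesgue. shell_wave \<tau> x * norm (G x)) \<le>
      sqrt (LINT x|lebesgue. (norm (shell_wave \<tau> x))\<^sup>2) * sqrt (LINT x|lebesgue. indicator (ball b0 \<rho>) x * (norm (G x))\<^sup>2)"
    unfolding sq inner_real_def eq by (auto simp: abs_le_iff)
qed

lemma q_outside: "\<tau> \<ge> 8 / \<rho> \<Longrightarrow> q \<notin> {x. 1 \<le> beta \<tau> x \<and> beta \<tau> x \<le> 4}"
  using beta_far(1)[of \<tau> q] \<rho> by auto

text \<open>Equal to one for \<open>beta\<close> between 2 and 3, and zero unless
  \<open>beta\<close> lies between 1 and 4.\<close>

definition shell_cut :: "real \<Rightarrow> real^3 \<Rightarrow> real" where
  "shell_cut \<tau> x = smoothstep (beta \<tau> x - 1) * smoothstep (4 - beta \<tau> x)"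

definition shell_cut_grad :: "real \<Rightarrow> real^3 \<Rightarrow> real^3" where
  "shell_cut_grad \<tau> x = ((smoothstep' (beta \<tau> x - 1) * smoothstep (4 - beta \<tau> x) - smoothstep (beta \<tau> x - 1) * smoothstep' (4 - beta \<tau> x))
    * (- (2 * \<tau> / \<rho>))) *\<^sub>R (x - b0)"

lemma shell_cut_dir_deriv: "has_dir_deriv (shell_cut \<tau>) (\<lambda>x. shell_cut_grad \<tau> x $ i) (axis i 1)"
  unfolding has_dir_deriv_def
proof
  fix x :: "real^3"
  let ?d = "- (2 * \<tau> / \<rho>) * (x - b0) $ i"
  have b: "((\<lambda>t. beta \<tau> (x + t *\<^sub>R axis i 1)) has_real_derivative ?d) (at 0)"
    using beta_DERIV[of \<tau> x "axis i 1"] by (simp add: inner_axis_real3)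
  have 1: "((\<lambda>t. smoothstep (beta \<tau> (x + t *\<^sub>R axis i 1) - 1)) has_real_derivative smoothstep' (beta \<tau> x - 1) * (?d - 0)) (at 0)"
    by (rule DERIV_chain2[where g="\<lambda>t. beta \<tau> (x + t *\<^sub>R axis i 1) - 1" and f=smoothstep, OF _ DERIV_diff[OF b DERIV_const]])
      (simp add: smoothstep_DERIV)
  have 2: "((\<lambda>t. smoothstep (4 - beta \<tau> (x + t *\<^sub>R axis i 1))) has_real_derivative smoothstep' (4 - beta \<tau> x) * (0 - ?d)) (at 0)"
    by (rule DERIV_chain2[where g="\<lambda>t. 4 - beta \<tau> (x + t *\<^sub>R axis i 1)" and f=smoothstep, OF _ DERIV_diff[OF DERIV_const b]])
      (simp add: smoothstep_DERIV)
  from DERIV_mult[OF 1 2] show "((\<lambda>t. shell_cut \<tau> (x + t *\<^sub>R axis i 1)) has_real_derivative shell_cut_grad \<tau> x $ i) (at 0)"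
    unfolding shell_cut_def by (rule DERIV_cong) (simp add: shell_cut_grad_def algebra_simps)
qed

lemma shell_cut_continuous: "continuous_on UNIV (shell_cut \<tau>)" "continuous_on UNIV (shell_cut_grad \<tau>)"
  unfolding shell_cut_def shell_cut_grad_def using \<rho>
  by (auto intro!: continuous_intros beta_continuous)

lemma shell_cut_support:
  assumes "x \<notin> {x. 1 \<le> beta \<tau> x \<and> beta \<tau> x \<le> 4}"
  shows "shell_cut \<tau> x = 0" "shell_cut_grad \<tau> x = 0"
  using assms by (auto simp: shell_cut_def shell_cut_grad_def smoothstep_simps not_le)

lemma norm_shell_cut_grad:
  assumes \<tau>: "\<tau> \<ge> 1"
  shows "norm (shell_cut_grad \<tau> x) \<le> 4 * \<tau>"
proof (cases "1 \<le> beta \<tau> x")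
  case True
  let ?a = "smoothstep' (beta \<tau> x - 1) * smoothstep (4 - beta \<tau> x)" and ?b = "smoothstep (beta \<tau> x - 1) * smoothstep' (4 - beta \<tau> x)"
  have "0 \<le> ?a" "?a \<le> 2 * 1" "0 \<le> ?b" "?b \<le> 1 * 2"
    by (rule mult_mono mult_nonneg_nonneg smoothstep_bounds zero_le_numeral zero_le_one)+
  then have "\<bar>?a - ?b\<bar> \<le> 2" by linarith
  moreover have "norm (x - b0) \<le> \<rho>" using beta_pos_ball[OF \<tau>, of x] True by simp
  ultimately have "\<bar>?a - ?b\<bar> * (2 * \<tau> / \<rho>) * norm (x - b0) \<le> 2 * (2 * \<tau> / \<rho>) * \<rho>"
    using \<tau> \<rho> by (intro mult_mono) auto
  then show ?thesis using \<tau> \<rho> by (simp add: shell_cut_grad_def abs_mult)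
qed (use \<tau> shell_cut_support in auto)

text \<open>The equation is tested with \<open>shell_cut\<close> times the pure radial wave. The
  source vanishes in the lower half-space, so \<open>\<tau>\<^sup>2\<close> times the mass of
  \<open>v\<close> is bounded by a gradient term, and the gradient of the test function is only of
  order \<open>\<tau>\<close> times the wave. Thus \<open>v\<close> is traded for \<open>G\<close>
  with a gain of \<open>1/\<tau>\<close>, without a Poincare inequality.\<close>

lemma shell_mass:
  assumes \<tau>: "\<tau> \<ge> 1" "\<tau> \<ge> 8 / \<rho>" and w: "wsol (two_layer \<gamma>p \<gamma>m) f \<tau> v G"
    and v: "AE x in lebesgue. v x \<ge> 0" and f: "AE x in lebesgue. x $ 3 \<le> 0 \<longrightarrow> f x = 0"
  shows "integrable lebesgue (\<lambda>x. (if 2 \<le> beta \<tau> x \<and> beta \<tau> x \<le> 3 then El \<tau> x else 0) * \<bar>v x\<bar>)"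
    and "\<tau>\<^sup>2 * (LINT x|lebesgue. (if 2 \<le> beta \<tau> x \<and> beta \<tau> x \<le> 3 then El \<tau> x else 0) * \<bar>v x\<bar>)
      \<le> \<gamma>m * (4 + nm + kc) * \<tau> * (LINT x|lebesgue. shell_wave \<tau> x * norm (G x))"
proof -
  let ?S = "{x. 1 \<le> beta \<tau> x \<and> beta \<tau> x \<le> 4}" and ?U = "- {q}"
  let ?E = "\<lambda>x. if 2 \<le> beta \<tau> x \<and> beta \<tau> x \<le> 3 then El \<tau> x else 0"
  have sv: "square_integrable v" and sG: "square_integrable G"
    using w by (auto simp: wsol_def has_weak_gradient_def)
  have E0: "El \<tau> x > 0" for x by (simp add: lower_exp_def)
  \<comment> \<open>With \<open>sg = 0\<close> and \<open>kap = 0\<close> the boundary layer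
    disappears, and the derivative formulas for the lower wave serve the radial wave.\<close>
  define g where "g = lower_grad (k \<tau>) 0 0 (\<rho> / 2) q"
  have Elw: "lower_wave (k \<tau>) 0 0 (\<rho> / 2) q = El \<tau>" by (simp add: fun_eq_iff lower_wave_def)
  note U = shell_closed[of 1 \<tau> 4]
  have SU: "?S \<subseteq> ?U" using q_outside[OF \<tau>(2)] by auto
  have oU: "open ?U" by (simp add: open_Compl)
  have cg: "continuous_on ?U g" unfolding g_def by (rule lower_continuous)
  have gd: "((\<lambda>t. El \<tau> (x + t *\<^sub>R axis i 1)) has_real_derivative g x $ i) (at 0)" if "x \<in> ?U" for x i
    using lower_DERIV(1)[of x q "k \<tau>" 0 0 "\<rho> / 2" i] that by (simp add: Elw g_def)
  define \<eta> where "\<eta> x = shell_cut \<tau> x * El \<tau> x" for x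
  define \<eta>' where "\<eta>' x = El \<tau> x *\<^sub>R shell_cut_grad \<tau> x + shell_cut \<tau> x *\<^sub>R g x" for x
  have supp: "\<eta> x = 0" "\<eta>' x = 0" if "x \<notin> ?S" for x using shell_cut_support[OF that] by (simp_all add: \<eta>_def \<eta>'_def)
  have far: "x \<notin> ?S" if "norm x > rc" for x using beta_pos[OF \<tau>(1), of x] that by auto
  have \<eta>g: "has_weak_gradient \<eta> \<eta>'"
  proof -
    \<comment> \<open>The layered statement is used with the same function on both sides.\<close>
    have "has_weak_gradient (layer \<eta> \<eta>) (\<lambda>x. if x $ 3 > 0 then \<eta>' x else \<eta>' x)"
    proof (rule layered_weak_gradient[where r=rc])
      fix i
      have "has_dir_deriv (\<lambda>x. shell_cut \<tau> x * El \<tau> x) (\<lambda>x. shell_cut_grad \<tau> x $ i * El \<tau> x + shell_cut \<tau> x * g x $ i) (axis i 1)"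
        by (rule cutoff_dir_deriv[OF shell_cut_dir_deriv _ _ gd U SU]) (use shell_cut_support in auto)
      then show "has_dir_deriv \<eta> (\<lambda>x. \<eta>' x $ i) (axis i 1)"
        by (simp add: \<eta>_def[abs_def] \<eta>'_def mult.commute)
      then show "has_dir_deriv \<eta> (\<lambda>x. \<eta>' x $ i) (axis i 1)" .
    next
      show c: "continuous_on UNIV \<eta>" unfolding \<eta>_def by (intro continuous_intros shell_cut_continuous El_continuous)
      then show "continuous_on UNIV \<eta>" .
      have "continuous_on UNIV (\<lambda>x. shell_cut \<tau> x *\<^sub>R g x)"
        by (rule cutoff_continuous[OF shell_cut_continuous(1) shell_cut_support(1) cg oU U SU])
      then show c': "continuous_on UNIV \<eta>'" unfolding \<eta>'_def
        by (intro continuous_on_add[OF continuous_on_scaleR[OF El_continuous shell_cut_continuous(2)]])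
      then show "continuous_on UNIV \<eta>'" .
    qed (use supp far in auto)
    moreover have "layer \<eta> \<eta> = \<eta>" by (simp add: layer_def fun_eq_iff)
    ultimately show ?thesis by simp
  qed
  have s\<eta>: "square_integrable \<eta>" and s\<eta>': "square_integrable \<eta>'" using \<eta>g by (auto simp: has_weak_gradient_def)
  have cut: "0 \<le> shell_cut \<tau> x" "shell_cut \<tau> x \<le> 1" for x
    by (auto simp: shell_cut_def smoothstep_bounds intro!: mult_le_one)
  have \<eta>'_le: "norm (\<eta>' x) \<le> (4 + nm + kc) * \<tau> * shell_wave \<tau> x" for x
  proof (cases "x \<in> ?S")
    case True
    then have "x \<noteq> q" using SU by auto
    have "g x = (- (k \<tau> * El \<tau> x / norm (x - q))) *\<^sub>R (x - q)"
      by (simp add: g_def lower_grad_def vec_eq_iff inner_axis_real3 Elw)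
    then have "norm (g x) = k \<tau> * El \<tau> x" using \<open>x \<noteq> q\<close> k_bounds(3)[OF \<tau>(1)] E0[of x] by (simp add: abs_mult)
    then have "norm (shell_cut \<tau> x *\<^sub>R g x) \<le> 1 * (k \<tau> * El \<tau> x)"
      using cut[of x] E0[of x] k_bounds(3)[OF \<tau>(1)] by (simp add: mult_right_mono)
    moreover have "norm (El \<tau> x *\<^sub>R shell_cut_grad \<tau> x) \<le> El \<tau> x * (4 * \<tau>)"
      using E0[of x] norm_shell_cut_grad[OF \<tau>(1), of x] by simp
    moreover have "k \<tau> * El \<tau> x \<le> (nm + kc) * \<tau> * El \<tau> x"
      using E0[of x] k_bounds(2)[OF \<tau>(1)] by (intro mult_right_mono) auto
    moreover have "norm (\<eta>' x) \<le> norm (El \<tau> x *\<^sub>R shell_cut_grad \<tau> x) + norm (shell_cut \<tau> x *\<^sub>R g x)"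
      unfolding \<eta>'_def by (rule norm_triangle_ineq)
    ultimately show ?thesis using True by (simp add: shell_wave_def algebra_simps)
  next
    case False
    then show ?thesis using supp by (auto simp: shell_wave_def)
  qed
  have 1: "integrable lebesgue (\<lambda>x. \<eta> x * \<bar>v x\<bar>)"
    using square_integrable_inner(1)[OF s\<eta> square_integrable_norm[OF sv]] by simp
  have Em: "?E \<in> borel_measurable lebesgue"
  proof -
    have "?E = (\<lambda>x. indicator {x. 2 \<le> beta \<tau> x \<and> beta \<tau> x \<le> 3} x * El \<tau> x)" by (auto simp: indicator_def)
    also have "\<dots> \<in> borel_measurable lebesgue"
      using shell_closed[of 2 \<tau> 3] continuous_imp_lebesgue_measurable[OF El_continuous]
      by (intro borel_measurable_times borel_measurable_indicator) auto
    finally show ?thesis .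
  qed
  have E\<eta>: "?E x \<le> \<eta> x" "0 \<le> ?E x" for x
    using cut(1)[of x] E0[of x] by (auto simp: \<eta>_def shell_cut_def smoothstep_simps)
  have vm: "v \<in> borel_measurable lebesgue" using sv by (simp add: square_integrable_def)
  show i: "integrable lebesgue (\<lambda>x. ?E x * \<bar>v x\<bar>)"
  proof (rule Bochner_Integration.integrable_bound[OF 1])
    show "(\<lambda>x. ?E x * \<bar>v x\<bar>) \<in> borel_measurable lebesgue" using Em vm by (intro borel_measurable_times borel_measurable_abs) auto
    show "AE x in lebesgue. norm (?E x * \<bar>v x\<bar>) \<le> norm (\<eta> x * \<bar>v x\<bar>)"
    proof (rule AE_I2)
      fix x
      have "?E x * \<bar>v x\<bar> \<le> \<eta> x * \<bar>v x\<bar>" using E\<eta> by (intro mult_right_mono) auto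
      moreover have "0 \<le> ?E x * \<bar>v x\<bar>" using E\<eta>(2)[of x] by (intro mult_nonneg_nonneg) auto
      ultimately show "norm (?E x * \<bar>v x\<bar>) \<le> norm (\<eta> x * \<bar>v x\<bar>)" unfolding real_norm_def by linarith
    qed
  qed
  have "(LINT x|lebesgue. ?E x * \<bar>v x\<bar>) \<le> (LINT x|lebesgue. \<eta> x * \<bar>v x\<bar>)"
    by (rule integral_mono[OF i 1], rule mult_right_mono[OF E\<eta>(1)]) simp
  also have "\<dots> = (LINT x|lebesgue. v x * \<eta> x)"
    by (rule integral_cong_AE) (use v 1 square_integrable_inner(1)[OF sv s\<eta>] in \<open>auto elim: eventually_mono\<close>)
  finally have 2: "\<tau>\<^sup>2 * (LINT x|lebesgue. ?E x * \<bar>v x\<bar>) \<le> \<tau>\<^sup>2 * (LINT x|lebesgue. v x * \<eta> x)" by (simp add: mult_left_mono)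
  have ga: "two_layer \<gamma>p \<gamma>m \<in> borel_measurable lebesgue" by (rule two_layer_measurable)
  have "integrable lebesgue (\<lambda>x. v x * \<eta> x)" using square_integrable_inner(1)[OF sv s\<eta>] by simp
  then have iv: "integrable lebesgue (\<lambda>x. \<tau>\<^sup>2 * v x * \<eta> x)" using integrable_mult_right[of "\<tau>\<^sup>2"] by (simp add: mult.assoc)
  have "square_integrable (\<lambda>x. two_layer \<gamma>p \<gamma>m x *\<^sub>R G x)"
    by (rule square_integrable_bounded_mult[OF sG ga, of "\<gamma>p + \<gamma>m"]) (use \<gamma> in \<open>auto simp: two_layer_def\<close>)
  from square_integrable_inner(1)[OF this s\<eta>'] have iG: "integrable lebesgue (\<lambda>x. two_layer \<gamma>p \<gamma>m x * (G x \<bullet> \<eta>' x))" by simp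
  have "(LINT x|lebesgue. two_layer \<gamma>p \<gamma>m x * (G x \<bullet> \<eta>' x) + \<tau>\<^sup>2 * v x * \<eta> x) = (LINT x|lebesgue. f x * \<eta> x)"
    using w \<eta>g by (auto simp: wsol_def)
  also have "\<dots> = 0"
  proof (rule integral_eq_zero_AE)
    show "AE x in lebesgue. f x * \<eta> x = 0" using f
    proof eventually_elim
      case (elim x)
      then show ?case using beta_pos[OF \<tau>(1), of x] supp[of x] by (cases "x \<in> ?S") auto
    qed
  qed
  finally have "(LINT x|lebesgue. two_layer \<gamma>p \<gamma>m x * (G x \<bullet> \<eta>' x)) + (LINT x|lebesgue. \<tau>\<^sup>2 * v x * \<eta> x) = 0"
    using Bochner_Integration.integral_add[OF iG iv] by simp
  then have 3: "\<tau>\<^sup>2 * (LINT x|lebesgue. v x * \<eta> x) = (LINT x|lebesgue. - (two_layer \<gamma>p \<gamma>m x * (G x \<bullet> \<eta>' x)))"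
    by (simp add: mult.assoc)
  also have "\<dots> \<le> (LINT x|lebesgue. \<gamma>m * (4 + nm + kc) * \<tau> * (shell_wave \<tau> x * norm (G x)))"
  proof (rule integral_mono)
    show "integrable lebesgue (\<lambda>x. - (two_layer \<gamma>p \<gamma>m x * (G x \<bullet> \<eta>' x)))" using iG by simp
    show "integrable lebesgue (\<lambda>x. \<gamma>m * (4 + nm + kc) * \<tau> * (shell_wave \<tau> x * norm (G x)))"
      by (intro integrable_mult_right shell_wave_gradient(1) \<tau> sG)
    fix x
    have "- (two_layer \<gamma>p \<gamma>m x * (G x \<bullet> \<eta>' x)) \<le> \<gamma>m * (norm (G x) * norm (\<eta>' x))"
    proof (cases "x \<in> ?S")
      case True
      then have "two_layer \<gamma>p \<gamma>m x = \<gamma>m" using beta_pos[OF \<tau>(1), of x] by (auto simp: two_layer_def)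
      moreover have "- (G x \<bullet> \<eta>' x) \<le> norm (G x) * norm (\<eta>' x)" using Cauchy_Schwarz_ineq2[of "G x" "\<eta>' x"] by linarith
      ultimately show ?thesis using mult_left_mono[of "- (G x \<bullet> \<eta>' x)" "norm (G x) * norm (\<eta>' x)" \<gamma>m] \<gamma> by simp
    qed (simp add: supp)
    also have "\<dots> \<le> \<gamma>m * (norm (G x) * ((4 + nm + kc) * \<tau> * shell_wave \<tau> x))"
      using \<gamma> by (intro mult_left_mono \<eta>'_le) auto
    finally show "- (two_layer \<gamma>p \<gamma>m x * (G x \<bullet> \<eta>' x)) \<le> \<gamma>m * (4 + nm + kc) * \<tau> * (shell_wave \<tau> x * norm (G x))"
      by (simp only: mult_ac)
  qed
  finally show "\<tau>\<^sup>2 * (LINT x|lebesgue. ?E x * \<bar>v x\<bar>) \<le> \<gamma>m * (4 + nm + kc) * \<tau> * (LINT x|lebesgue. shell_wave \<tau> x * norm (G x))"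
    using 2 by simp
qed

end

section \<open>The total error caused by the cutoff, and the wave near the source\<close>

context beam
begin

abbreviation "wave \<tau> \<equiv> layer (Wu \<tau>) (Wl \<tau>)"
abbreviation "wave_grad \<tau> x \<equiv> if x $ 3 > 0 then du \<tau> x else dl \<tau> x"

text \<open>The four terms are the two zones of \<open>cut_grad\<close> times the two quantities
  \<open>g\<close> and \<open>s\<close>, which stand for the values of \<open>G\<close> and
  \<open>v\<close>. In the far zone both carry the tiny factor \<open>a\<close>; in the shell the
  term with the wave costs one power of \<open>\<tau>\<close>, the term with its gradient
  two.\<close>

lemma error_pointwise:
  fixes g :: "real^3" and s :: real
  assumes \<tau>: "\<tau> \<ge> 1"
  defines "a \<equiv> far_const * \<tau> * exp (- (\<tau> * (path_length + 1)))" and "b \<equiv> 3 * (nm + kc) + \<sigma>"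
  shows "two_layer \<gamma>p \<gamma>m x * (wave \<tau> x * (g \<bullet> cut_grad \<tau> x) - (wave_grad \<tau> x \<bullet> cut_grad \<tau> x) * s) \<le>
    (\<gamma>p + \<gamma>m) * (a * (8 / rc)) * (indicator (cball 0 (2 * rc)) x * norm g)
    + (\<gamma>p + \<gamma>m) * (a * (8 / rc)) * (indicator (cball 0 (2 * rc)) x * norm s)
    + (\<gamma>p + \<gamma>m) * (4 * \<tau>) * (shell_wave \<tau> x * norm g)
    + (\<gamma>p + \<gamma>m) * (4 * \<tau>) * (b * \<tau>) * ((if 2 \<le> beta \<tau> x \<and> beta \<tau> x \<le> 3 then El \<tau> x else 0) * \<bar>s\<bar>)"
proof -
  let ?W = "\<bar>wave \<tau> x\<bar>" and ?D = "norm (wave_grad \<tau> x)" and ?z = "norm (cut_grad \<tau> x)" and ?\<Gamma> = "\<gamma>p + \<gamma>m"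
  let ?I = "indicator (cball 0 (2 * rc)) x :: real" and ?E = "if 2 \<le> beta \<tau> x \<and> beta \<tau> x \<le> 3 then El \<tau> x else 0"
  have E0: "El \<tau> x \<ge> 0" by (simp add: lower_exp_def)
  have b0: "b \<ge> 0" using nm(1) kc \<sigma> by (simp add: b_def)
  have a0: "a \<ge> 0"
  proof -
    have "far_const \<ge> 0" using nm(1) kc \<sigma> M2(2) lam(1) mu
      unfolding far_const_def by (intro mult_nonneg_nonneg add_nonneg_nonneg) auto
    then show ?thesis using \<tau> by (simp add: a_def)
  qed
  have g0: "?\<Gamma> > 0" using \<gamma> by simp
  have nn: "0 \<le> a * (8 / rc)" "0 \<le> shell_wave \<tau> x" "0 \<le> ?E"
    using a0 rc(3) E0 by (auto simp: shell_wave_def)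
  have lhs: "two_layer \<gamma>p \<gamma>m x * (wave \<tau> x * (g \<bullet> cut_grad \<tau> x) - (wave_grad \<tau> x \<bullet> cut_grad \<tau> x) * s) \<le> ?\<Gamma> * (?W * ?z * norm g + ?D * ?z * \<bar>s\<bar>)"
  proof -
    have "\<bar>wave \<tau> x * (g \<bullet> cut_grad \<tau> x)\<bar> \<le> ?W * (norm g * ?z)"
      unfolding abs_mult by (intro mult_left_mono Cauchy_Schwarz_ineq2) auto
    moreover have "\<bar>(wave_grad \<tau> x \<bullet> cut_grad \<tau> x) * s\<bar> \<le> ?D * ?z * \<bar>s\<bar>"
      unfolding abs_mult by (intro mult_right_mono Cauchy_Schwarz_ineq2) auto
    ultimately have "wave \<tau> x * (g \<bullet> cut_grad \<tau> x) - (wave_grad \<tau> x \<bullet> cut_grad \<tau> x) * s \<le> ?W * ?z * norm g + ?D * ?z * \<bar>s\<bar>"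
      by (simp only: mult_ac)
    moreover have "0 \<le> ?W * ?z * norm g + ?D * ?z * \<bar>s\<bar>" by (intro add_nonneg_nonneg mult_nonneg_nonneg) auto
    moreover have "0 < two_layer \<gamma>p \<gamma>m x" "two_layer \<gamma>p \<gamma>m x \<le> ?\<Gamma>" using \<gamma> by (auto simp: two_layer_def)
    ultimately show ?thesis by (meson less_imp_le mult_left_mono mult_right_mono order_trans)
  qed
  have r: "?\<Gamma> * (?W * ?z * norm g + ?D * ?z * \<bar>s\<bar>) \<le> ?\<Gamma> * ((a * (8 / rc)) * (?I * norm g) + (a * (8 / rc)) * (?I * norm s)
      + (4 * \<tau>) * (shell_wave \<tau> x * norm g) + (4 * \<tau>) * (b * \<tau>) * (?E * \<bar>s\<bar>))"
  proof (rule mult_left_mono[OF _ less_imp_le[OF g0]])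
    have t: "0 \<le> (a * (8 / rc)) * (?I * norm g)" "0 \<le> (a * (8 / rc)) * (?I * norm s)"
      "0 \<le> (4 * \<tau>) * (shell_wave \<tau> x * norm g)" "0 \<le> (4 * \<tau>) * (b * \<tau>) * (?E * \<bar>s\<bar>)"
      using nn \<tau> b0 a0 rc(3) by (intro mult_nonneg_nonneg; simp)+
    show "?W * ?z * norm g + ?D * ?z * \<bar>s\<bar> \<le> (a * (8 / rc)) * (?I * norm g) + (a * (8 / rc)) * (?I * norm s)
      + (4 * \<tau>) * (shell_wave \<tau> x * norm g) + (4 * \<tau>) * (b * \<tau>) * (?E * \<bar>s\<bar>)"
      using \<tau>
    proof (rule cut_grad_cases[of \<tau> x])
      assume "cut_grad \<tau> x = 0"
      then have "?W * ?z * norm g + ?D * ?z * \<bar>s\<bar> = 0" by simp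
      then show ?thesis using t by linarith
    next
      assume c: "2 \<le> beta \<tau> x" "beta \<tau> x \<le> 3" "?z \<le> 4 * \<tau>"
      have x3: "x $ 3 < 0" using beta_pos[OF \<tau>, of x] c by simp
      note W = Wl_bounds[OF \<tau> less_imp_le[OF x3]]
      have eq: "?W = Wl \<tau> x" "wave_grad \<tau> x = dl \<tau> x" "shell_wave \<tau> x = El \<tau> x" "?E = El \<tau> x"
        using x3 W(1) c by (auto simp: layer_def shell_wave_def)
      have "?W * ?z * norm g \<le> El \<tau> x * (4 * \<tau>) * norm g" unfolding eq using W c E0 \<tau> by (intro mult_mono) auto
      moreover have "?D * ?z * \<bar>s\<bar> \<le> (b * \<tau> * El \<tau> x) * (4 * \<tau>) * \<bar>s\<bar>" unfolding eq
        using W(3) c E0 b0 \<tau> by (intro mult_mono) (auto simp: b_def)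
      ultimately have "?W * ?z * norm g + ?D * ?z * \<bar>s\<bar> \<le> (4 * \<tau>) * (shell_wave \<tau> x * norm g) + (4 * \<tau>) * (b * \<tau>) * (?E * \<bar>s\<bar>)"
        unfolding eq(3,4) by (simp only: mult_ac)
      then show ?thesis using t by linarith
    next
      assume c: "rc \<le> norm x" "norm x \<le> 2 * rc" "?z \<le> 8 / rc"
      note W = wave_far[OF \<tau> c(1), folded a_def]
      have I: "?I = 1" using c by simp
      have "?W * ?z * norm g \<le> a * (8 / rc) * norm g" "?D * ?z * \<bar>s\<bar> \<le> a * (8 / rc) * \<bar>s\<bar>"
        using W c a0 rc(3) by (intro mult_mono; simp)+
      then show ?thesis using t(3,4) unfolding I real_norm_def mult_1 by linarith
    qed
  qed
  show ?thesis using order_trans[OF lhs r] by (simp only: distrib_left mult.assoc)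
qed

text \<open>Count of powers in the shell: the gradient term has one \<open>\<tau>\<close>, matched
  by the norm \<open>A / \<tau>\<close> of \<open>shell_wave\<close>; the term with \<open>v\<close>
  has two, and \<open>shell_mass\<close> converts \<open>\<tau>\<^sup>2\<close> times the mass of
  \<open>v\<close> into one power times the same gradient integral. Far away the global energy
  bounds for \<open>v\<close> and \<open>G\<close> suffice.\<close>

lemma error_bound:
  assumes f: "square_integrable f" "AE x in lebesgue. x $ 3 \<le> 0 \<longrightarrow> f x = 0"
  obtains A1 A2 where "A1 > 0" "A2 > 0"
    "\<And>\<tau> v G. \<tau> \<ge> tau_low \<Longrightarrow> wsol (two_layer \<gamma>p \<gamma>m) f \<tau> v G \<Longrightarrow> AE x in lebesgue. v x \<ge> 0 \<Longrightarrow>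
      (LINT x|lebesgue. two_layer \<gamma>p \<gamma>m x * (wave \<tau> x * (G x \<bullet> cut_grad \<tau> x) - (wave_grad \<tau> x \<bullet> cut_grad \<tau> x) * v x))
      \<le> A1 * \<tau> * exp (- (\<tau> * (path_length + 1))) + A2 * sqrt (LINT x|lebesgue. indicator (ball b0 \<rho>) x * (norm (G x))\<^sup>2)"
proof -
  obtain A where A: "A \<ge> 0" "\<And>\<tau>. \<tau> \<ge> 1 \<Longrightarrow> (LINT x|lebesgue. (norm (shell_wave \<tau> x))\<^sup>2) \<le> (A / \<tau>)\<^sup>2"
    using shell_wave_L2 by blast
  define \<Gamma> where "\<Gamma> = \<gamma>p + \<gamma>m"
  define b where "b = 3 * (nm + kc) + \<sigma>"
  define F where "F = sqrt (LINT x|lebesgue. (f x)\<^sup>2)"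
  define V where "V = sqrt (measure lebesgue (cball (0::real^3) (2 * rc)))"
  define A1 where "A1 = \<Gamma> * (far_const * (8 / rc)) * (V * (F / sqrt (min \<gamma>p \<gamma>m)) + V * F)"
  define A2 where "A2 = \<Gamma> * 4 * A + \<Gamma> * 4 * b * (\<gamma>m * (4 + nm + kc)) * A"
  have nn: "\<Gamma> > 0" "b \<ge> 0" "F \<ge> 0" "V \<ge> 0" using \<gamma> nm(1) kc \<sigma> by (auto simp: \<Gamma>_def b_def F_def V_def)
  have fc: "far_const \<ge> 0" using nm(1) kc \<sigma> M2(2) lam(1) mu
    unfolding far_const_def by (intro mult_nonneg_nonneg add_nonneg_nonneg) auto
  have "A1 \<ge> 0" "A2 \<ge> 0"
    unfolding A1_def A2_def using nn fc rc(3) \<gamma> nm(1) kc A(1) by (intro mult_nonneg_nonneg add_nonneg_nonneg; simp)+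
  moreover have "(LINT x|lebesgue. two_layer \<gamma>p \<gamma>m x * (wave \<tau> x * (G x \<bullet> cut_grad \<tau> x) - (wave_grad \<tau> x \<bullet> cut_grad \<tau> x) * v x))
      \<le> A1 * \<tau> * exp (- (\<tau> * (path_length + 1))) + A2 * sqrt (LINT x|lebesgue. indicator (ball b0 \<rho>) x * (norm (G x))\<^sup>2)"
    (is "?L \<le> _ * _ * ?e + _ * ?N")
    if \<tau>: "\<tau> \<ge> tau_low" and w: "wsol (two_layer \<gamma>p \<gamma>m) f \<tau> v G" and v: "AE x in lebesgue. v x \<ge> 0" for \<tau> v G
  proof -
    have t: "\<tau> \<ge> 1" "\<tau> \<ge> 8 / \<rho>" using \<tau> by (auto simp: tau_low_def)
    have sv: "square_integrable v" and sG: "square_integrable G"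
      using w by (auto simp: wsol_def has_weak_gradient_def)
    define a where "a = far_const * \<tau> * ?e"
    have a0: "a \<ge> 0" using fc t by (simp add: a_def)
    let ?B = "cball (0::real^3) (2 * rc)"
    let ?E = "\<lambda>x. if 2 \<le> beta \<tau> x \<and> beta \<tau> x \<le> 3 then El \<tau> x else 0"
    have B: "?B \<in> lmeasurable" by simp
    note iG = integral_norm_indicator_le[OF sG B] and iv = integral_norm_indicator_le[OF sv B]
    note sg = shell_wave_gradient[OF t(1) sG]
    note sm = shell_mass[OF t w v f(2)]
    define T1 where "T1 = (\<lambda>x. \<Gamma> * (a * (8 / rc)) * (indicator ?B x * norm (G x)))"
    define T2 where "T2 = (\<lambda>x. \<Gamma> * (a * (8 / rc)) * (indicator ?B x * norm (v x)))"
    define T3 where "T3 = (\<lambda>x. \<Gamma> * (4 * \<tau>) * (shell_wave \<tau> x * norm (G x)))"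
    define T4 where "T4 = (\<lambda>x. \<Gamma> * (4 * \<tau>) * (b * \<tau>) * (?E x * \<bar>v x\<bar>))"
    have i: "integrable lebesgue T1" "integrable lebesgue T2" "integrable lebesgue T3" "integrable lebesgue T4"
      unfolding T1_def T2_def T3_def T4_def by (intro integrable_mult_right iG(1) iv(1) sg(1) sm(1))+
    have "?L \<le> (LINT x|lebesgue. T1 x + T2 x + T3 x + T4 x)"
    proof (rule integral_mono')
      show "integrable lebesgue (\<lambda>x. T1 x + T2 x + T3 x + T4 x)" by (intro Bochner_Integration.integrable_add i)
      show "two_layer \<gamma>p \<gamma>m x * (wave \<tau> x * (G x \<bullet> cut_grad \<tau> x) - (wave_grad \<tau> x \<bullet> cut_grad \<tau> x) * v x) \<le> T1 x + T2 x + T3 x + T4 x" for x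
        unfolding T1_def T2_def T3_def T4_def a_def b_def \<Gamma>_def by (rule error_pointwise[OF t(1)])
      have E0: "El \<tau> x \<ge> 0" for x by (simp add: lower_exp_def)
      show "0 \<le> T1 x + T2 x + T3 x + T4 x" for x
        unfolding T1_def T2_def T3_def T4_def using nn t a0 rc(3) E0[of x]
        by (intro add_nonneg_nonneg mult_nonneg_nonneg) (auto simp: shell_wave_def)
    qed
    also have "\<dots> = (LINT x|lebesgue. T1 x) + (LINT x|lebesgue. T2 x) + (LINT x|lebesgue. T3 x) + (LINT x|lebesgue. T4 x)"
      by (simp add: i)
    finally have L: "?L \<le> (LINT x|lebesgue. T1 x) + (LINT x|lebesgue. T2 x) + (LINT x|lebesgue. T3 x) + (LINT x|lebesgue. T4 x)" .
    have min0: "min \<gamma>p \<gamma>m > 0" using \<gamma> by simp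
    have en: "sqrt (LINT x|lebesgue. (v x)\<^sup>2) \<le> F / \<tau>\<^sup>2" "min \<gamma>p \<gamma>m * (LINT x|lebesgue. (norm (G x))\<^sup>2) \<le> (LINT x|lebesgue. (f x)\<^sup>2) / \<tau>\<^sup>2"
      using wsol_energy(1,2)[OF w _ f(1) two_layer_measurable, of "min \<gamma>p \<gamma>m" \<Gamma>] t \<gamma>
      by (auto simp: two_layer_def F_def \<Gamma>_def)
    have vF: "sqrt (LINT x|lebesgue. (norm (v x))\<^sup>2) \<le> F"
    proof -
      have "F / \<tau>\<^sup>2 \<le> F / 1" using t nn by (intro divide_left_mono) auto
      then show ?thesis using en(1) by simp
    qed
    have GF: "sqrt (LINT x|lebesgue. (norm (G x))\<^sup>2) \<le> F / sqrt (min \<gamma>p \<gamma>m)"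
    proof -
      have "(LINT x|lebesgue. (f x)\<^sup>2) / \<tau>\<^sup>2 \<le> (LINT x|lebesgue. (f x)\<^sup>2) / 1"
        using t by (intro divide_left_mono) (auto intro: integral_nonneg_AE)
      from order_trans[OF en(2) this] have "min \<gamma>p \<gamma>m * (LINT x|lebesgue. (norm (G x))\<^sup>2) \<le> (LINT x|lebesgue. (f x)\<^sup>2)"
        by (simp only: div_by_1)
      then have "(LINT x|lebesgue. (norm (G x))\<^sup>2) \<le> (LINT x|lebesgue. (f x)\<^sup>2) / min \<gamma>p \<gamma>m"
        unfolding pos_le_divide_eq[OF min0] by (simp only: mult.commute)
      then show ?thesis unfolding F_def by (simp add: real_sqrt_divide[symmetric])
    qed
    have 12: "(LINT x|lebesgue. T1 x) + (LINT x|lebesgue. T2 x) \<le> A1 * \<tau> * ?e"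
    proof -
      have c: "0 \<le> \<Gamma> * (a * (8 / rc))" using nn a0 rc(3) by (intro mult_nonneg_nonneg) auto
      have "(LINT x|lebesgue. indicator ?B x * norm (G x)) \<le> V * (F / sqrt (min \<gamma>p \<gamma>m))"
        using order_trans[OF iG(2) mult_left_mono[OF GF nn(4)[unfolded V_def]]] by (simp add: V_def)
      moreover have "(LINT x|lebesgue. indicator ?B x * norm (v x)) \<le> V * F"
        using order_trans[OF iv(2) mult_left_mono[OF vF nn(4)[unfolded V_def]]] by (simp add: V_def)
      ultimately have "\<Gamma> * (a * (8 / rc)) * ((LINT x|lebesgue. indicator ?B x * norm (G x)) + (LINT x|lebesgue. indicator ?B x * norm (v x)))
          \<le> \<Gamma> * (a * (8 / rc)) * (V * (F / sqrt (min \<gamma>p \<gamma>m)) + V * F)"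
        by (intro mult_left_mono[OF _ c] add_mono)
      also have "\<dots> = A1 * \<tau> * ?e" by (simp only: A1_def a_def mult_ac)
      finally show ?thesis by (simp add: T1_def T2_def distrib_left)
    qed
    define J where "J = (LINT x|lebesgue. shell_wave \<tau> x * norm (G x))"
    have J: "\<tau> * J \<le> A * ?N"
    proof -
      have "sqrt (LINT x|lebesgue. (norm (shell_wave \<tau> x))\<^sup>2) \<le> A / \<tau>"
        using A t by (intro real_le_lsqrt) auto
      from mult_right_mono[OF this, of ?N] have "J \<le> A / \<tau> * ?N"
        unfolding J_def using sg(2) by (rule order_trans[rotated]) (auto intro!: real_sqrt_ge_zero integral_nonneg_AE)
      then show ?thesis using t by (simp add: field_simps)
    qed
    have 3: "(LINT x|lebesgue. T3 x) \<le> \<Gamma> * 4 * A * ?N"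
    proof -
      have "(LINT x|lebesgue. T3 x) = \<Gamma> * 4 * (\<tau> * J)" by (simp add: T3_def J_def)
      also have "\<dots> \<le> \<Gamma> * 4 * (A * ?N)" using nn J by (intro mult_left_mono) auto
      finally show ?thesis by (simp only: mult.assoc)
    qed
    have 4: "(LINT x|lebesgue. T4 x) \<le> \<Gamma> * 4 * b * (\<gamma>m * (4 + nm + kc)) * A * ?N"
    proof -
      have "(LINT x|lebesgue. T4 x) = \<Gamma> * 4 * b * (\<tau>\<^sup>2 * (LINT x|lebesgue. ?E x * \<bar>v x\<bar>))"
        unfolding T4_def integral_mult_right_zero by (simp only: power2_eq_square mult_ac)
      also have "\<dots> \<le> \<Gamma> * 4 * b * (\<gamma>m * (4 + nm + kc) * \<tau> * J)"
        unfolding J_def using nn by (intro mult_left_mono sm(2)) auto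
      also have "\<dots> = \<Gamma> * 4 * b * (\<gamma>m * (4 + nm + kc)) * (\<tau> * J)" by (simp only: mult_ac)
      also have "\<dots> \<le> \<Gamma> * 4 * b * (\<gamma>m * (4 + nm + kc)) * (A * ?N)"
        using nn \<gamma> nm(1) kc by (intro mult_left_mono J mult_nonneg_nonneg) auto
      finally show ?thesis by (simp only: mult.assoc)
    qed
    have "A2 * ?N = \<Gamma> * 4 * A * ?N + \<Gamma> * 4 * b * (\<gamma>m * (4 + nm + kc)) * A * ?N" by (simp add: A2_def distrib_right)
    then show ?thesis using L 12 3 4 by linarith
  qed
  \<comment> \<open>The constants so far are only nonnegative; adding one makes them positive, since
    the final estimate divides by them.\<close>
  moreover have "x \<le> A1 * \<tau> * e + A2 * N \<Longrightarrow> 0 \<le> \<tau> * e \<Longrightarrow> 0 \<le> N \<Longrightarrow> x \<le> (A1 + 1) * \<tau> * e + (A2 + 1) * N" for x \<tau> e N :: real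
    by (simp add: algebra_simps)
  ultimately show ?thesis using that[of "A1 + 1" "A2 + 1"]
    by (simp add: tau_low_def)
qed

lemma wave_cut_continuous:
  assumes \<tau>: "\<tau> \<ge> tau_low"
  shows "closed {x. beta \<tau> x \<le> 3}" "{x. beta \<tau> x \<le> 3} \<subseteq> - {q}"
    "continuous_on UNIV (\<lambda>x. cut \<tau> x * Wl \<tau> x)" "continuous_on UNIV (\<lambda>x. cut \<tau> x * Wu \<tau> x)"
proof -
  show K: "closed {x. beta \<tau> x \<le> 3}" by (intro closed_Collect_le beta_continuous continuous_intros)
  show KU: "{x. beta \<tau> x \<le> 3} \<subseteq> - {q}" using beta_far[of \<tau> q] \<tau> \<rho> by (auto simp: tau_low_def)
  show "continuous_on UNIV (\<lambda>x. cut \<tau> x * Wl \<tau> x)"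
    using cutoff_continuous[OF cut_continuous(1) _ lower_continuous(1) _ K KU] cut_support(1) by (auto simp: open_Compl not_le)
  show "continuous_on UNIV (\<lambda>x. cut \<tau> x * Wu \<tau> x)"
    by (intro continuous_intros cut_continuous upper_continuous) (use q3 in auto)
qed

text \<open>The optical length carried by the wave at \<open>x\<close> near \<open>y\<close> is at
  most \<open>path_length\<close> plus \<open>np * (\<omega> \<bullet> (x - y))\<close> plus a
  quadratic term: by Snell's law the first-order effect of moving the foot is compensated. The tube
  conditions make the excess of order \<open>1/\<tau>\<close>, so the wave loses only the constant
  \<open>exp (- A)\<close>.\<close>

lemma Wu_near:
  obtains A where "\<And>\<tau> x. \<tau> \<ge> 1 \<Longrightarrow> x \<in> ball c r \<Longrightarrow> \<omega> \<bullet> (x - y) \<le> 2 / \<tau> \<Longrightarrow> (norm (x - y))\<^sup>2 \<le> 2 * r / \<tau> \<Longrightarrow>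
    Wu \<tau> x \<ge> (1 - kap) * exp (- A) * exp (- (\<tau> * path_length))"
proof -
  \<comment> \<open>The distance from \<open>q\<close> to the crossing point \<open>z\<close>, since
    \<open>p\<close> lies between them on one line.\<close>
  define u where "u = norm (z - p) + \<rho> / 2"
  have u: "u > 0" using \<rho> by (simp add: u_def add_nonneg_pos)
  define a where "a = 1 + 1 / \<omega> $ 3"
  have a: "a > 0" using \<omega>3 by (simp add: a_def add_pos_pos)
  define A where "A = 2 * np + nm * a\<^sup>2 * r / u + kc * (u + a * (2 * r)) + mu * (norm c + r)"
  have "Wu \<tau> x \<ge> (1 - kap) * exp (- A) * exp (- (\<tau> * path_length))"
    if \<tau>: "\<tau> \<ge> 1" and x: "x \<in> ball c r" and s: "\<omega> \<bullet> (x - y) \<le> 2 / \<tau>" and d2: "(norm (x - y))\<^sup>2 \<le> 2 * r / \<tau>" for \<tau> x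
  proof -
    define d where "d = x - y"
    \<comment> \<open>The displacement of the foot of \<open>x\<close> on the interface, relative to
      \<open>z\<close>, which is the foot of \<open>y\<close>.\<close>
    define \<delta> where "\<delta> = d - (d $ 3 / \<omega> $ 3) *\<^sub>R \<omega>"
    define P where "P = norm (upper_vec m1 m2 q x)"
    have y3': "y $ 3 = norm (z - y) * \<omega> $ 3"
      using arg_cong[OF yz_eq, of "\<lambda>w. w $ 3"] z3 by simp
    have zq: "z - q = (- u) *\<^sub>R \<nu>"
      using pz_eq by (simp add: q_def u_def scaleR_add_left algebra_simps)
    have vec: "upper_vec m1 m2 q x = \<delta> - u *\<^sub>R \<nu>"
    proof -
      have "upper_vec m1 m2 q x = (z - q) + (d - ((x $ 3 - norm (z - y) * \<omega> $ 3) / \<omega> $ 3) *\<^sub>R \<omega>)"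
        unfolding upper_vec_eq d_def using \<omega>3 by (subst (2) yz_eq) (simp add: diff_divide_distrib scaleR_diff_left)
      moreover have "x $ 3 - norm (z - y) * \<omega> $ 3 = d $ 3" by (simp add: d_def y3')
      ultimately show ?thesis by (simp add: zq \<delta>_def)
    qed
    have \<delta>3: "\<delta> $ 3 = 0" using \<omega>3 by (simp add: \<delta>_def)
    have n\<delta>: "norm \<delta> \<le> a * norm d"
    proof -
      have "\<bar>d $ 3\<bar> \<le> norm d" by (rule component_le_norm_cart)
      then have "\<bar>d $ 3\<bar> / \<omega> $ 3 \<le> norm d / \<omega> $ 3" using \<omega>3 by (intro divide_right_mono) auto
      moreover have "norm \<delta> \<le> norm d + norm ((d $ 3 / \<omega> $ 3) *\<^sub>R \<omega>)" unfolding \<delta>_def by (rule norm_triangle_ineq4)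
      ultimately show ?thesis using \<omega>3 norm_\<omega> by (simp add: a_def distrib_right)
    qed
    \<comment> \<open>\<open>\<delta>\<close> is horizontal and the tangential slowness vectors on
      both sides agree, so the first variation of the lower leg can be expressed by
      \<open>\<omega>\<close>.\<close>
    have snell': "- nm * (\<nu> \<bullet> \<delta>) = np * (\<omega> \<bullet> d) - lam * d $ 3"
    proof -
      have "- nm * (\<nu> \<bullet> \<delta>) = (- nm * \<nu> $ 1) * \<delta> $ 1 + (- nm * \<nu> $ 2) * \<delta> $ 2"
        by (simp add: inner_real3 \<delta>3 distrib_left)
      also have "\<dots> = (np * \<omega> $ 1) * \<delta> $ 1 + (np * \<omega> $ 2) * \<delta> $ 2" using snell[of 1] snell[of 2] by simp
      also have "\<dots> = np * (\<omega> \<bullet> \<delta>)" by (simp add: inner_real3 \<delta>3 distrib_left)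
      also have "\<omega> \<bullet> \<delta> = \<omega> \<bullet> d - d $ 3 / \<omega> $ 3"
        using norm_\<omega> by (simp add: \<delta>_def inner_diff_right norm_eq_1)
      finally show ?thesis by (simp add: lam_def right_diff_distrib)
    qed
    \<comment> \<open>The square root \<open>P\<close> is bounded by its tangent at
      \<open>u\<^sup>2\<close>, that is, by \<open>0 \<le> (P - u)\<^sup>2\<close>.\<close>
    have P: "P \<le> u - \<nu> \<bullet> \<delta> + (norm \<delta>)\<^sup>2 / (2 * u)"
    proof -
      have "P\<^sup>2 = (norm \<delta>)\<^sup>2 - 2 * u * (\<nu> \<bullet> \<delta>) + u\<^sup>2"
        unfolding P_def vec power2_norm_eq_inner using norm_\<nu>
        by (simp add: inner_diff inner_commute norm_eq_1 power2_eq_square)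
      moreover have "0 \<le> (P - u)\<^sup>2" by simp
      ultimately have "2 * u * P \<le> 2 * u * (u - \<nu> \<bullet> \<delta>) + (norm \<delta>)\<^sup>2"
        by (simp add: power2_eq_square algebra_simps)
      then have "P \<le> (2 * u * (u - \<nu> \<bullet> \<delta>) + (norm \<delta>)\<^sup>2) / (2 * u)" using u by (simp add: le_divide_eq mult.commute)
      then show ?thesis using u by (simp add: add_divide_distrib)
    qed
    have x3: "x $ 3 = norm (z - y) * \<omega> $ 3 + d $ 3" by (simp add: d_def y3')
    have main: "nm * (P - \<rho> / 2) + lam * x $ 3 \<le> path_length + (2 * np + nm * a\<^sup>2 * r / u) / \<tau>"
    proof -
      have "nm * P \<le> nm * (u - \<nu> \<bullet> \<delta> + (norm \<delta>)\<^sup>2 / (2 * u))" using nm by (intro mult_left_mono P) auto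
      moreover have "nm * ((norm \<delta>)\<^sup>2 / (2 * u)) \<le> nm * a\<^sup>2 * r / u / \<tau>"
      proof -
        have "(norm \<delta>)\<^sup>2 \<le> (a * norm d)\<^sup>2" by (intro power_mono n\<delta>) simp
        also have "\<dots> \<le> a\<^sup>2 * (2 * r / \<tau>)" unfolding power_mult_distrib using d2 by (intro mult_left_mono) (auto simp: d_def)
        finally have "(norm \<delta>)\<^sup>2 / (2 * u) \<le> a\<^sup>2 * (2 * r / \<tau>) / (2 * u)" using u by (intro divide_right_mono) auto
        then have "nm * ((norm \<delta>)\<^sup>2 / (2 * u)) \<le> nm * (a\<^sup>2 * (2 * r / \<tau>) / (2 * u))" using nm by (intro mult_left_mono) auto
        also have "\<dots> = nm * a\<^sup>2 * r / u / \<tau>" by (simp add: mult.assoc mult.commute[of \<tau> u])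
        finally show ?thesis .
      qed
      moreover have "np * (\<omega> \<bullet> d) \<le> np * (2 / \<tau>)" using np s by (intro mult_left_mono) (auto simp: d_def)
      moreover have "lam * x $ 3 = np * norm (z - y) + lam * d $ 3"
        using lam(3) by (simp add: x3 distrib_left mult.left_commute mult.commute)
      moreover have "nm * (u - \<nu> \<bullet> \<delta> + (norm \<delta>)\<^sup>2 / (2 * u)) = nm * u + (- nm * (\<nu> \<bullet> \<delta>)) + nm * ((norm \<delta>)\<^sup>2 / (2 * u))"
        by (simp add: algebra_simps)
      moreover have "nm * (P - \<rho> / 2) = nm * P - nm * (\<rho> / 2)" "nm * u = nm * norm (z - p) + nm * (\<rho> / 2)"
        by (simp_all add: u_def algebra_simps)
      moreover have "(2 * np + nm * a\<^sup>2 * r / u) / \<tau> = np * (2 / \<tau>) + nm * a\<^sup>2 * r / u / \<tau>" by (simp add: add_divide_distrib)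
      ultimately show ?thesis unfolding snell' path_length_def by linarith
    qed
    have "\<tau> * (nm * (P - \<rho> / 2) + lam * x $ 3) \<le> \<tau> * (path_length + (2 * np + nm * a\<^sup>2 * r / u) / \<tau>)"
      using \<tau> by (intro mult_left_mono main) auto
    also have "\<dots> = \<tau> * path_length + (2 * np + nm * a\<^sup>2 * r / u)"
    proof -
      have "\<tau> * (X / \<tau>) = X" for X using \<tau> by simp
      then show ?thesis by (simp only: distrib_left)
    qed
    finally have m1: "\<tau> * (nm * (P - \<rho> / 2) + lam * x $ 3) \<le> \<tau> * path_length + (2 * np + nm * a\<^sup>2 * r / u)" .
    have nd: "norm d \<le> 2 * r"
    proof -
      have "norm (y - c) = r" using c_eq norm_\<omega> r by simp
      moreover have "norm (x - c) < r" using x by (simp add: dist_norm norm_minus_commute)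
      moreover have "norm d \<le> norm (x - c) + norm (y - c)" using norm_triangle_ineq4[of "x - c" "y - c"] by (simp add: d_def)
      ultimately show ?thesis by linarith
    qed
    have m2: "kc * (P - \<rho> / 2) \<le> kc * (u + a * (2 * r))"
    proof (rule mult_left_mono)
      have "P \<le> norm \<delta> + norm (u *\<^sub>R \<nu>)" unfolding P_def vec by (rule norm_triangle_ineq4)
      moreover have "a * norm d \<le> a * (2 * r)" using a nd by (intro mult_left_mono) auto
      ultimately show "P - \<rho> / 2 \<le> u + a * (2 * r)" using n\<delta> norm_\<nu> u \<rho> by simp
    qed (use kc in simp)
    have m3: "mu * x $ 3 \<le> mu * (norm c + r)"
    proof (rule mult_left_mono)
      have "x $ 3 \<le> norm x" using component_le_norm_cart[of x 3] by linarith
      also have "\<dots> \<le> norm c + norm (x - c)" using norm_triangle_ineq[of c "x - c"] by simp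
      finally show "x $ 3 \<le> norm c + r" using x by (simp add: dist_norm norm_minus_commute)
    qed (use mu in simp)
    have "k \<tau> * (P - \<rho> / 2) + lm \<tau> * x $ 3 = \<tau> * (nm * (P - \<rho> / 2) + lam * x $ 3) + kc * (P - \<rho> / 2) + mu * x $ 3"
      by (simp add: k_def lm_def algebra_simps)
    then have "k \<tau> * (P - \<rho> / 2) + lm \<tau> * x $ 3 \<le> A + \<tau> * path_length" using m1 m2 m3 unfolding A_def by linarith
    then have "exp (- A) * exp (- (\<tau> * path_length)) \<le> exp (- (k \<tau> * (P - \<rho> / 2)) - lm \<tau> * x $ 3)"
      by (simp add: exp_add[symmetric])
    then have "(1 - kap) * (exp (- A) * exp (- (\<tau> * path_length))) \<le> (1 - kap) * exp (- (k \<tau> * (P - \<rho> / 2)) - lm \<tau> * x $ 3)"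
      using kap by (intro mult_left_mono) auto
    then show ?thesis by (simp add: upper_wave_def P_def mult.assoc)
  qed
  then show ?thesis using that by blast
qed

end

section \<open>The source term and the lower bound\<close>

lemma exp_neg_cubic_le:
  assumes "t > 0" "t \<ge> 64 / \<epsilon>" "\<epsilon> > 0"
  shows "t ^ 3 * exp (- t) \<le> (\<epsilon>::real)"
proof -
  have "((t / 2)\<^sup>2 / 2)\<^sup>2 \<le> (exp (t / 2))\<^sup>2"
    using power2_exp_le[of "t / 2"] assms by (intro power_mono) auto
  moreover have "(exp (t / 2))\<^sup>2 = exp t" using exp_double[of "t / 2"] by simp
  moreover have "((t / 2)\<^sup>2 / 2)\<^sup>2 = t ^ 4 / 64" by (simp add: power2_eq_square power4_eq_xxxx)
  ultimately have "t ^ 4 / 64 \<le> exp t" by simp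
  then have "exp (- t) \<le> 64 / t ^ 4" using assms by (simp add: exp_minus field_simps)
  then have "t ^ 3 * exp (- t) \<le> t ^ 3 * (64 / t ^ 4)" using assms by (intro mult_left_mono) auto
  also have "\<dots> = 64 / t" using assms by (simp add: power4_eq_xxxx power3_eq_cube)
  also have "\<dots> \<le> \<epsilon>" using assms by (simp add: field_simps)
  finally show ?thesis .
qed

context beam
begin

text \<open>Along the inward normal \<open>\<omega>\<close> of the ball at \<open>y\<close>, a tube
  at depth between \<open>1/\<tau>\<close> and \<open>2/\<tau>\<close> with half-width
  \<open>sqrt (r / (4 * \<tau>))\<close> fits into the ball, because the sphere bends only
  quadratically. There \<open>f \<ge> C0\<close>, the cutoff is one and the wave has its size; the
  volume is \<open>r / \<tau>\<^sup>2\<close>.\<close>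

lemma main_term:
  obtains a where "a > 0" "\<And>\<tau> f C0. \<tau> \<ge> tau_low \<Longrightarrow> \<tau> \<ge> 4 / r \<Longrightarrow> C0 > 0 \<Longrightarrow> square_integrable f \<Longrightarrow>
    AE x in lebesgue. f x \<ge> 0 \<Longrightarrow> AE x in lebesgue. x \<in> ball c r \<longrightarrow> C0 \<le> f x \<Longrightarrow>
    C0 * a * exp (- (\<tau> * path_length)) / \<tau>\<^sup>2 \<le> (LINT x|lebesgue. f x * (cut \<tau> x * wave \<tau> x))"
proof -
  obtain A where A: "\<And>\<tau> x. \<tau> \<ge> 1 \<Longrightarrow> x \<in> ball c r \<Longrightarrow> \<omega> \<bullet> (x - y) \<le> 2 / \<tau> \<Longrightarrow> (norm (x - y))\<^sup>2 \<le> 2 * r / \<tau> \<Longrightarrow>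
    Wu \<tau> x \<ge> (1 - kap) * exp (- A) * exp (- (\<tau> * path_length))"
    using Wu_near by blast
  define a where "a = (1 - kap) * exp (- A) * r"
  have "a > 0" using kap r by (simp add: a_def)
  moreover have "C0 * a * exp (- (\<tau> * path_length)) / \<tau>\<^sup>2 \<le> (LINT x|lebesgue. f x * (cut \<tau> x * wave \<tau> x))"
    if \<tau>: "\<tau> \<ge> tau_low" "\<tau> \<ge> 4 / r" and C0: "C0 > 0" and f: "square_integrable f"
      and f0: "AE x in lebesgue. f x \<ge> 0" and fC: "AE x in lebesgue. x \<in> ball c r \<longrightarrow> C0 \<le> f x" for \<tau> f C0
  proof -
    have t: "\<tau> \<ge> 1" using \<tau> by (simp add: tau_low_def)
    have t2: "2 / \<tau> \<le> r / 2" using \<tau>(2) t r by (simp add: field_simps)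
    define w where "w = (1 - kap) * exp (- A) * exp (- (\<tau> * path_length))"
    obtain S where S: "S \<in> lmeasurable" "measure lebesgue S = 4 * (sqrt (r / (4 * \<tau>)))\<^sup>2 * (2 / \<tau> - 1 / \<tau>)"
      and SD: "\<And>x. x \<in> S \<Longrightarrow> 1 / \<tau> \<le> \<omega> \<bullet> (x - y) \<and> \<omega> \<bullet> (x - y) \<le> 2 / \<tau> \<and>
        (norm (x - y))\<^sup>2 \<le> 2 * (sqrt (r / (4 * \<tau>)))\<^sup>2 + (\<omega> \<bullet> (x - y))\<^sup>2"
      using tube_measure[OF norm_\<omega>, of "sqrt (r / (4 * \<tau>))" "1 / \<tau>" "2 / \<tau>" y] r t by (auto simp: divide_right_mono)
    have mS: "measure lebesgue S = r / \<tau>\<^sup>2" unfolding S(2) using r t by (simp add: power2_eq_square diff_divide_distrib[symmetric])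
    have inS: "x \<in> ball c r \<and> wave \<tau> x \<ge> w \<and> cut \<tau> x = 1" if x: "x \<in> S" for x
    proof -
      define s where "s = \<omega> \<bullet> (x - y)"
      have s: "1 / \<tau> \<le> s" "s \<le> 2 / \<tau>" "(norm (x - y))\<^sup>2 \<le> r / (2 * \<tau>) + s\<^sup>2"
        using SD[OF x] r t by (auto simp: s_def)
      have s0: "s > 0" using s(1) t by (smt (verit) divide_pos_pos)
      have "s * s \<le> s * (r / 2)" using s t2 s0 by (intro mult_left_mono) auto
      moreover have "r / (2 * \<tau>) \<le> s * (r / 2)" using mult_right_mono[OF s(1), of "r / 2"] r by (simp add: mult.commute)
      \<comment> \<open>Membership in the ball asks only for less than \<open>2 * r * s\<close>. One
        half of \<open>r * s\<close> covers the width, as \<open>1/\<tau> \<le> s\<close>, and the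
        other covers \<open>s\<^sup>2\<close>, as \<open>s \<le> r / 2\<close>.\<close>
      ultimately have d: "(norm (x - y))\<^sup>2 \<le> r * s" using s(3) by (simp add: power2_eq_square algebra_simps)
      have rs: "r * s \<le> r * (2 / \<tau>)" using s(2) r by (intro mult_left_mono) auto
      have "(norm (x - c))\<^sup>2 = (norm (x - y))\<^sup>2 - 2 * r * s + r\<^sup>2"
      proof -
        have "(norm (d - r *\<^sub>R \<omega>))\<^sup>2 = (norm d)\<^sup>2 - 2 * r * (\<omega> \<bullet> d) + r\<^sup>2" for d
          using norm_\<omega> unfolding power2_norm_eq_inner
          by (simp add: inner_diff inner_commute norm_eq_1 power2_eq_square algebra_simps)
        moreover have "x - c = (x - y) - r *\<^sub>R \<omega>" by (simp add: c_eq)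
        ultimately show ?thesis by (simp only: s_def)
      qed
      also have "\<dots> < r\<^sup>2" using d mult_pos_pos[OF r s0] by linarith
      finally have "(norm (x - c))\<^sup>2 < r\<^sup>2" .
      then have xc: "norm (x - c) < r" by (rule power_less_imp_less_base) (use r in simp)
      then have b: "x \<in> ball c r" by (simp add: dist_norm norm_minus_commute)
      then have "x \<in> upper_half" using ball_upper ball_subset_cball[of c r] by blast
      then have x3: "x $ 3 > 0" by (simp add: upper_half_def)
      have "(norm (x - y))\<^sup>2 \<le> 2 * r / \<tau>" using order_trans[OF d rs] by (simp add: mult.commute)
      then have "Wu \<tau> x \<ge> w" unfolding w_def using s(2) by (intro A[OF t b]) (auto simp: s_def)
      moreover have "cut \<tau> x = 1"
      proof -
        have "norm x \<le> norm c + norm (x - c)" using norm_triangle_ineq[of c "x - c"] by simp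
        then have "norm x < rc" using xc rc(2) by linarith
        moreover have "\<not> beta \<tau> x > 0" using beta_pos[OF t, of x] x3 by auto
        ultimately show ?thesis by (simp add: cut_def smoothstep_radial smoothstep_simps)
      qed
      ultimately show ?thesis using b x3 by (simp add: layer_def)
    qed
    have w0: "w \<ge> 0" using kap by (simp add: w_def)
    have wave0: "wave \<tau> x \<ge> 0" for x using Wu_bounds(1)[OF t, of x] Wl_bounds(1)[OF t, of x] by (simp add: layer_def)
    have "integrable lebesgue (\<lambda>x. layer (\<lambda>x. cut \<tau> x * Wu \<tau> x) (\<lambda>x. cut \<tau> x * Wl \<tau> x) x * f x)"
      by (rule layer_mult_integrable[OF wave_cut_continuous(4)[OF \<tau>(1)] _ wave_cut_continuous(3)[OF \<tau>(1)] _ square_integrable_locally_integrable[OF f], of "2 * rc"])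
        (use cut_support(3) in auto)
    moreover have "layer (\<lambda>x. cut \<tau> x * Wu \<tau> x) (\<lambda>x. cut \<tau> x * Wl \<tau> x) x * f x = f x * (cut \<tau> x * wave \<tau> x)" for x
      by (simp add: layer_def)
    ultimately have i: "integrable lebesgue (\<lambda>x. f x * (cut \<tau> x * wave \<tau> x))" by simp
    have "C0 * a * exp (- (\<tau> * path_length)) / \<tau>\<^sup>2 = C0 * w * measure lebesgue S"
      by (simp add: a_def w_def mS)
    also have "\<dots> = (LINT x|lebesgue. (C0 * w) * indicator S x)" using S(1) by simp
    also have "\<dots> \<le> (LINT x|lebesgue. f x * (cut \<tau> x * wave \<tau> x))"
    proof (rule integral_mono_AE[OF _ i])
      show "integrable lebesgue (\<lambda>x. (C0 * w) * indicator S x)"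
        using S(1) by (intro integrable_mult_right) (auto simp: integrable_indicator_iff fmeasurable_def)
      show "AE x in lebesgue. C0 * w * indicator S x \<le> f x * (cut \<tau> x * wave \<tau> x)"
        using f0 fC
      proof eventually_elim
        case (elim x)
        show ?case
        proof (cases "x \<in> S")
          case True
          then show ?thesis using inS[OF True] elim C0 w0 by (simp add: mult_mono)
        next
          case False
          then show ?thesis using elim(1) cut_support(5)[of \<tau> x] wave0[of x] by simp
        qed
      qed
    qed
    finally show ?thesis .
  qed
  ultimately show ?thesis using that by blast
qed

lemma lower_bound:
  assumes f: "square_integrable f" "AE x in lebesgue. f x \<ge> 0" "AE x in lebesgue. x $ 3 \<le> 0 \<longrightarrow> f x = 0"
    and C0: "C0 > 0" "AE x in lebesgue. x \<in> ball c r \<longrightarrow> C0 \<le> f x"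
  obtains a T where "a > 0" "T > 0" "\<And>\<tau> v G. \<tau> \<ge> T \<Longrightarrow> wsol (two_layer \<gamma>p \<gamma>m) f \<tau> v G \<Longrightarrow>
    a / \<tau> ^ 4 * exp (- 2 * \<tau> * path_length) \<le> (LINT x|lebesgue. indicator (ball b0 \<rho>) x * (norm (G x))\<^sup>2)"
proof -
  obtain a where a: "a > 0" "\<And>\<tau> f C0. \<tau> \<ge> tau_low \<Longrightarrow> \<tau> \<ge> 4 / r \<Longrightarrow> C0 > 0 \<Longrightarrow> square_integrable f \<Longrightarrow>
    AE x in lebesgue. f x \<ge> 0 \<Longrightarrow> AE x in lebesgue. x \<in> ball c r \<longrightarrow> C0 \<le> f x \<Longrightarrow>
    C0 * a * exp (- (\<tau> * path_length)) / \<tau>\<^sup>2 \<le> (LINT x|lebesgue. f x * (cut \<tau> x * wave \<tau> x))"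
    using main_term by blast
  obtain A1 A2 where A: "A1 > 0" "A2 > 0"
    and err: "\<And>\<tau> v G. \<tau> \<ge> tau_low \<Longrightarrow> wsol (two_layer \<gamma>p \<gamma>m) f \<tau> v G \<Longrightarrow> AE x in lebesgue. v x \<ge> 0 \<Longrightarrow>
      (LINT x|lebesgue. two_layer \<gamma>p \<gamma>m x * (wave \<tau> x * (G x \<bullet> cut_grad \<tau> x) - (wave_grad \<tau> x \<bullet> cut_grad \<tau> x) * v x))
      \<le> A1 * \<tau> * exp (- (\<tau> * (path_length + 1))) + A2 * sqrt (LINT x|lebesgue. indicator (ball b0 \<rho>) x * (norm (G x))\<^sup>2)"
    using error_bound[OF f(1,3)] by blast
  \<comment> \<open>Relative to the main term the far error is
    \<open>\<tau> ^ 3 * exp (- \<tau>)\<close> up to constants; once this is at most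
    \<open>e\<close>, the far error takes at most half of the main term.\<close>
  define e where "e = C0 * a / (2 * A1)"
  have e: "e > 0" using A a C0 by (simp add: e_def)
  define T where "T = max tau_low (max (4 / r) (64 / e))"
  define b where "b = C0 * a / (2 * A2)"
  have b: "b > 0" using A a C0 by (simp add: b_def)
  have T: "T > 0" by (simp add: T_def tau_low_def)
  have "b\<^sup>2 / \<tau> ^ 4 * exp (- 2 * \<tau> * path_length) \<le> (LINT x|lebesgue. indicator (ball b0 \<rho>) x * (norm (G x))\<^sup>2)"
    (is "_ \<le> ?I")
    if \<tau>: "\<tau> \<ge> T" and w: "wsol (two_layer \<gamma>p \<gamma>m) f \<tau> v G" for \<tau> v G
  proof -
    have t: "\<tau> \<ge> tau_low" "\<tau> \<ge> 4 / r" "\<tau> \<ge> 64 / e" using \<tau> by (auto simp: T_def)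
    have t1: "\<tau> \<ge> 1" using t by (simp add: tau_low_def)
    have v0: "AE x in lebesgue. v x \<ge> 0"
      by (rule wsol_nonneg[OF w _ f(1,2) two_layer_measurable, of "\<gamma>p + \<gamma>m"]) (use t1 \<gamma> in \<open>auto simp: two_layer_def\<close>)
    have K: "\<not> x \<notin> {x. beta \<tau> x \<le> 3}" "norm x \<le> 2 * rc" if "cut \<tau> x > 0" for x
      using cut_support(1)[of \<tau> x] cut_support(3)[of x \<tau>] that by force+
    have q0: "q $ 3 \<noteq> 0" using q3 by simp
    have vec0: "norm (x - q) \<ge> \<rho> / 4" if "cut \<tau> x > 0" for x
      using beta_far(2)[of \<tau> x] K(1)[OF that] t by (auto simp: tau_low_def)
    have sub: "(LINT x|lebesgue. f x * (cut \<tau> x * wave \<tau> x)) \<le>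
      (LINT x|lebesgue. two_layer \<gamma>p \<gamma>m x * (wave \<tau> x * (G x \<bullet> cut_grad \<tau> x) - (wave_grad \<tau> x \<bullet> cut_grad \<tau> x) * v x))"
    proof (rule subsolution_test[OF w v0 _ wave_cut_continuous(1,2)[OF t(1)], where r="2 * rc"
          and sl="sl \<tau>" and su="su \<tau>"])
      show "open (- {q})" by (simp add: open_Compl)
      show "has_dir_deriv (cut \<tau>) (\<lambda>x. cut_grad \<tau> x $ i) (axis i 1)" for i by (rule cut_dir_deriv)
      show "cut \<tau> x = 0" "cut_grad \<tau> x = 0" if "x \<notin> {x. beta \<tau> x \<le> 3}" for x using that cut_support(1,2) by auto
      show "Wl \<tau> x = Wu \<tau> x" if "x $ 3 = 0" for x by (rule interface_wave[OF that])
      show "\<gamma>m * dl \<tau> x $ 3 \<le> \<gamma>p * du \<tau> x $ 3" if "x $ 3 = 0" for x by (rule flux[OF t1 that])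
      show "\<tau>\<^sup>2 * Wl \<tau> x \<le> \<gamma>m * (sl \<tau> 1 x + sl \<tau> 2 x + sl \<tau> 3 x)" if "x $ 3 \<le> 0" "cut \<tau> x > 0" for x
        by (rule lower_sub[OF t(1) that(1) K(2) vec0]) (use that in auto)
      show "((\<lambda>t. Wu \<tau> (x + t *\<^sub>R axis i 1)) has_real_derivative du \<tau> x $ i) (at 0)"
        "((\<lambda>t. du \<tau> (x + t *\<^sub>R axis i 1) $ i) has_real_derivative su \<tau> i x) (at 0)" for i x
        by (rule upper_DERIV[OF q0])+
      show "((\<lambda>t. Wl \<tau> (x + t *\<^sub>R axis i 1)) has_real_derivative dl \<tau> x $ i) (at 0)"
        "((\<lambda>t. dl \<tau> (x + t *\<^sub>R axis i 1) $ i) has_real_derivative sl \<tau> i x) (at 0)" if "x \<in> - {q}" for i x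
        using that by (auto intro: lower_DERIV)
    qed (rule cut_support cut_continuous lower_continuous upper_continuous[OF q0] upper_sub[OF t1]; assumption)+
    define E where "E = exp (- (\<tau> * path_length))"
    have E: "E > 0" by (simp add: E_def)
    have "C0 * a * E / \<tau>\<^sup>2 \<le> A1 * \<tau> * exp (- (\<tau> * (path_length + 1))) + A2 * sqrt ?I"
      using a(2)[OF t(1,2) C0(1) f(1,2) C0(2)] sub err[OF t(1) w v0] by (simp add: E_def)
    moreover have "A1 * \<tau> * exp (- (\<tau> * (path_length + 1))) \<le> C0 * a * E / \<tau>\<^sup>2 / 2"
    proof -
      have "exp (- (\<tau> * (path_length + 1))) = E * exp (- \<tau>)" by (simp add: E_def exp_add[symmetric] algebra_simps)
      then have "A1 * \<tau> * exp (- (\<tau> * (path_length + 1))) = A1 * E / \<tau>\<^sup>2 * (\<tau> ^ 3 * exp (- \<tau>))"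
        using t1 by (simp add: power2_eq_square power3_eq_cube)
      also have "\<dots> \<le> A1 * E / \<tau>\<^sup>2 * e"
        using A E e t t1 by (intro mult_left_mono exp_neg_cubic_le) auto
      also have "\<dots> = C0 * a * E / \<tau>\<^sup>2 / 2" using A by (simp add: e_def)
      finally show ?thesis .
    qed
    ultimately have "C0 * a * E / \<tau>\<^sup>2 / 2 \<le> A2 * sqrt ?I" by linarith
    then have "(C0 * a * E / \<tau>\<^sup>2 / 2) / A2 \<le> sqrt ?I" unfolding pos_divide_le_eq[OF A(2)] by (simp only: mult.commute)
    then have "b * E / \<tau>\<^sup>2 \<le> sqrt ?I" by (simp add: b_def mult_ac)
    \<comment> \<open>The shell error was linear in the norm of the gradient, so squaring doubles
      the exponential rate and turns \<open>\<tau>^-2\<close> into \<open>\<tau>^-4\<close>.\<close>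
    then have "(b * E / \<tau>\<^sup>2)\<^sup>2 \<le> (sqrt ?I)\<^sup>2" using b E by (intro power_mono) auto
    also have "(sqrt ?I)\<^sup>2 = ?I" by (intro real_sqrt_pow2 integral_nonneg_AE) auto
    finally show ?thesis by (simp add: E_def power_mult_distrib power_divide exp_double[symmetric] mult_ac)
  qed
  then show ?thesis using that[OF _ T, of "b\<^sup>2"] b by simp
qed

end

section \<open>Both signs of the source, and the two bounds together\<close>

theorem theorem1p4:
  fixes \<gamma>p \<gamma>m :: real
    and D B :: "(real^3) set"
    and c :: "real^3" and r :: real
    and f :: "real^3 \<Rightarrow> real"
    and v :: "real \<Rightarrow> real^3 \<Rightarrow> real"
  assumes "\<gamma>p > 0" and "\<gamma>m > 0"
    and "D \<noteq> {}" and "bounded D" and "open D" and "C2_boundary D"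
    and "closure D \<subseteq> lower_half"
    and "r > 0" and "B = ball c r" and "closure B \<subseteq> upper_half"
    and "square_integrable f" and "ess_support f \<subseteq> closure B"
    and "\<exists>C0>0. (AE x in lebesgue. x \<in> B \<longrightarrow> f x \<ge> C0) \<or>
                (AE x in lebesgue. x \<in> B \<longrightarrow> - f x \<ge> C0)"
    and "\<gamma>p < \<gamma>m"
    and "\<And>\<tau>. \<tau> > 0 \<Longrightarrow> weak_solution (two_layer \<gamma>p \<gamma>m) f \<tau> (v \<tau>)"
  shows "\<exists>C \<tau>0. C > 0 \<and> \<tau>0 > 0 \<and> (\<forall>\<tau>\<ge>\<tau>0.
           inverse C * \<tau> powi (-4) * exp (- 2 * \<tau> * optical_dist_sets \<gamma>p \<gamma>m D B)
             \<le> (LINT x:D|lebesgue. (norm (weak_gradient (v \<tau>) x))\<^sup>2) \<and>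
           (LINT x:D|lebesgue. (norm (weak_gradient (v \<tau>) x))\<^sup>2)
             \<le> C * \<tau>\<^sup>2 * exp (- 2 * \<tau> * optical_dist_sets \<gamma>p \<gamma>m D B))"
proof -
  let ?l = "optical_dist_sets \<gamma>p \<gamma>m D B" and ?g = "two_layer \<gamma>p \<gamma>m" and ?G = "\<lambda>\<tau>. weak_gradient (v \<tau>)"
  have cB: "closure B = cball c r" using assms(8,9) by simp
  have DL: "D \<subseteq> lower_half" using closure_subset assms(7) by blast
  have ws: "wsol ?g f \<tau> (v \<tau>) (?G \<tau>)" if "\<tau> > 0" for \<tau>
    by (rule weak_solution_wsol[OF assms(15)[OF that] two_layer_measurable])
  have f0: "AE x in lebesgue. x \<notin> closure B \<longrightarrow> f x = 0" by (rule ess_support_AE_0[OF assms(12)])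
  obtain C where C: "C > 0" and up: "\<And>\<tau> v G. \<tau> \<ge> 2 \<Longrightarrow> wsol ?g f \<tau> v G \<Longrightarrow>
      (LINT x|lebesgue. indicator D x * (norm (G x))\<^sup>2) \<le> C * \<tau>\<^sup>2 * exp (- 2 * \<tau> * ?l)"
    by (rule upper_bound[OF assms(1,2,14,3,5) DL _ assms(10,11) f0]) (use assms(8,9) in auto)
  have ge: "?l \<le> slow \<gamma>m * norm (z - u) + slow \<gamma>p * norm (z - y)"
    if "u \<in> closure D" "y \<in> closure B" "z $ 3 = 0" for u y z
    using that by (rule optical_dist_sets_le_closure[OF assms(1,2)])
  obtain p y z \<rho> where pyz: "p $ 3 < 0" "y $ 3 > 0" "z $ 3 = 0"
    and len: "slow \<gamma>m * norm (z - p) + slow \<gamma>p * norm (z - y) = ?l"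
    and short: "\<forall>z'. z' $ 3 = 0 \<longrightarrow> slow \<gamma>m * norm (z - p) + slow \<gamma>p * norm (z - y) \<le> slow \<gamma>m * norm (z' - p) + slow \<gamma>p * norm (z' - y)"
    and rho: "\<rho> > 0" "ball (p + (\<rho> / norm (p - z)) *\<^sub>R (p - z)) \<rho> \<subseteq> D"
    and c: "c = y + (r / norm (y - z)) *\<^sub>R (y - z)"
    using shortest_path[OF assms(1-10) ge] .
  interpret beam \<gamma>p \<gamma>m r \<rho> p y z c
    using assms(1,2,8,10) pyz short rho c DL cB by unfold_locales auto
  have pl: "path_length = ?l" using len by (simp add: path_length_def nm_def np_def)
  have bD: "ball b0 \<rho> \<subseteq> D" using rho(2) by (simp add: b0_eq)
  obtain C0 where C0: "C0 > 0"
    and sign: "(AE x in lebesgue. x \<in> ball c r \<longrightarrow> C0 \<le> f x) \<or> (AE x in lebesgue. x \<in> ball c r \<longrightarrow> C0 \<le> - f x)"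
    using assms(13) unfolding assms(9) by blast
  \<comment> \<open>The sign of the source becomes a factor \<open>s\<close>; the equation is linear
    and the norm of the gradient does not see the sign.\<close>
  obtain s where s: "s = 1 \<or> s = (-1::real)" and fC: "AE x in lebesgue. x \<in> ball c r \<longrightarrow> C0 \<le> s * f x"
    using sign that[of 1] that[of "-1"] unfolding mult_1 mult_minus1 by blast
  have sf: "square_integrable (\<lambda>x. s * f x)"
    using s assms(11) square_integrable_minus[OF assms(11)] by auto
  \<comment> \<open>The hypotheses give the sign of \<open>f\<close> on the open ball and its
    vanishing off the closed one; between them lies the sphere, a null set.\<close>
  have sph: "AE x in lebesgue. x \<notin> sphere c r"
    using negligible_sphere[of c r] by (intro AE_not_in) (simp add: negligible_iff_null_sets)
  have f1: "AE x in lebesgue. s * f x \<ge> 0"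
    using f0 fC sph
  proof eventually_elim
    case (elim x)
    then show ?case using C0 by (cases "x \<in> ball c r") (auto simp: cB)
  qed
  have f2: "AE x in lebesgue. x $ 3 \<le> 0 \<longrightarrow> s * f x = 0"
    using f0
  proof eventually_elim
    case (elim x)
    show ?case
    proof
      assume "x $ 3 \<le> 0"
      then have "x \<notin> closure B" using assms(10) by (auto simp: upper_half_def)
      then show "s * f x = 0" using elim by simp
    qed
  qed
  obtain a T where a: "a > 0" "T > 0" and low: "\<And>\<tau> v G. \<tau> \<ge> T \<Longrightarrow> wsol ?g (\<lambda>x. s * f x) \<tau> v G \<Longrightarrow>
    a / \<tau> ^ 4 * exp (- 2 * \<tau> * path_length) \<le> (LINT x|lebesgue. indicator (ball b0 \<rho>) x * (norm (G x))\<^sup>2)"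
    using lower_bound[OF sf f1 f2 C0 fC] by blast
  have low': "a / \<tau> ^ 4 * exp (- 2 * \<tau> * ?l) \<le> (LINT x|lebesgue. indicator D x * (norm (?G \<tau> x))\<^sup>2)" if \<tau>: "\<tau> \<ge> T" for \<tau>
  proof -
    have w: "wsol ?g f \<tau> (v \<tau>) (?G \<tau>)" using ws \<tau> a(2) by simp
    have "wsol ?g (\<lambda>x. s * f x) \<tau> (\<lambda>x. s * v \<tau> x) (\<lambda>x. s *\<^sub>R ?G \<tau> x)"
      using s w wsol_uminus[OF w] by auto
    from low[OF \<tau> this] have "a / \<tau> ^ 4 * exp (- 2 * \<tau> * ?l) \<le> (LINT x|lebesgue. indicator (ball b0 \<rho>) x * (norm (?G \<tau> x))\<^sup>2)"
      using s by (auto simp: pl)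
    also have "\<dots> \<le> (LINT x|lebesgue. indicator D x * (norm (?G \<tau> x))\<^sup>2)"
    proof (rule integral_mono')
      have sG: "square_integrable (?G \<tau>)" using w by (simp add: wsol_def has_weak_gradient_def)
      show "integrable lebesgue (\<lambda>x. indicator D x * (norm (?G \<tau> x))\<^sup>2)"
        using integrable_mult_indicator[of D lebesgue "\<lambda>x. (norm (?G \<tau> x))\<^sup>2"] sG assms(5) by (auto simp: square_integrable_def)
      show "indicator (ball b0 \<rho>) x * (norm (?G \<tau> x))\<^sup>2 \<le> indicator D x * (norm (?G \<tau> x))\<^sup>2" for x
        using bD by (auto simp: indicator_def)
    qed auto
    finally show ?thesis .
  qed
  \<comment> \<open>One constant must serve both bounds: \<open>C\<close> comes from the upper
    bound, \<open>1 / a\<close> from the lower.\<close>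
  define K where "K = max C (1 / a)"
  have K: "K > 0" "C \<le> K" "inverse K \<le> a"
  proof -
    show "K > 0" "C \<le> K" using C by (auto simp: K_def)
    have "1 / a \<le> K" by (simp add: K_def)
    then show "inverse K \<le> a" using \<open>K > 0\<close> a(1) by (simp add: field_simps)
  qed
  have "inverse K * \<tau> powi (-4) * exp (- 2 * \<tau> * ?l) \<le> (LINT x:D|lebesgue. (norm (?G \<tau> x))\<^sup>2) \<and>
    (LINT x:D|lebesgue. (norm (?G \<tau> x))\<^sup>2) \<le> K * \<tau>\<^sup>2 * exp (- 2 * \<tau> * ?l)" if \<tau>: "\<tau> \<ge> max 2 T" for \<tau>
  proof -
    have t: "\<tau> \<ge> 2" "\<tau> \<ge> T" "\<tau> > 0" using \<tau> by auto
    have eq: "(LINT x:D|lebesgue. (norm (?G \<tau> x))\<^sup>2) = (LINT x|lebesgue. indicator D x * (norm (?G \<tau> x))\<^sup>2)"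
      by (simp add: set_lebesgue_integral_def)
    have "inverse K * \<tau> powi (-4) * exp (- 2 * \<tau> * ?l) = inverse K / \<tau> ^ 4 * exp (- 2 * \<tau> * ?l)"
      by (simp add: power_int_def divide_inverse power_inverse)
    also have "\<dots> \<le> a / \<tau> ^ 4 * exp (- 2 * \<tau> * ?l)"
      using K t by (intro mult_right_mono divide_right_mono) auto
    also have "\<dots> \<le> (LINT x:D|lebesgue. (norm (?G \<tau> x))\<^sup>2)" unfolding eq by (rule low'[OF t(2)])
    finally have 1: "inverse K * \<tau> powi (-4) * exp (- 2 * \<tau> * ?l) \<le> (LINT x:D|lebesgue. (norm (?G \<tau> x))\<^sup>2)" .
    have "(LINT x:D|lebesgue. (norm (?G \<tau> x))\<^sup>2) \<le> C * \<tau>\<^sup>2 * exp (- 2 * \<tau> * ?l)" unfolding eq by (rule up[OF t(1) ws[OF t(3)]])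
    also have "\<dots> \<le> K * \<tau>\<^sup>2 * exp (- 2 * \<tau> * ?l)" using K by (intro mult_right_mono) auto
    finally show ?thesis using 1 by blast
  qed
  then show ?thesis using K(1) by (intro exI[of _ K] exI[of _ "max 2 T"]) auto
qed

end
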